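(* Assume the Generalized Riemann Hypothesis for all Dirichlet $L$-functions. Fix $\alpha\in\mathbb{R}$ and $\varepsilon,\varepsilon'>0$. There is a constant $c=c(\varepsilon,\varepsilon')>0$ such that the following holds: whenever $x\ge 2$ and $y\le x^{5/9-\varepsilon}$ are reals for which there exists an irreducible fraction $u/s$ (with $s\ge 1$) satisfying $\left|\alpha-\frac{u}{s}\right|\le\frac{1}{s^2}$ and $\varepsilon' s^2\le y\le s^2/12$, we have $$\frac{1}{x}\sum_{\substack{n\in\mathbb{Z}\\ -y<n\le x}}\left|\sum_{\substack{m\in\mathbb{Z},\ n<m\le n+y\\ 1\le m\le x}}\Lambda(m)\,\mathrm{e}(\alpha m)\right|^2\ \ge\ c\, y\log x .$$
   Context: $\Lambda$ denotes the von Mangoldt function and $\mathrm{e}(\beta):=e^{2\pi i\beta}$ for real $\beta$.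
   Formalization: The formal statement adds y ≥ 1: for 0 < y < 1 every window n < m ≤ n+y with n an integer is empty, so the left side is 0 while c·y·log x > 0 and the claim fails (e.g. α=0, u/s=0/1, y=1/12, x=2, ε=0.1, ε'=1/20). *)

theory Defs
  imports
    "HOL-Complex_Analysis.Complex_Analysis"
    "HOL-Number_Theory.Prime_Powers"
begin

text \<open>
  Dirichlet characters modulo \<open>q\<close>, as functions on the naturals.  The value
  \<open>\<psi> 1 = 1\<close> follows from the first and the third clause; \<open>\<psi> n\<close> vanishes
  exactly when \<open>n\<close> is not coprime to \<open>q\<close>.  Imprimitive and principal characters are
  included, and the only character modulo 1 is the constant 1.
\<close>

definition dirichlet_character :: "nat \<Rightarrow> (nat \<Rightarrow> complex) \<Rightarrow> bool" where
  "dirichlet_character q \<psi> \<longleftrightarrow>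
     q > 0 \<and>
     (\<forall>m n. \<psi> (m * n) = \<psi> m * \<psi> n) \<and>
     (\<forall>n. \<psi> (n + q) = \<psi> n) \<and>
     (\<forall>n. \<psi> n \<noteq> 0 \<longleftrightarrow> coprime n q)"

text \<open>
  The Dirichlet \<open>L\<close>-function of \<open>\<psi>\<close> is the meromorphic continuation to the whole complex
  plane of the series \<open>\<psi>(1) 1\<^sup>-\<^sup>s + \<psi>(2) 2\<^sup>-\<^sup>s + \<dots>\<close>.  Being nicely meromorphic forces
  removable singularities to be filled in and the value 0 at poles, which makes the
  continuation unique as a total function.  Its only possible pole is at the point 1.
\<close>

definition is_L_continuation :: "(nat \<Rightarrow> complex) \<Rightarrow> (complex \<Rightarrow> complex) \<Rightarrow> bool" where
  "is_L_continuation \<psi> L \<longleftrightarrow>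
     L nicely_meromorphic_on UNIV \<and>
     (\<forall>s. Re s > 1 \<longrightarrow> (\<lambda>n. \<psi> (Suc n) / of_nat (Suc n) powr s) sums L s)"

definition dirichlet_L :: "(nat \<Rightarrow> complex) \<Rightarrow> complex \<Rightarrow> complex" where
  "dirichlet_L \<psi> = (THE L. is_L_continuation \<psi> L)"

lemma is_L_continuation_unique:
  assumes "is_L_continuation \<psi> f" "is_L_continuation \<psi> g"
  shows "f = g"
proof -
  have f: "f nicely_meromorphic_on UNIV" and g: "g nicely_meromorphic_on UNIV"
    using assms by (auto simp: is_L_continuation_def)
  have eq: "f s = g s" if "Re s > 1" for s
    using that assms sums_unique2 unfolding is_L_continuation_def by blast
  define h where "h = (\<lambda>z. f z - g z)"
  have h: "h meromorphic_on UNIV"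
    unfolding h_def using f g
    by (intro meromorphic_intros) (auto simp: nicely_meromorphic_on_def)
  have h2: "\<forall>\<^sub>F z in at 2. h z = 0"
    using eventually_at_in_open'[of "{z. Re z > 1}" 2]
    by (auto simp: open_halfspace_Re_gt h_def eq elim!: eventually_mono)
  have "\<forall>\<^sub>F z in cosparse UNIV. h z = 0"
  proof (rule ccontr)
    assume "\<not> ?thesis"
    hence "\<forall>\<^sub>F z in cosparse UNIV. h z \<noteq> 0"
      using meromorphic_imp_constant_or_avoid[OF h, of 0] by auto
    hence "\<forall>\<^sub>F z in at 2. h z \<noteq> 0"
      by (auto simp: eventually_cosparse_open_eq)
    with h2 have "\<forall>\<^sub>F z :: complex in at 2. False"
      by eventually_elim auto
    thus False by simp
  qed
  hence ev: "\<forall>\<^sub>F w in at z. f w = g w" for z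
    by (auto simp: eventually_cosparse_open_eq h_def)
  show ?thesis
  proof
    fix z
    have pole: "is_pole f z \<longleftrightarrow> is_pole g z"
      using ev by (intro is_pole_cong) auto
    show "f z = g z"
    proof (cases "is_pole f z")
      case True
      have "\<not> f \<midarrow>z\<rightarrow> f z" "\<not> g \<midarrow>z\<rightarrow> g z"
        using True pole not_tendsto_and_filterlim_at_infinity[of "at z"]
        unfolding is_pole_def by auto
      hence "f z = 0" "g z = 0"
        using f g unfolding nicely_meromorphic_on_def by blast+
      thus ?thesis by simp
    next
      case False
      have "f \<midarrow>z\<rightarrow> f z" "g \<midarrow>z\<rightarrow> g z"
        using False pole f g unfolding nicely_meromorphic_on_def by auto
      moreover from this(1) have "g \<midarrow>z\<rightarrow> f z"
        using tendsto_cong[OF ev] by blast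
      ultimately show ?thesis
        using LIM_unique by blast
    qed
  qed
qed

definition GRH :: bool where
  "GRH \<longleftrightarrow>
     (\<forall>q \<psi> s. dirichlet_character q \<psi> \<and> 0 < Re s \<and> Re s < 1 \<and> dirichlet_L \<psi> s = 0
        \<longrightarrow> Re s = 1 / 2)"

definition ee :: "real \<Rightarrow> complex" where
  "ee \<beta> = exp (2 * of_real pi * \<i> * of_real \<beta>)"

text \<open>
  For \<open>y < 1\<close> every window \<open>n < m \<le> n + y\<close> with integral \<open>n\<close> is empty, so no lower bound
  of the order \<open>y log x\<close> can hold for such \<open>y\<close>.  For this reason the theorem is stated
  for \<open>y \<ge> 1\<close>.
\<close>

lemma short_window_empty:
  fixes n :: int and y :: real
  assumes "y < 1"
  shows "{m :: int. n < m \<and> of_int m \<le> of_int n + y} = {}"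
  using assms by auto

end

theory Submission
  imports
    Defs
    "HOL-Number_Theory.Residue_Primitive_Roots"
    "HOL-Computational_Algebra.Squarefree"
    "HOL-Real_Asymp.Real_Asymp"
begin

text \<open>
  Choose integers with \<open>v s - u t = 1\<close> and consider the fractions
  \<open>a / q = (k u + l v) / (k s + l t)\<close> with \<open>l < k\<close>, \<open>k\<close> and \<open>l\<close> coprime, and \<open>q\<close> squarefree of
  size at most \<open>x powr (1 / 3 - \<delta>)\<close>.  They lie within \<open>2 / s\<^sup>2\<close> of \<open>\<alpha>\<close>, hence within
  \<open>1 / (6 y)\<close>.  Under GRH the expansion into characters modulo \<open>q\<close> shows that the sum of
  \<open>\<Lambda>(n) (1 - n / x) e(a n / q)\<close> over \<open>n \<le> x\<close> is dominated by the principal character, whose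
  Gauss sum has modulus 1, and so has modulus at least \<open>x / (32 q)\<close>.  In the sum over
  windows, twisted by \<open>a / q - \<alpha>\<close>, it appears \<open>y\<close> times without cancellation, because \<open>a / q - \<alpha>\<close> is small compared with \<open>1 / y\<close>; the large
  sieve then bounds the sum of \<open>(x y / q)\<^sup>2\<close> over all these fractions by a multiple of \<open>x\<close> times the
  sum of the squared windows.

  It remains to see that the sum of \<open>1 / q\<^sup>2\<close> is at least a multiple of \<open>ln x / s\<^sup>2\<close>, since
  \<open>y / s\<^sup>2 \<ge> \<epsilon>'\<close>.  For every \<open>N\<close> with \<open>s x powr (6 \<delta>) \<le> N ^ 5\<close>, a positive proportion of
  the pairs \<open>(k, l)\<close> of size \<open>N\<close> is coprime with \<open>k s + l t\<close> squarefree, so each scale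
  \<open>N\<close> contributes a multiple of \<open>1 / s\<^sup>2\<close>.  The scales between \<open>(s x powr (6 \<delta>)) powr (1 / 5)\<close> and
  \<open>x powr (1 / 3 - \<delta>) / (6 s)\<close> are available, and as \<open>s\<close> is at most of order
  \<open>x powr (5 / 18 - \<epsilon> / 2)\<close> there are at least a multiple of \<open>ln x\<close> of them: the exponent
  \<open>5 / 9\<close> is exactly where the two ends meet.
\<close>

text \<open>\<open>GRH\<close> speaks only of the open strip and of \<open>dirichlet_L\<close>, so
  the continuation, its growth and its non-vanishing on the line \<open>Re s = 1\<close> are derived
  here. The weight \<open>1 - n / x\<close> has a Mellin kernel of order \<open>1 / |s|^2\<close>,
  integrable on vertical lines. Up to small powers the non-principal characters contribute an error
  \<open>q^(1/2) x^(1/2)\<close>; against the main term \<open>x / q\<close> this permits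
  \<open>q\<close> up to \<open>x^(1/3)\<close>. The principal Gauss sum is a Ramanujan sum, which
  vanishes unless \<open>q\<close> is squarefree.

  The obstacle is to find squarefree values of \<open>k s + l t\<close> when \<open>s\<close> is far
  larger than the range \<open>N\<close> of \<open>k\<close> and \<open>l\<close>. Squares of primes
  up to about \<open>N^2\<close> yield to elementary counting and the geometry of a lattice. Larger
  primes are handled by counting collisions, which costs the condition that \<open>s\<close> is at
  most \<open>N^5\<close>, up to small powers. Together with \<open>N s <= x^(1/3)\<close> this
  leaves room for \<open>N\<close> exactly when \<open>s^(6/5) < x^(1/3)\<close>, that is
  \<open>s^2 < x^(5/9)\<close>.\<close>

section \<open>Dirichlet series with periodic coefficients of mean zero\<close>

text \<open>Summation by parts against the periodic partial sums of the coefficients replaces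
  \<open>z powr (- s)\<close> by the sum of its differences to its first \<open>q\<close> shifts.  This operator gains a
  factor of order \<open>s / z\<close>, so that its \<open>k\<close>-th iterate makes the series converge for \<open>Re s > 1 - k\<close>.\<close>

primrec shift_difference :: "nat \<Rightarrow> nat \<Rightarrow> complex \<Rightarrow> complex \<Rightarrow> complex" where
  "shift_difference q 0 s z = z powr (- s)"
| "shift_difference q (Suc k) s z = (\<Sum>j<q. shift_difference q k s (z + of_nat j) - shift_difference q k s z)"

text \<open>Differentiation in \<open>z\<close> commutes with differencing and turns the exponent
  \<open>s\<close> into \<open>s + 1\<close>. Hence the size of order \<open>k + 1\<close> at
  \<open>s\<close> can be read off from order \<open>k\<close> at \<open>s + 1\<close> by the mean
  value theorem.\<close>

lemma shift_difference_has_field_derivative: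
  "Re z > 0 \<Longrightarrow> (shift_difference q k s has_field_derivative - s * shift_difference q k (s + 1) z) (at z)"
proof (induction k arbitrary: z)
  case 0
  have "z \<notin> \<real>\<^sub>\<le>\<^sub>0" using 0 by (auto simp: complex_nonpos_Reals_iff)
  then have "((\<lambda>z. z powr - s) has_field_derivative - s * z powr (- s - 1)) (at z)"
    by (rule has_field_derivative_powr)
  moreover have "- s - 1 = - (s + 1)" by simp
  ultimately show ?case
    unfolding shift_difference.simps by metis
next
  case (Suc k)
  have "((\<lambda>z. shift_difference q k s (z + of_nat j)) has_field_derivative
      - s * shift_difference q k (s + 1) (z + of_nat j)) (at z)" for j
    using Suc.IH[of "z + of_nat j"] Suc.prems by (simp add: DERIV_at_within_shift DERIV_shift add.commute)
  then have "(shift_difference q (Suc k) s has_field_derivative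
      (\<Sum>j<q. - s * shift_difference q k (s + 1) (z + of_nat j) - (- s * shift_difference q k (s + 1) z))) (at z)"
    unfolding shift_difference.simps using Suc by (intro DERIV_sum DERIV_diff) auto
  also have "(\<Sum>j<q. - s * shift_difference q k (s + 1) (z + of_nat j) - (- s * shift_difference q k (s + 1) z))
      = - s * shift_difference q (Suc k) (s + 1) z"
    by (simp add: sum_distrib_left algebra_simps)
  finally show ?case .
qed

lemma shift_difference_holomorphic: "Re z > 0 \<Longrightarrow> (\<lambda>s. shift_difference q k s z) holomorphic_on A"
proof (induction k arbitrary: z)
  case 0
  then have "z \<noteq> 0" by auto
  then show ?case by (auto intro!: holomorphic_intros)
next
  case (Suc k)
  then show ?case by (auto intro!: holomorphic_intros)
qed

text \<open>Each step sums \<open>q\<close> differences over shifts shorter than \<open>q\<close>,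
  and the derivative costs \<open>norm s\<close>: a factor \<open>q^2 * norm s / x\<close> per step.
  The hypothesis \<open>Re s + k >= 0\<close> keeps the power of \<open>x\<close> from increasing,
  so the left end of each segment is the worst point.\<close>

lemma norm_shift_difference_le:
  "x > 0 \<Longrightarrow> Re s + real k \<ge> 0 \<Longrightarrow>
    norm (shift_difference q k s (of_real x)) \<le>
      (real q ^ 2) ^ k * (\<Prod>i<k. norm (s + of_nat i)) * x powr (- Re s - real k)"
proof (induction k arbitrary: s x)
  case 0
  then show ?case by (simp add: norm_powr_real_powr)
next
  case (Suc k)
  let ?C = "(real q ^ 2) ^ k * (\<Prod>i<k. norm (s + 1 + of_nat i))"
  let ?B = "norm s * (?C * x powr (- Re s - 1 - real k))"
  have C0: "?C \<ge> 0" by (intro mult_nonneg_nonneg prod_nonneg) auto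
  have "norm (shift_difference q k s (of_real x + of_nat j) - shift_difference q k s (of_real x)) \<le> ?B * real q" if "j < q" for j
  proof -
    let ?S = "closed_segment (complex_of_real x) (of_real (x + real j))"
    have seg: "?S = of_real ` {x..x + real j}"
      using closed_segment_of_real[of x "x + real j"] by (simp add: closed_segment_eq_real_ivl)
    have "norm (shift_difference q k s (of_real (x + real j)) - shift_difference q k s (of_real x))
        \<le> ?B * norm (complex_of_real (x + real j) - of_real x)"
    proof (rule field_differentiable_bound)
      show "convex ?S" by (rule convex_closed_segment)
      fix z assume z: "z \<in> ?S"
      then obtain t where t: "z = of_real t" "x \<le> t" unfolding seg by auto
      then have t0: "t > 0" "Re z > 0" using Suc.prems by auto
      show "(shift_difference q k s has_field_derivative - s * shift_difference q k (s + 1) z) (at z within ?S)"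
        using shift_difference_has_field_derivative[OF t0(2)] by (rule has_field_derivative_at_within)
      have "norm (shift_difference q k (s + 1) (of_real t)) \<le> ?C * t powr (- Re s - 1 - real k)"
      proof -
        have "- Re (s + 1) - real k = - Re s - 1 - real k" by simp
        then show ?thesis using Suc.IH[of t "s + 1"] t0 Suc.prems by simp
      qed
      also have "\<dots> \<le> ?C * x powr (- Re s - 1 - real k)"
        using Suc.prems t C0 by (intro mult_left_mono powr_mono2') auto
      finally show "norm (- s * shift_difference q k (s + 1) z) \<le> ?B"
        using mult_left_mono[of _ _ "norm s"] t by (simp only: norm_mult norm_minus_cancel norm_ge_zero)
    qed auto
    also have "\<dots> \<le> ?B * real q"
      using that C0 by (intro mult_left_mono mult_nonneg_nonneg[OF norm_ge_zero] mult_nonneg_nonneg[OF C0]) auto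
    finally show ?thesis by simp
  qed
  then have "norm (shift_difference q (Suc k) s (of_real x)) \<le> (\<Sum>j<q. ?B * real q)"
    unfolding shift_difference.simps by (intro sum_norm_le) auto
  also have "\<dots> = (real q ^ 2) ^ Suc k * (norm s * (\<Prod>i<k. norm (s + 1 + of_nat i))) *
      x powr (- Re s - real (Suc k))"
    by (simp add: power2_eq_square algebra_simps)
  also have "norm s * (\<Prod>i<k. norm (s + 1 + of_nat i)) = (\<Prod>i<Suc k. norm (s + of_nat i))"
    unfolding prod.lessThan_Suc_shift by (simp add: add.assoc)
  finally show ?case .
qed

lemma summable_Suc_powr: "a > 1 \<Longrightarrow> summable (\<lambda>n. real (Suc n) powr (- a))"
  using summable_real_powr_iff[of "- a"] by (subst summable_Suc_iff) auto

section \<open>Continuation of the series to the whole plane\<close>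

definition difference_series :: "(nat \<Rightarrow> complex) \<Rightarrow> nat \<Rightarrow> nat \<Rightarrow> complex \<Rightarrow> complex" where
  "difference_series g q k s = (\<Sum>n. g (Suc n) * shift_difference q k s (of_nat (Suc n)))"

text \<open>When the \<open>q\<close> shifted series are added, the coefficient at
  \<open>m + 1\<close> is a sum of \<open>g\<close> over \<open>q\<close> consecutive arguments,
  which is 0, except at the first \<open>q - 1\<close> indices, where the sum is cut off. This is
  what those indices leave behind.\<close>

definition boundary_term :: "(nat \<Rightarrow> complex) \<Rightarrow> nat \<Rightarrow> nat \<Rightarrow> complex \<Rightarrow> complex" where
  "boundary_term g q k s = (\<Sum>m<q - 1. (\<Sum>j\<le>m. g (Suc m - j)) * shift_difference q k s (of_nat (Suc m)))"

locale mean_zero_periodic =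
  fixes g :: "nat \<Rightarrow> complex" and q :: nat
  assumes q_pos: "q > 0" and periodic: "\<And>n. g (n + q) = g n"
    and norm_le: "\<And>n. norm (g n) \<le> 1" and mean_zero: "(\<Sum>n<q. g n) = 0"
begin

lemma norm_term_le:
  assumes "Re s + real k \<ge> 0"
  shows "norm (g n * shift_difference q k s (of_nat (Suc m))) \<le>
    (real q ^ 2) ^ k * (\<Prod>i<k. norm (s + of_nat i)) * real (Suc m) powr (- (Re s + real k))"
proof -
  have "norm (g n * shift_difference q k s (of_nat (Suc m))) \<le> 1 * norm (shift_difference q k s (of_nat (Suc m)))"
    unfolding norm_mult using norm_le by (intro mult_right_mono) auto
  also have "\<dots> \<le> (real q ^ 2) ^ k * (\<Prod>i<k. norm (s + of_nat i)) * real (Suc m) powr (- (Re s + real k))"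
    using norm_shift_difference_le[of "real (Suc m)" s k q] assms by (simp add: algebra_simps)
  finally show ?thesis .
qed

lemma sum_period: "(\<Sum>j<q. g (a + j)) = 0"
proof (induction a)
  case 0
  then show ?case using mean_zero by simp
next
  case (Suc a)
  have "(\<Sum>j<q. g (Suc a + j)) + g a = (\<Sum>j<Suc q. g (a + j))"
    unfolding sum.lessThan_Suc_shift by simp
  also have "\<dots> = g a" using Suc periodic by simp
  finally show ?case by simp
qed

lemma sum_period_rev:
  assumes "m \<ge> q - 1" shows "(\<Sum>j<q. g (Suc m - j)) = 0"
proof -
  have "(\<Sum>j<q. g (Suc m - j)) = (\<Sum>j<q. g (Suc m - (q - Suc j)))"
    by (subst sum.nat_diff_reindex[symmetric]) simp
  also have "\<dots> = (\<Sum>j<q. g ((Suc m - (q - 1)) + j))"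
    using assms q_pos by (intro sum.cong refl arg_cong[of _ _ g]) auto
  finally show ?thesis using sum_period by simp
qed

lemma summable_term:
  assumes "Re s + real k > 1"
  shows "summable (\<lambda>n. g (Suc n) * shift_difference q k s (of_nat (Suc n + j)))"
proof (rule summable_comparison_test')
  let ?C = "(real q ^ 2) ^ k * (\<Prod>i<k. norm (s + of_nat i))"
  have C0: "?C \<ge> 0" by (intro mult_nonneg_nonneg prod_nonneg) auto
  show "summable (\<lambda>n. ?C * real (Suc n) powr (- (Re s + real k)))"
    using assms by (intro summable_mult summable_Suc_powr) auto
  fix n
  have "norm (g (Suc n) * shift_difference q k s (of_nat (Suc (n + j))))
      \<le> ?C * real (Suc (n + j)) powr (- (Re s + real k))"
    using assms by (intro norm_term_le) auto
  also have "\<dots> \<le> ?C * real (Suc n) powr (- (Re s + real k))"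
    using assms C0 by (intro mult_left_mono powr_mono2') auto
  finally show "norm (g (Suc n) * shift_difference q k s (of_nat (Suc n + j)))
      \<le> ?C * real (Suc n) powr (- (Re s + real k))" by simp
qed

text \<open>The sum of the \<open>q\<close> shifted series is computed twice: collected by the
  argument of the kernel it is \<open>boundary_term\<close>, collected by the coefficient it is
  \<open>q\<close> copies of the series plus the series of the next order.\<close>

lemma difference_series_Suc:
  assumes "Re s + real k > 1"
  shows "of_nat q * difference_series g q k s = boundary_term g q k s - difference_series g q (Suc k) s"
proof -
  define a where "a = (\<lambda>m. shift_difference q k s (of_nat m))"
  define T where "T = (\<lambda>j. \<Sum>n. g (Suc n) * a (Suc n + j))"
  have T: "(\<lambda>n. g (Suc n) * a (Suc n + j)) sums T j" for j
    unfolding T_def a_def using summable_term[OF assms] by (rule summable_sums)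
  \<comment> \<open>Padded by zeros below \<open>j\<close>, all the \<open>T j\<close> become series
    in the same kernel values \<open>a (Suc m)\<close> and can be added termwise.\<close>
  have T': "(\<lambda>m. if j \<le> m then g (Suc m - j) * a (Suc m) else 0) sums T j" for j
  proof -
    define f where "f = (\<lambda>m. if j \<le> m then g (Suc m - j) * a (Suc m) else 0)"
    have "(\<lambda>n. f (n + j)) = (\<lambda>n. g (Suc n) * a (Suc n + j))" by (auto simp: f_def)
    moreover have "(\<Sum>i<j. f i) = 0" by (auto simp: f_def intro!: sum.neutral)
    ultimately have "f sums T j"
      using T[of j] sums_iff_shift[of f j "T j"] by simp
    then show ?thesis unfolding f_def .
  qed
  have "(\<lambda>m. \<Sum>j<q. if j \<le> m then g (Suc m - j) * a (Suc m) else 0) sums (\<Sum>j<q. T j)"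
    by (intro sums_sum T')
  also have "(\<lambda>m. \<Sum>j<q. if j \<le> m then g (Suc m - j) * a (Suc m) else 0) =
      (\<lambda>m. if m \<in> {..<q - 1} then (\<Sum>j\<le>m. g (Suc m - j)) * a (Suc m) else 0)"
  proof
    fix m
    show "(\<Sum>j<q. if j \<le> m then g (Suc m - j) * a (Suc m) else 0) =
      (if m \<in> {..<q - 1} then (\<Sum>j\<le>m. g (Suc m - j)) * a (Suc m) else 0)"
    proof (cases "m < q - 1")
      case True
      then have "(\<Sum>j<q. if j \<le> m then g (Suc m - j) * a (Suc m) else 0)
          = (\<Sum>j\<le>m. g (Suc m - j) * a (Suc m))"
        by (intro sum.mono_neutral_cong_right) auto
      then show ?thesis using True by (simp add: sum_distrib_right)
    next
      case False
      then have "(\<Sum>j<q. if j \<le> m then g (Suc m - j) * a (Suc m) else 0)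
          = (\<Sum>j<q. g (Suc m - j)) * a (Suc m)"
        unfolding sum_distrib_right by (intro sum.cong) auto
      then show ?thesis using False sum_period_rev[of m] by simp
    qed
  qed
  finally have "(\<Sum>j<q. T j) = boundary_term g q k s"
    using sums_If_finite_set[of "{..<q - 1}" "\<lambda>m. (\<Sum>j\<le>m. g (Suc m - j)) * a (Suc m)"]
    by (auto simp: boundary_term_def a_def dest: sums_unique2)
  moreover have "(\<lambda>n. \<Sum>j<q. g (Suc n) * a (Suc n + j) - g (Suc n) * a (Suc n + 0)) sums (\<Sum>j<q. T j - T 0)"
    by (intro sums_sum sums_diff T)
  then have "difference_series g q (Suc k) s = (\<Sum>j<q. T j - T 0)"
    unfolding difference_series_def
    by (subst sums_unique[symmetric]) (auto simp: a_def sum_distrib_left sum_subtractf algebra_simps sums_iff)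
  moreover have "T 0 = difference_series g q k s" by (simp add: T_def difference_series_def a_def)
  ultimately show ?thesis by (simp add: sum_subtractf)
qed

lemma difference_series_holomorphic: "difference_series g q k holomorphic_on {s. Re s > 1 - real k}"
proof (rule holomorphic_uniform_sequence)
  show "open {s. Re s > 1 - real k}" by (rule open_halfspace_Re_gt)
  show "(\<lambda>s. \<Sum>n<N. g (Suc n) * shift_difference q k s (of_nat (Suc n))) holomorphic_on {s. Re s > 1 - real k}" for N
    by (intro holomorphic_intros shift_difference_holomorphic) auto
  fix s0 :: complex assume "s0 \<in> {s. Re s > 1 - real k}"
  define d where "d = (Re s0 - (1 - real k)) / 2"
  have d: "d > 0" "Re s0 - d > 1 - real k"
    using \<open>s0 \<in> _\<close> by (auto simp: d_def field_simps)
  have Re: "Re s \<ge> Re s0 - d" if "s \<in> cball s0 d" for s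
    using that abs_Re_le_cmod[of "s0 - s"] by (auto simp: dist_norm)
  define C where "C = (real q ^ 2) ^ k * (\<Prod>i<k. norm s0 + d + real i)"
  have C: "(real q ^ 2) ^ k * (\<Prod>i<k. norm (s + of_nat i)) \<le> C" if "s \<in> cball s0 d" for s
    unfolding C_def
  proof (intro mult_left_mono prod_mono conjI)
    fix i
    have "norm (s + of_nat i) \<le> norm s + real i" using norm_triangle_ineq[of s "of_nat i"] by simp
    also have "norm s \<le> norm s0 + d"
      using that norm_triangle_ineq2[of s s0] by (auto simp: dist_norm norm_minus_commute)
    finally show "norm (s + of_nat i) \<le> norm s0 + d + real i" by simp
  qed auto
  have "uniform_limit (cball s0 d) (\<lambda>N s. \<Sum>n<N. g (Suc n) * shift_difference q k s (of_nat (Suc n))) (difference_series g q k) sequentially"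
    unfolding difference_series_def
  proof (rule Weierstrass_m_test)
    show "summable (\<lambda>n. C * real (Suc n) powr (- (Re s0 - d + real k)))"
      using d by (intro summable_mult summable_Suc_powr) auto
    fix n s assume s: "s \<in> cball s0 d"
    have "norm (g (Suc n) * shift_difference q k s (of_nat (Suc n)))
        \<le> (real q ^ 2) ^ k * (\<Prod>i<k. norm (s + of_nat i)) * real (Suc n) powr (- (Re s + real k))"
      using Re[OF s] d by (intro norm_term_le) auto
    also have "\<dots> \<le> C * real (Suc n) powr (- (Re s0 - d + real k))"
    proof -
      have "C \<ge> 0" unfolding C_def using d by (intro mult_nonneg_nonneg prod_nonneg) (auto intro!: add_nonneg_nonneg)
      then show ?thesis using C[OF s] Re[OF s] d by (intro mult_mono powr_mono) auto
    qed
    finally show "norm (g (Suc n) * shift_difference q k s (of_nat (Suc n))) \<le> C * real (Suc n) powr (- (Re s0 - d + real k))" .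
  qed
  then show "\<exists>d. 0 < d \<and> cball s0 d \<subseteq> {s. Re s > 1 - real k} \<and>
      uniform_limit (cball s0 d) (\<lambda>N s. \<Sum>n<N. g (Suc n) * shift_difference q k s (of_nat (Suc n))) (difference_series g q k) sequentially"
    using d Re by (intro exI[of _ d]) fastforce
qed

primrec boundary_sum :: "nat \<Rightarrow> complex \<Rightarrow> complex" where
  "boundary_sum 0 s = 0"
| "boundary_sum (Suc k) s = boundary_sum k s + (- 1) ^ k / of_nat q ^ Suc k * boundary_term g q k s"

text \<open>The recursion \<open>difference_series_Suc\<close>, solved for the lower order and
  iterated \<open>k\<close> times. Different \<open>k\<close> agree where both converge, and larger
  \<open>k\<close> converge further to the left.\<close>

definition approx_L :: "nat \<Rightarrow> complex \<Rightarrow> complex" where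
  "approx_L k s = boundary_sum k s + (- 1) ^ k / of_nat q ^ k * difference_series g q k s"

lemma approx_L_Suc:
  assumes "Re s + real k > 1" shows "approx_L (Suc k) s = approx_L k s"
proof -
  have "difference_series g q (Suc k) s = boundary_term g q k s - of_nat q * difference_series g q k s"
    using difference_series_Suc[OF assms] by simp
  moreover define a :: complex where "a = (- 1) ^ k / of_nat q ^ k"
  moreover have "a / of_nat q * boundary_term g q k s - a / of_nat q * (boundary_term g q k s - of_nat q * difference_series g q k s)
      = a * difference_series g q k s"
    using q_pos by (simp add: algebra_simps)
  ultimately show ?thesis by (simp add: approx_L_def mult.commute[of "of_nat q"])
qed

lemma approx_L_ge:
  assumes "Re s + real k > 1" "k \<le> l" shows "approx_L l s = approx_L k s"
  using assms(2)
proof (induction l rule: dec_induct)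
  case (step n)
  then show ?case using approx_L_Suc[of s n] assms by simp
qed simp

lemma approx_L_holomorphic: "approx_L k holomorphic_on {s. Re s > 1 - real k}"
proof -
  have "boundary_sum k holomorphic_on A" for k A
    by (induction k) (auto intro!: holomorphic_intros shift_difference_holomorphic simp: boundary_term_def q_pos)
  then show ?thesis unfolding approx_L_def
    by (auto intro!: holomorphic_intros difference_series_holomorphic simp: q_pos)
qed

text \<open>By \<open>L_eq\<close> every \<open>k\<close> with \<open>Re s + k > 1\<close> gives the
  same value; rounding up \<open>2 - Re s\<close> instead of \<open>1 - Re s\<close> secures the
  strict inequality.\<close>

definition L :: "complex \<Rightarrow> complex" where
  "L s = approx_L (nat \<lceil>2 - Re s\<rceil>) s"

lemma L_eq:
  assumes "Re s + real k > 1" shows "L s = approx_L k s"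
proof -
  define k0 where "k0 = nat \<lceil>2 - Re s\<rceil>"
  have "Re s + real k0 > 1" unfolding k0_def by linarith
  then have "approx_L (max k k0) s = approx_L k0 s" "approx_L (max k k0) s = approx_L k s"
    using approx_L_ge[of s k0 "max k k0"] approx_L_ge[of s k "max k k0"] assms by simp_all
  then show ?thesis by (simp add: L_def k0_def)
qed

lemma L_holomorphic: "L holomorphic_on A"
proof -
  have "L field_differentiable at s" for s
  proof -
    define k where "k = nat \<lceil>2 - Re s\<rceil>"
    have "Re s > 1 - real k" unfolding k_def by linarith
    then have "approx_L k field_differentiable at s"
      using approx_L_holomorphic[of k]
      by (intro holomorphic_on_imp_differentiable_at[of _ "{s. Re s > 1 - real k}"]) (auto simp: open_halfspace_Re_gt)
    moreover have "\<forall>\<^sub>F z in nhds s. L z = approx_L k z"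
    proof (rule eventually_mono[OF eventually_nhds_in_open])
      show "open {s. Re s > 1 - real k}" by (rule open_halfspace_Re_gt)
    qed (use \<open>Re s > 1 - real k\<close> in \<open>auto intro: L_eq\<close>)
    ultimately show ?thesis
      unfolding field_differentiable_def using DERIV_cong_ev[OF refl _ refl, of L "approx_L k" s] by auto
  qed
  then show ?thesis
    by (rule holomorphic_onI[OF field_differentiable_at_within])
qed

lemma L_sums:
  assumes "Re s > 1"
  shows "(\<lambda>n. g (Suc n) / of_nat (Suc n) powr s) sums L s"
proof -
  have "L s = difference_series g q 0 s" using L_eq[of s 0] assms by (simp add: approx_L_def)
  moreover have "(\<lambda>n. g (Suc n) * shift_difference q 0 s (of_nat (Suc n))) sums difference_series g q 0 s"
    unfolding difference_series_def using summable_term[of s 0 0] assms by (intro summable_sums) auto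
  ultimately show ?thesis by (simp add: powr_minus divide_inverse)
qed

lemma is_L_continuation_L: "is_L_continuation g L"
  unfolding is_L_continuation_def
  using L_sums L_holomorphic[of UNIV]
  by (auto intro!: analytic_on_imp_nicely_meromorphic_on simp: analytic_on_open)

lemma dirichlet_L_eq: "dirichlet_L g = L"
  unfolding dirichlet_L_def
  using is_L_continuation_L is_L_continuation_unique by blast

text \<open>Order 1 suffices for \<open>Re s >= 1 / 2\<close>: the tail then has exponent at least 3
  / 2, and the division by \<open>q\<close> cancels one factor of \<open>q^2\<close>. What matters
  later is that the bound is polynomial in \<open>q\<close> and \<open>norm s\<close>.\<close>

lemma norm_L_le:
  assumes "Re s \<ge> 1 / 2"
  shows "norm (L s) \<le> real q * (1 + (\<Sum>n. real (Suc n) powr (- (3 / 2))) * norm s)"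
proof -
  define Z where "Z = (\<Sum>n. real (Suc n) powr (- (3 / 2)))"
  have s: "summable (\<lambda>n. real (Suc n) powr (- (3 / 2)))" by (rule summable_Suc_powr) simp
  have "norm (boundary_term g q 0 s) \<le> (\<Sum>m<q - 1. real q * 1)"
    unfolding boundary_term_def
  proof (intro sum_norm_le)
    fix m assume m: "m \<in> {..<q - 1}"
    have "norm (\<Sum>j\<le>m. g (Suc m - j)) \<le> (\<Sum>j\<le>m. 1)"
      by (intro sum_norm_le norm_le)
    then have "norm (\<Sum>j\<le>m. g (Suc m - j)) \<le> real q" using m by simp
    moreover have "norm (shift_difference q 0 s (of_nat (Suc m))) \<le> 1"
    proof -
      have "norm (shift_difference q 0 s (of_real (real (Suc m)))) \<le> real (Suc m) powr (- Re s)"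
        using norm_shift_difference_le[of "real (Suc m)" s 0 q] assms by simp
      also have "\<dots> \<le> real (Suc m) powr 0" using assms by (intro powr_mono) auto
      finally show ?thesis by simp
    qed
    ultimately show "norm ((\<Sum>j\<le>m. g (Suc m - j)) * shift_difference q 0 s (of_nat (Suc m))) \<le> real q * 1"
      unfolding norm_mult by (intro mult_mono) auto
  qed
  also have "\<dots> \<le> real q * real q" by (simp add: mult_right_mono)
  finally have b: "norm (boundary_term g q 0 s) \<le> real q * real q" .
  have "norm (difference_series g q 1 s) \<le> (\<Sum>n. real q ^ 2 * norm s * real (Suc n) powr (- (3 / 2)))"
    unfolding difference_series_def
  proof (rule norm_suminf_le)
    fix n
    have "norm (g (Suc n) * shift_difference q 1 s (of_nat (Suc n)))
        \<le> real q ^ 2 * norm s * real (Suc n) powr (- (Re s + 1))"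
      using norm_term_le[of s 1 "Suc n" n] assms by simp
    also have "\<dots> \<le> real q ^ 2 * norm s * real (Suc n) powr (- (3 / 2))"
      using assms by (intro mult_left_mono powr_mono) auto
    finally show "norm (g (Suc n) * shift_difference q 1 s (of_nat (Suc n)))
        \<le> real q ^ 2 * norm s * real (Suc n) powr (- (3 / 2))" .
  qed (intro summable_mult s)
  also have "\<dots> = real q ^ 2 * norm s * Z" unfolding Z_def by (intro suminf_mult s)
  finally have v: "norm (difference_series g q 1 s) \<le> real q ^ 2 * norm s * Z" .
  have "L s = (boundary_term g q 0 s - difference_series g q 1 s) / of_nat q"
    using L_eq[of s 1] assms by (simp add: approx_L_def diff_divide_distrib)
  then have "norm (L s) = norm (boundary_term g q 0 s - difference_series g q 1 s) / real q"
    by (simp add: norm_divide)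
  also have "\<dots> \<le> (real q * real q + real q ^ 2 * norm s * Z) / real q"
    using b v by (intro divide_right_mono order.trans[OF norm_triangle_ineq4] add_mono) auto
  also have "\<dots> = real q * (1 + Z * norm s)"
    using q_pos by (simp add: field_simps power2_eq_square)
  finally show ?thesis unfolding Z_def .
qed

end

section \<open>Dirichlet series with completely multiplicative coefficients\<close>

definition dirichlet_series :: "(nat \<Rightarrow> complex) \<Rightarrow> complex \<Rightarrow> complex" where
  "dirichlet_series c s = (\<Sum>n. c n * of_nat n powr (- s))"

text \<open>Covers coefficients bounded by 1 as well as those dominated by the von Mangoldt
  function, so that one theory of convergence serves \<open>\<psi>\<close>, its twist and the tilted
  coefficients below.\<close>

definition log_bounded :: "(nat \<Rightarrow> complex) \<Rightarrow> bool" where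
  "log_bounded c \<longleftrightarrow> (\<forall>n\<ge>1. norm (c n) \<le> 1 + ln (real n))"

lemma norm_dirichlet_series_term_le:
  assumes "log_bounded c" "1 < \<sigma>" "\<sigma> \<le> Re s"
  shows "norm (c n * of_nat n powr (- s)) \<le> (1 + 2 / (\<sigma> - 1)) * real n powr (- (1 + (\<sigma> - 1) / 2))"
proof (cases "n = 0")
  case False
  \<comment> \<open>Half of the excess \<open>\<sigma> - 1\<close> pays for the logarithm, the other
    half for convergence.\<close>
  define \<eta> where "\<eta> = (\<sigma> - 1) / 2"
  have \<eta>: "\<eta> > 0" using assms by (simp add: \<eta>_def)
  have n1: "real n \<ge> 1" using False by simp
  have "1 \<le> real n powr \<eta>" using n1 \<eta> by (simp add: ge_one_powr_ge_zero)
  moreover have "ln (real n) \<le> real n powr \<eta> / \<eta>"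
    using ln_powr_bound[OF n1 \<eta>] .
  ultimately have l: "1 + ln (real n) \<le> (1 + 1 / \<eta>) * real n powr \<eta>"
    by (simp add: algebra_simps)
  have "norm (c n * of_nat n powr (- s)) = norm (c n) * real n powr (- Re s)"
    using norm_powr_real_powr[of "of_nat n" "- s"] by (simp add: norm_mult)
  also have "\<dots> \<le> ((1 + 1 / \<eta>) * real n powr \<eta>) * real n powr (- \<sigma>)"
  proof (intro mult_mono)
    show "norm (c n) \<le> (1 + 1 / \<eta>) * real n powr \<eta>"
    proof -
      have "norm (c n) \<le> 1 + ln (real n)" using assms(1) n1 by (simp add: log_bounded_def)
      then show ?thesis using l by linarith
    qed
    show "real n powr (- Re s) \<le> real n powr (- \<sigma>)"
      using n1 assms by (intro powr_mono) auto
  qed (use \<eta> in auto)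
  also have "\<dots> = (1 + 1 / \<eta>) * real n powr (\<eta> + - \<sigma>)"
    by (simp only: powr_add mult.assoc)
  also have "\<eta> + - \<sigma> = - (1 + (\<sigma> - 1) / 2)" by (simp add: \<eta>_def field_simps)
  also have "1 / \<eta> = 2 / (\<sigma> - 1)" by (simp add: \<eta>_def)
  finally show ?thesis .
qed simp

lemma dirichlet_series_abs_summable:
  assumes "log_bounded c" "Re s > 1"
  shows "summable (\<lambda>n. norm (c n * of_nat n powr (- s)))"
proof (rule summable_comparison_test')
  show "summable (\<lambda>n. (1 + 2 / (Re s - 1)) * real n powr (- (1 + (Re s - 1) / 2)))"
    using assms by (intro summable_mult iffD2[OF summable_real_powr_iff]) auto
  show "norm (norm (c n * of_nat n powr (- s))) \<le> (1 + 2 / (Re s - 1)) * real n powr (- (1 + (Re s - 1) / 2))" for n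
    using norm_dirichlet_series_term_le[OF assms(1), of "Re s" s n] assms by simp
qed

lemma dirichlet_series_sums:
  assumes "log_bounded c" "Re s > 1"
  shows "(\<lambda>n. c n * of_nat n powr (- s)) sums dirichlet_series c s"
  unfolding dirichlet_series_def
  by (rule summable_sums[OF summable_norm_cancel[OF dirichlet_series_abs_summable[OF assms]]])

lemma dirichlet_series_deriv_exists:
  assumes "log_bounded c"
  shows "\<exists>d. \<forall>s. Re s > 1 \<longrightarrow> (\<lambda>n. - of_real (ln (real n)) * (c n * of_nat n powr (- s))) sums d s \<and>
    (dirichlet_series c has_field_derivative d s) (at s)"
proof -
  let ?S = "{s. Re s > 1}"
  have der: "((\<lambda>s. c n * of_nat n powr (- s)) has_field_derivative
      - of_real (ln (real n)) * (c n * of_nat n powr (- s))) (at s)" for n s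
  proof (cases "n = 0")
    case False
    have "Ln (of_nat n) = of_real (ln (real n))"
      using False Ln_of_real[of "real n"] by simp
    then have eq: "(of_nat n :: complex) powr (- s) = exp (- s * of_real (ln (real n)))" for s
      using False by (simp add: powr_def)
    show ?thesis unfolding eq by (auto intro!: derivative_eq_intros)
  qed simp
  have "\<exists>g g'. \<forall>s\<in>?S. ((\<lambda>n. c n * of_nat n powr (- s)) sums g s) \<and>
      ((\<lambda>n. - of_real (ln (real n)) * (c n * of_nat n powr (- s))) sums g' s) \<and>
      (g has_field_derivative g' s) (at s)"
  proof (rule series_and_derivative_comparison_local)
    show "open ?S" by (rule open_halfspace_Re_gt)
    fix s :: complex assume s: "s \<in> ?S"
    define d where "d = (Re s - 1) / 2"
    have d: "d > 0" "Re s - d > 1" using s by (auto simp: d_def field_simps)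
    let ?h = "\<lambda>n. (1 + 2 / (Re s - d - 1)) * real n powr (- (1 + (Re s - d - 1) / 2))"
    have "summable ?h"
      using d by (intro summable_mult iffD2[OF summable_real_powr_iff]) auto
    moreover have "norm (c n * of_nat n powr (- y)) \<le> ?h n" if "y \<in> ball s d \<inter> ?S" for n y
    proof (rule norm_dirichlet_series_term_le[OF assms d(2)])
      show "Re s - d \<le> Re y"
        using that abs_Re_le_cmod[of "s - y"] by (auto simp: dist_norm)
    qed
    ultimately show "\<exists>d h. 0 < d \<and> summable h \<and>
        (\<forall>\<^sub>F n in sequentially. \<forall>y\<in>ball s d \<inter> ?S. norm (c n * of_nat n powr (- y)) \<le> h n)"
      using d(1) by (intro exI[of _ d] exI[of _ ?h]) (auto intro!: always_eventually)
  qed (rule der)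
  then obtain g g' where g: "\<And>s. Re s > 1 \<Longrightarrow> ((\<lambda>n. c n * of_nat n powr (- s)) sums g s)"
    "\<And>s. Re s > 1 \<Longrightarrow> ((\<lambda>n. - of_real (ln (real n)) * (c n * of_nat n powr (- s))) sums g' s)"
    "\<And>s. Re s > 1 \<Longrightarrow> (g has_field_derivative g' s) (at s)" by auto
  have "(dirichlet_series c has_field_derivative g' s) (at s)" if "Re s > 1" for s
  proof (rule has_field_derivative_transform_within_open[OF g(3)[OF that]])
    show "open ?S" by (rule open_halfspace_Re_gt)
    show "s \<in> ?S" using that by simp
    show "g x = dirichlet_series c x" if "x \<in> ?S" for x
      using g(1)[of x] that by (simp add: dirichlet_series_def sums_iff)
  qed
  with g(2) show ?thesis by (intro exI[of _ g']) simp
qed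

lemma dirichlet_series_holomorphic:
  assumes "log_bounded c" shows "dirichlet_series c holomorphic_on {s. Re s > 1}"
proof -
  obtain d where "\<forall>s. Re s > 1 \<longrightarrow> (\<lambda>n. - of_real (ln (real n)) * (c n * of_nat n powr (- s))) sums d s \<and>
    (dirichlet_series c has_field_derivative d s) (at s)"
    using dirichlet_series_deriv_exists[OF assms] by (rule exE)
  then show ?thesis by (auto simp: holomorphic_on_open open_halfspace_Re_gt)
qed

lemma dirichlet_series_has_sum:
  assumes "log_bounded c" "Re s > 1"
  shows "((\<lambda>n. c n * of_nat n powr (- s)) has_sum dirichlet_series c s) {0<..}"
proof -
  have "((\<lambda>n. c n * of_nat n powr (- s)) has_sum dirichlet_series c s) UNIV"
    using dirichlet_series_abs_summable[OF assms] dirichlet_series_sums[OF assms] by (rule norm_summable_imp_has_sum)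
  also have "?this \<longleftrightarrow> ?thesis"
    by (rule has_sum_cong_neutral) auto
  finally show ?thesis .
qed

lemma dirichlet_series_mult_sums:
  assumes a: "log_bounded a" and b: "log_bounded b" and s: "Re s > 1"
  shows "(\<lambda>n. (\<Sum>d | d dvd n. if n = 0 then 0 else a d * b (n div d)) * of_nat n powr (- s)) sums (dirichlet_series a s * dirichlet_series b s)"
proof -
  define A where "A = (\<lambda>n. a n * of_nat n powr (- s))"
  define B where "B = (\<lambda>n. b n * of_nat n powr (- s))"
  have sA: "(A has_sum dirichlet_series a s) {0<..}" and sB: "(B has_sum dirichlet_series b s) {0<..}"
    unfolding A_def B_def using dirichlet_series_has_sum a b s by auto
  have nA: "(\<lambda>n. norm (A n)) summable_on {0<..}" and nB: "(\<lambda>n. norm (B n)) summable_on {0<..}"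
    using summable_on_subset[OF norm_summable_imp_summable_on, of "\<lambda>n. norm (A n)" "{0<..}"]
      summable_on_subset[OF norm_summable_imp_summable_on, of "\<lambda>n. norm (B n)" "{0<..}"]
      dirichlet_series_abs_summable[OF a s] dirichlet_series_abs_summable[OF b s]
    by (auto simp: A_def B_def)
  have "(\<lambda>p. norm (case p of (x, y) \<Rightarrow> A x * B y)) summable_on ({0<..} \<times> {0<..})"
    using nA nB by (subst Infinite_Sum.abs_summable_on_Sigma_iff)
      (auto simp: norm_mult infsum_cmult_right' abs_mult infsum_nonneg intro!: summable_on_cmult_right summable_on_cmult_left)
  then have sm: "(\<lambda>(x, y). A x * B y) summable_on {0<..} \<times> {0<..}"
    by (rule abs_summable_summable)
  have "((\<lambda>(x, y). A x * B y) has_sum (dirichlet_series a s * dirichlet_series b s)) ({0<..} \<times> {0<..})"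
  proof (rule has_sum_SigmaI[OF _ _ sm])
    show "((\<lambda>y. case (x, y) of (x, y) \<Rightarrow> A x * B y) has_sum A x * dirichlet_series b s) {0<..}" for x
      using has_sum_cmult_right[OF sB, of "A x"] by simp
    show "((\<lambda>x. A x * dirichlet_series b s) has_sum dirichlet_series a s * dirichlet_series b s) {0<..}"
      using has_sum_cmult_left[OF sA] .
  qed
  also have "?this \<longleftrightarrow> ((\<lambda>(n, d). A d * B (n div d)) has_sum (dirichlet_series a s * dirichlet_series b s)) (SIGMA n:{0<..}. {d. d dvd n})"
    by (rule has_sum_reindex_bij_witness[where i = "\<lambda>(n, d). (d, n div d)" and j = "\<lambda>(x, y). (x * y, x)"])
       (auto elim!: dvdE)
  finally have "((\<lambda>(n, d). A d * B (n div d)) has_sum (dirichlet_series a s * dirichlet_series b s)) (SIGMA n:{0<..}. {d. d dvd n})" .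
  then have "((\<lambda>n. \<Sum>d | d dvd n. A d * B (n div d)) has_sum (dirichlet_series a s * dirichlet_series b s)) {0<..}"
    by (rule has_sum_SigmaD) (auto intro!: has_sum_finiteI)
  also have "?this \<longleftrightarrow> ((\<lambda>n. (\<Sum>d | d dvd n. if n = 0 then 0 else a d * b (n div d)) * of_nat n powr (- s))
      has_sum (dirichlet_series a s * dirichlet_series b s)) UNIV"
  proof (rule has_sum_cong_neutral)
    fix n :: nat assume "n \<in> {0<..} \<inter> UNIV"
    then have n: "n > 0" by simp
    have "A d * B (n div d) = a d * b (n div d) * of_nat n powr (- s)" if "d dvd n" for d
    proof -
      have "n = d * (n div d)" using that by simp
      then have "(of_nat n :: complex) = of_real (real d) * of_real (real (n div d))"
        by (metis of_nat_mult of_real_of_nat_eq)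
      then have "(of_nat n :: complex) powr (- s) = of_nat d powr (- s) * of_nat (n div d) powr (- s)"
        by (simp add: powr_times_real)
      then show ?thesis by (simp add: A_def B_def)
    qed
    then show "(\<Sum>d | d dvd n. A d * B (n div d)) =
        (\<Sum>d | d dvd n. if n = 0 then 0 else a d * b (n div d)) * of_nat n powr (- s)"
      using n by (simp add: sum_distrib_right)
  qed auto
  finally show ?thesis by (rule has_sum_imp_sums)
qed

section \<open>Logarithmic derivative and absence of zeros to the right of 1\<close>

locale bounded_completely_multiplicative =
  fixes \<psi> :: "nat \<Rightarrow> complex"
  assumes mult: "\<And>m n. \<psi> (m * n) = \<psi> m * \<psi> n" and norm_le_1: "\<And>n. norm (\<psi> n) \<le> 1"
    and one: "\<psi> 1 = 1"
begin

definition twist :: "nat \<Rightarrow> complex" where "twist n = mangoldt n * \<psi> n"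

lemma log_bounded_\<psi>: "log_bounded \<psi>"
proof -
  have "norm (\<psi> n) \<le> 1 + ln (real n)" if "n \<ge> 1" for n
    using norm_le_1[of n] ln_ge_zero[of "real n"] that by linarith
  then show ?thesis by (simp add: log_bounded_def)
qed

lemma norm_twist_le: "norm (twist n) \<le> mangoldt n"
  using mult_left_mono[OF norm_le_1[of n], of "mangoldt n"] mangoldt_nonneg[of n]
  by (simp add: twist_def norm_mult)

lemma log_bounded_twist: "log_bounded twist"
proof -
  have "norm (twist n) \<le> 1 + ln (real n)" if "n \<ge> 1" for n
    using norm_twist_le[of n] mangoldt_le[of n] that by linarith
  then show ?thesis by (simp add: log_bounded_def)
qed

text \<open>The von Mangoldt function convolved with 1 is the logarithm; complete multiplicativity
  carries this over to the twisted coefficients, so the product of the two series is minus the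
  termwise derivative.\<close>

lemma dirichlet_series_has_field_derivative:
  assumes s: "Re s > 1"
  shows "(dirichlet_series \<psi> has_field_derivative - (dirichlet_series twist s * dirichlet_series \<psi> s)) (at s)"
proof -
  obtain d where d: "\<And>s. Re s > 1 \<Longrightarrow> (\<lambda>n. - of_real (ln (real n)) * (\<psi> n * of_nat n powr (- s))) sums d s"
    "\<And>s. Re s > 1 \<Longrightarrow> (dirichlet_series \<psi> has_field_derivative d s) (at s)"
  proof -
    obtain d where "\<forall>s. Re s > 1 \<longrightarrow> (\<lambda>n. - of_real (ln (real n)) * (\<psi> n * of_nat n powr (- s))) sums d s \<and>
      (dirichlet_series \<psi> has_field_derivative d s) (at s)"
      using dirichlet_series_deriv_exists[OF log_bounded_\<psi>] by (rule exE)
    then show ?thesis using that[of d] by simp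
  qed
  have "(\<Sum>d | d dvd n. if n = 0 then 0 else twist d * \<psi> (n div d)) * of_nat n powr (- s)
      = - (- of_real (ln (real n)) * (\<psi> n * of_nat n powr (- s)))" for n
  proof (cases "n = 0")
    case False
    have "(\<Sum>d | d dvd n. twist d * \<psi> (n div d)) = (\<Sum>d | d dvd n. mangoldt d * \<psi> n)"
      by (intro sum.cong refl) (auto simp: twist_def mult[symmetric])
    also have "\<dots> = of_real (ln (real n)) * \<psi> n"
      using False by (simp add: sum_distrib_right[symmetric] mangoldt_sum)
    finally show ?thesis using False by simp
  qed simp
  then have "(\<lambda>n. - (- of_real (ln (real n)) * (\<psi> n * of_nat n powr (- s)))) sums (dirichlet_series twist s * dirichlet_series \<psi> s)"
    using dirichlet_series_mult_sums[OF log_bounded_twist log_bounded_\<psi> s] by (simp only:)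
  then have "d s = - (dirichlet_series twist s * dirichlet_series \<psi> s)"
    using sums_unique2[OF sums_minus[OF d(1)[OF s]]] by (simp add: minus_equation_iff)
  with d(2)[OF s] show ?thesis by simp
qed

text \<open>The first term is 1 and the tail is at most 2 / 3, by comparing \<open>1 / n^2\<close>
  with the telescoping differences of \<open>1 / (n - 1 / 2)\<close>. The bound is uniform in
  \<open>\<psi>\<close>; it will be used at the centres of the discs on which \<open>L\<close> is
  estimated.\<close>

lemma norm_dirichlet_series_2_ge:
  assumes "Re s = 2" shows "norm (dirichlet_series \<psi> s) \<ge> 1 / 3"
proof -
  let ?f = "\<lambda>n. \<psi> n * of_nat n powr (- s)"
  have "(\<lambda>n. ?f (n + 2)) sums (dirichlet_series \<psi> s - (\<Sum>i<2. ?f i))"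
    using dirichlet_series_sums[OF log_bounded_\<psi>, of s] assms by (subst sums_iff_shift') auto
  moreover have "(\<Sum>i<2. ?f i) = 1" using one by (simp add: numeral_2_eq_2)
  ultimately have eq: "dirichlet_series \<psi> s - 1 = (\<Sum>n. ?f (n + 2))" by (simp add: sums_iff)
  let ?t = "\<lambda>n. 1 / (real n + 3 / 2)"
  have "(\<lambda>n. ?t n - ?t (Suc n)) sums (?t 0 - 0)"
    by (rule telescope_sums') real_asymp
  then have t: "(\<lambda>n. ?t n - ?t (Suc n)) sums (2 / 3)" by simp
  have "norm (\<Sum>n. ?f (n + 2)) \<le> (\<Sum>n. ?t n - ?t (Suc n))"
  proof (rule norm_suminf_le)
    fix n
    have "norm (?f (n + 2)) \<le> 1 * norm ((of_nat (n + 2) :: complex) powr (- s))"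
      unfolding norm_mult using norm_le_1 by (intro mult_right_mono) auto
    also have "\<dots> = real (n + 2) powr (- 2)"
      using norm_powr_real_powr[of "of_nat (n + 2)" "- s"] assms by simp
    also have "\<dots> = 1 / (real n + 2) ^ 2"
      by (simp add: powr_minus_divide add_ac)
    also have "\<dots> \<le> ?t n - ?t (Suc n)"
    proof -
      have "?t n - ?t (Suc n) = 1 / ((real n + 3 / 2) * (real n + 5 / 2))"
        by (simp add: field_simps)
      moreover have "(real n + 3 / 2) * (real n + 5 / 2) \<le> (real n + 2) ^ 2"
        by (simp add: power2_eq_square algebra_simps)
      ultimately show ?thesis by (simp add: frac_le)
    qed
    finally show "norm (?f (n + 2)) \<le> ?t n - ?t (Suc n)" .
  qed (use t in \<open>simp add: sums_iff\<close>)
  also have "\<dots> = 2 / 3" using t by (simp add: sums_iff)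
  finally have "norm (dirichlet_series \<psi> s - 1) \<le> 2 / 3" unfolding eq .
  moreover have "norm (1 :: complex) \<le> norm (dirichlet_series \<psi> s) + norm (dirichlet_series \<psi> s - 1)"
    by (metis norm_triangle_sub norm_minus_commute)
  ultimately show ?thesis by simp
qed

text \<open>In place of an Euler product: if \<open>P\<close> is a primitive of
  \<open>dirichlet_series twist\<close>, then the series times \<open>exp P\<close> has derivative
  0, and this constant is not 0 because the value at 2 is not.\<close>

lemma dirichlet_series_nonzero:
  assumes "Re s > 1" shows "dirichlet_series \<psi> s \<noteq> 0"
proof -
  let ?S = "{s. Re s > 1}"
  have S: "open ?S" "convex ?S" by (auto simp: open_halfspace_Re_gt convex_halfspace_Re_gt)
  obtain P where P: "\<And>x. x \<in> ?S \<Longrightarrow> (P has_field_derivative dirichlet_series twist x) (at x within ?S)"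
    using holomorphic_convex_primitive'[OF S(2,1) dirichlet_series_holomorphic[OF log_bounded_twist]] by blast
  have P': "(P has_field_derivative dirichlet_series twist x) (at x)" if "x \<in> ?S" for x
    using P[OF that] S(1) that by (metis at_within_open)
  have "\<exists>c. \<forall>x\<in>?S. dirichlet_series \<psi> x * exp (P x) = c"
  proof (rule has_field_derivative_zero_constant[OF S(2)])
    fix x assume x: "x \<in> ?S"
    have "(dirichlet_series \<psi> has_field_derivative - (dirichlet_series twist x * dirichlet_series \<psi> x)) (at x)"
      using dirichlet_series_has_field_derivative[of x] x by simp
    then have "((\<lambda>x. dirichlet_series \<psi> x * exp (P x)) has_field_derivative 0) (at x)"
      using P'[OF x] by (auto intro!: derivative_eq_intros)
    then show "((\<lambda>x. dirichlet_series \<psi> x * exp (P x)) has_field_derivative 0) (at x within ?S)"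
      by (rule has_field_derivative_at_within)
  qed
  then obtain c where c: "\<And>x. x \<in> ?S \<Longrightarrow> dirichlet_series \<psi> x * exp (P x) = c" by blast
  have "dirichlet_series \<psi> 2 \<noteq> 0" using norm_dirichlet_series_2_ge[of 2] by auto
  then have "c \<noteq> 0" using c[of 2] by auto
  then show ?thesis using c[of s] assms by auto
qed

end

section \<open>Non-vanishing on the line of real part 1\<close>

lemma sum_in_nonneg_Reals:
  "(\<And>x. x \<in> A \<Longrightarrow> f x \<in> \<real>\<^sub>\<ge>\<^sub>0) \<Longrightarrow> sum f A \<in> (\<real>\<^sub>\<ge>\<^sub>0 :: complex set)"
  by (induction A rule: infinite_finite_induct) auto

lemma higher_deriv_powr_neg:
  assumes "n > 0"
  shows "(deriv ^^ k) (\<lambda>s :: complex. of_nat n powr (- s)) = (\<lambda>s. (- of_real (ln (real n))) ^ k * of_nat n powr (- s))"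
proof (induction k)
  case (Suc k)
  have "Ln (of_nat n) = of_real (ln (real n))"
    using assms Ln_of_real[of "real n"] by simp
  then have eq: "(of_nat n :: complex) powr (- s) = exp (- s * of_real (ln (real n)))" for s
    using assms by (simp add: powr_def)
  have "((\<lambda>s. (- of_real (ln (real n))) ^ k * of_nat n powr (- s)) has_field_derivative
     (- of_real (ln (real n))) ^ Suc k * of_nat n powr (- s)) (at s)" for s :: complex
    unfolding eq by (auto intro!: derivative_eq_intros)
  then show ?case by (auto simp: Suc intro!: DERIV_imp_deriv)
qed simp

text \<open>Complete monotonicity at one point. A Taylor series around \<open>z\<close> with such
  coefficients has only nonnegative terms at \<open>z - r\<close> for real
  \<open>r >= 0\<close>.\<close>

definition alternating_at :: "complex \<Rightarrow> (complex \<Rightarrow> complex) \<Rightarrow> bool" where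
  "alternating_at z f \<longleftrightarrow> (\<forall>k. (- 1) ^ k * (deriv ^^ k) f z \<in> \<real>\<^sub>\<ge>\<^sub>0)"

text \<open>The \<open>k\<close>-th derivative of \<open>n powr (- s)\<close> carries the factor
  \<open>(- ln n) ^ k\<close>. The sign pattern holds for partial sums and survives the limit
  because the nonnegative reals are closed.\<close>

lemma dirichlet_series_alternating:
  assumes c: "log_bounded c" and nn: "\<And>n. c n \<in> \<real>\<^sub>\<ge>\<^sub>0"
  shows "alternating_at 2 (dirichlet_series c)"
  unfolding alternating_at_def
proof
  fix k
  let ?f = "\<lambda>N s. \<Sum>n<N. c n * of_nat n powr (- s)"
  let ?h = "\<lambda>n. (1 + 2 / (3 / 2 - 1)) * real n powr (- (1 + (3 / 2 - 1) / 2))"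
  have ul: "uniform_limit (ball 2 (1 / 2)) ?f (dirichlet_series c) sequentially"
    unfolding dirichlet_series_def
  proof (rule Weierstrass_m_test)
    show "summable ?h" by (intro summable_mult iffD2[OF summable_real_powr_iff]) auto
    fix n s assume "s \<in> ball (2 :: complex) (1 / 2)"
    then have "3 / 2 \<le> Re s" using abs_Re_le_cmod[of "2 - s"] by (auto simp: dist_norm)
    then show "norm (c n * of_nat n powr (- s)) \<le> ?h n" by (intro norm_dirichlet_series_term_le[OF c]) auto
  qed
  have "(\<lambda>N. (deriv ^^ k) (?f N) 2) \<longlonglongrightarrow> (deriv ^^ k) (dirichlet_series c) 2"
  proof (rule higher_deriv_complex_uniform_limit[OF ul])
    show "\<forall>\<^sub>F N in sequentially. ?f N holomorphic_on ball 2 (1 / 2)"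
    proof (intro always_eventually allI)
      fix N
      have "(\<lambda>s. c n * of_nat n powr (- s)) holomorphic_on ball 2 (1 / 2)" for n
        by (cases "n = 0") (auto intro!: holomorphic_intros)
      then show "?f N holomorphic_on ball 2 (1 / 2)" by (intro holomorphic_intros)
    qed
  qed auto
  then have lim: "(\<lambda>N. (- 1) ^ k * (deriv ^^ k) (?f N) 2) \<longlonglongrightarrow> (- 1) ^ k * (deriv ^^ k) (dirichlet_series c) 2"
    by (intro tendsto_intros)
  have "(- 1) ^ k * (deriv ^^ k) (?f N) 2 \<in> \<real>\<^sub>\<ge>\<^sub>0" for N
  proof -
    have hol: "(\<lambda>s. c n * of_nat n powr (- s)) holomorphic_on UNIV" for n
      by (cases "n = 0") (auto intro!: holomorphic_intros)
    have "(deriv ^^ k) (?f N) 2 = (\<Sum>n<N. (deriv ^^ k) (\<lambda>s. c n * of_nat n powr (- s)) 2)"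
    proof (induction N)
      case 0
      show ?case by (induction k) auto
    next
      case (Suc N)
      then show ?case
        using higher_deriv_add[of "?f N" UNIV "\<lambda>s. c N * of_nat N powr (- s)" 2 k]
          holomorphic_on_sum[of "{..<N}" "\<lambda>n s. c n * of_nat n powr (- s)" UNIV] hol
        by simp
    qed
    moreover have "(- 1) ^ k * (deriv ^^ k) (\<lambda>s. c n * of_nat n powr (- s)) 2 \<in> \<real>\<^sub>\<ge>\<^sub>0" for n
    proof (cases "n = 0")
      case True
      have "(deriv ^^ k) (\<lambda>s. 0) (2 :: complex) = (0 :: complex)" by (induction k) auto
      with True show ?thesis by simp
    next
      case False
      have "(deriv ^^ k) (\<lambda>s. c n * of_nat n powr (- s)) 2 = c n * (deriv ^^ k) (\<lambda>s. of_nat n powr (- s)) 2"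
        using False by (intro higher_deriv_cmult[of _ UNIV]) (auto intro!: holomorphic_intros)
      also have "\<dots> = c n * ((- of_real (ln (real n))) ^ k * of_nat n powr (- 2))"
        using False by (simp add: higher_deriv_powr_neg)
      also have "(- 1) ^ k * \<dots> = c n * of_real (ln (real n) ^ k * real n powr (- 2))"
      proof -
        have "(- 1) ^ k * (- complex_of_real (ln (real n))) ^ k = of_real (ln (real n) ^ k)"
          by (simp flip: power_mult_distrib)
        moreover have "(of_nat n :: complex) powr (- 2) = of_real (real n powr (- 2))"
          using powr_of_real[of "real n" "- 2"] by simp
        moreover have "(- 1) ^ k * (c n * (a * b)) = c n * (((- 1) ^ k * a) * b)" for a b :: complex
          by (simp only: mult_ac)
        ultimately show ?thesis by (simp only: of_real_mult)
      qed
      also have "\<dots> \<in> \<real>\<^sub>\<ge>\<^sub>0"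
        using False nn by (intro nonneg_Reals_mult_I) (auto intro!: mult_nonneg_nonneg)
      finally show ?thesis .
    qed
    ultimately show ?thesis
      by (simp add: sum_distrib_left sum_in_nonneg_Reals)
  qed
  then show "(- 1) ^ k * (deriv ^^ k) (dirichlet_series c) 2 \<in> \<real>\<^sub>\<ge>\<^sub>0"
    by (rule closed_sequentially[OF closed_nonneg_Reals_complex _ lim])
qed

text \<open>By the equation and the Leibniz rule the alternating signs of \<open>d\<close> pass to
  \<open>R\<close>, by strong induction on the order. The Taylor series of \<open>R\<close> at 2
  converges at 0, since the disc of radius 3 contains 0; all its terms there are nonnegative, and
  the first of them is \<open>R 2\<close>.\<close>

lemma alternating_ode:
  assumes holR: "R holomorphic_on ball 2 3" and hold: "d holomorphic_on ball 2 1"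
    and alt: "alternating_at 2 d" and R2: "R 2 \<in> \<real>\<^sub>\<ge>\<^sub>0"
    and ode: "\<And>s. s \<in> ball 2 1 \<Longrightarrow> deriv R s = - 4 * (d s * R s)"
  shows "Re (R 2) \<le> Re (R 0)"
proof -
  have holR1: "R holomorphic_on ball 2 1" by (rule holomorphic_on_subset[OF holR]) auto
  have alt_R: "(- 1) ^ k * (deriv ^^ k) R 2 \<in> \<real>\<^sub>\<ge>\<^sub>0" for k
  proof (induction k rule: less_induct)
    case (less k)
    show ?case
    proof (cases k)
      case 0
      then show ?thesis using R2 by simp
    next
      case (Suc m)
      have "(deriv ^^ k) R 2 = (deriv ^^ m) (deriv R) 2"
        unfolding Suc by (simp only: funpow_Suc_right o_def)
      also have "\<dots> = (deriv ^^ m) (\<lambda>s. (- 4) * (d s * R s)) 2"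
        by (rule higher_deriv_transform_within_open[of _ "ball 2 1"])
          (auto intro!: holomorphic_intros holR1 hold simp: ode holomorphic_deriv)
      also have "\<dots> = - 4 * (deriv ^^ m) (\<lambda>s. d s * R s) 2"
        by (subst higher_deriv_cmult[of _ "ball 2 1"]) (auto intro!: holomorphic_intros holR1 hold)
      also have "(deriv ^^ m) (\<lambda>s. d s * R s) 2 =
          (\<Sum>i = 0..m. of_nat (m choose i) * (deriv ^^ i) d 2 * (deriv ^^ (m - i)) R 2)"
        by (rule higher_deriv_mult[OF hold holR1]) auto
      finally have "(- 1) ^ k * (deriv ^^ k) R 2 =
          (\<Sum>i = 0..m. (- 1) ^ m * (4 * of_nat (m choose i) * (deriv ^^ i) d 2 * (deriv ^^ (m - i)) R 2))"
        by (simp add: Suc sum_distrib_left sum_negf mult_ac)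
      also have "\<dots> = (\<Sum>i = 0..m. 4 * of_nat (m choose i) * ((- 1) ^ i * (deriv ^^ i) d 2) *
          ((- 1) ^ (m - i) * (deriv ^^ (m - i)) R 2))"
      proof (intro sum.cong refl)
        fix i assume "i \<in> {0..m}"
        then have "(- 1 :: complex) ^ m = (- 1) ^ i * (- 1) ^ (m - i)" by (simp flip: power_add)
        then show "(- 1) ^ m * (4 * of_nat (m choose i) * (deriv ^^ i) d 2 * (deriv ^^ (m - i)) R 2) =
          4 * of_nat (m choose i) * ((- 1) ^ i * (deriv ^^ i) d 2) * ((- 1) ^ (m - i) * (deriv ^^ (m - i)) R 2)"
          by (simp add: mult_ac)
      qed
      also have "\<dots> \<in> \<real>\<^sub>\<ge>\<^sub>0"
      proof (intro sum_in_nonneg_Reals)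
        fix i assume "i \<in> {0..m}"
        have "(- 1) ^ i * (deriv ^^ i) d 2 \<in> \<real>\<^sub>\<ge>\<^sub>0" using alt unfolding alternating_at_def by blast
        moreover have "(- 1) ^ (m - i) * (deriv ^^ (m - i)) R 2 \<in> \<real>\<^sub>\<ge>\<^sub>0" using Suc by (intro less.IH) auto
        moreover have "4 * complex_of_nat (m choose i) \<in> \<real>\<^sub>\<ge>\<^sub>0" by (intro nonneg_Reals_mult_I) simp_all
        ultimately show "4 * of_nat (m choose i) * ((- 1) ^ i * (deriv ^^ i) d 2) *
          ((- 1) ^ (m - i) * (deriv ^^ (m - i)) R 2) \<in> \<real>\<^sub>\<ge>\<^sub>0"
          by (intro nonneg_Reals_mult_I[OF nonneg_Reals_mult_I[of "4 * of_nat (m choose i)"]])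
      qed
      finally show ?thesis .
    qed
  qed
  let ?t = "\<lambda>n. (deriv ^^ n) R 2 / fact n * (0 - 2) ^ n"
  have sums: "?t sums R 0" by (rule holomorphic_power_series[OF holR]) auto
  have nn: "?t n \<in> \<real>\<^sub>\<ge>\<^sub>0" for n
  proof -
    have "?t n = ((- 1) ^ n * (deriv ^^ n) R 2) * of_real (2 ^ n / fact n)"
      by (simp add: power_minus[of 2])
    also have "\<dots> \<in> \<real>\<^sub>\<ge>\<^sub>0"
      using alt_R[of n] by (rule nonneg_Reals_mult_I) (simp only: nonneg_Reals_of_real_iff, simp)
    finally show ?thesis .
  qed
  have re: "(\<lambda>n. Re (?t n)) sums Re (R 0)" by (rule sums_Re[OF sums])
  have "(\<Sum>n<1. Re (?t n)) \<le> (\<Sum>n. Re (?t n))"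
  proof (rule sum_le_suminf)
    show "summable (\<lambda>n. Re (?t n))" using re by (rule sums_summable)
    show "0 \<le> Re (?t n)" if "n \<in> - {..<1}" for n
      using nn[of n] unfolding complex_nonneg_Reals_iff by (rule conjunct1)
  qed simp
  also have "\<dots> = Re (R 0)" using re by (rule sums_unique[symmetric])
  finally show ?thesis by simp
qed

text \<open>The alternating series \<open>1 - 2^(-s) + 3^(-s) - 4^(-s) + ...\<close> has periodic
  coefficients of mean zero and is therefore entire. It gives access to zeta, whose own coefficients
  do not have mean zero.\<close>

interpretation eta: mean_zero_periodic "\<lambda>n. if odd n then 1 else - 1" 2
proof
  have "{..<2} = {0, 1 :: nat}" by auto
  then show "(\<Sum>n<2::nat. if odd n then 1 else - 1) = (0 :: complex)" by simp
qed auto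

interpretation zeta: bounded_completely_multiplicative "\<lambda>_. 1"
  by unfold_locales auto

text \<open>The signs at even \<open>n\<close> are switched by subtracting the even terms twice, and
  these add up to \<open>2 powr (- s)\<close> times zeta.\<close>

lemma eta_eq_zeta:
  assumes "Re s > 1"
  shows "eta.L s = (1 - 2 powr (1 - s)) * dirichlet_series (\<lambda>_. 1) s"
proof -
  have z: "(\<lambda>n. of_nat n powr (- s)) sums dirichlet_series (\<lambda>_. 1) s"
    using dirichlet_series_sums[OF zeta.log_bounded_\<psi> assms] by simp
  have "(\<lambda>n. if even n then 2 powr (- s) * of_nat (n div 2) powr (- s) else 0) sums (2 powr (- s) * dirichlet_series (\<lambda>_. 1) s)"
  proof (subst sums_mono_reindex[of "\<lambda>n. 2 * n", symmetric])
    show "strict_mono (\<lambda>n :: nat. 2 * n)" by (simp add: strict_mono_def)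
    show "(\<lambda>n. if even (2 * n) then 2 powr (- s) * of_nat (2 * n div 2) powr (- s) else 0) sums
        (2 powr (- s) * dirichlet_series (\<lambda>_. 1) s)"
      using sums_mult[OF z, of "2 powr (- s)"] by simp
  qed (auto elim!: evenE)
  moreover have "2 powr (- s) * of_nat (n div 2) powr (- s) = (of_nat n :: complex) powr (- s)" if "even n" for n
  proof -
    have "(of_nat n :: complex) = of_real 2 * of_real (real (n div 2))"
      using that by (auto elim!: evenE)
    also have "\<dots> powr (- s) = of_real 2 powr (- s) * of_real (real (n div 2)) powr (- s)"
      by (rule powr_times_real) auto
    finally show ?thesis by simp
  qed
  ultimately have "(\<lambda>n. if even n then of_nat n powr (- s) else 0) sums (2 powr (- s) * dirichlet_series (\<lambda>_. 1) s)"
    by (simp cong: if_cong)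
  then have "(\<lambda>n. of_nat n powr (- s) - 2 * (if even n then of_nat n powr (- s) else 0)) sums
      (dirichlet_series (\<lambda>_. 1) s - 2 * (2 powr (- s) * dirichlet_series (\<lambda>_. 1) s))"
    by (intro sums_diff sums_mult z)
  moreover have "(\<lambda>n. of_nat n powr (- s) - 2 * (if even n then of_nat n powr (- s) else 0)) sums eta.L s"
  proof -
    let ?f = "\<lambda>n. (of_nat n :: complex) powr (- s) - 2 * (if even n then of_nat n powr (- s) else 0)"
    have "(\<lambda>n. (if odd (Suc n) then 1 else - 1) / of_nat (Suc n) powr s) = (\<lambda>n. ?f (Suc n))"
      by (auto simp: powr_minus divide_inverse)
    then have "(\<lambda>n. ?f (Suc n)) sums eta.L s" using eta.L_sums[OF assms] by simp
    then show ?thesis by (subst (asm) sums_Suc_iff) simp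
  qed
  ultimately have "eta.L s = dirichlet_series (\<lambda>_. 1) s - 2 * (2 powr (- s) * dirichlet_series (\<lambda>_. 1) s)"
    by (rule sums_unique2[symmetric])
  moreover have "(2 :: complex) powr (1 - s) = 2 * 2 powr (- s)"
    using powr_add[of "2 :: complex" 1 "- s"] by simp
  ultimately show ?thesis by (simp add: algebra_simps)
qed

text \<open>The solutions of the equation are spaced by \<open>2 pi / ln 2 > 6\<close> on a vertical
  line through 1, and the disc reaches only to imaginary part 3.\<close>

lemma two_powr_eq_1_imp:
  fixes s :: complex
  assumes "2 powr (1 - s) = 1" "s \<in> ball 2 3"
  shows "s = 1"
proof -
  have "exp ((1 - s) * of_real (ln 2)) = exp 0"
    using assms(1) Ln_of_real[of 2] by (simp add: powr_def)
  moreover have "\<bar>Im ((1 - s) * of_real (ln 2)) - Im 0\<bar> < 2 * pi"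
  proof -
    have "\<bar>Im s\<bar> < 3" using assms(2) abs_Im_le_cmod[of "2 - s"] by (auto simp: dist_norm)
    moreover have "ln (2 :: real) < 1" "ln (2 :: real) > 0" using ln_2_less_1 by auto
    ultimately have "\<bar>Im s\<bar> * ln 2 \<le> 3 * 1" by (intro mult_mono) auto
    then show ?thesis using pi_gt3 by (simp add: abs_mult)
  qed
  ultimately have "(1 - s) * of_real (ln 2) = 0" by (intro exp_complex_eqI[of _ 0])
  then show ?thesis by simp
qed

locale nonprincipal = mean_zero_periodic \<psi> q + bounded_completely_multiplicative \<psi>
  for \<psi> q
begin

lemma L_eq_dirichlet_series:
  assumes "Re s > 1" shows "L s = dirichlet_series \<psi> s"
proof -
  have "(\<lambda>n. \<psi> (Suc n) * of_nat (Suc n) powr (- s)) sums L s"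
    using L_sums[OF assms] by (simp add: powr_minus divide_inverse)
  then have "(\<lambda>n. \<psi> n * of_nat n powr (- s)) sums L s" by (subst (asm) sums_Suc_iff) simp
  then show ?thesis using dirichlet_series_sums[OF log_bounded_\<psi> assms] by (rule sums_unique2)
qed

lemma L_has_field_derivative:
  assumes "Re s > 1" shows "(L has_field_derivative - (dirichlet_series twist s * L s)) (at s)"
proof -
  have "(dirichlet_series \<psi> has_field_derivative - (dirichlet_series twist s * L s)) (at s)"
    using dirichlet_series_has_field_derivative[OF assms] L_eq_dirichlet_series[OF assms] by simp
  then show ?thesis
    by (rule has_field_derivative_transform_within_open[of _ _ _ "{s. Re s > 1}"])
      (auto simp: open_halfspace_Re_gt assms L_eq_dirichlet_series)
qed

section \<open>Non-vanishing at \<open>1 + w\<close> for purely imaginary \<open>w\<close>\<close>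

context
  fixes w :: complex
  assumes Re_w: "Re w = 0"
begin

text \<open>The bracket lies between 0 and 2, so half of it keeps the coefficient between 0 and the
  von Mangoldt function. Up to the factor 4 these are the coefficients of \<open>- F' / F\<close>
  for the product \<open>F\<close> in \<open>L_nonzero_aux\<close>.\<close>

definition tilted_mangoldt :: "nat \<Rightarrow> real" where
  "tilted_mangoldt n = mangoldt n * (1 + Re (\<psi> n * of_nat n powr (- w))) / 2"

lemma norm_twisted_le: "norm (\<psi> n * of_nat n powr (- w)) \<le> 1"
proof -
  have "norm ((of_nat n :: complex) powr (- w)) \<le> 1"
    using norm_powr_real_powr[of "of_nat n" "- w"] Re_w by (cases "n = 0") auto
  then show ?thesis using norm_le_1[of n] by (simp add: norm_mult mult_le_one)
qed

lemma tilted_mangoldt_nonneg: "tilted_mangoldt n \<ge> 0" and tilted_mangoldt_le: "tilted_mangoldt n \<le> mangoldt n"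
proof -
  have "\<bar>Re (\<psi> n * of_nat n powr (- w))\<bar> \<le> 1"
    using norm_twisted_le[of n] abs_Re_le_cmod order.trans by blast
  then have r: "0 \<le> 1 + Re (\<psi> n * of_nat n powr (- w))" "1 + Re (\<psi> n * of_nat n powr (- w)) \<le> 2"
    by auto
  show "tilted_mangoldt n \<ge> 0" using r mangoldt_nonneg[of n] by (simp add: tilted_mangoldt_def)
  show "tilted_mangoldt n \<le> mangoldt n"
    using mult_left_mono[OF r(2) mangoldt_nonneg[of n]] by (simp add: tilted_mangoldt_def)
qed

lemma log_bounded_tilted_mangoldt:
  assumes "\<And>n. c n \<in> {0, of_real (tilted_mangoldt n)}" shows "log_bounded c"
proof -
  have "norm (c n) \<le> 1 + ln (real n)" if "n \<ge> 1" for n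
    using assms[of n] tilted_mangoldt_nonneg[of n] tilted_mangoldt_le[of n] mangoldt_le[of n] ln_ge_zero[of "real n"] that
    by auto
  then show ?thesis by (simp add: log_bounded_def)
qed

lemma dirichlet_series_tilted_mangoldt:
  assumes s: "Re s > 1"
  shows "2 * dirichlet_series zeta.twist s + dirichlet_series twist (s + w) + cnj (dirichlet_series twist (cnj s + w))
    = 4 * dirichlet_series (\<lambda>n. of_real (tilted_mangoldt n)) s"
proof -
  have a: "(\<lambda>n. zeta.twist n * of_nat n powr (- s)) sums dirichlet_series zeta.twist s"
    using dirichlet_series_sums[OF zeta.log_bounded_twist s] .
  have b: "(\<lambda>n. twist n * of_nat n powr (- (s + w))) sums dirichlet_series twist (s + w)"
    using dirichlet_series_sums[OF log_bounded_twist, of "s + w"] s Re_w by simp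
  have c: "(\<lambda>n. cnj (twist n * of_nat n powr (- (cnj s + w)))) sums cnj (dirichlet_series twist (cnj s + w))"
    using dirichlet_series_sums[OF log_bounded_twist, of "cnj s + w"] s Re_w by (simp only: sums_cnj) simp
  have "(\<lambda>n. 2 * (zeta.twist n * of_nat n powr (- s)) + twist n * of_nat n powr (- (s + w)) +
      cnj (twist n * of_nat n powr (- (cnj s + w)))) sums
    (2 * dirichlet_series zeta.twist s + dirichlet_series twist (s + w) + cnj (dirichlet_series twist (cnj s + w)))"
    by (intro sums_add sums_mult a b c)
  moreover have "2 * (zeta.twist n * of_nat n powr (- s)) + twist n * of_nat n powr (- (s + w)) +
      cnj (twist n * of_nat n powr (- (cnj s + w))) = 4 * (of_real (tilted_mangoldt n) * of_nat n powr (- s))" for n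
  proof (cases "n = 0")
    case False
    define u where "u = \<psi> n * of_nat n powr (- w)"
    have p: "(of_nat n :: complex) powr (- (z + w)) = of_nat n powr (- z) * of_nat n powr (- w)" for z
      using False by (simp add: powr_def exp_add[symmetric] algebra_simps)
    have "cnj ((of_nat n :: complex) powr (- cnj s)) = of_nat n powr (- s)"
      using False by (subst cnj_powr) (auto simp: complex_nonpos_Reals_iff)
    then have "2 * (zeta.twist n * of_nat n powr (- s)) + twist n * of_nat n powr (- (s + w)) +
        cnj (twist n * of_nat n powr (- (cnj s + w)))
      = mangoldt n * of_nat n powr (- s) * (2 + (u + cnj u))"
      unfolding p twist_def zeta.twist_def u_def
      by (simp add: algebra_simps mangoldt_def)
    also have "u + cnj u = of_real (2 * Re u)" by (simp add: complex_eq_iff)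
    also have "mangoldt n * of_nat n powr (- s) * (2 + of_real (2 * Re u)) =
        4 * (of_real (tilted_mangoldt n) * of_nat n powr (- s))"
      by (simp add: tilted_mangoldt_def u_def algebra_simps)
    finally show ?thesis .
  qed (simp add: twist_def)
  ultimately have "(\<lambda>n. 4 * (of_real (tilted_mangoldt n) * of_nat n powr (- s))) sums
    (2 * dirichlet_series zeta.twist s + dirichlet_series twist (s + w) + cnj (dirichlet_series twist (cnj s + w)))" by simp
  moreover have "(\<lambda>n. 4 * (of_real (tilted_mangoldt n) * of_nat n powr (- s))) sums
      (4 * dirichlet_series (\<lambda>n. of_real (tilted_mangoldt n)) s)"
    by (intro sums_mult dirichlet_series_sums log_bounded_tilted_mangoldt s) auto
  ultimately show ?thesis by (rule sums_unique2)
qed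

text \<open>A partial sum of \<open>ln F\<close> at the real point \<open>\<sigma>\<close>: dividing
  the coefficients of \<open>- F' / F\<close> by \<open>ln n\<close> integrates termwise.\<close>

definition tilted_prime_sum :: "nat \<Rightarrow> real \<Rightarrow> real" where
  "tilted_prime_sum N \<sigma> = (\<Sum>n\<in>{2..N}. 4 * (tilted_mangoldt n / ln (real n)) * real n powr (- \<sigma>))"

lemma tilted_prime_sum_2_le: "tilted_prime_sum N 2 \<le> 4 * (\<Sum>n. real n powr (- 2))"
proof -
  have s: "summable (\<lambda>n. real n powr (- 2))" by (subst summable_real_powr_iff) auto
  have "tilted_prime_sum N 2 \<le> (\<Sum>n\<in>{2..N}. 4 * 1 * real n powr (- 2))"
    unfolding tilted_prime_sum_def
  proof (intro sum_mono mult_right_mono mult_left_mono)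
    fix n assume "n \<in> {2..N}"
    then have "n \<ge> 2" by simp
    then show "tilted_mangoldt n / ln (real n) \<le> 1"
      using tilted_mangoldt_le[of n] mangoldt_le[of n] by (simp add: divide_le_eq)
  qed auto
  also have "\<dots> = 4 * (\<Sum>n\<in>{2..N}. real n powr (- 2))" by (simp add: sum_distrib_left)
  also have "(\<Sum>n\<in>{2..N}. real n powr (- 2)) \<le> (\<Sum>n. real n powr (- 2))"
    by (intro sum_le_suminf s) auto
  finally show ?thesis by simp
qed

text \<open>A prime alone contributes nothing if \<open>z = \<psi> p * p powr (- w)\<close> equals
  -1. Together with its square it contributes
  \<open>2 (1 + Re z) + (1 + Re (z^2)) = 2 + 2 Re z + 2 (Re z)^2\<close>, as
  \<open>norm z = 1\<close>, and this is at least 3 / 2.\<close>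

lemma tilted_prime_sum_0_ge:
  assumes P: "finite P" "\<And>p. p \<in> P \<Longrightarrow> prime p" and unit: "\<And>p. p \<in> P \<Longrightarrow> norm (\<psi> p) = 1"
  shows "\<exists>N. tilted_prime_sum N 0 \<ge> 3 / 2 * real (card P)"
proof -
  define N where "N = (\<Sum>p\<in>P. p ^ 2)"
  have N: "p ^ 2 \<le> N" if "p \<in> P" for p
    unfolding N_def using P that by (intro member_le_sum) auto
  define f where "f = (\<lambda>n. 4 * (tilted_mangoldt n / ln (real n)))"
  have fnn: "f n \<ge> 0" if "n \<ge> 2" for n
    using that tilted_mangoldt_nonneg[of n] by (simp add: f_def)
  have inj: "inj_on (\<lambda>p. p ^ 2) P" by (auto simp: inj_on_def)
  have disj: "P \<inter> (\<lambda>p. p ^ 2) ` P = {}"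
  proof safe
    fix p assume "p ^ 2 \<in> P" "p \<in> P"
    then have "prime (p ^ 2)" using P by blast
    then show "p ^ 2 \<in> {}" by (simp add: prime_power_iff)
  qed
  have f_ge: "f p + f (p ^ 2) \<ge> 3 / 2" if p: "p \<in> P" for p
  proof -
    have pr: "prime p" using P p by blast
    then have p1: "real p > 1" using prime_gt_1_nat by auto
    define z where "z = \<psi> p * of_nat p powr (- w)"
    have nz: "norm z = 1"
      using unit[OF p] norm_powr_real_powr[of "of_nat p" "- w"] Re_w p1
      by (simp add: z_def norm_mult)
    have "(of_nat (p ^ 2) :: complex) powr (- w) = of_nat p powr (- w) * of_nat p powr (- w)"
      using powr_times_real[of "of_nat p" "of_nat p" "- w"] by (simp add: power2_eq_square)
    then have z2: "\<psi> (p ^ 2) * of_nat (p ^ 2) powr (- w) = z ^ 2"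
      using mult[of p p] by (simp add: z_def power2_eq_square)
    have "f p = 2 * (1 + Re z)"
      using p1 pr by (simp add: f_def tilted_mangoldt_def z_def)
    moreover have "f (p ^ 2) = 1 + Re (z ^ 2)"
    proof -
      have "mangoldt (p ^ 2) = ln (real p)" using pr by simp
      moreover have "ln (real (p ^ 2)) = 2 * ln (real p)" using p1 by (simp add: ln_realpow)
      ultimately show ?thesis using p1 unfolding f_def tilted_mangoldt_def z2 by simp
    qed
    moreover have "Re (z ^ 2) = 2 * (Re z) ^ 2 - 1"
      using nz cmod_power2[of z] by (simp add: Re_power2)
    moreover have "2 + 2 * Re z + 2 * (Re z) ^ 2 \<ge> 3 / 2"
      using zero_le_power2[of "2 * Re z + 1"] by (simp add: power2_eq_square algebra_simps)
    ultimately show ?thesis by simp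
  qed
  have "3 / 2 * real (card P) = (\<Sum>p\<in>P. 3 / 2)" by simp
  also have "\<dots> \<le> (\<Sum>p\<in>P. f p + f (p ^ 2))" by (intro sum_mono f_ge)
  also have "\<dots> = (\<Sum>n\<in>P \<union> (\<lambda>p. p ^ 2) ` P. f n)"
    using P disj by (subst sum.union_disjoint) (auto simp: sum.distrib sum.reindex[OF inj])
  also have "\<dots> \<le> (\<Sum>n\<in>{2..N}. f n)"
  proof (intro sum_mono2)
    have "p \<ge> 2 \<and> p \<le> N \<and> p ^ 2 \<ge> 2" if "p \<in> P" for p
    proof -
      have "p \<ge> 2" using P that prime_ge_2_nat by blast
      moreover have "p \<le> p ^ 2" by (simp add: power2_eq_square)
      ultimately show ?thesis using N[OF that] by linarith
    qed
    then show "P \<union> (\<lambda>p. p ^ 2) ` P \<subseteq> {2..N}" using N by auto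
  qed (use fnn in auto)
  also have "\<dots> = tilted_prime_sum N 0" by (auto simp: tilted_prime_sum_def f_def intro!: sum.cong)
  finally show ?thesis by blast
qed


text \<open>If \<open>L (1 + w) = 0\<close>, then \<open>F s = \<zeta>(s)\<^sup>2 L(s + w) cnj (L(cnj s + w))\<close> has no pole, and
  \<open>F' / F\<close> is \<open>- 4\<close> times a Dirichlet series with nonnegative coefficients.  Dividing \<open>F\<close> by the
  exponential of any partial sum of \<open>ln F\<close> leaves a function whose Taylor coefficients at 2 still
  alternate in sign, hence whose value at 0 is at least its value at 2.  Thus all these partial sums are
  bounded at 0, which is absurd.\<close>

lemma L_nonzero_aux:
  assumes inf: "infinite {p. prime p \<and> norm (\<psi> p) = 1}" and zero: "L (1 + w) = 0"
  shows False
proof -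
  define Lw where "Lw = (\<lambda>s. L (s + w))"
  \<comment> \<open>\<open>A\<close> and \<open>Ab\<close> divide out the assumed zeros,
    \<open>E1\<close> the zero of \<open>1 - 2 powr (1 - s)\<close> at 1. The double pole of zeta
    squared is thereby cancelled, and \<open>F\<close> is holomorphic on a disc around 2 that
    contains 0.\<close>
  define A where "A = (\<lambda>s. if s = 1 then deriv Lw 1 else (Lw s - Lw 1) / (s - 1))"
  define Ab where "Ab = cnj \<circ> A \<circ> cnj"
  define E where "E = (\<lambda>s :: complex. 1 - 2 powr (1 - s))"
  define E1 where "E1 = (\<lambda>s. if s = 1 then deriv E 1 else (E s - E 1) / (s - 1))"
  define Z where "Z = dirichlet_series (\<lambda>_. 1)"
  define F where "F = (\<lambda>s. (eta.L s / E1 s) ^ 2 * (A s * Ab s))"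
  have holLw: "Lw holomorphic_on UNIV"
  proof -
    have "(\<lambda>s. s + w) holomorphic_on UNIV" by (intro holomorphic_intros)
    then show ?thesis
      using holomorphic_on_compose[of "\<lambda>s. s + w" UNIV L] L_holomorphic by (simp add: Lw_def o_def)
  qed
  have holA: "A holomorphic_on UNIV"
    unfolding A_def by (intro pole_lemma_open holLw) auto
  have holAb: "Ab holomorphic_on UNIV"
    unfolding Ab_def by (intro holomorphic_on_compose_cnj_cnj holomorphic_on_subset[OF holA]) auto
  have holE: "E holomorphic_on UNIV"
    unfolding E_def by (auto intro!: holomorphic_intros)
  have holE1: "E1 holomorphic_on UNIV"
    unfolding E1_def by (intro pole_lemma_open holE) auto
  have Lw1: "Lw 1 = 0" using zero by (simp add: Lw_def)
  have E_1: "E 1 = 0" by (simp add: E_def)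
  have E1_nz: "E1 s \<noteq> 0" if "s \<in> ball 2 3" for s
  proof (cases "s = 1")
    case True
    have eq: "(2 :: complex) powr (1 - s) = exp ((1 - s) * of_real (ln 2))" for s
      using Ln_of_real[of 2] by (simp add: powr_def)
    have "(E has_field_derivative of_real (ln 2)) (at 1)"
      unfolding E_def eq by (auto intro!: derivative_eq_intros)
    then have "deriv E 1 = of_real (ln 2)" by (rule DERIV_imp_deriv)
    then show ?thesis using True by (simp add: E1_def)
  next
    case False
    then have "E s \<noteq> 0" using two_powr_eq_1_imp[of s] that by (auto simp: E_def)
    then show ?thesis using False by (simp add: E1_def E_1)
  qed
  have holF: "F holomorphic_on ball 2 3"
    unfolding F_def using E1_nz
    by (intro holomorphic_intros eta.L_holomorphic holomorphic_on_subset[OF holA]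
        holomorphic_on_subset[OF holAb] holomorphic_on_subset[OF holE1]) auto
  have F_eq: "F s = Z s ^ 2 * (L (s + w) * cnj (L (cnj s + w)))" if s: "Re s > 1" for s
  proof -
    have s1: "s \<noteq> 1" "cnj s \<noteq> 1" using s by auto
    have "E s \<noteq> 0 \<or> eta.L s = 0" using eta_eq_zeta[OF s] by (auto simp: E_def)
    moreover have "E s \<noteq> 0"
    proof
      assume "E s = 0"
      then have "norm ((2 :: complex) powr (1 - s)) = 1" by (simp add: E_def)
      then have "2 powr (1 - Re s) = (1 :: real)"
        using norm_powr_real_powr[of 2 "1 - s"] by simp
      then show False using s powr_eq_one_iff[of 2 "1 - Re s"] by simp
    qed
    ultimately have "eta.L s / E1 s = Z s * (s - 1)"
      using s1 eta_eq_zeta[OF s] by (simp add: E1_def E_1 E_def Z_def)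
    moreover have "A s = L (s + w) / (s - 1)" using s1 by (simp add: A_def Lw1) (simp add: Lw_def)
    moreover have "Ab s = cnj (L (cnj s + w)) / (s - 1)"
      using s1 by (simp add: Ab_def A_def Lw1) (simp add: Lw_def)
    moreover have "(z * k) ^ 2 * (a / k * (b / k)) = z ^ 2 * (a * b)" if "k \<noteq> 0" for z k a b :: complex
      using that by (simp add: field_simps power2_eq_square)
    ultimately show ?thesis using s1 by (simp add: F_def)
  qed
  define e where "e = (\<lambda>n. complex_of_real (tilted_mangoldt n))"
  have F_deriv: "(F has_field_derivative - (4 * dirichlet_series e s * F s)) (at s)" if s: "Re s > 1" for s
  proof -
    have sw: "Re (s + w) > 1" "Re (cnj s + w) > 1" using s Re_w by auto
    have "(Z has_field_derivative - (dirichlet_series zeta.twist s * Z s)) (at s)"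
      unfolding Z_def by (rule zeta.dirichlet_series_has_field_derivative[OF s])
    moreover have "((\<lambda>s. L (s + w)) has_field_derivative - (dirichlet_series twist (s + w) * L (s + w))) (at s)"
      using L_has_field_derivative[OF sw(1)] by (simp add: DERIV_shift)
    moreover have "((\<lambda>s. cnj (L (cnj s + w))) has_field_derivative
        cnj (- (dirichlet_series twist (cnj s + w) * L (cnj s + w)))) (at s)"
    proof -
      have "((\<lambda>s. L (s + w)) has_field_derivative - (dirichlet_series twist (cnj s + w) * L (cnj s + w))) (at (cnj s))"
        using L_has_field_derivative[OF sw(2)] by (simp add: DERIV_shift)
      from has_field_derivative_cnj_cnj[OF this] show ?thesis unfolding o_def .
    qed
    ultimately have "((\<lambda>s. Z s ^ 2 * (L (s + w) * cnj (L (cnj s + w)))) has_field_derivative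
        - ((2 * dirichlet_series zeta.twist s + dirichlet_series twist (s + w) + cnj (dirichlet_series twist (cnj s + w))) *
          (Z s ^ 2 * (L (s + w) * cnj (L (cnj s + w)))))) (at s)"
      by (auto intro!: derivative_eq_intros simp: power2_eq_square algebra_simps)
    then have "((\<lambda>s. Z s ^ 2 * (L (s + w) * cnj (L (cnj s + w)))) has_field_derivative
        - (4 * dirichlet_series e s * F s)) (at s)"
      using dirichlet_series_tilted_mangoldt[OF s] F_eq[OF s] unfolding e_def by simp
    then show ?thesis
      by (rule has_field_derivative_transform_within_open[of _ _ _ "{s. Re s > 1}"])
        (auto simp: open_halfspace_Re_gt s F_eq)
  qed
  define F2 where "F2 = (norm (Z 2) * norm (L (2 + w))) ^ 2"
  have lb_e: "log_bounded e" unfolding e_def by (rule log_bounded_tilted_mangoldt) auto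
  \<comment> \<open>Order 0 of this says that \<open>Z 2\<close> is a nonnegative real, so that
    \<open>F 2\<close> is the real number \<open>F2\<close>.\<close>
  have "alternating_at 2 Z"
    unfolding Z_def by (rule dirichlet_series_alternating[OF zeta.log_bounded_\<psi>]) auto
  then have "(- 1) ^ 0 * (deriv ^^ 0) Z 2 \<in> \<real>\<^sub>\<ge>\<^sub>0" unfolding alternating_at_def by blast
  then obtain z0 where z0: "Z 2 = of_real z0" "z0 \<ge> 0"
    by (auto elim!: nonneg_Reals_cases)
  have F_2: "F 2 = of_real F2"
    using F_eq[of 2] complex_norm_square[of "L (2 + w)"] z0
    by (simp add: F2_def power_mult_distrib)
  have F2_pos: "F2 > 0"
    using dirichlet_series_nonzero[of "2 + w"] zeta.dirichlet_series_nonzero[of 2] L_eq_dirichlet_series[of "2 + w"] Re_w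
    by (auto simp: F2_def Z_def)
  have bound: "F2 * exp (tilted_prime_sum N 0 - tilted_prime_sum N 2) \<le> norm (F 0)" for N
  proof -
    define c where "c = (\<lambda>n. if n \<le> N then 0 else e n)"
    define B where "B = (\<lambda>s :: complex. \<Sum>n\<in>{2..N}. of_real (4 * (tilted_mangoldt n / ln (real n))) * of_nat n powr (- s))"
    define R where "R = (\<lambda>s. F s * exp (- B s))"
    have lb_c: "log_bounded c" by (rule log_bounded_tilted_mangoldt) (auto simp: c_def e_def)
    have B_real: "B (of_real \<sigma>) = of_real (tilted_prime_sum N \<sigma>)" for \<sigma>
      unfolding B_def tilted_prime_sum_def of_real_sum
    proof (intro sum.cong refl)
      fix n
      have "(of_nat n :: complex) powr (- of_real \<sigma>) = of_real (real n powr (- \<sigma>))"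
        using powr_of_real[of "real n" "- \<sigma>"] by simp
      then show "of_real (4 * (tilted_mangoldt n / ln (real n))) * of_nat n powr (- of_real \<sigma>) =
          complex_of_real (4 * (tilted_mangoldt n / ln (real n)) * real n powr (- \<sigma>))" by simp
    qed
    have B_deriv: "(B has_field_derivative - 4 * (\<Sum>n\<in>{2..N}. e n * of_nat n powr (- s))) (at s)" for s
    proof -
      have t: "((\<lambda>s. of_real (4 * (tilted_mangoldt n / ln (real n))) * of_nat n powr (- s)) has_field_derivative
          - 4 * (e n * of_nat n powr (- s))) (at s)" if "n \<in> {2..N}" for n
      proof -
        have n: "n \<ge> 2" using that by simp
        have "Ln (of_nat n) = of_real (ln (real n))"
          using n Ln_of_real[of "real n"] by simp
        then have eq: "(of_nat n :: complex) powr (- s) = exp (- s * of_real (ln (real n)))" for s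
          using n by (simp add: powr_def)
        have "ln (real n) \<noteq> 0" using n by simp
        then show ?thesis unfolding eq e_def by (auto intro!: derivative_eq_intros)
      qed
      show ?thesis unfolding B_def sum_distrib_left by (rule DERIV_sum[OF t])
    qed
    have holB: "B holomorphic_on A" for A
      using B_deriv by (meson field_differentiable_at_within field_differentiable_def holomorphic_onI)
    have tail: "dirichlet_series e s - (\<Sum>n\<in>{2..N}. e n * of_nat n powr (- s)) = dirichlet_series c s" if s: "Re s > 1" for s
    proof -
      have "(\<lambda>n. e n * of_nat n powr (- s) - (if n \<in> {2..N} then e n * of_nat n powr (- s) else 0)) sums
          (dirichlet_series e s - (\<Sum>n\<in>{2..N}. e n * of_nat n powr (- s)))"
        by (intro sums_diff dirichlet_series_sums lb_e s sums_If_finite_set) auto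
      moreover have "e n * of_nat n powr (- s) - (if n \<in> {2..N} then e n * of_nat n powr (- s) else 0)
          = c n * of_nat n powr (- s)" for n
      proof -
        have "n \<in> {2..N} \<or> n > N \<or> n = 0 \<or> n = Suc 0" by auto
        then show ?thesis by (auto simp: c_def e_def tilted_mangoldt_def)
      qed
      ultimately have "(\<lambda>n. c n * of_nat n powr (- s)) sums
          (dirichlet_series e s - (\<Sum>n\<in>{2..N}. e n * of_nat n powr (- s)))" by (simp only:)
      then show ?thesis by (rule sums_unique2[OF _ dirichlet_series_sums[OF lb_c s]])
    qed
    have exp_B: "exp (- B (of_real \<sigma>)) = of_real (exp (- tilted_prime_sum N \<sigma>))" for \<sigma>
      unfolding B_real exp_of_real[symmetric] by simp
    have Re_ball: "Re s > 1" if "s \<in> ball 2 1" for s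
      using that abs_Re_le_cmod[of "2 - s"] by (auto simp: dist_norm)
    have "Re (R 2) \<le> Re (R 0)"
    proof (rule alternating_ode)
      show "R holomorphic_on ball 2 3"
        unfolding R_def by (intro holomorphic_intros holF holB)
      show "dirichlet_series c holomorphic_on ball 2 1"
        by (rule holomorphic_on_subset[OF dirichlet_series_holomorphic[OF lb_c]]) (auto intro: Re_ball)
      show "alternating_at 2 (dirichlet_series c)"
        by (rule dirichlet_series_alternating[OF lb_c]) (auto simp: c_def e_def tilted_mangoldt_nonneg)
      show "R 2 \<in> \<real>\<^sub>\<ge>\<^sub>0"
        unfolding R_def using exp_B[of 2] F_2 F2_pos by (simp flip: of_real_mult)
      fix s :: complex assume "s \<in> ball 2 1"
      then have s: "Re s > 1" by (rule Re_ball)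
      have "(R has_field_derivative - 4 * (dirichlet_series c s * R s)) (at s)"
      proof -
        have "((\<lambda>s. exp (- B s)) has_field_derivative
            exp (- B s) * - (- 4 * (\<Sum>n\<in>{2..N}. e n * of_nat n powr (- s)))) (at s)"
          by (rule DERIV_chain2[OF DERIV_exp DERIV_minus[OF B_deriv]])
        from DERIV_mult[OF F_deriv[OF s] this] show ?thesis
          unfolding R_def tail[OF s, symmetric] by (simp add: algebra_simps)
      qed
      then show "deriv R s = - 4 * (dirichlet_series c s * R s)" by (rule DERIV_imp_deriv)
    qed
    moreover have "Re (R 2) = F2 * exp (- tilted_prime_sum N 2)"
      using exp_B[of 2] F_2 by (simp add: R_def)
    moreover have "Re (R 0) \<le> norm (F 0) * exp (- tilted_prime_sum N 0)"
      using complex_Re_le_cmod[of "F 0"] exp_B[of 0] by (simp add: R_def)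
    ultimately have "F2 * exp (- tilted_prime_sum N 2) \<le> norm (F 0) * exp (- tilted_prime_sum N 0)" by linarith
    then show ?thesis by (simp add: exp_diff exp_minus field_simps)
  qed
  define K where "K = 4 * (\<Sum>n. real n powr (- 2))"
  \<comment> \<open>\<open>m\<close> primes contribute at least \<open>3 m / 2\<close> at 0 whereas
    the sums at 2 stay below \<open>K\<close>; since \<open>exp t >= 1 + t\<close>, this
    \<open>m\<close> is too large for the bound \<open>norm (F 0) / F2\<close>.\<close>
  obtain m :: nat where m: "real m > (norm (F 0) / F2 + K)" using reals_Archimedean2 by blast
  obtain P where P: "P \<subseteq> {p. prime p \<and> norm (\<psi> p) = 1}" "finite P" "card P = m"
    using infinite_arbitrarily_large[OF inf] by metis
  obtain N where N: "tilted_prime_sum N 0 \<ge> 3 / 2 * real (card P)"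
    using tilted_prime_sum_0_ge[of P] P by auto
  have "norm (F 0) / F2 < real m - K" using m by simp
  also have "\<dots> \<le> tilted_prime_sum N 0 - tilted_prime_sum N 2" using N P tilted_prime_sum_2_le[of N] by (simp add: K_def)
  also have "\<dots> \<le> exp (tilted_prime_sum N 0 - tilted_prime_sum N 2)" using exp_ge_add_one_self[of "tilted_prime_sum N 0 - tilted_prime_sum N 2"] by linarith
  also have "\<dots> \<le> norm (F 0) / F2" using bound[of N] F2_pos by (simp add: field_simps)
  finally show False by simp
qed

end

lemma L_nonzero_Re_1:
  assumes "infinite {p. prime p \<and> norm (\<psi> p) = 1}" "Re s = 1"
  shows "L s \<noteq> 0"
  using L_nonzero_aux[of "s - 1"] assms by auto

end

section \<open>The logarithmic derivative in a zero-free half plane\<close>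

text \<open>The map \<open>w / (2 M - w)\<close> fixes 0 and takes the half plane
  \<open>Re w < M\<close> into the unit disc; Schwarz' lemma applies to its composition with the
  rescaled \<open>g\<close>.\<close>

lemma borel_caratheodory:
  assumes g: "g holomorphic_on ball c R" and gc: "g c = 0" and M: "\<And>z. z \<in> ball c R \<Longrightarrow> Re (g z) < M"
    and z: "z \<in> ball c R"
  shows "norm (g z) * (R - norm (z - c)) \<le> 2 * M * norm (z - c)"
proof -
  have R: "R > 0" using z by (metis ball_eq_empty empty_iff not_le)
  then have M0: "M > 0" using M[of c] gc by simp
  define G where "G = (\<lambda>\<xi>. g (c + of_real R * \<xi>))"
  define f where "f = (\<lambda>\<xi>. G \<xi> / (of_real (2 * M) - G \<xi>))"
  have im: "c + of_real R * \<xi> \<in> ball c R" if "norm \<xi> < 1" for \<xi>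
    using that R by (simp add: dist_norm norm_mult)
  have ReG: "Re (G \<xi>) < M" if "norm \<xi> < 1" for \<xi>
    unfolding G_def using M im[OF that] by blast
  have nz: "of_real (2 * M) - G \<xi> \<noteq> 0" if "norm \<xi> < 1" for \<xi>
    using ReG[OF that] M0 by (auto simp: complex_eq_iff)
  have holG: "G holomorphic_on ball 0 1"
  proof -
    have "(g \<circ> (\<lambda>\<xi>. c + of_real R * \<xi>)) holomorphic_on ball 0 1"
      by (rule holomorphic_on_compose_gen[OF _ g]) (auto intro!: holomorphic_intros im)
    then show ?thesis by (simp add: G_def o_def)
  qed
  have holf: "f holomorphic_on ball 0 1"
    unfolding f_def using nz by (intro holomorphic_intros holG) auto
  have lt: "norm (f \<xi>) < 1" if "norm \<xi> < 1" for \<xi>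
  proof -
    have "(norm (G \<xi>)) ^ 2 < (norm (of_real (2 * M) - G \<xi>)) ^ 2"
    proof -
      have "(2 * M - Re (G \<xi>)) ^ 2 - Re (G \<xi>) ^ 2 = 4 * (M * (M - Re (G \<xi>)))"
        by (simp add: power2_eq_square algebra_simps)
      moreover have "M * (M - Re (G \<xi>)) > 0" using ReG[OF that] M0 by simp
      ultimately show ?thesis by (simp add: cmod_power2)
    qed
    then have "norm (G \<xi>) < norm (of_real (2 * M) - G \<xi>)"
      by (rule power2_less_imp_less) simp
    then show ?thesis using nz[OF that] by (simp add: f_def norm_divide)
  qed
  define \<xi> where "\<xi> = (z - c) / of_real R"
  have zeq: "c + of_real R * \<xi> = z" using R by (simp add: \<xi>_def)
  have n\<xi>: "norm \<xi> = norm (z - c) / R" using R by (simp add: \<xi>_def norm_divide)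
  have \<xi>1: "norm \<xi> < 1" using z R by (simp add: n\<xi> dist_norm norm_minus_commute)
  have f0: "f 0 = 0" by (simp add: f_def G_def gc)
  have "norm (f \<xi>) \<le> norm \<xi>"
    by (rule Schwarz_Lemma(1)[OF holf f0 lt \<xi>1])
  then have "norm (G \<xi>) \<le> norm \<xi> * norm (of_real (2 * M) - G \<xi>)"
    using nz[OF \<xi>1] by (simp add: f_def norm_divide divide_le_eq mult.commute)
  also have "\<dots> \<le> norm \<xi> * (2 * M + norm (G \<xi>))"
    using norm_triangle_ineq4[of "of_real (2 * M)" "G \<xi>"] M0 by (intro mult_left_mono) auto
  finally have "norm (g z) \<le> norm (z - c) / R * (2 * M + norm (g z))"
    by (simp add: G_def zeq n\<xi>)
  then show ?thesis using R by (simp add: field_simps)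
qed

text \<open>A function without zeros on a disc has a logarithm there, whose real part is controlled
  by the size of the function. Borel-Caratheodory bounds the logarithm itself within radius
  \<open>r\<close>, and Cauchy's inequality on a circle of radius \<open>\<rho>\<close> bounds its
  derivative.\<close>

lemma log_deriv_bound:
  assumes f: "f holomorphic_on ball c R" and nz: "\<And>z. z \<in> ball c R \<Longrightarrow> f z \<noteq> 0"
    and M: "\<And>z. z \<in> ball c R \<Longrightarrow> norm (f z) < exp M * norm (f c)"
    and z: "norm (z - c) + \<rho> \<le> r" and r: "r < R" and \<rho>: "\<rho> > 0"
  shows "norm (deriv f z / f z) \<le> 2 * M * r / ((R - r) * \<rho>)"
proof -
  have r0: "r > 0" using z \<rho> norm_ge_zero[of "z - c"] by linarith
  then have c: "c \<in> ball c R" using r by auto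
  then have "norm (f c) < exp M * norm (f c)" using M by blast
  then have M0: "M > 0" using nz[OF c] by simp
  obtain h where h: "h holomorphic_on ball c R" "\<And>z. z \<in> ball c R \<Longrightarrow> f z = exp (h z)"
    using contractible_imp_holomorphic_log[OF f convex_imp_contractible[OF convex_ball] nz] by blast
  define g where "g = (\<lambda>z. h z - h c)"
  have holg: "g holomorphic_on ball c R" unfolding g_def by (intro holomorphic_intros h)
  have Re_g: "Re (g w) < M" if w: "w \<in> ball c R" for w
  proof -
    have "exp (Re (h w)) < exp M * exp (Re (h c))"
      using M[OF w] h(2)[OF w] h(2)[OF c] by simp
    then have "exp (Re (h w)) < exp (M + Re (h c))" by (simp add: exp_add)
    then show ?thesis by (simp add: g_def)
  qed
  have sub: "w \<in> ball c R" "norm (w - c) \<le> r" if "w \<in> cball z \<rho>" for w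
  proof -
    have "norm (w - c) \<le> norm (w - z) + norm (z - c)"
      using norm_triangle_ineq[of "w - z" "z - c"] by simp
    then show *: "norm (w - c) \<le> r" using that z by (simp add: dist_norm norm_minus_commute)
    then show "w \<in> ball c R" using r by (simp add: dist_norm norm_minus_commute)
  qed
  have bd: "norm (g w) \<le> 2 * M * r / (R - r)" if "w \<in> cball z \<rho>" for w
  proof -
    have "norm (g w) * (R - r) \<le> norm (g w) * (R - norm (w - c))"
      using sub[OF that] by (intro mult_left_mono) auto
    also have "\<dots> \<le> 2 * M * norm (w - c)"
      by (rule borel_caratheodory[OF holg _ Re_g]) (use sub[OF that] in \<open>auto simp: g_def\<close>)
    also have "\<dots> \<le> 2 * M * r" using sub[OF that] M0 by (intro mult_left_mono) auto
    finally show ?thesis using r by (simp add: pos_le_divide_eq)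
  qed
  have "norm ((deriv ^^ 1) g z) \<le> fact 1 * (2 * M * r / (R - r)) / \<rho> ^ 1"
  proof (rule Cauchy_inequality)
    show "g holomorphic_on ball z \<rho>" by (rule holomorphic_on_subset[OF holg]) (use sub(1) in auto)
    show "continuous_on (cball z \<rho>) g"
      by (rule holomorphic_on_imp_continuous_on, rule holomorphic_on_subset[OF holg]) (use sub(1) in auto)
  qed (use \<rho> bd in \<open>auto simp: dist_norm\<close>)
  then have "norm (deriv g z) \<le> 2 * M * r / ((R - r) * \<rho>)" by simp
  moreover have "deriv g z = deriv f z / f z"
  proof -
    have zb: "z \<in> ball c R" using sub(1)[of z] \<rho> by simp
    have hd: "(h has_field_derivative deriv h z) (at z)"
      using holomorphic_derivI[OF h(1) open_ball zb] .
    then have "(g has_field_derivative deriv h z) (at z)"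
      unfolding g_def by (auto intro!: derivative_eq_intros)
    then have g': "deriv g z = deriv h z" by (rule DERIV_imp_deriv)
    have "((\<lambda>z. exp (h z)) has_field_derivative exp (h z) * deriv h z) (at z)"
      using hd by (auto intro!: derivative_eq_intros)
    then have "(f has_field_derivative exp (h z) * deriv h z) (at z)"
      by (rule has_field_derivative_transform_within_open[OF _ open_ball zb]) (simp add: h(2))
    then have "deriv f z = f z * deriv h z" using h(2)[OF zb] by (simp add: DERIV_imp_deriv)
    then show ?thesis using g' nz[OF zb] by simp
  qed
  ultimately show ?thesis by simp
qed

definition zeta_three_halves :: real where "zeta_three_halves = (\<Sum>n. real (Suc n) powr (- (3 / 2)))"

lemma zeta_three_halves_nonneg: "zeta_three_halves \<ge> 0"
  unfolding zeta_three_halves_def by (intro suminf_nonneg summable_Suc_powr) auto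

context nonprincipal
begin

text \<open>The disc of radius 3 / 2 about \<open>2 + i Im s\<close> just touches the line
  \<open>Re s = 1 / 2\<close>. At its centre \<open>L\<close> is at least 1 / 3 in modulus, and the
  polynomial growth of \<open>L\<close> enters only through a logarithm.\<close>

lemma log_deriv_L_bound:
  assumes nz: "\<And>s. Re s > 1 / 2 \<Longrightarrow> L s \<noteq> 0" and \<delta>: "0 < \<delta>" "\<delta> < 1 / 2"
    and s: "1 / 2 + \<delta> \<le> Re s" "Re s \<le> 2" and x: "x \<ge> 2" "real q \<le> x" "\<bar>Im s\<bar> \<le> x ^ 3"
  shows "norm (deriv L s / L s) \<le> 12 / \<delta> ^ 2 * (ln (3 * (1 + 2 * zeta_three_halves)) + 1 + 4 * ln x)"
proof -
  define c where "c = Complex 2 (Im s)"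
  \<comment> \<open>The 3 inverts the lower bound at the centre, \<open>x^4\<close> bounds the
    growth of \<open>L\<close> on the disc, and the additional 1 makes the inequality
    strict.\<close>
  define M where "M = ln (3 * (1 + 2 * zeta_three_halves)) + 1 + 4 * ln x"
  have x0: "x > 0" and x3: "x ^ 3 \<ge> 8"
    using x power_mono[of 2 x 3] by auto
  have M0: "M > 0"
    unfolding M_def using x zeta_three_halves_nonneg by (intro add_nonneg_pos add_pos_nonneg) auto
  have expM: "exp M = 3 * (1 + 2 * zeta_three_halves) * x ^ 4 * exp 1"
  proof -
    have "exp (4 * ln x) = x ^ 4" using x0 exp_of_nat_mult[of 4 "ln x"] by simp
    then show ?thesis unfolding M_def using zeta_three_halves_nonneg by (simp add: exp_add)
  qed
  have "norm (deriv L s / L s) \<le> 2 * M * (3 / 2 - \<delta> / 2) / ((3 / 2 - (3 / 2 - \<delta> / 2)) * (\<delta> / 2))"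
  proof (rule log_deriv_bound)
    show "L holomorphic_on ball c (3 / 2)" by (rule L_holomorphic)
    fix z assume z: "z \<in> ball c (3 / 2)"
    have nzc: "norm (z - c) < 3 / 2" using z by (simp add: dist_norm norm_minus_commute)
    then have Rez: "Re z > 1 / 2" using abs_Re_le_cmod[of "z - c"] by (simp add: c_def abs_le_iff)
    then show "L z \<noteq> 0" by (rule nz)
    have "norm z \<le> norm (z - c) + norm c" using norm_triangle_ineq[of "z - c" c] by simp
    moreover have "norm c \<le> 2 + x ^ 3"
      using cmod_le[of c] x(3) by (simp add: c_def)
    ultimately have "norm z \<le> 2 * x ^ 3" using nzc x3 by linarith
    then have "norm (L z) \<le> real q * (1 + zeta_three_halves * (2 * x ^ 3))"
      using Rez zeta_three_halves_nonneg
      by (intro order.trans[OF norm_L_le[folded zeta_three_halves_def]] mult_left_mono add_left_mono) auto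
    also have "\<dots> \<le> x * (x ^ 3 + zeta_three_halves * (2 * x ^ 3))"
      using x x3 zeta_three_halves_nonneg by (intro mult_mono add_right_mono) auto
    also have "\<dots> = (1 + 2 * zeta_three_halves) * x ^ 4"
      by (simp add: algebra_simps power_numeral_reduce)
    also have "\<dots> < (1 + 2 * zeta_three_halves) * x ^ 4 * exp 1"
      using x0 zeta_three_halves_nonneg by (simp add: add_pos_nonneg)
    also have "\<dots> = exp M * (1 / 3)" by (simp add: expM)
    also have "\<dots> \<le> exp M * norm (L c)"
      using norm_dirichlet_series_2_ge[of c] L_eq_dirichlet_series[of c] by (intro mult_left_mono) (auto simp: c_def)
    finally show "norm (L z) < exp M * norm (L c)" .
  next
    have "s - c = of_real (Re s - 2)" by (simp add: c_def complex_eq_iff)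
    then have "norm (s - c) = 2 - Re s" using s by (simp only: norm_of_real)
    then show "norm (s - c) + \<delta> / 2 \<le> 3 / 2 - \<delta> / 2" using s by simp
  qed (use \<delta> in auto)
  also have "\<dots> = (4 * M / \<delta> ^ 2) * (3 - \<delta>)"
    using \<delta> by (simp add: field_simps power2_eq_square)
  also have "\<dots> \<le> (4 * M / \<delta> ^ 2) * 3" using \<delta> M0 by (intro mult_left_mono) auto
  also have "\<dots> = 12 / \<delta> ^ 2 * M" by simp
  finally show ?thesis by (simp add: M_def)
qed

end

section \<open>The Perron integral with a linear weight\<close>

lemma contour_integral_rectpath_eq:
  assumes cont: "continuous_on (path_image (rectpath (Complex a c) (Complex b d))) f"
    and ab: "a < b" "c < d"
  shows "contour_integral (rectpath (Complex a c) (Complex b d)) f =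
    contour_integral (linepath (Complex a c) (Complex b c)) f
    + contour_integral (linepath (Complex b c) (Complex b d)) f
    - contour_integral (linepath (Complex a d) (Complex b d)) f
    - contour_integral (linepath (Complex a c) (Complex a d)) f"
proof -
  have pi: "path_image (rectpath (Complex a c) (Complex b d)) =
      closed_segment (Complex a c) (Complex b c) \<union> closed_segment (Complex b c) (Complex b d) \<union>
      closed_segment (Complex a d) (Complex b d) \<union> closed_segment (Complex a c) (Complex a d)"
    by (simp add: rectpath_def Let_def path_image_join closed_segment_commute Un_assoc)
  have c: "continuous_on (closed_segment (Complex a c) (Complex b c)) f"
    "continuous_on (closed_segment (Complex b c) (Complex b d)) f"
    "continuous_on (closed_segment (Complex a d) (Complex b d)) f"
    "continuous_on (closed_segment (Complex a c) (Complex a d)) f"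
    using continuous_on_subset[OF cont] unfolding pi by blast+
  then have c': "continuous_on (closed_segment (Complex b d) (Complex a d)) f"
    "continuous_on (closed_segment (Complex a d) (Complex a c)) f"
    by (simp_all add: closed_segment_commute)
  note i = contour_integrable_continuous_linepath[OF c(1)] contour_integrable_continuous_linepath[OF c(2)]
    contour_integrable_continuous_linepath[OF c'(1)] contour_integrable_continuous_linepath[OF c'(2)]
  note r = contour_integral_reverse_linepath[OF c'(1)] contour_integral_reverse_linepath[OF c'(2)]
  show ?thesis
    using i by (simp add: rectpath_def Let_def r)
qed

lemma norm_add_diff_le: "norm (x + y - z) \<le> norm x + norm y + norm (z :: complex)"
  using norm_triangle_ineq4[of "x + y" z] norm_triangle_ineq[of x y] by linarith

lemma norm_pole_ge:
  "norm (Complex a t) \<ge> \<bar>t\<bar>" "norm (Complex a t) \<ge> \<bar>a\<bar>" "norm (Complex a t + 1) \<ge> \<bar>t\<bar>" "norm (Complex a t + 1) \<ge> \<bar>a + 1\<bar>"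
  using abs_Im_le_cmod[of "Complex a t"] abs_Re_le_cmod[of "Complex a t"]
    abs_Im_le_cmod[of "Complex a t + 1"] abs_Re_le_cmod[of "Complex a t + 1"] by simp_all

text \<open>\<open>1 / (s (s + 1))\<close> belongs to the weight \<open>max 0 (1 - 1 / y)\<close>.
  Thanks to the quadratic decay, cutting the integral at height \<open>H\<close> costs only order
  \<open>y^2 / H\<close>, even for \<open>y\<close> close to 1.\<close>

definition perron_kernel :: "real \<Rightarrow> complex \<Rightarrow> complex" where
  "perron_kernel y s = of_real y powr s / (s * (s + 1))"

lemma norm_perron_kernel_le:
  assumes "y > 0" "A \<le> norm (Complex a t)" "B \<le> norm (Complex a t + 1)" "A > 0" "B > 0"
  shows "norm (perron_kernel y (Complex a t)) \<le> y powr a / (A * B)"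
proof -
  have "norm (perron_kernel y (Complex a t)) = y powr a / (norm (Complex a t) * norm (Complex a t + 1))"
    using assms(1) norm_powr_real_powr[of "of_real y" "Complex a t"]
    by (simp add: perron_kernel_def norm_divide norm_mult)
  also have "\<dots> \<le> y powr a / (A * B)"
    using assms by (intro divide_left_mono mult_mono) (auto intro!: mult_pos_pos)
  finally show ?thesis .
qed

lemma perron_kernel_holomorphic:
  assumes "y > 0" "0 \<notin> A" "- 1 \<notin> A" shows "perron_kernel y holomorphic_on A"
proof -
  have "s + 1 \<noteq> 0" if "s \<in> A" for s using that assms(3) by (metis add_eq_0_iff2)
  then show ?thesis unfolding perron_kernel_def using assms by (auto intro!: holomorphic_intros)
qed

text \<open>For \<open>y >= 1\<close> the contour is closed to the left, around the poles 0 and -1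
  with residues 1 and \<open>- 1 / y\<close>. For \<open>y < 1\<close>, in the next lemma, it is
  closed to the right, where there is no pole.\<close>

lemma perron_kernel_integral_ge_1:
  assumes y: "y \<ge> 1" and H: "H \<ge> 1"
  shows "norm (contour_integral (linepath (Complex 2 (- H)) (Complex 2 H)) (perron_kernel y)
    - of_real (1 - 1 / y) * (2 * of_real pi * \<i>)) \<le> 10 * y ^ 2 / H"
proof -
  \<comment> \<open>Both poles are enclosed, and on the left side \<open>s\<close> and
    \<open>s + 1\<close> both have modulus at least \<open>H\<close>.\<close>
  define R where "R = H + 1"
  let ?g = "rectpath (Complex (- R) (- H)) (Complex 2 H)"
  let ?f = "perron_kernel y"
  have y0: "y > 0" using y by simp
  have box: "0 \<in> box (Complex (- R) (- H)) (Complex 2 H)" "- 1 \<in> box (Complex (- R) (- H)) (Complex 2 H)"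
    using H by (auto simp: in_box_complex_iff R_def)
  have pi: "path_image ?g = {z. Re z \<in> {- R, 2} \<and> Im z \<in> {- H..H}} \<union> {z. Im z \<in> {- H, H} \<and> Re z \<in> {- R..2}}"
    using H by (subst path_image_rectpath) (auto simp: R_def)
  have notin: "0 \<notin> path_image ?g" "- 1 \<notin> path_image ?g" using H unfolding pi by (auto simp: R_def)
  have holp: "(\<lambda>s. of_real y powr s) holomorphic_on UNIV" using y0 by (auto intro!: holomorphic_intros)
  have "((\<lambda>w. of_real y powr w / (w - 0)) has_contour_integral (2 * pi * \<i> * winding_number ?g 0 * of_real y powr 0)) ?g"
    by (rule Cauchy_integral_formula_convex_simple[OF _ holp]) (use notin in auto)
  then have i0: "((\<lambda>w. of_real y powr w / w) has_contour_integral (2 * pi * \<i>)) ?g"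
    using y0 winding_number_rectpath[OF box(1)] by simp
  have "((\<lambda>w. of_real y powr w / (w - (- 1))) has_contour_integral (2 * pi * \<i> * winding_number ?g (- 1) * of_real y powr (- 1))) ?g"
    by (rule Cauchy_integral_formula_convex_simple[OF _ holp]) (use notin in auto)
  then have i1: "((\<lambda>w. of_real y powr w / (w + 1)) has_contour_integral (2 * pi * \<i> * of_real (1 / y))) ?g"
    using y0 winding_number_rectpath[OF box(2)] by (simp add: powr_minus divide_inverse)
  have "((\<lambda>w. of_real y powr w / w - of_real y powr w / (w + 1)) has_contour_integral
      (2 * pi * \<i> - 2 * pi * \<i> * of_real (1 / y))) ?g"
    by (rule has_contour_integral_diff[OF i0 i1])
  then have "(?f has_contour_integral (2 * pi * \<i> - 2 * pi * \<i> * of_real (1 / y))) ?g"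
  proof (rule has_contour_integral_eq)
    fix w assume "w \<in> path_image ?g"
    then have "w \<noteq> 0" "w + 1 \<noteq> 0" using notin by (auto simp: add_eq_0_iff2)
    then show "of_real y powr w / w - of_real y powr w / (w + 1) = ?f w"
      by (simp add: perron_kernel_def field_simps)
  qed
  then have tot: "contour_integral ?g ?f = of_real (1 - 1 / y) * (2 * of_real pi * \<i>)"
    by (subst contour_integral_unique) (auto simp: algebra_simps)
  have cont: "continuous_on (path_image ?g) ?f"
    by (intro holomorphic_on_imp_continuous_on perron_kernel_holomorphic y0 notin)
  have split: "contour_integral ?g ?f = contour_integral (linepath (Complex (- R) (- H)) (Complex 2 (- H))) ?f
    + contour_integral (linepath (Complex 2 (- H)) (Complex 2 H)) ?f
    - contour_integral (linepath (Complex (- R) H) (Complex 2 H)) ?f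
    - contour_integral (linepath (Complex (- R) (- H)) (Complex (- R) H)) ?f"
    using H by (intro contour_integral_rectpath_eq cont) (auto simp: R_def)
  have hor: "norm (contour_integral (linepath (Complex (- R) t) (Complex 2 t)) ?f) \<le> 4 * y ^ 2 / H"
    if t: "\<bar>t\<bar> = H" for t
  proof -
    have "norm (contour_integral (linepath (Complex (- R) t) (Complex 2 t)) ?f)
      \<le> (y ^ 2 / (H * H)) * norm (Complex 2 t - Complex (- R) t)"
    proof (rule contour_integral_bound_linepath)
      have seg: "closed_segment (Complex (- R) t) (Complex 2 t) \<subseteq> path_image ?g"
        using t H unfolding pi by (auto simp: closed_segment_same_Im closed_segment_eq_real_ivl R_def abs_if split: if_splits)
      then show "?f contour_integrable_on linepath (Complex (- R) t) (Complex 2 t)"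
        by (intro contour_integrable_continuous_linepath continuous_on_subset[OF cont])
      fix z assume "z \<in> closed_segment (Complex (- R) t) (Complex 2 t)"
      then obtain a where z: "z = Complex a t" "a \<le> 2"
        using H by (auto simp: closed_segment_same_Im closed_segment_eq_real_ivl R_def complex_eq_iff split: if_splits intro: that[of "Re z"])
      have "norm (?f z) \<le> y powr a / (H * H)"
        unfolding z using norm_pole_ge[where a = a and t = t] t H y0 by (intro norm_perron_kernel_le) auto
      also have "\<dots> \<le> y powr 2 / (H * H)" using y z H by (intro divide_right_mono powr_mono) auto
      finally show "norm (?f z) \<le> y ^ 2 / (H * H)" using y0 by simp
    qed (use H in auto)
    also have "norm (Complex 2 t - Complex (- R) t) = H + 3"
    proof -
      have "Complex 2 t - Complex (- R) t = of_real (H + 3)" by (simp add: complex_eq_iff R_def)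
      then show ?thesis using H by (simp only: norm_of_real)
    qed
    also have "y ^ 2 / (H * H) * (H + 3) \<le> y ^ 2 / (H * H) * (4 * H)"
      using H by (intro mult_left_mono) auto
    also have "\<dots> = 4 * y ^ 2 / H" using H by (simp add: field_simps)
    finally show ?thesis .
  qed
  have ver: "norm (contour_integral (linepath (Complex (- R) (- H)) (Complex (- R) H)) ?f) \<le> 2 * y ^ 2 / H"
  proof -
    have "norm (contour_integral (linepath (Complex (- R) (- H)) (Complex (- R) H)) ?f)
      \<le> (y ^ 2 / (H * H)) * norm (Complex (- R) H - Complex (- R) (- H))"
    proof (rule contour_integral_bound_linepath)
      have seg: "closed_segment (Complex (- R) (- H)) (Complex (- R) H) \<subseteq> path_image ?g"
        using H unfolding pi by (auto simp: closed_segment_same_Re closed_segment_eq_real_ivl R_def split: if_splits)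
      then show "?f contour_integrable_on linepath (Complex (- R) (- H)) (Complex (- R) H)"
        by (intro contour_integrable_continuous_linepath continuous_on_subset[OF cont])
      fix z assume "z \<in> closed_segment (Complex (- R) (- H)) (Complex (- R) H)"
      then obtain t where z: "z = Complex (- R) t"
        by (auto simp: closed_segment_same_Re complex_eq_iff intro: that[of "Im z"])
      have "norm (?f z) \<le> y powr (- R) / (H * H)"
        unfolding z using norm_pole_ge[where a = "- R" and t = t] H y0
        by (intro norm_perron_kernel_le) (auto simp: R_def)
      also have "\<dots> \<le> y powr 2 / (H * H)" using y H by (intro divide_right_mono powr_mono) (auto simp: R_def)
      finally show "norm (?f z) \<le> y ^ 2 / (H * H)" using y0 by simp
    qed (use H in auto)
    also have "norm (Complex (- R) H - Complex (- R) (- H)) = 2 * H"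
    proof -
      have "Complex (- R) H - Complex (- R) (- H) = \<i> * of_real (2 * H)" by (simp add: complex_eq_iff)
      then show ?thesis using H by (simp only: norm_mult norm_of_real norm_ii)
    qed
    also have "y ^ 2 / (H * H) * (2 * H) = 2 * y ^ 2 / H" using H by (simp add: field_simps)
    finally show ?thesis .
  qed
  let ?b = "contour_integral (linepath (Complex (- R) (- H)) (Complex 2 (- H))) ?f"
  let ?t = "contour_integral (linepath (Complex (- R) H) (Complex 2 H)) ?f"
  let ?l = "contour_integral (linepath (Complex (- R) (- H)) (Complex (- R) H)) ?f"
  have eq: "contour_integral (linepath (Complex 2 (- H)) (Complex 2 H)) ?f
      - of_real (1 - 1 / y) * (2 * of_real pi * \<i>) = ?t + ?l - ?b"
    using split unfolding tot by (simp add: algebra_simps)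
  have "norm (?t + ?l - ?b) \<le> norm ?t + norm ?l + norm ?b"
    by (rule norm_add_diff_le)
  also have "\<dots> \<le> 4 * y ^ 2 / H + 2 * y ^ 2 / H + 4 * y ^ 2 / H"
    by (intro add_mono hor ver) (use H in simp_all)
  also have "\<dots> = 10 * y ^ 2 / H" by (simp add: field_simps)
  finally show ?thesis unfolding eq .
qed

lemma perron_kernel_integral_less_1:
  assumes y: "0 < y" "y < 1" and H: "H \<ge> 1"
  shows "norm (contour_integral (linepath (Complex 2 (- H)) (Complex 2 H)) (perron_kernel y)) \<le> 10 * y ^ 2 / H"
proof -
  define R where "R = H + 2"
  let ?g = "rectpath (Complex 2 (- H)) (Complex R H)"
  let ?f = "perron_kernel y"
  have pi: "path_image ?g = {z. Re z \<in> {2, R} \<and> Im z \<in> {- H..H}} \<union> {z. Im z \<in> {- H, H} \<and> Re z \<in> {2..R}}"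
    using H by (subst path_image_rectpath) (auto simp: R_def)
  have hol: "?f holomorphic_on {s. Re s > 1}" by (rule perron_kernel_holomorphic) (use y in auto)
  have sub: "path_image ?g \<subseteq> {s. Re s > 1}" using H unfolding pi by (auto simp: R_def)
  have "(?f has_contour_integral 0) ?g"
    by (rule Cauchy_theorem_convex_simple[OF hol convex_halfspace_Re_gt]) (use sub in auto)
  then have tot: "contour_integral ?g ?f = 0" by (rule contour_integral_unique)
  have cont: "continuous_on (path_image ?g) ?f"
    by (rule continuous_on_subset[OF holomorphic_on_imp_continuous_on[OF hol] sub])
  have split: "contour_integral ?g ?f = contour_integral (linepath (Complex 2 (- H)) (Complex R (- H))) ?f
    + contour_integral (linepath (Complex R (- H)) (Complex R H)) ?f
    - contour_integral (linepath (Complex 2 H) (Complex R H)) ?f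
    - contour_integral (linepath (Complex 2 (- H)) (Complex 2 H)) ?f"
    using H by (intro contour_integral_rectpath_eq cont) (auto simp: R_def)
  have hor: "norm (contour_integral (linepath (Complex 2 t) (Complex R t)) ?f) \<le> y ^ 2 / H"
    if t: "\<bar>t\<bar> = H" for t
  proof -
    have "norm (contour_integral (linepath (Complex 2 t) (Complex R t)) ?f)
      \<le> (y ^ 2 / (H * H)) * norm (Complex R t - Complex 2 t)"
    proof (rule contour_integral_bound_linepath)
      have seg: "closed_segment (Complex 2 t) (Complex R t) \<subseteq> path_image ?g"
        using t H unfolding pi by (auto simp: closed_segment_same_Im closed_segment_eq_real_ivl R_def abs_if split: if_splits)
      then show "?f contour_integrable_on linepath (Complex 2 t) (Complex R t)"
        by (intro contour_integrable_continuous_linepath continuous_on_subset[OF cont])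
      fix z assume "z \<in> closed_segment (Complex 2 t) (Complex R t)"
      then obtain a where z: "z = Complex a t" "a \<ge> 2"
        using H by (auto simp: closed_segment_same_Im closed_segment_eq_real_ivl R_def complex_eq_iff split: if_splits intro: that[of "Re z"])
      have "norm (?f z) \<le> y powr a / (H * H)"
        unfolding z using norm_pole_ge[where a = a and t = t] t H y by (intro norm_perron_kernel_le) auto
      also have "\<dots> \<le> y powr 2 / (H * H)" using y z H by (intro divide_right_mono powr_mono') auto
      finally show "norm (?f z) \<le> y ^ 2 / (H * H)" using y by simp
    qed (use H in auto)
    also have "norm (Complex R t - Complex 2 t) = H"
    proof -
      have "Complex R t - Complex 2 t = of_real H" by (simp add: complex_eq_iff R_def)
      then show ?thesis using H by (simp only: norm_of_real)
    qed
    also have "y ^ 2 / (H * H) * H = y ^ 2 / H" using H by (simp add: field_simps)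
    finally show ?thesis .
  qed
  have ver: "norm (contour_integral (linepath (Complex R (- H)) (Complex R H)) ?f) \<le> 2 * y ^ 2 / H"
  proof -
    have "norm (contour_integral (linepath (Complex R (- H)) (Complex R H)) ?f)
      \<le> (y ^ 2 / (H * H)) * norm (Complex R H - Complex R (- H))"
    proof (rule contour_integral_bound_linepath)
      have seg: "closed_segment (Complex R (- H)) (Complex R H) \<subseteq> path_image ?g"
        using H unfolding pi by (auto simp: closed_segment_same_Re closed_segment_eq_real_ivl R_def split: if_splits)
      then show "?f contour_integrable_on linepath (Complex R (- H)) (Complex R H)"
        by (intro contour_integrable_continuous_linepath continuous_on_subset[OF cont])
      fix z assume "z \<in> closed_segment (Complex R (- H)) (Complex R H)"
      then obtain t where z: "z = Complex R t"
        by (auto simp: closed_segment_same_Re complex_eq_iff intro: that[of "Im z"])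
      have "norm (?f z) \<le> y powr R / (H * H)"
        unfolding z using norm_pole_ge[where a = R and t = t] H y
        by (intro norm_perron_kernel_le) (auto simp: R_def)
      also have "\<dots> \<le> y powr 2 / (H * H)" using y H by (intro divide_right_mono powr_mono') (auto simp: R_def)
      finally show "norm (?f z) \<le> y ^ 2 / (H * H)" using y by simp
    qed (use H in auto)
    also have "norm (Complex R H - Complex R (- H)) = 2 * H"
    proof -
      have "Complex R H - Complex R (- H) = \<i> * of_real (2 * H)" by (simp add: complex_eq_iff)
      then show ?thesis using H by (simp only: norm_mult norm_of_real norm_ii)
    qed
    also have "y ^ 2 / (H * H) * (2 * H) = 2 * y ^ 2 / H" using H by (simp add: field_simps)
    finally show ?thesis .
  qed
  let ?b = "contour_integral (linepath (Complex 2 (- H)) (Complex R (- H))) ?f"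
  let ?t = "contour_integral (linepath (Complex 2 H) (Complex R H)) ?f"
  let ?r = "contour_integral (linepath (Complex R (- H)) (Complex R H)) ?f"
  have eq: "contour_integral (linepath (Complex 2 (- H)) (Complex 2 H)) ?f = ?b + ?r - ?t"
    using split unfolding tot by (simp add: algebra_simps)
  have "norm (?b + ?r - ?t) \<le> norm ?b + norm ?r + norm ?t"
    by (rule norm_add_diff_le)
  also have "\<dots> \<le> y ^ 2 / H + 2 * y ^ 2 / H + y ^ 2 / H"
    by (intro add_mono hor ver) (use H in simp_all)
  also have "\<dots> \<le> 10 * y ^ 2 / H" using H by (simp add: field_simps)
  finally show ?thesis unfolding eq .
qed

section \<open>Perron's formula for the twisted von Mangoldt function\<close>

definition mangoldt_series_2 :: real where "mangoldt_series_2 = (\<Sum>n. mangoldt n * real n powr (- 2))"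

lemma summable_mangoldt_series_2: "summable (\<lambda>n. mangoldt n * real n powr (- 2))"
proof -
  have "summable (\<lambda>n. norm (zeta.twist n * of_nat n powr (- 2)))"
    using dirichlet_series_abs_summable[OF zeta.log_bounded_twist, of 2] by simp
  moreover have "norm (zeta.twist n * of_nat n powr (- 2)) = mangoldt n * real n powr (- 2)" for n
    using norm_powr_real_powr[of "of_nat n" "- 2"] by (simp add: zeta.twist_def norm_mult)
  ultimately show ?thesis by simp
qed

lemma mangoldt_series_2_nonneg: "mangoldt_series_2 \<ge> 0"
  unfolding mangoldt_series_2_def by (intro suminf_nonneg summable_mangoldt_series_2) (simp add: mangoldt_nonneg)

lemma integral_arctan_bound:
  assumes "H \<ge> 0"
  shows "((\<lambda>t. 4 / (1 + t ^ 2)) has_integral 4 * (2 * arctan H)) {- H..H}"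
proof -
  have "((\<lambda>t. 4 / (1 + t ^ 2)) has_integral 4 * arctan H - 4 * arctan (- H)) {- H..H}"
  proof (rule fundamental_theorem_of_calculus)
    fix t
    have "((\<lambda>t. 4 * arctan t) has_real_derivative 4 / (1 + t ^ 2)) (at t within {- H..H})"
      by (auto intro!: derivative_eq_intros simp: divide_inverse)
    then show "((\<lambda>t. 4 * arctan t) has_vector_derivative 4 / (1 + t ^ 2)) (at t within {- H..H})"
      by (simp add: has_real_derivative_iff_has_vector_derivative)
  qed (use assms in auto)
  then show ?thesis by (simp add: arctan_minus)
qed

lemma norm_le_add_diff: "norm x \<le> norm y + norm (y - x)" for x y :: complex
  by (metis norm_triangle_sub norm_minus_commute)

context bounded_completely_multiplicative
begin

lemma perron_sums:
  assumes x: "x > 0" and H: "H > 0"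
  defines "J \<equiv> contour_integral (linepath (Complex 2 (- H)) (Complex 2 H))"
  shows "(\<lambda>n. twist n * J (perron_kernel (x / real n))) sums J (\<lambda>s. dirichlet_series twist s * perron_kernel x s)"
proof -
  let ?p = "linepath (Complex 2 (- H)) (Complex 2 H)"
  have img: "path_image ?p \<subseteq> {s. Re s = 2}"
    by (auto simp: closed_segment_same_Re)
  let ?t = "\<lambda>n s. twist n * of_nat n powr (- s) * perron_kernel x s"
  have kb: "norm (perron_kernel x s) \<le> x ^ 2" if "Re s = 2" for s
  proof -
    have s: "s = Complex 2 (Im s)" using that by (simp add: complex_eq_iff)
    have "norm (perron_kernel x (Complex 2 (Im s))) \<le> x powr 2 / (2 * 3)"
      using norm_pole_ge[where a = 2 and t = "Im s"] x by (intro norm_perron_kernel_le) auto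
    then have "norm (perron_kernel x s) \<le> x ^ 2 / 6" using x s by simp
    also have "\<dots> \<le> x ^ 2" by simp
    finally show ?thesis .
  qed
  have tint: "?t n contour_integrable_on ?p" for n
  proof (cases "n = 0")
    case False
    have "?t n holomorphic_on {s. Re s > 1}"
      using False x by (intro holomorphic_intros perron_kernel_holomorphic) auto
    then have "continuous_on {s. Re s > 1} (?t n)" by (rule holomorphic_on_imp_continuous_on)
    then show ?thesis
      by (rule contour_integrable_continuous_linepath[OF continuous_on_subset]) (use img in auto)
  next
    case True
    then show ?thesis
      using has_contour_integral_0 by (auto simp: twist_def contour_integrable_on_def)
  qed
  have ul: "uniform_limit (path_image ?p) (\<lambda>N s. \<Sum>n<N. ?t n s) (\<lambda>s. \<Sum>n. ?t n s) sequentially"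
  proof (rule Weierstrass_m_test)
    show "summable (\<lambda>n. mangoldt n * real n powr (- 2) * x ^ 2)"
      by (intro summable_mult2 summable_mangoldt_series_2)
    fix n s assume "s \<in> path_image ?p"
    then have s: "Re s = 2" using img by auto
    have "norm (twist n * of_nat n powr (- s)) \<le> mangoldt n * real n powr (- 2)"
      using norm_powr_real_powr[of "of_nat n" "- s"] s norm_twist_le[of n]
      by (simp add: norm_mult mult_right_mono)
    then show "norm (?t n s) \<le> mangoldt n * real n powr (- 2) * x ^ 2"
      unfolding norm_mult[of _ "perron_kernel x s"] using kb[OF s]
      by (intro mult_mono) (auto simp: mangoldt_nonneg)
  qed
  have "(\<lambda>N. J (\<lambda>s. \<Sum>n<N. ?t n s)) \<longlonglongrightarrow> J (\<lambda>s. \<Sum>n. ?t n s)"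
    unfolding J_def
  proof (rule contour_integral_uniform_limit(2)[OF _ ul])
    show "\<forall>\<^sub>F N in sequentially. (\<lambda>s. \<Sum>n<N. ?t n s) contour_integrable_on ?p"
      using tint by (intro always_eventually allI contour_integrable_sum) auto
    show "norm (vector_derivative ?p (at t)) \<le> norm (Complex 2 H - Complex 2 (- H))" for t
      by simp
  qed auto
  moreover have "J (\<lambda>s. \<Sum>n<N. ?t n s) = (\<Sum>n<N. twist n * J (perron_kernel (x / real n)))" for N
  proof -
    have "J (\<lambda>s. \<Sum>n<N. ?t n s) = (\<Sum>n<N. J (?t n))"
      unfolding J_def using tint by (intro contour_integral_sum) auto
    also have "\<dots> = (\<Sum>n<N. twist n * J (perron_kernel (x / real n)))"
    proof (intro sum.cong refl)
      fix n
      show "J (?t n) = twist n * J (perron_kernel (x / real n))"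
      proof (cases "n = 0")
        case False
        have eq: "?t n s = twist n * perron_kernel (x / real n) s" for s
        proof -
          have "of_real (x / real n) powr s = of_real x powr s / (of_nat n powr s :: complex)"
            using powr_times_real[of "of_real (x / real n)" "of_nat n" s] x False
            by (simp add: field_simps)
          then show ?thesis by (simp add: perron_kernel_def powr_minus divide_inverse)
        qed
        have "perron_kernel (x / real n) contour_integrable_on ?p"
        proof (intro contour_integrable_continuous_linepath holomorphic_on_imp_continuous_on perron_kernel_holomorphic)
          show "0 \<notin> closed_segment (Complex 2 (- H)) (Complex 2 H)" "- 1 \<notin> closed_segment (Complex 2 (- H)) (Complex 2 H)"
            using img by auto
        qed (use x False in auto)
        then show ?thesis unfolding eq J_def by (rule contour_integral_lmul)
      qed (simp add: twist_def J_def)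
    qed
    finally show ?thesis .
  qed
  moreover have "J (\<lambda>s. \<Sum>n. ?t n s) = J (\<lambda>s. dirichlet_series twist s * perron_kernel x s)"
    unfolding J_def
  proof (rule contour_integral_eq)
    fix s assume "s \<in> path_image ?p"
    then have s: "Re s > 1" using img by auto
    show "(\<Sum>n. ?t n s) = dirichlet_series twist s * perron_kernel x s"
      using sums_mult2[OF dirichlet_series_sums[OF log_bounded_twist s], of "perron_kernel x s"] by (simp add: sums_iff)
  qed
  ultimately show ?thesis by (simp add: sums_def)
qed

text \<open>Each \<open>n\<close> incurs an error of at most \<open>10 (x / n)^2 / H\<close>,
  uniformly up to and beyond \<open>n = x\<close>, and this is summable against the von Mangoldt
  function.\<close>

lemma perron_truncated:
  assumes x: "x \<ge> 1" and H: "H \<ge> 1"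
  defines "J \<equiv> contour_integral (linepath (Complex 2 (- H)) (Complex 2 H))"
  shows "norm (J (\<lambda>s. dirichlet_series twist s * perron_kernel x s) -
      (\<Sum>n | 1 \<le> n \<and> real n \<le> x. twist n * of_real (1 - real n / x)) * (2 * of_real pi * \<i>))
    \<le> 10 * x ^ 2 / H * mangoldt_series_2"
proof -
  let ?A = "{n. 1 \<le> n \<and> real n \<le> x}"
  have fin: "finite ?A"
    by (rule finite_subset[of _ "{..nat \<lfloor>x\<rfloor>}"]) (auto simp: le_nat_floor)
  let ?c = "2 * of_real pi * \<i> :: complex"
  let ?m = "\<lambda>n. if n \<in> ?A then twist n * of_real (1 - real n / x) * ?c else 0"
  have m: "?m sums ((\<Sum>n\<in>?A. twist n * of_real (1 - real n / x)) * ?c)"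
    unfolding sum_distrib_right by (rule sums_If_finite_set[OF fin])
  have s: "(\<lambda>n. twist n * J (perron_kernel (x / real n)) - ?m n) sums
     (J (\<lambda>s. dirichlet_series twist s * perron_kernel x s) - (\<Sum>n\<in>?A. twist n * of_real (1 - real n / x)) * ?c)"
    using x H unfolding J_def by (intro sums_diff m perron_sums) auto
  have "norm (twist n * J (perron_kernel (x / real n)) - ?m n) \<le> 10 * x ^ 2 / H * (mangoldt n * real n powr (- 2))" for n
  proof (cases "n = 0")
    case False
    define y where "y = x / real n"
    have y0: "y > 0" using x False by (simp add: y_def)
    define d where "d = J (perron_kernel y) - (if n \<in> ?A then of_real (1 - 1 / y) * ?c else 0)"
    have "norm d \<le> 10 * y ^ 2 / H"
    proof (cases "real n \<le> x")
      case True
      then have "n \<in> ?A" "y \<ge> 1" using False by (auto simp: y_def)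
      then show ?thesis using perron_kernel_integral_ge_1[OF _ H, of y] by (simp add: d_def J_def)
    next
      case c: False
      then have "n \<notin> ?A" "y < 1" using False by (auto simp: y_def)
      then show ?thesis using perron_kernel_integral_less_1[OF y0 _ H] c by (simp add: d_def J_def)
    qed
    then have "norm (twist n * d) \<le> mangoldt n * (10 * y ^ 2 / H)"
      unfolding norm_mult using norm_twist_le[of n] by (intro mult_mono) (auto simp: mangoldt_nonneg)
    moreover have e1: "twist n * d = twist n * J (perron_kernel (x / real n)) - ?m n"
      using False x by (simp add: d_def y_def algebra_simps)
    moreover have e2: "mangoldt n * (10 * y ^ 2 / H) = 10 * x ^ 2 / H * (mangoldt n * real n powr (- 2))"
      using False by (simp add: y_def powr_minus_divide power_divide mult_ac)
    ultimately show ?thesis by (simp only: e1 e2)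
  qed (simp add: twist_def)
  then have "norm (\<Sum>n. twist n * J (perron_kernel (x / real n)) - ?m n)
      \<le> (\<Sum>n. 10 * x ^ 2 / H * (mangoldt n * real n powr (- 2)))"
    by (rule norm_suminf_le[OF _ summable_mult[OF summable_mangoldt_series_2]])
  also have "(\<Sum>n. 10 * x ^ 2 / H * (mangoldt n * real n powr (- 2))) = 10 * x ^ 2 / H * mangoldt_series_2"
    unfolding mangoldt_series_2_def by (intro suminf_mult summable_mangoldt_series_2)
  finally show ?thesis using sums_unique[OF s] by simp
qed

end

context nonprincipal
begin

text \<open>The contour moves to \<open>Re s = 1 / 2 + \<delta>\<close> without meeting a
  singularity. There the kernel is at most \<open>4 x powr a / (1 + t^2)\<close>, with integral
  below \<open>4 pi * x powr a <= 16 x powr a\<close>; each horizontal side adds at most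
  \<open>C\<close>, whence the factor \<open>18 = 16 + 1 + 1\<close>.\<close>

lemma shifted_integral_bound:
  assumes nz: "\<And>s. Re s > 1 / 2 \<Longrightarrow> L s \<noteq> 0" and \<delta>: "0 < \<delta>" "\<delta> < 1 / 2"
    and x: "x \<ge> 2" "real q \<le> x" and C: "C = 12 / \<delta> ^ 2 * (ln (3 * (1 + 2 * zeta_three_halves)) + 1 + 4 * ln x)"
  shows "norm (contour_integral (linepath (Complex 2 (- (x ^ 3))) (Complex 2 (x ^ 3)))
      (\<lambda>s. dirichlet_series twist s * perron_kernel x s)) \<le> 18 * C * x powr (1 / 2 + \<delta>)"
proof -
  define a where "a = 1 / 2 + \<delta>"
  define H where "H = x ^ 3"
  have a: "1 / 2 < a" "a < 1" using \<delta> by (auto simp: a_def)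
  have H: "H \<ge> 8" using x power_mono[of 2 x 3] by (simp add: H_def)
  have xa: "x powr a \<ge> 1" using x a by (simp add: ge_one_powr_ge_zero)
  have C0: "C \<ge> 0" using x zeta_three_halves_nonneg unfolding C by (intro mult_nonneg_nonneg add_nonneg_nonneg) auto
  define D where "D = (\<lambda>s. - (deriv L s / L s))"
  define G where "G = (\<lambda>s. D s * perron_kernel x s)"
  let ?g = "rectpath (Complex a (- H)) (Complex 2 H)"
  have Dbound: "norm (D s) \<le> C" if "a \<le> Re s" "Re s \<le> 2" "\<bar>Im s\<bar> \<le> H" for s
    unfolding D_def norm_minus_cancel C
    by (rule log_deriv_L_bound) (use that x \<delta> nz in \<open>auto simp: a_def H_def\<close>)
  have holG: "G holomorphic_on {s. Re s > 1 / 2}"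
    unfolding G_def D_def using nz x
    by (intro holomorphic_intros perron_kernel_holomorphic L_holomorphic) (rule open_halfspace_Re_gt | force)+
  have sub: "path_image ?g \<subseteq> {s. Re s > 1 / 2}"
    using H a by (subst path_image_rectpath) auto
  have "(G has_contour_integral 0) ?g"
    by (rule Cauchy_theorem_convex_simple[OF holG convex_halfspace_Re_gt]) (use sub in auto)
  then have tot: "contour_integral ?g G = 0" by (rule contour_integral_unique)
  have contH: "continuous_on {s. Re s > 1 / 2} G" by (rule holomorphic_on_imp_continuous_on[OF holG])
  have cont: "continuous_on (path_image ?g) G" by (rule continuous_on_subset[OF contH sub])
  have split: "contour_integral ?g G = contour_integral (linepath (Complex a (- H)) (Complex 2 (- H))) G
    + contour_integral (linepath (Complex 2 (- H)) (Complex 2 H)) G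
    - contour_integral (linepath (Complex a H) (Complex 2 H)) G
    - contour_integral (linepath (Complex a (- H)) (Complex a H)) G"
    using H a by (intro contour_integral_rectpath_eq cont) auto
  have hor: "norm (contour_integral (linepath (Complex a t) (Complex 2 t)) G) \<le> C * 1" if t: "\<bar>t\<bar> = H" for t
  proof -
    have "norm (contour_integral (linepath (Complex a t) (Complex 2 t)) G) \<le> (C * (x ^ 2 / (H * H))) * norm (Complex 2 t - Complex a t)"
    proof (rule contour_integral_bound_linepath)
      show "G contour_integrable_on linepath (Complex a t) (Complex 2 t)"
        by (intro contour_integrable_continuous_linepath continuous_on_subset[OF contH])
          (use a in \<open>auto simp: closed_segment_same_Im closed_segment_eq_real_ivl\<close>)
      fix z assume "z \<in> closed_segment (Complex a t) (Complex 2 t)"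
      then obtain b where z: "z = Complex b t" "a \<le> b" "b \<le> 2"
        using a by (auto simp: closed_segment_same_Im closed_segment_eq_real_ivl complex_eq_iff split: if_splits intro: that[of "Re z"])
      have "norm (perron_kernel x z) \<le> x powr b / (H * H)"
        unfolding z using norm_pole_ge[where a = b and t = t] t H x by (intro norm_perron_kernel_le) auto
      also have "\<dots> \<le> x powr 2 / (H * H)" using x z H by (intro divide_right_mono powr_mono) auto
      finally have "norm (perron_kernel x z) \<le> x ^ 2 / (H * H)" using x by simp
      then show "norm (G z) \<le> C * (x ^ 2 / (H * H))"
        unfolding G_def norm_mult using Dbound[of z] z t C0 by (intro mult_mono) auto
    qed (use H C0 in auto)
    also have "norm (Complex 2 t - Complex a t) = 2 - a"
    proof -
      have "Complex 2 t - Complex a t = of_real (2 - a)" by (simp add: complex_eq_iff)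
      then show ?thesis using a by (simp only: norm_of_real)
    qed
    also have "C * (x ^ 2 / (H * H)) * (2 - a) \<le> C * (1 / 8) * 2"
    proof (intro mult_mono mult_left_mono)
      have "x ^ 2 \<le> H" using x power_increasing[of 2 3 x] by (simp add: H_def)
      then have "x ^ 2 / (H * H) \<le> H / (H * H)" using H by (intro divide_right_mono) auto
      also have "\<dots> \<le> 1 / 8" using H by (simp add: field_simps)
      finally show "x ^ 2 / (H * H) \<le> 1 / 8" .
    qed (use C0 a in auto)
    also have "\<dots> \<le> C * 1" using C0 by simp
    finally show ?thesis .
  qed
  have ver: "norm (contour_integral (linepath (Complex a (- H)) (Complex a H)) G) \<le> C * x powr a * (4 * pi)"
  proof -
    have "contour_integral (linepath (Complex a (- H)) (Complex a H)) G =
        \<i> * integral {- H..H} (\<lambda>t. G (Complex a t))"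
      using H by (intro contour_integral_linepath_same_Re) auto
    then have "norm (contour_integral (linepath (Complex a (- H)) (Complex a H)) G)
      = norm (integral {- H..H} (\<lambda>t. G (Complex a t)))" by (simp add: norm_mult)
    also have "\<dots> \<le> integral {- H..H} (\<lambda>t. C * x powr a * (4 / (1 + t ^ 2)))"
    proof (rule integral_norm_bound_integral)
      have "continuous_on {- H..H} (\<lambda>t. G (Complex a t))"
        by (rule continuous_on_compose2[OF contH]) (use a in \<open>auto intro!: continuous_intros\<close>)
      then show "(\<lambda>t. G (Complex a t)) integrable_on {- H..H}" by (rule integrable_continuous_real)
      show "(\<lambda>t. C * x powr a * (4 / (1 + t ^ 2))) integrable_on {- H..H}"
        using integral_arctan_bound[of H] H has_integral_mult_right by (metis has_integral_integrable order.trans zero_le_numeral)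
      fix t assume t: "t \<in> {- H..H}"
      let ?s = "Complex a t"
      have n0: "norm ?s > 0" using norm_pole_ge(2)[of a t] a by linarith
      have "norm (?s + 1) ^ 2 = norm ?s ^ 2 + 2 * a + 1"
        unfolding cmod_power2 by (simp add: power2_eq_square algebra_simps)
      then have "norm ?s ^ 2 \<le> norm (?s + 1) ^ 2" using a by simp
      then have "norm ?s \<le> norm (?s + 1)" by (rule power2_le_imp_le) simp
      then have "norm (perron_kernel x ?s) \<le> x powr a / (norm ?s * norm ?s)"
        using x n0 by (intro norm_perron_kernel_le) auto
      also have "\<dots> \<le> x powr a / ((1 + t ^ 2) / 4)"
      proof (rule divide_left_mono)
        have "norm ?s * norm ?s = a ^ 2 + t ^ 2"
          by (simp add: cmod_power2 flip: power2_eq_square)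
        moreover have "a ^ 2 \<ge> 1 / 4" using a power_mono[of "1/2" a 2] by (simp add: power2_eq_square)
        then have "(1 + t ^ 2) / 4 \<le> a ^ 2 + t ^ 2" using zero_le_power2[of t] by argo
        ultimately show "(1 + t ^ 2) / 4 \<le> norm ?s * norm ?s" by simp
        show "0 < norm ?s * norm ?s * ((1 + t ^ 2) / 4)"
          using n0 by (intro mult_pos_pos) (auto simp: add_pos_nonneg)
      qed simp
      finally have "norm (perron_kernel x ?s) \<le> x powr a * (4 / (1 + t ^ 2))" by simp
      then show "norm (G ?s) \<le> C * x powr a * (4 / (1 + t ^ 2))"
        unfolding G_def norm_mult mult.assoc using Dbound[of ?s] t a C0 by (intro mult_mono) auto
    qed
    also have "\<dots> = C * x powr a * (4 * (2 * arctan H))"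
      using integral_arctan_bound[of H] H by (intro integral_unique has_integral_mult_right) auto
    also have "\<dots> \<le> C * x powr a * (4 * pi)"
      using arctan_ubound[of H] C0 by (intro mult_left_mono) auto
    finally show ?thesis .
  qed
  have eq: "contour_integral (linepath (Complex 2 (- H)) (Complex 2 H)) (\<lambda>s. dirichlet_series twist s * perron_kernel x s)
    = contour_integral (linepath (Complex 2 (- H)) (Complex 2 H)) G"
  proof (rule contour_integral_eq)
    fix s assume "s \<in> path_image (linepath (Complex 2 (- H)) (Complex 2 H))"
    then have s: "Re s > 1" by (auto simp: closed_segment_same_Re)
    have "deriv L s = - (dirichlet_series twist s * L s)" by (rule DERIV_imp_deriv[OF L_has_field_derivative[OF s]])
    then show "dirichlet_series twist s * perron_kernel x s = G s" using nz[of s] s by (simp add: G_def D_def)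
  qed
  let ?b = "contour_integral (linepath (Complex a (- H)) (Complex 2 (- H))) G"
  let ?t = "contour_integral (linepath (Complex a H) (Complex 2 H)) G"
  let ?l = "contour_integral (linepath (Complex a (- H)) (Complex a H)) G"
  have eq2: "contour_integral (linepath (Complex 2 (- H)) (Complex 2 H)) G = ?t + ?l - ?b"
    using split unfolding tot by (simp add: algebra_simps)
  have "norm (?t + ?l - ?b) \<le> norm ?t + norm ?l + norm ?b" by (rule norm_add_diff_le)
  also have "\<dots> \<le> C * 1 + C * x powr a * (4 * pi) + C * 1"
    by (intro add_mono hor ver) (use H in simp_all)
  also have "\<dots> \<le> C * x powr a + C * x powr a * 16 + C * x powr a"
  proof -
    have "4 * pi \<le> 16" using pi_less_4 by simp
    then show ?thesis using xa C0 by (intro add_mono mult_left_mono) auto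
  qed
  also have "\<dots> = 18 * C * x powr a" by simp
  finally show ?thesis using eq eq2 by (simp add: H_def a_def)
qed

text \<open>The height \<open>x^3\<close> makes the truncation error bounded, while in the bound for
  the logarithmic derivative it affects only the coefficient of \<open>ln x\<close>.\<close>

lemma psi_bound:
  assumes nz: "\<And>s. Re s > 1 / 2 \<Longrightarrow> L s \<noteq> 0" and \<delta>: "0 < \<delta>" "\<delta> < 1 / 2"
    and x: "x \<ge> 2" "real q \<le> x"
  shows "norm (\<Sum>n | 1 \<le> n \<and> real n \<le> x. twist n * of_real (1 - real n / x))
    \<le> (2 * mangoldt_series_2 + 36 / \<delta> ^ 2 * (ln (3 * (1 + 2 * zeta_three_halves)) + 1 + 4 * ln x)) * x powr (1 / 2 + \<delta>)"
proof -
  define C where "C = 12 / \<delta> ^ 2 * (ln (3 * (1 + 2 * zeta_three_halves)) + 1 + 4 * ln x)"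
  let ?S = "\<Sum>n | 1 \<le> n \<and> real n \<le> x. twist n * of_real (1 - real n / x)"
  let ?J = "contour_integral (linepath (Complex 2 (- (x ^ 3))) (Complex 2 (x ^ 3))) (\<lambda>s. dirichlet_series twist s * perron_kernel x s)"
  have C0: "C \<ge> 0" using x zeta_three_halves_nonneg unfolding C_def by (intro mult_nonneg_nonneg add_nonneg_nonneg) auto
  have xa: "x powr (1 / 2 + \<delta>) \<ge> 1" using x \<delta> by (simp add: ge_one_powr_ge_zero)
  have x3: "x ^ 3 \<ge> 1" "x ^ 2 \<le> x ^ 3" using x power_increasing[of 2 3 x] by (auto simp: one_le_power)
  have "norm (?S * (2 * of_real pi * \<i>)) \<le> norm ?J + norm (?J - ?S * (2 * of_real pi * \<i>))"
    by (rule norm_le_add_diff)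
  also have "\<dots> \<le> 18 * C * x powr (1 / 2 + \<delta>) + 10 * x ^ 2 / x ^ 3 * mangoldt_series_2"
    using x x3 by (intro add_mono shifted_integral_bound[OF nz \<delta>] perron_truncated) (auto simp: C_def)
  also have "10 * x ^ 2 / x ^ 3 * mangoldt_series_2 \<le> 10 * 1 * mangoldt_series_2"
  proof (rule mult_right_mono[OF _ mangoldt_series_2_nonneg])
    have "x ^ 3 > 0" using x by simp
    then show "10 * x ^ 2 / x ^ 3 \<le> 10 * 1" using x3(2) by (simp add: pos_divide_le_eq)
  qed
  also have "10 * 1 * mangoldt_series_2 \<le> 10 * mangoldt_series_2 * x powr (1 / 2 + \<delta>)"
    using xa mangoldt_series_2_nonneg mult_left_mono[of 1 "x powr (1 / 2 + \<delta>)" "10 * mangoldt_series_2"] by simp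
  finally have "norm ?S * (2 * pi) \<le> (10 * mangoldt_series_2 + 18 * C) * x powr (1 / 2 + \<delta>)"
    by (simp add: norm_mult algebra_simps)
  moreover have "norm ?S * 6 \<le> norm ?S * (2 * pi)" using pi_gt3 by (intro mult_left_mono) auto
  moreover have "(10 * mangoldt_series_2 + 18 * C) * x powr (1 / 2 + \<delta>) \<le> (12 * mangoldt_series_2 + 18 * C) * x powr (1 / 2 + \<delta>)"
    using C0 mangoldt_series_2_nonneg xa by (intro mult_right_mono) auto
  ultimately have "norm ?S * 6 \<le> (12 * mangoldt_series_2 + 18 * C) * x powr (1 / 2 + \<delta>)" by linarith
  then have "norm ?S \<le> (2 * mangoldt_series_2 + 3 * C) * x powr (1 / 2 + \<delta>)" by (simp add: algebra_simps)
  also have "3 * C = 36 / \<delta> ^ 2 * (ln (3 * (1 + 2 * zeta_three_halves)) + 1 + 4 * ln x)"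
    by (simp add: C_def)
  finally show ?thesis .
qed

end

section \<open>Characters and Ramanujan sums to a squarefree modulus\<close>

lemma ee_add: "ee (x + y) = ee x * ee y"
  by (simp add: ee_def exp_add[symmetric] algebra_simps)

lemma norm_ee [simp]: "norm (ee x) = 1"
  by (simp add: ee_def norm_exp_eq_Re)

lemma ee_0 [simp]: "ee 0 = 1"
  by (simp add: ee_def)

lemma ee_of_int [simp]: "ee (of_int k) = 1"
  unfolding ee_def by (subst exp_eq_1) (auto simp: intro!: exI[of _ k])

lemma ee_cong: "x - y = of_int k \<Longrightarrow> ee x = ee y"
  by (metis diff_add_cancel ee_add ee_of_int mult_1)

lemma cnj_ee: "cnj (ee x) = ee (- x)"
  by (simp add: ee_def exp_cnj)

lemma ee_eq_1_iff: "ee x = 1 \<longleftrightarrow> x \<in> \<int>"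
proof
  assume "ee x = 1"
  then obtain k :: int where "2 * pi * x = of_int (2 * k) * pi"
    unfolding ee_def exp_eq_1 by auto
  then show "x \<in> \<int>" by simp
next
  assume "x \<in> \<int>"
  then show "ee x = 1" by (auto elim!: Ints_cases)
qed

lemma ee_mult_nat: "ee (x * of_nat n) = ee x ^ n"
  unfolding ee_def by (subst exp_of_nat_mult[symmetric]) (simp add: algebra_simps)

text \<open>Residues below \<open>q\<close>, so that the set is closed under reduction modulo
  \<open>q\<close>; for \<open>q = 1\<close> it is \<open>{0}\<close>.\<close>

definition units_mod :: "nat \<Rightarrow> nat set" where
  "units_mod q = {b \<in> {..<q}. coprime b q}"

lemma finite_units_mod [simp]: "finite (units_mod q)"
  by (simp add: units_mod_def)

lemma card_units_mod_le: "card (units_mod q) \<le> q"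
  using card_mono[of "{..<q}" "units_mod q"] by (auto simp: units_mod_def)

lemma one_in_units_mod: "q > 0 \<Longrightarrow> 1 mod q \<in> units_mod q"
  by (simp add: units_mod_def)

lemma card_units_mod_pos: "q > 0 \<Longrightarrow> card (units_mod q) > 0"
  using one_in_units_mod[of q] by (auto simp: card_gt_0_iff)

lemma bij_units_mod:
  assumes "coprime m q" "q > 0"
  shows "bij_betw (\<lambda>n. m * n mod q) (units_mod q) (units_mod q)"
proof -
  have inj: "inj_on (\<lambda>n. m * n mod q) (units_mod q)"
  proof (rule inj_onI)
    fix a b assume ab: "a \<in> units_mod q" "b \<in> units_mod q" "m * a mod q = m * b mod q"
    then have "[a = b] (mod q)"
      using cong_mult_lcancel_nat[of m q a b] assms by (simp add: cong_def)
    then show "a = b" using ab by (simp add: cong_def units_mod_def)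
  qed
  have "(\<lambda>n. m * n mod q) ` units_mod q \<subseteq> units_mod q"
    using assms by (auto simp: units_mod_def)
  then show ?thesis using inj endo_inj_surj[OF finite_units_mod] by (auto simp: bij_betw_def)
qed

definition characters :: "nat \<Rightarrow> (nat \<Rightarrow> complex) set" where
  "characters q = {\<psi>. dirichlet_character q \<psi>}"

definition principal :: "nat \<Rightarrow> nat \<Rightarrow> complex" where
  "principal q n = (if coprime n q then 1 else 0)"

locale character =
  fixes q :: nat and \<psi> :: "nat \<Rightarrow> complex"
  assumes char: "dirichlet_character q \<psi>"
begin

lemma q_pos: "q > 0" and mult: "\<psi> (m * n) = \<psi> m * \<psi> n" and periodic: "\<psi> (n + q) = \<psi> n"
  and nonzero_iff: "\<psi> n \<noteq> 0 \<longleftrightarrow> coprime n q"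
  using char by (auto simp: dirichlet_character_def)

lemma one: "\<psi> 1 = 1"
proof -
  have "\<psi> 1 \<noteq> 0" using nonzero_iff[of 1] by simp
  then show ?thesis using mult[of 1 1] by simp
qed

lemma mod: "\<psi> (n mod q) = \<psi> n"
proof -
  have "\<psi> (m + k * q) = \<psi> m" for m k
    by (induction k) (simp_all add: periodic add.assoc[symmetric] add.commute[of q])
  from this[of "n mod q" "n div q"] show ?thesis by simp
qed

lemma cong: "[m = n] (mod q) \<Longrightarrow> \<psi> m = \<psi> n"
  using mod[of m] mod[of n] by (simp add: cong_def)

lemma power: "\<psi> (n ^ k) = \<psi> n ^ k"
  using one by (induction k) (auto simp: mult)

lemma power_totient: "coprime n q \<Longrightarrow> \<psi> n ^ totient q = 1"
  using euler_theorem[of n q] cong[of "n ^ totient q" 1] one by (simp add: power)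

lemma norm_eq_1: "coprime n q \<Longrightarrow> norm (\<psi> n) = 1"
  using power_totient[of n] q_pos
  by (metis norm_one norm_power norm_ge_zero power_eq_1_iff totient_gt_0_iff nat_neq_iff)

lemma norm_le_1: "norm (\<psi> n) \<le> 1"
  using norm_eq_1[of n] nonzero_iff[of n] by (cases "coprime n q") auto

lemma mult_cnj: "coprime n q \<Longrightarrow> \<psi> n * cnj (\<psi> n) = 1"
  using norm_eq_1[of n] complex_norm_square[of "\<psi> n"] by simp

lemma sum_eq_0:
  assumes "\<psi> \<noteq> principal q" shows "(\<Sum>n\<in>units_mod q. \<psi> n) = 0"
proof -
  obtain m where "\<psi> m \<noteq> principal q m" using assms by blast
  then have m: "coprime m q" "\<psi> m \<noteq> 1"
    using nonzero_iff[of m] by (auto simp: principal_def split: if_splits)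
  have "(\<Sum>n\<in>units_mod q. \<psi> n) = (\<Sum>n\<in>units_mod q. \<psi> (m * n mod q))"
    by (rule sum.reindex_bij_betw[OF bij_units_mod[OF m(1) q_pos], symmetric])
  also have "\<dots> = \<psi> m * (\<Sum>n\<in>units_mod q. \<psi> n)" by (simp add: mod mult sum_distrib_left)
  finally show ?thesis using m(2) by simp
qed

lemma sum_lessThan: "(\<Sum>n<q. \<psi> n) = (\<Sum>n\<in>units_mod q. \<psi> n)"
  using nonzero_iff by (intro sum.mono_neutral_right) (auto simp: units_mod_def)

end

lemma coprime_add_self_nat: "coprime (n + q) q \<longleftrightarrow> coprime n (q :: nat)"
  by (simp add: coprime_iff_gcd_eq_1)

lemma character_principal: "q > 0 \<Longrightarrow> dirichlet_character q (principal q)"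
  by (auto simp: dirichlet_character_def principal_def coprime_add_self_nat)

lemma character_mult:
  assumes "dirichlet_character q \<psi>" "dirichlet_character q \<phi>"
  shows "dirichlet_character q (\<lambda>n. \<psi> n * \<phi> n)"
  using assms by (auto simp: dirichlet_character_def)

lemma character_cnj: "dirichlet_character q \<psi> \<Longrightarrow> dirichlet_character q (\<lambda>n. cnj (\<psi> n))"
  by (auto simp: dirichlet_character_def)

lemma finite_characters: "finite (characters q)"
proof (cases "q = 0")
  case True
  then have "characters q = {}" by (auto simp: characters_def dirichlet_character_def)
  then show ?thesis by simp
next
  case False
  let ?R = "insert 0 {z :: complex. z ^ totient q = 1}"
  have fin: "finite (PiE {..<q} (\<lambda>_. ?R))"
    using False by (intro finite_PiE) (auto intro!: finite_roots_unity simp: Suc_le_eq)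
  have "(\<lambda>\<psi>. restrict \<psi> {..<q}) ` characters q \<subseteq> PiE {..<q} (\<lambda>_. ?R)"
  proof (rule image_subsetI)
    fix \<psi> assume "\<psi> \<in> characters q"
    then interpret character q \<psi> by unfold_locales (simp add: characters_def)
    have "\<psi> n \<in> ?R" for n using power_totient[of n] nonzero_iff[of n] by auto
    then show "restrict \<psi> {..<q} \<in> PiE {..<q} (\<lambda>_. ?R)" by (simp only: restrict_PiE_iff ball_simps) blast
  qed
  moreover have "inj_on (\<lambda>\<psi>. restrict \<psi> {..<q}) (characters q)"
  proof (rule inj_onI)
    fix \<psi> \<phi> assume a: "\<psi> \<in> characters q" "\<phi> \<in> characters q" "restrict \<psi> {..<q} = restrict \<phi> {..<q}"
    interpret a: character q \<psi> by unfold_locales (use a in \<open>simp add: characters_def\<close>)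
    interpret b: character q \<phi> by unfold_locales (use a in \<open>simp add: characters_def\<close>)
    show "\<psi> = \<phi>"
    proof
      fix n
      have "restrict \<psi> {..<q} (n mod q) = restrict \<phi> {..<q} (n mod q)" using a by simp
      then show "\<psi> n = \<phi> n" using a.q_pos by (simp add: a.mod b.mod)
    qed
  qed
  ultimately show ?thesis using fin by (meson finite_imageD finite_subset)
qed

text \<open>The discrete logarithm \<open>ind\<close> to a primitive root gives the character
  \<open>ee (ind n / (p - 1))\<close> on units. It equals 1 only at index 0, that is at the residue
  1. The choice of \<open>ind\<close> depends on \<open>n mod p\<close> alone, which yields
  periodicity.\<close>

lemma character_prime_separates:
  assumes p: "prime p" and n: "coprime n p" "n mod p \<noteq> 1 mod p"
  obtains \<psi> where "dirichlet_character p \<psi>" "\<psi> n \<noteq> 1"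
proof -
  have p1: "p > 1" using p by (rule prime_gt_1_nat)
  obtain g where g: "residue_primroot p g" using prime_primitive_root_exists[OF p1 p] by blast
  have gco: "coprime p g" and ordg: "ord p g = totient p" using g by (auto simp: residue_primroot_def)
  have bij: "bij_betw (\<lambda>i. g ^ i mod p) {..<totient p} (totatives p)"
    using residue_primroot_is_generator[OF p1 g] .
  define T where "T = totient p"
  have T: "T > 0" using p1 by (simp add: T_def)
  define ind where "ind = (\<lambda>n. SOME i. i < T \<and> g ^ i mod p = n mod p)"
  have ind: "ind n < T \<and> g ^ ind n mod p = n mod p" if "coprime n p" for n
    unfolding ind_def
  proof (rule someI_ex)
    have "n mod p \<noteq> 0"
    proof
      assume "n mod p = 0"
      then have "p dvd n" by auto
      then have "is_unit p" using that by (meson coprime_common_divisor dvd_refl)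
      then show False using p1 by simp
    qed
    then have "n mod p \<in> totatives p" using that p1 by (auto simp: in_totatives_iff)
    then show "\<exists>i. i < T \<and> g ^ i mod p = n mod p"
      using bij_betw_imp_surj_on[OF bij] by (force simp: T_def)
  qed
  define \<psi> where "\<psi> = (\<lambda>n. if coprime n p then ee (real (ind n) / real T) else 0)"
  have cong_ind: "ee (real i / real T) = ee (real j / real T)" if "[g ^ i = g ^ j] (mod p)" for i j
  proof -
    have "[i = j] (mod T)" using that order_divides_expdiff[OF gco] ordg by (simp add: T_def)
    then have "[int i = int j] (mod int T)" by (simp add: cong_int_iff)
    then obtain k where "int i - int j = int T * k" by (auto simp: cong_iff_dvd_diff dvd_def)
    then have "real i - real j = real T * of_int k"
      by (metis of_int_diff of_int_mult of_int_of_nat_eq)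
    then have "real i / real T - real j / real T = of_int k" using T by (simp add: field_simps)
    then show ?thesis by (rule ee_cong)
  qed
  have "dirichlet_character p \<psi>"
    unfolding dirichlet_character_def
  proof (intro conjI allI)
    show "p > 0" using p1 by simp
    fix m n
    show "\<psi> (m * n) = \<psi> m * \<psi> n"
    proof (cases "coprime m p \<and> coprime n p")
      case True
      then have c: "coprime (m * n) p" by simp
      have "[g ^ ind (m * n) = g ^ (ind m + ind n)] (mod p)"
        using ind[OF c] ind[of m] ind[of n] True
        by (metis cong_def cong_mult power_add)
      then have "ee (real (ind (m * n)) / real T) = ee (real (ind m + ind n) / real T)"
        by (rule cong_ind)
      then show ?thesis using True c by (simp add: \<psi>_def add_divide_distrib ee_add)
    qed (auto simp: \<psi>_def)
    have "coprime (n + p) p \<longleftrightarrow> coprime n p" by (rule coprime_add_self_nat)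
    moreover have "ind (n + p) = ind n" by (simp add: ind_def)
    ultimately show "\<psi> (n + p) = \<psi> n" by (simp add: \<psi>_def)
    have "ee x \<noteq> 0" for x using norm_ee[of x] by force
    then show "\<psi> n \<noteq> 0 \<longleftrightarrow> coprime n p" by (simp add: \<psi>_def)
  qed
  moreover have "\<psi> n \<noteq> 1"
  proof
    assume "\<psi> n = 1"
    then have "real (ind n) / real T \<in> \<int>" using n by (simp add: \<psi>_def ee_eq_1_iff)
    moreover have "0 \<le> real (ind n) / real T" "real (ind n) / real T < 1"
      using ind[OF n(1)] T by auto
    moreover obtain z where z: "real (ind n) / real T = of_int z"
      using calculation(1) by (rule Ints_cases)
    ultimately have "0 \<le> z" "z < 1" by simp_all
    then have "real (ind n) / real T = 0" using z by simp
    then have "ind n = 0" using T by simp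
    then show False using ind[OF n(1)] n(2) by simp
  qed
  ultimately show ?thesis using that by blast
qed

text \<open>Congruence to 1 modulo all prime factors of a squarefree \<open>q\<close> gives
  congruence modulo \<open>q\<close>. So some prime factor already separates \<open>n\<close> from
  1, and a character modulo that prime is lifted by the principal character modulo \<open>q\<close>;
  unit groups of prime powers never enter.\<close>

lemma character_squarefree_separates:
  assumes q: "squarefree q" "q > 0" and n: "coprime n q" "n mod q \<noteq> 1 mod q"
  obtains \<psi> where "\<psi> \<in> characters q" "\<psi> n \<noteq> 1"
proof -
  have "\<exists>p. prime p \<and> p dvd q \<and> n mod p \<noteq> 1 mod p"
  proof (rule ccontr)
    assume "\<nexists>p. prime p \<and> p dvd q \<and> n mod p \<noteq> 1 mod p"
    then have "[n = 1] (mod (\<Prod>p\<in>prime_factors q. p))"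
      by (intro coprime_cong_prod_nat) (auto intro: primes_coprime simp: cong_def)
    moreover have "(\<Prod>p\<in>prime_factors q. p) = q"
    proof -
      have "q = (\<Prod>p\<in>prime_factors q. p ^ multiplicity p q)" using q by (simp add: prime_factorization_nat)
      also have "\<dots> = (\<Prod>p\<in>prime_factors q. p)"
      proof (intro prod.cong refl)
        fix p assume "p \<in> prime_factors q"
        then have "multiplicity p q = 1"
          using q squarefree_factorial_semiring''[of q] by (auto simp: prime_factors_multiplicity)
        then show "p ^ multiplicity p q = p" by simp
      qed
      finally show ?thesis by simp
    qed
    ultimately show False using n by (simp add: cong_def)
  qed
  then obtain p where p: "prime p" "p dvd q" "n mod p \<noteq> 1 mod p" by blast
  have "coprime n p" by (rule coprime_divisors[OF dvd_refl p(2) n(1)])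
  then obtain \<phi> where \<phi>: "dirichlet_character p \<phi>" "\<phi> n \<noteq> 1"
    using character_prime_separates[OF p(1)] p(3) by blast
  interpret \<phi>: character p \<phi> by unfold_locales (rule \<phi>)
  define \<psi> where "\<psi> = (\<lambda>m. principal q m * \<phi> m)"
  have "dirichlet_character q \<psi>"
    unfolding dirichlet_character_def
  proof (intro conjI allI)
    show "q > 0" by fact
    fix m k
    show "\<psi> (m * k) = \<psi> m * \<psi> k" by (simp add: \<psi>_def principal_def \<phi>.mult)
    have "\<phi> (m + q) = \<phi> m" by (rule \<phi>.cong) (use p in \<open>auto simp: cong_def elim!: dvdE\<close>)
    then show "\<psi> (m + q) = \<psi> m" by (simp add: \<psi>_def principal_def coprime_add_self_nat)
    have "coprime m q \<Longrightarrow> coprime m p" by (rule coprime_divisors[OF dvd_refl p(2)])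
    then show "\<psi> m \<noteq> 0 \<longleftrightarrow> coprime m q" using \<phi>.nonzero_iff[of m] by (auto simp: \<psi>_def principal_def)
  qed
  moreover have "\<psi> n \<noteq> 1" using \<phi> n by (simp add: \<psi>_def principal_def)
  ultimately show ?thesis using that by (auto simp: characters_def)
qed

lemma sum_characters_neq:
  assumes q: "squarefree q" "q > 0" and n: "coprime n q" "n mod q \<noteq> 1 mod q"
  shows "(\<Sum>\<psi>\<in>characters q. \<psi> n) = 0"
proof -
  obtain \<phi> where \<phi>: "\<phi> \<in> characters q" "\<phi> n \<noteq> 1"
    using character_squarefree_separates[OF q n] by blast
  interpret \<phi>: character q \<phi> by unfold_locales (use \<phi> in \<open>simp add: characters_def\<close>)
  have cancel: "\<phi> m * cnj (\<phi> m) * \<psi> m = \<psi> m" if "\<psi> \<in> characters q" for \<psi> m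
  proof -
    interpret character q \<psi> by unfold_locales (use that in \<open>simp add: characters_def\<close>)
    show ?thesis using \<phi>.mult_cnj[of m] nonzero_iff[of m] by (cases "coprime m q") auto
  qed
  have "(\<Sum>\<psi>\<in>characters q. \<psi> n) = (\<Sum>\<psi>\<in>characters q. \<phi> n * \<psi> n)"
    by (rule sum.reindex_bij_witness[where i = "\<lambda>\<psi> m. \<phi> m * \<psi> m" and j = "\<lambda>\<psi> m. cnj (\<phi> m) * \<psi> m"])
      (use cancel \<phi>(1) in \<open>auto simp: characters_def mult_ac intro!: character_mult character_cnj\<close>)
  also have "\<dots> = \<phi> n * (\<Sum>\<psi>\<in>characters q. \<psi> n)" by (simp add: sum_distrib_left)
  finally show ?thesis using \<phi>(2) by simp
qed

lemma sum_characters_eq: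
  assumes "n mod q = 1 mod q" shows "(\<Sum>\<psi>\<in>characters q. \<psi> n) = of_nat (card (characters q))"
proof -
  have "\<psi> n = 1" if "\<psi> \<in> characters q" for \<psi>
  proof -
    interpret character q \<psi> by unfold_locales (use that in \<open>simp add: characters_def\<close>)
    show ?thesis using cong[of n 1] assms one by (simp add: cong_def)
  qed
  then have "(\<Sum>\<psi>\<in>characters q. \<psi> n) = (\<Sum>\<psi>\<in>characters q. 1)" by (rule sum.cong[OF refl])
  then show ?thesis by simp
qed

text \<open>The double sum of \<open>\<psi> n\<close> over characters and units is evaluated in both
  orders: in one only the residue 1 survives, in the other only the principal character.\<close>

lemma card_characters:
  assumes q: "squarefree q" "q > 0"
  shows "card (characters q) = card (units_mod q)"
proof -
  have "(\<Sum>n\<in>units_mod q. \<Sum>\<psi>\<in>characters q. \<psi> n) =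
      (\<Sum>n\<in>units_mod q. if n = 1 mod q then of_nat (card (characters q)) else 0)"
  proof (intro sum.cong refl)
    fix n assume "n \<in> units_mod q"
    then show "(\<Sum>\<psi>\<in>characters q. \<psi> n) = (if n = 1 mod q then of_nat (card (characters q)) else 0)"
      using sum_characters_eq[of n q] sum_characters_neq[OF q, of n] by (auto simp: units_mod_def)
  qed
  also have "\<dots> = (of_nat (card (characters q)) :: complex)"
    using one_in_units_mod[OF q(2)] by simp
  finally have 1: "(\<Sum>n\<in>units_mod q. \<Sum>\<psi>\<in>characters q. \<psi> n) = of_nat (card (characters q))" .
  have "(\<Sum>\<psi>\<in>characters q. \<Sum>n\<in>units_mod q. \<psi> n) =
      (\<Sum>\<psi>\<in>characters q. if \<psi> = principal q then of_nat (card (units_mod q)) else 0)"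
  proof (intro sum.cong refl)
    fix \<psi> assume "\<psi> \<in> characters q"
    then interpret character q \<psi> by unfold_locales (simp add: characters_def)
    have "(\<Sum>n\<in>units_mod q. principal q n) = of_nat (card (units_mod q))"
      by (simp add: principal_def units_mod_def)
    then show "(\<Sum>n\<in>units_mod q. \<psi> n) = (if \<psi> = principal q then of_nat (card (units_mod q)) else 0)"
      using sum_eq_0 by auto
  qed
  also have "\<dots> = (of_nat (card (units_mod q)) :: complex)"
    using character_principal[OF q(2)] finite_characters by (simp add: characters_def)
  finally have 2: "(\<Sum>\<psi>\<in>characters q. \<Sum>n\<in>units_mod q. \<psi> n) = (of_nat (card (units_mod q)) :: complex)" .
  have "(\<Sum>\<psi>\<in>characters q. \<Sum>n\<in>units_mod q. \<psi> n) = (\<Sum>n\<in>units_mod q. \<Sum>\<psi>\<in>characters q. \<psi> n)"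
    by (rule sum.swap)
  then show ?thesis unfolding 1 2 by simp
qed

lemma character_orthogonality:
  assumes q: "squarefree q" "q > 0" and mn: "coprime m q" "coprime n q"
  shows "(\<Sum>\<psi>\<in>characters q. \<psi> m * cnj (\<psi> n)) = (if m mod q = n mod q then of_nat (card (units_mod q)) else 0)"
proof -
  obtain k where k: "[n * k = 1] (mod q)" using cong_solve_coprime_nat[OF mn(2)] by auto
  then have ck: "coprime k q" "coprime (n * k) q"
    using cong_imp_coprime[of 1 "n * k" q] cong_sym by (auto simp: cong_sym_eq)
  have "\<psi> m * cnj (\<psi> n) = \<psi> (m * k)" if "\<psi> \<in> characters q" for \<psi>
  proof -
    interpret character q \<psi> by unfold_locales (use that in \<open>simp add: characters_def\<close>)
    have "\<psi> n * \<psi> k = 1" using cong[OF k] one mult by simp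
    then have "cnj (\<psi> n) = cnj (\<psi> n) * (\<psi> n * \<psi> k)" by simp
    also have "\<dots> = \<psi> k" using mult_cnj[OF mn(2)] by (simp add: mult_ac)
    finally show ?thesis by (simp add: mult)
  qed
  then have eq: "(\<Sum>\<psi>\<in>characters q. \<psi> m * cnj (\<psi> n)) = (\<Sum>\<psi>\<in>characters q. \<psi> (m * k))"
    by (intro sum.cong) auto
  have iff: "m * k mod q = 1 mod q \<longleftrightarrow> m mod q = n mod q"
  proof -
    have "[m * k = n * k] (mod q) \<longleftrightarrow> [m = n] (mod q)"
      using ck(1) cong_mult_rcancel_nat by blast
    then show ?thesis using k by (simp add: cong_def)
  qed
  show ?thesis
    unfolding eq using sum_characters_eq[of "m * k" q] sum_characters_neq[OF q, of "m * k"] iff ck mn card_characters[OF q]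
    by auto
qed

section \<open>Ramanujan sums\<close>

definition ramanujan_sum :: "nat \<Rightarrow> int \<Rightarrow> complex" where
  "ramanujan_sum q a = (\<Sum>b\<in>units_mod q. ee (of_int a * of_nat b / of_nat q))"

lemma sum_ee_prime:
  assumes "p > 0" "\<not> int p dvd a"
  shows "(\<Sum>j<p. ee (of_int a * of_nat j / of_nat p)) = 0"
proof -
  define z where "z = ee (of_int a / of_nat p)"
  have "of_int a / real p \<notin> \<int>"
  proof
    assume "of_int a / real p \<in> \<int>"
    then obtain k where "of_int a / real p = of_int k" by (auto elim!: Ints_cases)
    then have "real_of_int a = of_int (int p * k)" using assms(1) by (simp add: field_simps)
    then have "a = int p * k" by (simp only: of_int_eq_iff)
    then show False using assms(2) by simp
  qed
  then have "z \<noteq> 1" by (simp add: z_def ee_eq_1_iff)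
  have "ee (of_int a * of_nat j / of_nat p) = z ^ j" for j
    using ee_mult_nat[of "of_int a / of_nat p" j] by (simp add: z_def)
  then have "(\<Sum>j<p. ee (of_int a * of_nat j / of_nat p)) = (\<Sum>j<p. z ^ j)" by simp
  also have "\<dots> = (z ^ p - 1) / (z - 1)" using \<open>z \<noteq> 1\<close> by (simp add: geometric_sum)
  also have "z ^ p = 1" using ee_mult_nat[of "of_int a / of_nat p" p] assms(1) by (simp add: z_def)
  finally show ?thesis by simp
qed

text \<open>The residues modulo \<open>p r\<close> that are prime to \<open>r\<close> are the units
  modulo \<open>p r\<close> together with \<open>p\<close> times the units modulo \<open>r\<close>.
  Over all of them the sum is 0, because the lifts \<open>c + r j\<close> of each unit
  \<open>c\<close> modulo \<open>r\<close> run through a complete geometric sum modulo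
  \<open>p\<close>.\<close>

lemma ramanujan_sum_mult_prime:
  assumes p: "prime p" "\<not> p dvd r" and r: "r > 0" and a: "coprime a (int p)"
  shows "ramanujan_sum (p * r) a = - ramanujan_sum r a"
proof -
  have p0: "p > 0" using p prime_gt_0_nat by blast
  have cpr: "coprime p r" using p by (simp add: prime_imp_coprime)
  let ?f = "\<lambda>b. ee (of_int a * of_nat b / of_nat (p * r))"
  define A where "A = {b. b < p * r \<and> coprime b r}"
  have eqA: "A = units_mod (p * r) \<union> (\<lambda>b. p * b) ` units_mod r"
  proof safe
    fix b assume b: "b \<in> A" "b \<notin> (\<lambda>b. p * b) ` units_mod r"
    have "\<not> p dvd b"
    proof
      assume "p dvd b"
      then obtain c where c: "b = p * c" by blast
      then have "c \<in> units_mod r" using b(1) by (auto simp: A_def units_mod_def)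
      then show False using b(2) c by blast
    qed
    then have "coprime b p" using p(1) by (metis coprime_commute prime_imp_coprime)
    then show "b \<in> units_mod (p * r)" using b(1) by (auto simp: A_def units_mod_def)
  qed (use p0 cpr in \<open>auto simp: A_def units_mod_def\<close>)
  have disj: "units_mod (p * r) \<inter> (\<lambda>b. p * b) ` units_mod r = {}"
    using p(1) prime_gt_1_nat[OF p(1)] by (auto simp: units_mod_def)
  have inj: "inj_on (\<lambda>b. p * b) (units_mod r)" using p0 by (auto simp: inj_on_def)
  have "(\<Sum>b\<in>A. ?f b) = (\<Sum>b\<in>units_mod (p * r). ?f b) + (\<Sum>b\<in>(\<lambda>b. p * b) ` units_mod r. ?f b)"
    unfolding eqA using disj by (intro sum.union_disjoint) auto
  also have "(\<Sum>b\<in>(\<lambda>b. p * b) ` units_mod r. ?f b) = ramanujan_sum r a"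
    unfolding sum.reindex[OF inj] ramanujan_sum_def using p0 by (intro sum.cong) auto
  finally have 1: "(\<Sum>b\<in>A. ?f b) = ramanujan_sum (p * r) a + ramanujan_sum r a"
    by (simp add: ramanujan_sum_def)
  have "(\<Sum>b\<in>A. ?f b) = (\<Sum>(c, j)\<in>units_mod r \<times> {..<p}. ?f (c + r * j))"
  proof (rule sum.reindex_bij_witness[where i = "\<lambda>(c, j). c + r * j" and j = "\<lambda>b. (b mod r, b div r)"])
    fix b assume "b \<in> A"
    then show "(b mod r, b div r) \<in> units_mod r \<times> {..<p}"
      using r by (auto simp: A_def units_mod_def less_mult_imp_div_less)
  next
    fix x assume "x \<in> units_mod r \<times> {..<p}"
    then obtain c j where x: "x = (c, j)" "c < r" "coprime c r" "j < p" by (auto simp: units_mod_def)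
    have "c + r * j < r + r * j" using x by simp
    also have "r + r * j = r * Suc j" by simp
    also have "\<dots> \<le> r * p" using x by (intro mult_le_mono) auto
    finally have "c + r * j < p * r" by (simp add: mult.commute)
    moreover have "coprime (c + r * j) r" using x(3) by (metis coprime_mod_left_iff mod_mult_self2 r less_irrefl)
    ultimately show "(case x of (c, j) \<Rightarrow> c + r * j) \<in> A" using x by (simp add: A_def)
  next
    fix b assume "b \<in> A"
    show "(case (b mod r, b div r) of (c, j) \<Rightarrow> ?f (c + r * j)) = ?f b"
      by (simp only: prod.case mod_mult_div_eq)
  qed (auto simp: units_mod_def)
  also have "\<dots> = (\<Sum>c\<in>units_mod r. \<Sum>j<p. ?f c * ee (of_int a * of_nat j / of_nat p))"
    unfolding sum.cartesian_product
  proof (intro sum.cong refl, clarify)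
    fix c j
    have "of_int a * real (c + r * j) / real (p * r) = of_int a * real c / real (p * r) + of_int a * real j / real p"
      using r p0 by (simp add: field_simps)
    then show "?f (c + r * j) = ?f c * ee (of_int a * of_nat j / of_nat p)" by (simp add: ee_add)
  qed
  also have "\<dots> = 0"
  proof -
    have "\<not> int p dvd a"
      using a p(1) by (metis coprime_common_divisor dvd_refl not_prime_unit prime_nat_int_transfer)
    then show ?thesis using sum_ee_prime[OF p0] by (simp add: sum_distrib_left[symmetric])
  qed
  finally show ?thesis using 1 by (simp add: eq_neg_iff_add_eq_0)
qed

text \<open>Removing one prime factor at a time changes only the sign; the sum is the Moebius
  function of \<open>q\<close>.\<close>

lemma norm_ramanujan_sum:
  "squarefree q \<Longrightarrow> q > 0 \<Longrightarrow> coprime a (int q) \<Longrightarrow> norm (ramanujan_sum q a) = 1"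
proof (induction q rule: less_induct)
  case (less q)
  show ?case
  proof (cases "q = 1")
    case True
    have "units_mod 1 = {0}" by (auto simp: units_mod_def)
    then show ?thesis using True by (simp add: ramanujan_sum_def)
  next
    case False
    then obtain p where p: "prime p" "p dvd q" using prime_factor_nat by blast
    then obtain r where q: "q = p * r" by blast
    have r0: "r > 0" using less.prems q by simp
    have sq: "squarefree r" using less.prems(1) q squarefree_multD by blast
    have "\<not> p dvd r"
    proof
      assume "p dvd r"
      then have "p ^ 2 dvd q" using q by (auto simp: power2_eq_square)
      then have "p dvd 1" using less.prems(1) squarefreeD by blast
      then show False using p(1) by simp
    qed
    moreover have "coprime a (int p)" "coprime a (int r)" using less.prems q by auto
    moreover have "r < q" using q r0 prime_gt_1_nat[OF p(1)] by simp
    ultimately show ?thesis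
      using less.IH[of r] ramanujan_sum_mult_prime[OF p(1) _ r0, of a] r0 sq q by simp
  qed
qed

section \<open>Chebyshev bounds\<close>

text \<open>Legendre's formula: \<open>n div d\<close> counts the multiples of \<open>d\<close> up
  to \<open>n\<close>.\<close>

lemma ln_fact_eq_sum:
  "ln (fact n :: real) = (\<Sum>d\<in>{1..n}. mangoldt d * real (n div d))"
proof -
  have "ln (fact n :: real) = (\<Sum>m\<in>{1..n}. ln (real m))"
    unfolding fact_prod of_nat_prod by (subst ln_prod) auto
  also have "\<dots> = (\<Sum>m\<in>{1..n}. \<Sum>d\<in>{1..n}. if d dvd m then mangoldt d else 0)"
  proof (intro sum.cong refl)
    fix m assume m: "m \<in> {1..n}"
    have "ln (real m) = (\<Sum>d | d dvd m. mangoldt d :: real)"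
      using mangoldt_sum[of m, where ?'a = real] m by simp
    also have "\<dots> = (\<Sum>d\<in>{1..n}. if d dvd m then mangoldt d else 0)"
    proof (intro sum.mono_neutral_cong_left)
      show "{d. d dvd m} \<subseteq> {1..n}"
      proof
        fix d assume "d \<in> {d. d dvd m}"
        then have "d \<le> m" "d > 0" using m by (auto intro: dvd_imp_le Nat.gr0I)
        then show "d \<in> {1..n}" using m by simp
      qed
    qed auto
    finally show "ln (real m) = (\<Sum>d\<in>{1..n}. if d dvd m then mangoldt d else 0)" .
  qed
  also have "\<dots> = (\<Sum>d\<in>{1..n}. \<Sum>m\<in>{1..n}. if d dvd m then mangoldt d else 0)"
    by (rule sum.swap)
  also have "\<dots> = (\<Sum>d\<in>{1..n}. mangoldt d * real (n div d))"
  proof (intro sum.cong refl)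
    fix d assume d: "d \<in> {1..n}"
    have "{m \<in> {1..n}. d dvd m} = (\<lambda>k. d * k) ` {1..n div d}"
    proof safe
      fix m assume "m \<in> {1..n}" "d dvd m"
      then obtain k where k: "m = d * k" by blast
      then have "k \<le> n div d" using \<open>m \<in> _\<close> d by (simp add: less_eq_div_iff_mult_less_eq mult.commute)
      then show "m \<in> (\<lambda>k. d * k) ` {1..n div d}" using k \<open>m \<in> _\<close> by auto
    next
      fix k assume "k \<in> {1..n div d}"
      then show "d * k \<in> {1..n}" using d by (auto simp: less_eq_div_iff_mult_less_eq mult.commute)
    qed auto
    moreover have "inj_on (\<lambda>k. d * k) {1..n div d}" using d by (auto simp: inj_on_def)
    ultimately have "card {m \<in> {1..n}. d dvd m} = n div d" by (simp add: card_image)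
    then show "(\<Sum>m\<in>{1..n}. if d dvd m then mangoldt d else 0) = mangoldt d * real (n div d)"
      by (simp add: sum.If_cases Int_def mult.commute)
  qed
  finally show ?thesis .
qed

text \<open>Chebyshev's argument: in the logarithm of the central binomial coefficient the von
  Mangoldt function at \<open>d\<close> has weight \<open>2 n div d - 2 (n div d)\<close>, which is
  at most 1.\<close>

lemma chebyshev_lower_even:
  assumes "n > 0"
  shows "real n * ln 4 - ln (2 * real n) \<le> (\<Sum>d\<in>{1..2 * n}. mangoldt d)"
proof -
  have "ln (real ((2 * n) choose n)) = ln (fact (2 * n) :: real) - 2 * ln (fact n)"
  proof -
    have "real ((2 * n) choose n) = fact (2 * n) / (fact n * fact n)"
      using binomial_fact[of n "2 * n", where ?'a = real] by simp
    then show ?thesis by (simp add: ln_div ln_mult)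
  qed
  also have "\<dots> = (\<Sum>d\<in>{1..2 * n}. mangoldt d * real (2 * n div d)) - (\<Sum>d\<in>{1..2 * n}. 2 * (mangoldt d * real (n div d)))"
  proof -
    have "(\<Sum>d\<in>{1..n}. mangoldt d * real (n div d)) = (\<Sum>d\<in>{1..2 * n}. mangoldt d * real (n div d))"
      by (intro sum.mono_neutral_left) auto
    then show ?thesis by (simp add: ln_fact_eq_sum sum_distrib_left)
  qed
  also have "\<dots> = (\<Sum>d\<in>{1..2 * n}. mangoldt d * (real (2 * n div d) - 2 * real (n div d)))"
    by (simp add: sum_subtractf[symmetric] algebra_simps)
  also have "\<dots> \<le> (\<Sum>d\<in>{1..2 * n}. mangoldt d * 1)"
  proof (intro sum_mono mult_left_mono)
    fix d assume "d \<in> {1..2 * n}"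
    then have d: "d > 0" by simp
    have "n < Suc (n div d) * d" using d dividend_less_div_times[of d n] by simp
    then have "2 * n < (2 * (n div d) + 2) * d" by simp
    then have "2 * n div d < 2 * (n div d) + 2" using d by (simp add: div_less_iff_less_mult)
    then show "real (2 * n div d) - 2 * real (n div d) \<le> 1" by linarith
  qed (simp add: mangoldt_nonneg)
  finally have "ln (real ((2 * n) choose n)) \<le> (\<Sum>d\<in>{1..2 * n}. mangoldt d)" by simp
  moreover have "ln (4 ^ n / (2 * real n)) \<le> ln (real ((2 * n) choose n))"
  proof -
    have "4 ^ n / (2 * real n) \<le> real ((2 * n) choose n)"
      by (rule central_binomial_lower_bound[OF assms])
    moreover have "4 ^ n / (2 * real n) > 0" using assms by simp
    ultimately show ?thesis by (subst ln_le_cancel_iff) auto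
  qed
  moreover have "ln (4 ^ n / (2 * real n)) = real n * ln 4 - ln (2 * real n)"
    using assms by (simp add: ln_div ln_realpow)
  ultimately show ?thesis by simp
qed

text \<open>Only powers of primes dividing \<open>q\<close> contribute; those of a single prime up
  to \<open>x\<close> add up to at most \<open>ln x\<close>.\<close>

lemma sum_mangoldt_not_coprime_le:
  assumes q: "q > 0" and x: "x \<ge> 1"
  shows "(\<Sum>n | 1 \<le> n \<and> real n \<le> x \<and> \<not> coprime n q. mangoldt n) \<le> real q * ln x"
proof -
  let ?A = "{n. 1 \<le> n \<and> real n \<le> x \<and> \<not> coprime n q}"
  let ?B = "{n \<in> ?A. primepow n}"
  define K where "K = (\<lambda>p :: nat. nat \<lfloor>ln x / ln (real p)\<rfloor>)"
  let ?S = "SIGMA p:prime_factors q. {1..K p}"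
  have fin: "finite ?A" by (rule finite_subset[of _ "{..nat \<lfloor>x\<rfloor>}"]) (auto simp: le_nat_floor)
  have "(\<Sum>n\<in>?A. mangoldt n :: real) = (\<Sum>n\<in>?B. mangoldt n)"
    using fin by (intro sum.mono_neutral_right) (auto simp: mangoldt_def)
  also have "\<dots> \<le> (\<Sum>n\<in>(\<lambda>(p, k). p ^ k) ` ?S. mangoldt n)"
  proof (rule sum_mono2)
    show "?B \<subseteq> (\<lambda>(p, k). p ^ k) ` ?S"
    proof
      fix n assume n: "n \<in> ?B"
      then obtain p k where pk: "prime p" "k > 0" "n = p ^ k" by (auto simp: primepow_def)
      have p1: "real p > 1" using prime_gt_1_nat[OF pk(1)] by simp
      have "\<not> coprime p q" using n pk by simp
      then have "p \<in> prime_factors q" using pk(1) q prime_imp_coprime by (auto simp: prime_factors_dvd)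
      moreover have "real k * ln (real p) \<le> ln x"
      proof -
        have "ln (real p ^ k) \<le> ln x" using n pk p1 x by (subst ln_le_cancel_iff) auto
        then show ?thesis using p1 by (simp add: ln_realpow)
      qed
      then have "k \<le> K p" unfolding K_def using p1 by (intro le_nat_floor) (simp add: pos_le_divide_eq)
      ultimately show "n \<in> (\<lambda>(p, k). p ^ k) ` ?S" using pk by force
    qed
  qed (auto simp: mangoldt_nonneg)
  also have "\<dots> \<le> (\<Sum>(p, k)\<in>?S. mangoldt (p ^ k))"
    by (rule order.trans[OF sum_image_le]) (auto simp: mangoldt_nonneg case_prod_unfold)
  also have "\<dots> = (\<Sum>p\<in>prime_factors q. \<Sum>k\<in>{1..K p}. ln (real p))"
  proof -
    have "(\<Sum>(p, k)\<in>?S. mangoldt (p ^ k) :: real) = (\<Sum>p\<in>prime_factors q. \<Sum>k\<in>{1..K p}. mangoldt (p ^ k))"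
      by (subst sum.Sigma) auto
    also have "\<dots> = (\<Sum>p\<in>prime_factors q. \<Sum>k\<in>{1..K p}. ln (real p))"
      by (intro sum.cong refl) (auto simp: in_prime_factors_iff)
    finally show ?thesis .
  qed
  also have "\<dots> \<le> (\<Sum>p\<in>prime_factors q. ln x)"
  proof (intro sum_mono)
    fix p assume "p \<in> prime_factors q"
    then have p1: "real p > 1" using prime_gt_1_nat by (auto simp: in_prime_factors_iff)
    have "real (K p) \<le> ln x / ln (real p)" using x p1 by (simp add: K_def)
    then have "real (K p) * ln (real p) \<le> ln x" using p1 by (simp add: pos_le_divide_eq)
    then show "(\<Sum>k\<in>{1..K p}. ln (real p)) \<le> ln x" by simp
  qed
  also have "\<dots> = real (card (prime_factors q)) * ln x" by simp
  also have "\<dots> \<le> real q * ln x"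
  proof (intro mult_right_mono)
    have "prime_factors q \<subseteq> {1..q}"
      using q by (auto simp: in_prime_factors_iff dvd_imp_le prime_gt_0_nat Suc_le_eq)
    then show "real (card (prime_factors q)) \<le> real q" using card_mono[of "{1..q}"] by simp
  qed (use x in simp)
  finally show ?thesis .
qed

lemma weighted_chebyshev_lower:
  assumes x: "x \<ge> 16"
  shows "x / 16 - ln x / 2 \<le> (\<Sum>n | 1 \<le> n \<and> real n \<le> x. mangoldt n * (1 - real n / x))"
proof -
  let ?A = "{n. 1 \<le> n \<and> real n \<le> x}"
  have fin: "finite ?A" by (rule finite_subset[of _ "{..nat \<lfloor>x\<rfloor>}"]) (auto simp: le_nat_floor)
  \<comment> \<open>Only \<open>n <= 2 N <= x / 2\<close> are kept, where the weight is at least 1 /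
    2.\<close>
  define N where "N = nat \<lfloor>x / 4\<rfloor>"
  have N: "real N \<le> x / 4" "x / 4 < real N + 1" using x by (auto simp: N_def) linarith+
  have N0: "N > 0" using N x by linarith
  have "real N \<ge> x / 8" using N x by linarith
  have "real N * 1 \<le> real N * ln 4" 
  proof -
    have "exp 1 \<le> (4 :: real)" using exp_le by simp
    then have "1 \<le> ln (4 :: real)" by (subst ln_ge_iff) auto
    then show ?thesis by (intro mult_left_mono) auto
  qed
  moreover have "ln (2 * real N) \<le> ln x" using N N0 by (subst ln_le_cancel_iff) auto
  ultimately have "x / 8 - ln x \<le> (\<Sum>d\<in>{1..2 * N}. mangoldt d :: real)"
    using chebyshev_lower_even[OF N0] \<open>real N \<ge> x / 8\<close> by linarith
  then have "x / 16 - ln x / 2 \<le> (\<Sum>d\<in>{1..2 * N}. mangoldt d * (1 / 2))"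
    unfolding sum_distrib_right[symmetric] by simp
  also have "\<dots> \<le> (\<Sum>n\<in>{1..2 * N}. mangoldt n * (1 - real n / x))"
  proof (intro sum_mono mult_left_mono)
    fix n assume "n \<in> {1..2 * N}"
    then have "real n \<le> x / 2" using N(1) by simp
    then show "1 / 2 \<le> 1 - real n / x" using x by (simp add: field_simps)
  qed (simp add: mangoldt_nonneg)
  also have "\<dots> \<le> (\<Sum>n\<in>?A. mangoldt n * (1 - real n / x))"
  proof (rule sum_mono2[OF fin])
    show "{1..2 * N} \<subseteq> ?A" using N by auto
    fix n assume "n \<in> ?A - {1..2 * N}"
    then have "real n / x \<le> 1" using x by simp
    then show "0 \<le> mangoldt n * (1 - real n / x)" by (simp add: mangoldt_nonneg)
  qed
  finally show ?thesis .
qed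

section \<open>The weighted exponential sum over primes at a fraction\<close>

lemma nonprincipal_character:
  assumes "dirichlet_character q \<psi>" "\<psi> \<noteq> principal q"
  shows "nonprincipal \<psi> q"
proof -
  interpret character q \<psi> by unfold_locales fact
  show ?thesis
    by unfold_locales (use q_pos periodic norm_le_1 sum_lessThan sum_eq_0[OF assms(2)] mult one in auto)
qed

text \<open>The hypothesis treats \<open>1 / 2 < Re s < 1\<close>. On the line
  \<open>Re s = 1\<close> the non-vanishing theorem applies, the primes not dividing
  \<open>q\<close> supplying infinitely many values of modulus 1; further right \<open>L\<close> is
  the absolutely convergent series.\<close>

lemma GRH_nonzero:
  assumes GRH and \<psi>: "dirichlet_character q \<psi>" "\<psi> \<noteq> principal q" and s: "Re s > 1 / 2"
  shows "mean_zero_periodic.L \<psi> q s \<noteq> 0"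
proof -
  interpret character q \<psi> by unfold_locales fact
  interpret nonprincipal \<psi> q by (rule nonprincipal_character[OF \<psi>])
  have "infinite {p. prime p \<and> norm (\<psi> p) = 1}"
  proof -
    have "infinite ({p :: nat. prime p} - prime_factors q)"
      using primes_infinite by (intro Diff_infinite_finite) auto
    moreover have "{p. prime p} - prime_factors q \<subseteq> {p. prime p \<and> norm (\<psi> p) = 1}"
      using \<psi>(1) by (auto simp: dirichlet_character_def in_prime_factors_iff intro!: norm_eq_1 prime_imp_coprime)
    ultimately show ?thesis using finite_subset by blast
  qed
  then consider "Re s < 1" | "Re s = 1 \<Longrightarrow> L s \<noteq> 0" "Re s \<ge> 1" using L_nonzero_Re_1 by force
  then show ?thesis
  proof cases
    case 1
    show ?thesis
    proof
      assume "L s = 0"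
      then have "dirichlet_L \<psi> s = 0" by (simp add: dirichlet_L_eq)
      then have "Re s = 1 / 2" using \<open>GRH\<close> \<psi> s 1 unfolding GRH_def by force
      then show False using s by simp
    qed
  next
    case 2
    then show ?thesis using L_eq_dirichlet_series[of s] dirichlet_series_nonzero[of s] by (cases "Re s = 1") auto
  qed
qed

section \<open>Gauss sums and the passage from additive to multiplicative characters\<close>

definition gauss_sum :: "nat \<Rightarrow> int \<Rightarrow> (nat \<Rightarrow> complex) \<Rightarrow> complex" where
  "gauss_sum q a \<psi> = (\<Sum>b\<in>units_mod q. ee (of_int a * of_nat b / of_nat q) * cnj (\<psi> b))"

lemma gauss_sum_principal: "gauss_sum q a (principal q) = ramanujan_sum q a"
  unfolding gauss_sum_def ramanujan_sum_def by (intro sum.cong) (auto simp: principal_def units_mod_def)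

lemma ee_mod:
  assumes "q > 0" shows "ee (of_int a * of_nat (n mod q) / of_nat q) = ee (of_int a * of_nat n / of_nat q)"
proof (rule ee_cong)
  have "real n = real (n mod q) + real q * real (n div q)"
    by (metis add.commute mult_div_mod_eq of_nat_add of_nat_mult)
  then show "of_int a * real (n mod q) / real q - of_int a * real n / real q = of_int (- (a * int (n div q)))"
    using assms by (simp add: field_simps)
qed

lemma character_expansion:
  assumes q: "squarefree q" "q > 0" and A: "finite A" "\<And>n. n \<in> A \<Longrightarrow> coprime n q"
  shows "of_nat (card (units_mod q)) * (\<Sum>n\<in>A. W n * ee (of_int a * of_nat n / of_nat q))
    = (\<Sum>\<psi>\<in>characters q. gauss_sum q a \<psi> * (\<Sum>n\<in>A. W n * \<psi> n))"
proof -
  let ?v = "\<lambda>n. ee (of_int a * of_nat n / of_nat q)"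
  have "(\<Sum>\<psi>\<in>characters q. gauss_sum q a \<psi> * (\<Sum>n\<in>A. W n * \<psi> n))
      = (\<Sum>\<psi>\<in>characters q. \<Sum>n\<in>A. \<Sum>b\<in>units_mod q. ?v b * W n * (\<psi> n * cnj (\<psi> b)))"
  proof (rule sum.cong[OF refl])
    fix \<psi>
    show "gauss_sum q a \<psi> * (\<Sum>n\<in>A. W n * \<psi> n) = (\<Sum>n\<in>A. \<Sum>b\<in>units_mod q. ?v b * W n * (\<psi> n * cnj (\<psi> b)))"
      unfolding gauss_sum_def sum_product by (subst sum.swap) (simp add: mult_ac)
  qed
  also have "\<dots> = (\<Sum>n\<in>A. \<Sum>\<psi>\<in>characters q. \<Sum>b\<in>units_mod q. ?v b * W n * (\<psi> n * cnj (\<psi> b)))"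
    by (rule sum.swap)
  also have "\<dots> = (\<Sum>n\<in>A. \<Sum>b\<in>units_mod q. ?v b * W n * (\<Sum>\<psi>\<in>characters q. \<psi> n * cnj (\<psi> b)))"
    unfolding sum_distrib_left by (rule sum.cong[OF refl sum.swap])
  also have "\<dots> = (\<Sum>n\<in>A. of_nat (card (units_mod q)) * (W n * ?v n))"
  proof (intro sum.cong refl)
    fix n assume "n \<in> A"
    then have n: "coprime n q" by (rule A)
    have "(\<Sum>b\<in>units_mod q. ?v b * W n * (\<Sum>\<psi>\<in>characters q. \<psi> n * cnj (\<psi> b))) =
        (\<Sum>b\<in>units_mod q. if b = n mod q then ?v b * W n * of_nat (card (units_mod q)) else 0)"
      using character_orthogonality[OF q n] by (intro sum.cong) (auto simp: units_mod_def)
    also have "\<dots> = ?v (n mod q) * W n * of_nat (card (units_mod q))"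
      using n q by (subst sum.delta) (auto simp: units_mod_def)
    finally show "(\<Sum>b\<in>units_mod q. ?v b * W n * (\<Sum>\<psi>\<in>characters q. \<psi> n * cnj (\<psi> b))) =
        of_nat (card (units_mod q)) * (W n * ?v n)"
      using ee_mod[OF q(2)] by (simp add: mult_ac)
  qed
  finally show ?thesis by (simp add: sum_distrib_left)
qed

text \<open>Parseval on the group of units replaces the evaluation of individual Gauss sums.\<close>

lemma sum_norm_gauss_sum_square:
  assumes q: "squarefree q" "q > 0"
  shows "(\<Sum>\<psi>\<in>characters q. norm (gauss_sum q a \<psi>) ^ 2) = real (card (units_mod q)) ^ 2"
proof -
  let ?v = "\<lambda>n. ee (of_int a * of_nat n / of_nat q)"
  let ?\<phi> = "of_nat (card (units_mod q)) :: complex"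
  have "of_real (\<Sum>\<psi>\<in>characters q. norm (gauss_sum q a \<psi>) ^ 2) =
      (\<Sum>\<psi>\<in>characters q. gauss_sum q a \<psi> * cnj (gauss_sum q a \<psi>))"
    unfolding of_real_sum complex_norm_square ..
  also have "\<dots> = (\<Sum>\<psi>\<in>characters q. \<Sum>b\<in>units_mod q. \<Sum>c\<in>units_mod q. ?v b * cnj (?v c) * (\<psi> c * cnj (\<psi> b)))"
    unfolding gauss_sum_def cnj_sum sum_product by (intro sum.cong refl) (simp add: mult_ac)
  also have "\<dots> = (\<Sum>b\<in>units_mod q. \<Sum>\<psi>\<in>characters q. \<Sum>c\<in>units_mod q. ?v b * cnj (?v c) * (\<psi> c * cnj (\<psi> b)))"
    by (rule sum.swap)
  also have "\<dots> = (\<Sum>b\<in>units_mod q. \<Sum>c\<in>units_mod q. ?v b * cnj (?v c) * (\<Sum>\<psi>\<in>characters q. \<psi> c * cnj (\<psi> b)))"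
    unfolding sum_distrib_left by (rule sum.cong[OF refl sum.swap])
  also have "\<dots> = (\<Sum>b\<in>units_mod q. \<Sum>c\<in>units_mod q. if c = b then ?v b * cnj (?v c) * ?\<phi> else 0)"
    using character_orthogonality[OF q] by (intro sum.cong refl) (auto simp: units_mod_def)
  also have "\<dots> = (\<Sum>b\<in>units_mod q. ?\<phi>)"
  proof (intro sum.cong refl)
    fix b assume "b \<in> units_mod q"
    have "?v b * cnj (?v b) = 1" using complex_norm_square[of "?v b"] by simp
    then show "(\<Sum>c\<in>units_mod q. if c = b then ?v b * cnj (?v c) * ?\<phi> else 0) = ?\<phi>"
      using \<open>b \<in> _\<close> by (subst sum.delta) auto
  qed
  also have "\<dots> = of_real (real (card (units_mod q)) ^ 2)" by (simp add: power2_eq_square)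
  finally show ?thesis by (simp only: of_real_eq_iff)
qed

lemma sum_norm_gauss_sum_le:
  assumes q: "squarefree q" "q > 0"
  shows "(\<Sum>\<psi>\<in>characters q. norm (gauss_sum q a \<psi>)) \<le> real (card (units_mod q)) * sqrt (real (card (units_mod q)))"
proof -
  let ?\<phi> = "real (card (units_mod q))"
  have "(\<Sum>\<psi>\<in>characters q. norm (gauss_sum q a \<psi>) * 1) ^ 2 \<le>
      (\<Sum>\<psi>\<in>characters q. norm (gauss_sum q a \<psi>) ^ 2) * (\<Sum>\<psi>\<in>characters q. 1 ^ 2)"
    by (rule Cauchy_Schwarz_ineq_sum)
  also have "\<dots> = (?\<phi> * sqrt ?\<phi>) ^ 2"
    using sum_norm_gauss_sum_square[OF q] card_characters[OF q] by (simp add: power_mult_distrib)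
  finally have "(\<Sum>\<psi>\<in>characters q. norm (gauss_sum q a \<psi>)) ^ 2 \<le> (?\<phi> * sqrt ?\<phi>) ^ 2" by simp
  then show ?thesis by (rule power2_le_imp_le) simp
qed

text \<open>In the character expansion the principal character has a Gauss sum of modulus 1 and
  carries the whole prime sum. The others carry at most \<open>B\<close> each, with Gauss sums of
  total size at most \<open>\<phi> * sqrt \<phi>\<close>. After division by \<open>\<phi>\<close>
  this is the bound; the \<open>n\<close> not prime to \<open>q\<close> are paid for twice, in the
  prime sum and in the exponential sum.\<close>

lemma exp_sum_lower_from_characters:
  assumes q: "squarefree q" "q > 0" and a: "coprime a (int q)" and x: "x \<ge> 16" and B0: "B \<ge> 0"
    and B: "\<And>\<psi>. \<psi> \<in> characters q \<Longrightarrow> \<psi> \<noteq> principal q \<Longrightarrow>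
      norm (\<Sum>n | 1 \<le> n \<and> real n \<le> x. mangoldt n * \<psi> n * of_real (1 - real n / x)) \<le> B"
  shows "(x / 16 - ln x / 2 - real q * ln x) / real (card (units_mod q)) - sqrt (real q) * B - real q * ln x \<le>
    norm (\<Sum>n | 1 \<le> n \<and> real n \<le> x. of_real (mangoldt n * (1 - real n / x)) * ee (of_int a * of_nat n / of_nat q))"
proof -
  let ?N = "{n. 1 \<le> n \<and> real n \<le> x}"
  let ?A = "{n \<in> ?N. coprime n q}" and ?A' = "{n. 1 \<le> n \<and> real n \<le> x \<and> \<not> coprime n q}"
  define \<phi> where "\<phi> = real (card (units_mod q))"
  have \<phi>: "\<phi> > 0" "\<phi> \<le> real q" using card_units_mod_pos[OF q(2)] card_units_mod_le[of q] by (auto simp: \<phi>_def)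
  define w where "w = (\<lambda>n. mangoldt n * (1 - real n / x))"
  have w: "0 \<le> w n" "w n \<le> mangoldt n" if "n \<in> ?N" for n
  proof -
    have "0 \<le> 1 - real n / x" "1 - real n / x \<le> 1" using that x by auto
    then show "0 \<le> w n" "w n \<le> mangoldt n"
      using mult_left_mono[of "1 - real n / x" 1 "mangoldt n"] by (auto simp: w_def mangoldt_nonneg)
  qed
  have fin: "finite ?N" by (rule finite_subset[of _ "{..nat \<lfloor>x\<rfloor>}"]) (auto simp: le_nat_floor)
  have un: "?N = ?A \<union> ?A'" "?A \<inter> ?A' = {}" by auto
  have finA: "finite ?A" "finite ?A'" by (rule finite_subset[OF _ fin], blast)+
  have small: "(\<Sum>n\<in>?A'. w n) \<le> real q * ln x"
  proof -
    have "(\<Sum>n\<in>?A'. w n) \<le> (\<Sum>n\<in>?A'. mangoldt n)" using w by (intro sum_mono) auto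
    also have "\<dots> \<le> real q * ln x" using q x by (intro sum_mangoldt_not_coprime_le) auto
    finally show ?thesis .
  qed
  have "(\<Sum>n\<in>?N. w n) = (\<Sum>n\<in>?A. w n) + (\<Sum>n\<in>?A'. w n)"
    by (subst un(1), rule sum.union_disjoint[OF finA un(2)])
  then have P: "x / 16 - ln x / 2 - real q * ln x \<le> (\<Sum>n\<in>?A. w n)"
    using weighted_chebyshev_lower[OF x] small by (simp add: w_def)
  let ?v = "\<lambda>n. ee (of_int a * of_nat n / of_nat q)"
  let ?S = "\<lambda>\<psi>. \<Sum>n\<in>?A. of_real (w n) * \<psi> n"
  have S_le: "norm (?S \<psi>) \<le> B" if "\<psi> \<in> characters q" "\<psi> \<noteq> principal q" for \<psi>
  proof -
    interpret character q \<psi> by unfold_locales (use that in \<open>simp add: characters_def\<close>)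
    have "?S \<psi> = (\<Sum>n\<in>?N. of_real (w n) * \<psi> n)"
      using fin nonzero_iff by (intro sum.mono_neutral_left) auto
    also have "\<dots> = (\<Sum>n\<in>?N. mangoldt n * \<psi> n * of_real (1 - real n / x))"
      by (intro sum.cong) (auto simp: w_def)
    finally show ?thesis using B[OF that] by simp
  qed
  have principal_in: "principal q \<in> characters q" using character_principal[OF q(2)] by (simp add: characters_def)
  have S0: "?S (principal q) = of_real (\<Sum>n\<in>?A. w n)" by (simp add: principal_def)
  define SA SB SN where "SA = (\<Sum>n\<in>?A. of_real (w n) * ?v n)" and "SB = (\<Sum>n\<in>?A'. of_real (w n) * ?v n)"
    and "SN = (\<Sum>n\<in>?N. of_real (w n) * ?v n)"
  have exp: "of_real \<phi> * SA =
      gauss_sum q a (principal q) * ?S (principal q) + (\<Sum>\<psi>\<in>characters q - {principal q}. gauss_sum q a \<psi> * ?S \<psi>)"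
  proof -
    have "of_real \<phi> * SA = (\<Sum>\<psi>\<in>characters q. gauss_sum q a \<psi> * ?S \<psi>)"
      unfolding \<phi>_def of_real_of_nat_eq SA_def by (rule character_expansion[OF q finA(1)]) simp
    also have "\<dots> = gauss_sum q a (principal q) * ?S (principal q) +
        (\<Sum>\<psi>\<in>characters q - {principal q}. gauss_sum q a \<psi> * ?S \<psi>)"
      by (rule sum.remove[OF finite_characters principal_in])
    finally show ?thesis .
  qed
  have "norm (\<Sum>\<psi>\<in>characters q - {principal q}. gauss_sum q a \<psi> * ?S \<psi>)
      \<le> (\<Sum>\<psi>\<in>characters q - {principal q}. norm (gauss_sum q a \<psi>) * B)"
    using S_le by (intro sum_norm_le) (auto simp: norm_mult intro!: mult_left_mono)
  also have "\<dots> \<le> (\<Sum>\<psi>\<in>characters q. norm (gauss_sum q a \<psi>) * B)"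
    using finite_characters B0 by (intro sum_mono2) auto
  also have "\<dots> \<le> \<phi> * sqrt \<phi> * B"
    unfolding sum_distrib_right[symmetric] \<phi>_def by (intro mult_right_mono sum_norm_gauss_sum_le q B0)
  finally have err: "norm (\<Sum>\<psi>\<in>characters q - {principal q}. gauss_sum q a \<psi> * ?S \<psi>) \<le> \<phi> * sqrt \<phi> * B" .
  have main: "norm (gauss_sum q a (principal q) * ?S (principal q)) = \<bar>\<Sum>n\<in>?A. w n\<bar>"
    unfolding S0 norm_mult gauss_sum_principal norm_ramanujan_sum[OF q a] by (simp only: norm_of_real mult_1)
  have "(\<Sum>n\<in>?A. w n) - \<phi> * sqrt \<phi> * B \<le> norm (of_real \<phi> * SA)"
  proof -
    have "norm (gauss_sum q a (principal q) * ?S (principal q)) -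
        norm (\<Sum>\<psi>\<in>characters q - {principal q}. gauss_sum q a \<psi> * ?S \<psi>)
      \<le> norm (of_real \<phi> * SA)"
      unfolding exp by (rule norm_diff_ineq)
    then show ?thesis using main err by linarith
  qed
  then have "(\<Sum>n\<in>?A. w n) - \<phi> * (sqrt \<phi> * B) \<le> \<phi> * norm SA"
    using \<phi> by (simp add: norm_mult)
  then have "(\<Sum>n\<in>?A. w n) / \<phi> - sqrt \<phi> * B \<le> norm SA"
    using \<phi> by (simp add: field_simps)
  moreover have "sqrt \<phi> * B \<le> sqrt (real q) * B" using \<phi> B0 by (intro mult_right_mono) auto
  moreover have "(x / 16 - ln x / 2 - real q * ln x) / \<phi> \<le> (\<Sum>n\<in>?A. w n) / \<phi>"
    using P \<phi> by (intro divide_right_mono) auto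
  moreover have "norm SB \<le> real q * ln x"
  proof -
    have "norm SB \<le> (\<Sum>n\<in>?A'. w n)"
      unfolding SB_def using w by (intro sum_norm_le) (auto simp: norm_mult)
    then show ?thesis using small by simp
  qed
  moreover have "SN = SA + SB"
    unfolding SA_def SB_def SN_def by (subst un(1), rule sum.union_disjoint[OF finA un(2)])
  moreover have "norm SA - norm SB
      \<le> norm (SA + SB)"
    by (rule norm_diff_ineq)
  ultimately have "(x / 16 - ln x / 2 - real q * ln x) / \<phi> - sqrt (real q) * B - real q * ln x \<le> norm SN"
    by simp
  then show ?thesis unfolding SN_def w_def \<phi>_def .
qed

lemma exp_sum_lower:
  assumes GRH and \<delta>: "0 < \<delta>" "\<delta> < 1 / 3"
  shows "\<exists>X\<ge>16. \<forall>x\<ge>X. \<forall>q a. squarefree q \<and> q > 0 \<and> coprime a (int q) \<and> real q \<le> x powr (1 / 3 - \<delta>) \<longrightarrow>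
    x / (32 * real q) \<le>
      norm (\<Sum>n | 1 \<le> n \<and> real n \<le> x. of_real (mangoldt n * (1 - real n / x)) * ee (of_int a * of_nat n / of_nat q))"
proof -
  define C where "C = 2 * mangoldt_series_2 + 36 / (\<delta> / 2) ^ 2 * (ln (3 * (1 + 2 * zeta_three_halves)) + 1)"
  define D where "D = 36 / (\<delta> / 2) ^ 2 * 4"
  have "eventually (\<lambda>x :: real. (C + D * ln x) * x powr (2 / 3) + x powr (1 / 3) * ln x \<le> x powr (2 / 3 + \<delta>) / 96) at_top"
    using \<delta> by real_asymp
  moreover have "eventually (\<lambda>x :: real. x / 24 \<le> x / 16 - ln x / 2 - x powr (1 / 3) * ln x) at_top"
    by real_asymp
  ultimately have "eventually (\<lambda>x :: real. x \<ge> 16 \<and>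
     (C + D * ln x) * x powr (2 / 3) + x powr (1 / 3) * ln x \<le> x powr (2 / 3 + \<delta>) / 96 \<and>
     x / 24 \<le> x / 16 - ln x / 2 - x powr (1 / 3) * ln x) at_top"
    using eventually_ge_at_top[of 16] by eventually_elim auto
  then obtain X where X: "\<And>x. x \<ge> X \<Longrightarrow> x \<ge> 16 \<and>
     (C + D * ln x) * x powr (2 / 3) + x powr (1 / 3) * ln x \<le> x powr (2 / 3 + \<delta>) / 96 \<and>
     x / 24 \<le> x / 16 - ln x / 2 - x powr (1 / 3) * ln x"
    by (auto simp: eventually_at_top_linorder)
  show ?thesis
  proof (intro exI[of _ "max X 16"] conjI allI impI)
    fix x :: real and q a assume xX: "x \<ge> max X 16"
      and h: "squarefree q \<and> q > 0 \<and> coprime a (int q) \<and> real q \<le> x powr (1 / 3 - \<delta>)"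
    have x16: "x \<ge> 16" using xX by simp
    have e1: "(C + D * ln x) * x powr (2 / 3) + x powr (1 / 3) * ln x \<le> x powr (2 / 3 + \<delta>) / 96"
      and e2: "x / 24 \<le> x / 16 - ln x / 2 - x powr (1 / 3) * ln x"
      using X[of x] xX by auto
    have x0: "x > 0" and lnx: "ln x \<ge> 0" using x16 by auto
    \<comment> \<open>Using \<open>\<delta> / 2\<close> here balances the powers: with
      \<open>sqrt q <= x powr (1 / 6 - \<delta> / 2)\<close> the error is
      \<open>x powr (2 / 3)\<close> up to a logarithm, while \<open>x / q\<close> is at least
      \<open>x powr (2 / 3 + \<delta>)\<close>.\<close>
    define B where "B = (C + D * ln x) * x powr (1 / 2 + \<delta> / 2)"
    have q13: "real q \<le> x powr (1 / 3)"
    proof -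
      have "x powr (1 / 3 - \<delta>) \<le> x powr (1 / 3)" using x16 \<delta> by (intro powr_mono) auto
      then show ?thesis using h by linarith
    qed
    have qx: "real q \<le> x"
      using q13 powr_mono[of "1 / 3" 1 x] x16 by simp
    have CD: "C + D * ln x = 2 * mangoldt_series_2 + 36 / (\<delta> / 2) ^ 2 * (ln (3 * (1 + 2 * zeta_three_halves)) + 1 + 4 * ln x)"
      by (simp add: C_def D_def algebra_simps add_divide_distrib)
    have CD0: "C + D * ln x \<ge> 0"
      unfolding CD using mangoldt_series_2_nonneg zeta_three_halves_nonneg lnx
      by (intro add_nonneg_nonneg mult_nonneg_nonneg) auto
    have B0: "B \<ge> 0" using CD0 by (simp add: B_def)
    define \<phi> where "\<phi> = real (card (units_mod q))"
    have \<phi>: "\<phi> > 0" "\<phi> \<le> real q" using card_units_mod_pos[of q] card_units_mod_le[of q] h by (auto simp: \<phi>_def)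
    have "(x / 16 - ln x / 2 - real q * ln x) / \<phi> - sqrt (real q) * B - real q * ln x \<le>
      norm (\<Sum>n | 1 \<le> n \<and> real n \<le> x. of_real (mangoldt n * (1 - real n / x)) * ee (of_int a * of_nat n / of_nat q))"
      unfolding \<phi>_def
    proof (rule exp_sum_lower_from_characters[OF _ _ _ x16 B0])
      fix \<psi> assume \<psi>: "\<psi> \<in> characters q" "\<psi> \<noteq> principal q"
      then have \<psi>': "dirichlet_character q \<psi>" by (simp add: characters_def)
      interpret nonprincipal \<psi> q by (rule nonprincipal_character[OF \<psi>' \<psi>(2)])
      show "norm (\<Sum>n | 1 \<le> n \<and> real n \<le> x. mangoldt n * \<psi> n * of_real (1 - real n / x)) \<le> B"
        using psi_bound[of "\<delta> / 2" x] GRH_nonzero[OF \<open>GRH\<close> \<psi>' \<psi>(2)] \<delta> x16 qx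
        unfolding B_def CD twist_def by simp
    qed (use h in auto)
    moreover have "x / (24 * real q) \<le> (x / 16 - ln x / 2 - real q * ln x) / \<phi>"
    proof -
      have "real q * ln x \<le> x powr (1 / 3) * ln x" using q13 lnx by (intro mult_right_mono)
      then have m: "x / 24 \<le> x / 16 - ln x / 2 - real q * ln x" using e2 by linarith
      have "x / (24 * real q) = (x / 24) / real q" by simp
      also have "\<dots> \<le> (x / 24) / \<phi>" using \<phi> x0 by (intro divide_left_mono) auto
      also have "\<dots> \<le> (x / 16 - ln x / 2 - real q * ln x) / \<phi>" using m \<phi> by (intro divide_right_mono) auto
      finally show ?thesis .
    qed
    moreover have "sqrt (real q) * B + real q * ln x \<le> x / (96 * real q)"
    proof -
      have "sqrt (real q) \<le> sqrt (x powr (1 / 3 - \<delta>))" using h by simp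
      also have "\<dots> = x powr (1 / 6 - \<delta> / 2)"
        using x0 by (simp add: powr_half_sqrt[symmetric] powr_powr)  (simp add: field_simps)
      finally have "sqrt (real q) * B \<le> x powr (1 / 6 - \<delta> / 2) * B" using B0 by (intro mult_right_mono)
      also have "\<dots> = (C + D * ln x) * (x powr (1 / 6 - \<delta> / 2) * x powr (1 / 2 + \<delta> / 2))" by (simp add: B_def)
      also have "x powr (1 / 6 - \<delta> / 2) * x powr (1 / 2 + \<delta> / 2) = x powr (2 / 3)"
        by (simp add: powr_add[symmetric])
      finally have "sqrt (real q) * B \<le> (C + D * ln x) * x powr (2 / 3)" .
      moreover have "real q * ln x \<le> x powr (1 / 3) * ln x" using q13 lnx by (intro mult_right_mono)
      ultimately have "sqrt (real q) * B + real q * ln x \<le> x powr (2 / 3 + \<delta>) / 96" using e1 by linarith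
      also have "x powr (2 / 3 + \<delta>) = x / x powr (1 / 3 - \<delta>)"
      proof -
        have "2 / 3 + \<delta> = 1 - (1 / 3 - \<delta>)" by simp
        then show ?thesis using powr_diff[of x 1 "1 / 3 - \<delta>"] x0 by (simp only: powr_one_eq_one powr_one' less_imp_le)
      qed
      also have "\<dots> \<le> x / real q" using h x0 by (intro divide_left_mono) auto
      finally show ?thesis by (simp add: field_simps)
    qed
    moreover have "x / (24 * real q) - x / (96 * real q) = x / (32 * real q)"
      using h by (simp add: field_simps)
    ultimately show "x / (32 * real q) \<le> norm (\<Sum>n | 1 \<le> n \<and> real n \<le> x.
      of_real (mangoldt n * (1 - real n / x)) * ee (of_int a * of_nat n / of_nat q))"
      by linarith
  qed simp
qed

section \<open>The large sieve and the sums over windows\<close>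

text \<open>The left side \<open>Z\<close> is the pairing of \<open>a\<close> with the trigonometric
  polynomial \<open>T\<close> whose coefficients are the conjugates of the values
  \<open>s r\<close>. Cauchy-Schwarz leaves the mean square of \<open>T\<close>, a quadratic form in
  the \<open>s r\<close>; replacing \<open>norm (s r) * norm (s t)\<close> by the mean of the
  squares bounds it by the row sums, hence by \<open>B * Z\<close>.\<close>

lemma dual_large_sieve:
  fixes a :: "int \<Rightarrow> complex" and \<theta> :: "'r \<Rightarrow> real"
  assumes fin: "finite I" "finite R" and B0: "B \<ge> 0"
    and B: "\<And>r. r \<in> R \<Longrightarrow> (\<Sum>t\<in>R. norm (\<Sum>n\<in>I. ee ((\<theta> r - \<theta> t) * of_int n))) \<le> B"
  shows "(\<Sum>r\<in>R. norm (\<Sum>n\<in>I. a n * ee (\<theta> r * of_int n)) ^ 2) \<le> B * (\<Sum>n\<in>I. norm (a n) ^ 2)"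
proof -
  define s where "s = (\<lambda>r. \<Sum>n\<in>I. a n * ee (\<theta> r * of_int n))"
  define Z where "Z = (\<Sum>r\<in>R. norm (s r) ^ 2)"
  define K where "K = (\<lambda>r t. norm (\<Sum>n\<in>I. ee ((\<theta> r - \<theta> t) * of_int n)))"
  define T where "T = (\<lambda>n :: int. \<Sum>r\<in>R. cnj (s r) * ee (\<theta> r * of_int n))"
  have Z0: "Z \<ge> 0" by (simp add: Z_def sum_nonneg)
  have K_sym: "K r t = K t r" for r t
  proof -
    have "cnj (\<Sum>n\<in>I. ee ((\<theta> r - \<theta> t) * of_int n)) = (\<Sum>n\<in>I. ee ((\<theta> t - \<theta> r) * of_int n))"
      by (simp add: cnj_ee algebra_simps)
    then show ?thesis unfolding K_def by (metis complex_mod_cnj)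
  qed
  have Zeq: "of_real Z = (\<Sum>n\<in>I. a n * T n)"
  proof -
    have "of_real Z = (\<Sum>r\<in>R. cnj (s r) * s r)"
      unfolding Z_def of_real_sum complex_norm_square by (simp add: mult.commute)
    also have "\<dots> = (\<Sum>r\<in>R. \<Sum>n\<in>I. a n * (cnj (s r) * ee (\<theta> r * of_int n)))"
    proof (rule sum.cong[OF refl])
      fix r
      show "cnj (s r) * s r = (\<Sum>n\<in>I. a n * (cnj (s r) * ee (\<theta> r * of_int n)))"
        by (subst (2) s_def) (simp add: sum_distrib_left mult_ac)
    qed
    also have "\<dots> = (\<Sum>n\<in>I. a n * T n)"
      unfolding T_def sum_distrib_left by (rule sum.swap)
    finally show ?thesis .
  qed
  have T2: "(\<Sum>n\<in>I. norm (T n) ^ 2) \<le> B * Z"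
  proof -
    have "of_real (\<Sum>n\<in>I. norm (T n) ^ 2) = (\<Sum>n\<in>I. T n * cnj (T n))"
      unfolding of_real_sum complex_norm_square ..
    also have "\<dots> = (\<Sum>n\<in>I. \<Sum>r\<in>R. \<Sum>t\<in>R. (cnj (s r) * s t) * ee ((\<theta> r - \<theta> t) * of_int n))"
    proof (rule sum.cong[OF refl])
      fix n
      show "T n * cnj (T n) = (\<Sum>r\<in>R. \<Sum>t\<in>R. (cnj (s r) * s t) * ee ((\<theta> r - \<theta> t) * of_int n))"
        unfolding T_def cnj_sum sum_product
      proof (intro sum.cong refl)
        fix r t
        have "ee ((\<theta> r - \<theta> t) * of_int n) = ee (\<theta> r * of_int n) * ee (- (\<theta> t * of_int n))"
          by (simp add: ee_add[symmetric] algebra_simps)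
        then show "cnj (s r) * ee (\<theta> r * of_int n) * cnj (cnj (s t) * ee (\<theta> t * of_int n))
            = (cnj (s r) * s t) * ee ((\<theta> r - \<theta> t) * of_int n)" by (simp add: cnj_ee)
      qed
    qed
    also have "\<dots> = (\<Sum>r\<in>R. \<Sum>n\<in>I. \<Sum>t\<in>R. (cnj (s r) * s t) * ee ((\<theta> r - \<theta> t) * of_int n))"
      by (rule sum.swap)
    also have "\<dots> = (\<Sum>r\<in>R. \<Sum>t\<in>R. (cnj (s r) * s t) * (\<Sum>n\<in>I. ee ((\<theta> r - \<theta> t) * of_int n)))"
      unfolding sum_distrib_left by (rule sum.cong[OF refl sum.swap])
    finally have eq: "complex_of_real (\<Sum>n\<in>I. norm (T n) ^ 2) =
        (\<Sum>r\<in>R. \<Sum>t\<in>R. (cnj (s r) * s t) * (\<Sum>n\<in>I. ee ((\<theta> r - \<theta> t) * of_int n)))" .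
    have "(\<Sum>n\<in>I. norm (T n) ^ 2) = norm (complex_of_real (\<Sum>n\<in>I. norm (T n) ^ 2))"
      by (simp only: norm_of_real) (simp add: sum_nonneg)
    also have "\<dots> \<le> (\<Sum>r\<in>R. \<Sum>t\<in>R. (norm (s r) ^ 2 / 2 + norm (s t) ^ 2 / 2) * K r t)"
      unfolding eq
    proof (intro sum_norm_le)
      fix r t
      have "norm (cnj (s r) * s t * (\<Sum>n\<in>I. ee ((\<theta> r - \<theta> t) * of_int n))) = norm (s r) * norm (s t) * K r t"
        by (simp add: norm_mult K_def)
      also have "\<dots> \<le> (norm (s r) ^ 2 / 2 + norm (s t) ^ 2 / 2) * K r t"
      proof (rule mult_right_mono)
        have "0 \<le> (norm (s r) - norm (s t)) ^ 2" by simp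
        then show "norm (s r) * norm (s t) \<le> norm (s r) ^ 2 / 2 + norm (s t) ^ 2 / 2"
          by (simp add: power2_eq_square algebra_simps)
      qed (simp add: K_def)
      finally show "norm (cnj (s r) * s t * (\<Sum>n\<in>I. ee ((\<theta> r - \<theta> t) * of_int n)))
          \<le> (norm (s r) ^ 2 / 2 + norm (s t) ^ 2 / 2) * K r t" .
    qed
    also have "\<dots> = (\<Sum>r\<in>R. \<Sum>t\<in>R. norm (s r) ^ 2 / 2 * K r t) + (\<Sum>r\<in>R. \<Sum>t\<in>R. norm (s t) ^ 2 / 2 * K r t)"
      by (simp add: distrib_right sum.distrib)
    also have "(\<Sum>r\<in>R. \<Sum>t\<in>R. norm (s t) ^ 2 / 2 * K r t) = (\<Sum>t\<in>R. \<Sum>r\<in>R. norm (s t) ^ 2 / 2 * K r t)"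
      by (rule sum.swap)
    also have "\<dots> = (\<Sum>r\<in>R. \<Sum>t\<in>R. norm (s r) ^ 2 / 2 * K r t)"
      using K_sym by simp
    also have "(\<Sum>r\<in>R. \<Sum>t\<in>R. norm (s r) ^ 2 / 2 * K r t) + \<dots> = (\<Sum>r\<in>R. norm (s r) ^ 2 * (\<Sum>t\<in>R. K r t))"
      unfolding sum.distrib[symmetric] sum_distrib_left by (intro sum.cong refl) simp
    also have "\<dots> \<le> (\<Sum>r\<in>R. norm (s r) ^ 2 * B)"
      using B by (intro sum_mono mult_left_mono) (auto simp: K_def)
    also have "\<dots> = B * Z" by (simp add: Z_def sum_distrib_left mult.commute)
    finally show ?thesis .
  qed
  have "Z = norm (complex_of_real Z)" using Z0 by simp
  also have "\<dots> \<le> (\<Sum>n\<in>I. norm (a n) * norm (T n))"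
    unfolding Zeq by (rule order.trans[OF norm_sum]) (simp add: norm_mult)
  finally have "Z ^ 2 \<le> (\<Sum>n\<in>I. norm (a n) * norm (T n)) ^ 2" using Z0 by (intro power_mono)
  also have "\<dots> \<le> (\<Sum>n\<in>I. norm (a n) ^ 2) * (\<Sum>n\<in>I. norm (T n) ^ 2)"
    by (rule Cauchy_Schwarz_ineq_sum)
  also have "\<dots> \<le> (\<Sum>n\<in>I. norm (a n) ^ 2) * (B * Z)"
    by (intro mult_left_mono T2 sum_nonneg) auto
  finally have Z2: "Z * Z \<le> (B * (\<Sum>n\<in>I. norm (a n) ^ 2)) * Z" by (simp add: power2_eq_square mult_ac)
  have "Z \<le> B * (\<Sum>n\<in>I. norm (a n) ^ 2)"
  proof (cases "Z = 0")
    case True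
    then show ?thesis using B0 by (simp add: sum_nonneg)
  next
    case False
    then have "Z > 0" using Z0 by simp
    then show ?thesis using Z2 by simp
  qed
  then show ?thesis by (simp add: Z_def s_def)
qed

section \<open>Geometric sums and spaced points\<close>

lemma norm_ee_minus_1_ge:
  assumes "0 < \<bar>\<beta>\<bar>" "2 * pi * \<bar>\<beta>\<bar> \<le> 1"
  shows "norm (ee \<beta> - 1) \<ge> 2 * \<bar>\<beta>\<bar>"
proof -
  define t where "t = 2 * pi * \<bar>\<beta>\<bar>"
  have t: "0 < t" "t \<le> 1" using assms by (auto simp: t_def)
  obtain z where z: "0 < z" "z < t" "sin t - sin 0 = (t - 0) * cos z"
    using MVT2[of 0 t sin cos] t by (auto intro: DERIV_sin)
  have "cos z \<ge> cos (pi / 3)" using z t pi_gt3 by (intro cos_monotone_0_pi_le) auto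
  then have "cos z \<ge> 1 / 2" by (simp add: cos_60)
  then have "t * (1 / 2) \<le> t * cos z" using t by (intro mult_left_mono) auto
  then have "t / 2 \<le> sin t" using z by simp
  moreover have "t \<ge> 4 * \<bar>\<beta>\<bar>" unfolding t_def using pi_gt3 by (intro mult_right_mono) auto
  moreover have "\<bar>sin (2 * pi * \<beta>)\<bar> = \<bar>sin t\<bar>"
    by (cases "\<beta> \<ge> 0") (simp_all add: t_def)
  moreover have "\<bar>sin (2 * pi * \<beta>)\<bar> \<le> norm (ee \<beta> - 1)"
  proof -
    have "Im (ee \<beta> - 1) = sin (2 * pi * \<beta>)" by (simp add: ee_def Im_exp)
    then show ?thesis using abs_Im_le_cmod[of "ee \<beta> - 1"] by simp
  qed
  ultimately show ?thesis by linarith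
qed

lemma norm_sum_ee_le:
  assumes \<beta>: "0 < \<bar>\<beta>\<bar>" "2 * pi * \<bar>\<beta>\<bar> \<le> 1"
  shows "norm (\<Sum>n\<in>{lo..<lo + int N}. ee (\<beta> * of_int n)) \<le> 1 / \<bar>\<beta>\<bar>"
proof -
  define z where "z = ee \<beta>"
  have z1: "norm (z - 1) \<ge> 2 * \<bar>\<beta>\<bar>" unfolding z_def by (rule norm_ee_minus_1_ge[OF \<beta>])
  then have "z \<noteq> 1" using \<beta> by auto
  have "(\<Sum>n\<in>{lo..<lo + int N}. ee (\<beta> * of_int n)) = (\<Sum>k<N. ee (\<beta> * of_int (lo + int k)))"
    by (rule sum.reindex_bij_witness[where i = "\<lambda>k. lo + int k" and j = "\<lambda>n. nat (n - lo)"]) auto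
  also have "\<dots> = ee (\<beta> * of_int lo) * (\<Sum>k<N. z ^ k)"
    by (simp add: z_def ee_mult_nat[symmetric] ee_add[symmetric] sum_distrib_left algebra_simps)
  also have "\<dots> = ee (\<beta> * of_int lo) * ((z ^ N - 1) / (z - 1))" using \<open>z \<noteq> 1\<close> by (simp add: geometric_sum)
  also have "norm \<dots> = norm (z ^ N - 1) / norm (z - 1)" by (simp add: norm_mult norm_divide)
  also have "\<dots> \<le> 2 / (2 * \<bar>\<beta>\<bar>)"
  proof (rule frac_le)
    have "norm (z ^ N - 1) \<le> norm (z ^ N) + norm (1 :: complex)" by (rule norm_triangle_ineq4)
    then show "norm (z ^ N - 1) \<le> 2" by (simp add: norm_power z_def)
  qed (use \<beta> z1 in auto)
  finally show ?thesis by simp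
qed

lemma norm_sum_ee_ge:
  assumes "\<bar>\<beta>\<bar> * real Y \<le> 5 / 24"
  shows "norm (\<Sum>j\<in>{1..Y}. ee (\<beta> * of_nat j)) \<ge> real Y / 2"
proof -
  \<comment> \<open>Rotation by the midpoint of the progression halves the largest phase: it is at
    most \<open>2 pi * 5 / 48 < pi / 3\<close>, so every term has real part at least 1 / 2.\<close>
  define c where "c = \<beta> * (real Y + 1) / 2"
  have "real Y / 2 = (\<Sum>j\<in>{1..Y}. 1 / 2)" by simp
  also have "\<dots> \<le> (\<Sum>j\<in>{1..Y}. Re (ee (- c) * ee (\<beta> * of_nat j)))"
  proof (rule sum_mono)
    fix j assume j: "j \<in> {1..Y}"
    have "ee (- c) * ee (\<beta> * of_nat j) = ee (\<beta> * real j - c)" by (simp only: ee_add[symmetric]) simp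
    then have "Re (ee (- c) * ee (\<beta> * of_nat j)) = cos (2 * pi * (\<beta> * real j - c))"
      by (simp only:) (simp add: ee_def Re_exp)
    also have "\<dots> = cos \<bar>2 * pi * (\<beta> * real j - c)\<bar>" by (simp add: abs_if)
    also have "\<dots> \<ge> cos (pi / 3)"
    proof (rule cos_monotone_0_pi_le)
      have "\<beta> * real j - c = \<beta> * (real j - (real Y + 1) / 2)" by (simp add: c_def algebra_simps)
      then have "\<bar>\<beta> * real j - c\<bar> = \<bar>\<beta>\<bar> * \<bar>real j - (real Y + 1) / 2\<bar>" by (simp add: abs_mult)
      also have "\<dots> \<le> \<bar>\<beta>\<bar> * (real Y / 2)" using j by (intro mult_left_mono) (auto simp: abs_if field_simps)
      also have "\<dots> \<le> 1 / 6" using assms by simp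
      finally have "\<bar>\<beta> * real j - c\<bar> \<le> 1 / 6" .
      then have "2 * pi * \<bar>\<beta> * real j - c\<bar> \<le> 2 * pi * (1 / 6)" by (intro mult_left_mono) auto
      then show "\<bar>2 * pi * (\<beta> * real j - c)\<bar> \<le> pi / 3" by (simp add: abs_mult)
    qed auto
    finally show "1 / 2 \<le> Re (ee (- c) * ee (\<beta> * of_nat j))" by (simp add: cos_60)
  qed
  also have "\<dots> = Re (ee (- c) * (\<Sum>j\<in>{1..Y}. ee (\<beta> * of_nat j)))" by (simp only: sum_distrib_left Re_sum)
  also have "\<dots> \<le> norm (ee (- c) * (\<Sum>j\<in>{1..Y}. ee (\<beta> * of_nat j)))" by (rule complex_Re_le_cmod)
  finally show ?thesis by (simp add: norm_mult)
qed

lemma sum_inverse_le: "N \<ge> 1 \<Longrightarrow> (\<Sum>j\<in>{1..N}. 1 / real j) \<le> 1 + ln (real N)"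
proof (induction N rule: dec_induct)
  case (step N)
  have "ln (real N / real (Suc N)) \<le> real N / real (Suc N) - 1"
    using step by (intro ln_le_minus_one) auto
  then have "ln (real N) - ln (real (Suc N)) \<le> - (1 / real (Suc N))"
    using step by (simp add: ln_div field_simps)
  then show ?case using step by simp
qed simp

text \<open>Cut into intervals of length \<open>d\<close> to the right of \<open>c\<close>, each
  contains at most one point, and the point with index \<open>j\<close> is at distance at least
  \<open>j * d\<close>. What remains is a harmonic sum up to \<open>1 / d\<close>.\<close>

lemma sum_inverse_spaced_le:
  fixes \<theta> :: "'r \<Rightarrow> real"
  assumes fin: "finite R" and d: "0 < d" "d \<le> 1"
    and sep: "\<And>r t. r \<in> R \<Longrightarrow> t \<in> R \<Longrightarrow> r \<noteq> t \<Longrightarrow> d \<le> \<bar>\<theta> r - \<theta> t\<bar>"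
    and gt: "\<And>r. r \<in> R \<Longrightarrow> \<theta> r \<ge> c + d" "\<And>r. r \<in> R \<Longrightarrow> \<theta> r \<le> c + 1"
  shows "(\<Sum>r\<in>R. 1 / (\<theta> r - c)) \<le> (1 + ln (1 / d)) / d"
proof -
  define f where "f = (\<lambda>r. nat \<lfloor>(\<theta> r - c) / d\<rfloor>)"
  have f_le: "real (f r) \<le> (\<theta> r - c) / d" "(\<theta> r - c) / d < real (f r) + 1" "f r \<ge> 1" if "r \<in> R" for r
  proof -
    have "(\<theta> r - c) / d \<ge> 1" using gt(1)[OF that] d by (simp add: field_simps)
    then show "real (f r) \<le> (\<theta> r - c) / d" "(\<theta> r - c) / d < real (f r) + 1" "f r \<ge> 1"
      unfolding f_def by linarith+
  qed
  have inj: "inj_on f R"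
  proof (rule inj_onI, rule ccontr)
    fix r t assume rt: "r \<in> R" "t \<in> R" "f r = f t" "r \<noteq> t"
    have "\<bar>(\<theta> r - c) / d - (\<theta> t - c) / d\<bar> < 1" using f_le[OF rt(1)] f_le[OF rt(2)] rt(3) by linarith
    moreover have "(\<theta> r - c) / d - (\<theta> t - c) / d = (\<theta> r - \<theta> t) / d" by (simp add: diff_divide_distrib)
    ultimately have "\<bar>\<theta> r - \<theta> t\<bar> < d" using d by (simp add: abs_divide)
    then show False using sep rt by force
  qed
  define N where "N = nat \<lfloor>1 / d\<rfloor>"
  have N1: "N \<ge> 1" using d by (simp add: N_def le_nat_floor)
  have Nd: "real N \<le> 1 / d" using d by (simp add: N_def)
  have sub: "f ` R \<subseteq> {1..N}"
  proof safe
    fix r assume r: "r \<in> R"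
    have "(\<theta> r - c) / d \<le> 1 / d" using gt(2)[OF r] d by (intro divide_right_mono) auto
    then have "real (f r) \<le> 1 / d" using f_le[OF r] by linarith
    then show "f r \<in> {1..N}" using f_le(3)[OF r] by (simp add: N_def le_nat_floor)
  qed
  have "(\<Sum>r\<in>R. 1 / (\<theta> r - c)) \<le> (\<Sum>r\<in>R. (1 / d) * (1 / real (f r)))"
  proof (rule sum_mono)
    fix r assume r: "r \<in> R"
    have "d * real (f r) \<le> \<theta> r - c" using f_le(1)[OF r] d by (simp add: field_simps)
    moreover have "d * real (f r) > 0" using d f_le(3)[OF r] by simp
    ultimately have "1 / (\<theta> r - c) \<le> 1 / (d * real (f r))" by (intro divide_left_mono) auto
    then show "1 / (\<theta> r - c) \<le> (1 / d) * (1 / real (f r))" by simp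
  qed
  also have "\<dots> = (1 / d) * (\<Sum>j\<in>f ` R. 1 / real j)"
    by (simp add: sum.reindex[OF inj] sum_distrib_left)
  also have "(\<Sum>j\<in>f ` R. 1 / real j) \<le> (\<Sum>j\<in>{1..N}. 1 / real j)"
    by (rule sum_mono2) (use sub in auto)
  also have "\<dots> \<le> 1 + ln (real N)" by (rule sum_inverse_le[OF N1])
  also have "ln (real N) \<le> ln (1 / d)" using Nd N1 d by (subst ln_le_cancel_iff) auto
  finally show ?thesis using d by (simp add: field_simps)
qed

text \<open>The logarithm lost here is harmless, since in the application \<open>1 / d\<close> is
  \<open>x powr (2 / 3)\<close>. The hypothesis \<open>close\<close> keeps all differences small, so
  that distances modulo 1 are plain distances.\<close>

lemma large_sieve_spaced:
  fixes a :: "int \<Rightarrow> complex" and \<theta> :: "'r \<Rightarrow> real"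
  assumes fin: "finite R" and d: "0 < d" "d \<le> 1"
    and sep: "\<And>r t. r \<in> R \<Longrightarrow> t \<in> R \<Longrightarrow> r \<noteq> t \<Longrightarrow> d \<le> \<bar>\<theta> r - \<theta> t\<bar>"
    and close: "\<And>r t. r \<in> R \<Longrightarrow> t \<in> R \<Longrightarrow> 2 * pi * \<bar>\<theta> r - \<theta> t\<bar> \<le> 1"
  shows "(\<Sum>r\<in>R. norm (\<Sum>n\<in>{lo..<lo + int N}. a n * ee (\<theta> r * of_int n)) ^ 2)
    \<le> (real N + 2 * ((1 + ln (1 / d)) / d)) * (\<Sum>n\<in>{lo..<lo + int N}. norm (a n) ^ 2)"
proof (rule dual_large_sieve)
  have L0: "0 \<le> (1 + ln (1 / d)) / d" using d by (intro divide_nonneg_pos add_nonneg_nonneg) auto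
  show "0 \<le> real N + 2 * ((1 + ln (1 / d)) / d)"
    by (intro add_nonneg_nonneg mult_nonneg_nonneg L0) simp_all
  fix r assume r: "r \<in> R"
  let ?k = "\<lambda>t. norm (\<Sum>n\<in>{lo..<lo + int N}. ee ((\<theta> r - \<theta> t) * of_int n))"
  let ?P = "{t \<in> R. \<theta> t > \<theta> r}" and ?M = "{t \<in> R. \<theta> t < \<theta> r}"
  have close1: "\<bar>\<theta> r - \<theta> t\<bar> \<le> 1" if "t \<in> R" for t
  proof -
    have "1 * \<bar>\<theta> r - \<theta> t\<bar> \<le> (2 * pi) * \<bar>\<theta> r - \<theta> t\<bar>" using pi_gt3 by (intro mult_right_mono) auto
    then show ?thesis using close[OF r that] by simp
  qed
  have R: "R = {r} \<union> (?P \<union> ?M)"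
  proof -
    have "\<theta> t \<noteq> \<theta> r" if "t \<in> R" "t \<noteq> r" for t using sep[OF r that(1)] that(2) d by auto
    then show ?thesis using r by fastforce
  qed
  have "(\<Sum>t\<in>R. ?k t) = (\<Sum>t\<in>{r}. ?k t) + (\<Sum>t\<in>?P \<union> ?M. ?k t)"
    by (subst R, rule sum.union_disjoint) (use fin in auto)
  also have "(\<Sum>t\<in>?P \<union> ?M. ?k t) = (\<Sum>t\<in>?P. ?k t) + (\<Sum>t\<in>?M. ?k t)"
    by (rule sum.union_disjoint) (use fin in auto)
  also have "(\<Sum>t\<in>{r}. ?k t) = real N"
  proof -
    have "(\<Sum>n\<in>{lo..<lo + int N}. ee ((\<theta> r - \<theta> r) * of_int n)) = of_nat N" by simp
    then show ?thesis by simp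
  qed
  also have "(\<Sum>t\<in>?P. ?k t) \<le> (\<Sum>t\<in>?P. 1 / (\<theta> t - \<theta> r))"
  proof (rule sum_mono)
    fix t assume t: "t \<in> ?P"
    then show "?k t \<le> 1 / (\<theta> t - \<theta> r)"
      using norm_sum_ee_le[of "\<theta> r - \<theta> t" lo N] close[OF r, of t] by simp
  qed
  also have "(\<Sum>t\<in>?P. 1 / (\<theta> t - \<theta> r)) \<le> (1 + ln (1 / d)) / d"
  proof (rule sum_inverse_spaced_le[OF _ d])
    show "\<theta> r + d \<le> \<theta> t" if "t \<in> ?P" for t
    proof -
      have "r \<noteq> t" using that by auto
      then show ?thesis using sep[OF r, of t] that by auto
    qed
    show "\<theta> t \<le> \<theta> r + 1" if "t \<in> ?P" for t using close1[of t] that by auto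
  qed (use fin sep in auto)
  also have "(\<Sum>t\<in>?M. ?k t) \<le> (\<Sum>t\<in>?M. 1 / (- \<theta> t - (- \<theta> r)))"
  proof (rule sum_mono)
    fix t assume t: "t \<in> ?M"
    then show "?k t \<le> 1 / (- \<theta> t - (- \<theta> r))"
      using norm_sum_ee_le[of "\<theta> r - \<theta> t" lo N] close[OF r, of t] by simp
  qed
  also have "(\<Sum>t\<in>?M. 1 / (- \<theta> t - (- \<theta> r))) \<le> (1 + ln (1 / d)) / d"
  proof (rule sum_inverse_spaced_le[OF _ d])
    show "- \<theta> r + d \<le> - \<theta> t" if "t \<in> ?M" for t
    proof -
      have "r \<noteq> t" using that by auto
      then show ?thesis using sep[OF r, of t] that by auto
    qed
    show "- \<theta> t \<le> - \<theta> r + 1" if "t \<in> ?M" for t using close1[of t] that by auto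
    show "d \<le> \<bar>- \<theta> s - - \<theta> t\<bar>" if "s \<in> ?M" "t \<in> ?M" "s \<noteq> t" for s t
      using sep[of t s] that by auto
  qed (use fin in auto)
  finally show "(\<Sum>t\<in>R. ?k t) \<le> real N + 2 * ((1 + ln (1 / d)) / d)" by simp
qed (use fin in auto)

text \<open>The window starting at \<open>n\<close> is weighted by \<open>1 - n / x\<close>.  Interchanging the sums produces the
  weighted sum over primes times a geometric sum of length \<open>y\<close>, with an error of at most \<open>y\<^sup>2 ln x\<close>
  from replacing \<open>1 - n / x\<close> by \<open>1 - m / x\<close>.\<close>

lemma window_lower_bound:
  fixes \<alpha> x y d :: real and \<theta> Lb :: "'r \<Rightarrow> real"
  assumes xy: "1 \<le> y" "y \<le> x" and fin: "finite R" and d: "0 < d" "d \<le> 1"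
    and sep: "\<And>r t. r \<in> R \<Longrightarrow> t \<in> R \<Longrightarrow> r \<noteq> t \<Longrightarrow> d \<le> \<bar>\<theta> r - \<theta> t\<bar>"
    and close: "\<And>r t. r \<in> R \<Longrightarrow> t \<in> R \<Longrightarrow> 2 * pi * \<bar>\<theta> r - \<theta> t\<bar> \<le> 1"
    and near: "\<And>r. r \<in> R \<Longrightarrow> \<bar>\<theta> r - \<alpha>\<bar> * y \<le> 5 / 24"
    and lb: "\<And>r. r \<in> R \<Longrightarrow> Lb r \<le>
      norm (\<Sum>n | 1 \<le> n \<and> real n \<le> x. of_real (mangoldt n * (1 - real n / x)) * ee (\<theta> r * of_nat n))"
    and big: "\<And>r. r \<in> R \<Longrightarrow> y * ln x \<le> Lb r / 4"
  shows "(\<Sum>r\<in>R. (y * Lb r / 8) ^ 2) \<le> (x + y + 1 + 2 * ((1 + ln (1 / d)) / d)) * 4 *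
    (\<Sum>n | - y < of_int n \<and> of_int n \<le> x.
       (cmod (\<Sum>m | n < m \<and> of_int m \<le> of_int n + y \<and> 1 \<le> m \<and> of_int m \<le> x.
          mangoldt (nat m) * ee (\<alpha> * of_int m)))\<^sup>2)"
proof -
  define I where "I = {n :: int. - y < of_int n \<and> of_int n \<le> x}"
  define M where "M = {m :: int. 1 \<le> m \<and> of_int m \<le> x}"
  define Y where "Y = nat \<lfloor>y\<rfloor>"
  define A where "A = (\<lambda>n :: int. \<Sum>m | m \<in> M \<and> (n < m \<and> of_int m \<le> of_int n + y). mangoldt (nat m) * ee (\<alpha> * of_int m))"
  define lo where "lo = \<lfloor>- y\<rfloor> + 1"
  define N where "N = nat (\<lfloor>x\<rfloor> - \<lfloor>- y\<rfloor>)"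
  have le: "\<lfloor>- y\<rfloor> \<le> \<lfloor>x\<rfloor>" using xy by (intro floor_mono) simp
  have I_eq: "I = {lo..<lo + int N}"
    unfolding I_def lo_def N_def using le by (auto simp: floor_less_iff le_floor_iff) linarith+
  have NN: "real N \<le> x + y + 1" unfolding N_def using le by linarith
  have finI: "finite I" by (simp add: I_eq)
  have M_eq: "M = {1..\<lfloor>x\<rfloor>}" by (auto simp: M_def le_floor_iff)
  have finM: "finite M" by (simp add: M_eq)
  have cardM: "real (card M) \<le> x" using xy by (simp add: M_eq)
  have Y: "real Y \<le> y" "y / 2 \<le> real Y" "y < real Y + 1" "Y \<ge> 1"
  proof -
    have "\<lfloor>y\<rfloor> \<ge> 1" using xy by simp
    then show "real Y \<le> y" "y / 2 \<le> real Y" "y < real Y + 1" "Y \<ge> 1" unfolding Y_def by linarith+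
  qed
  have y0: "y \<ge> 0" using xy by simp
  have x0: "x > 0" "ln x \<ge> 0" using xy by auto
  have L_nonneg: "Lb r \<ge> 0" if "r \<in> R" for r
    using big[OF that] mult_nonneg_nonneg[OF y0 x0(2)] by linarith
  have A_eq: "A n = (\<Sum>m | n < m \<and> of_int m \<le> of_int n + y \<and> 1 \<le> m \<and> of_int m \<le> x. mangoldt (nat m) * ee (\<alpha> * of_int m))" for n
    unfolding A_def M_def by (intro sum.cong) auto
  define a where "a = (\<lambda>n :: int. of_real (1 - of_int n / x) * A n)"
  \<comment> \<open>Windows may start at negative \<open>n\<close>, but only above
    \<open>- y >= - x\<close>, so the weight \<open>1 - n / x\<close> has modulus at most 2.\<close>
  have a_le: "norm (a n) ^ 2 \<le> 4 * norm (A n) ^ 2" if n: "n \<in> I" for n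
  proof -
    have "- x < of_int n" "of_int n \<le> x" using n xy by (auto simp: I_def)
    then have "- 1 \<le> of_int n / x" "of_int n / x \<le> 1" using x0 by (auto simp: field_simps)
    then have "\<bar>1 - of_int n / x\<bar> \<le> 2" by linarith
    then have "norm (a n) \<le> 2 * norm (A n)" unfolding a_def norm_mult norm_of_real by (intro mult_right_mono) auto
    then have "norm (a n) ^ 2 \<le> (2 * norm (A n)) ^ 2" by (intro power_mono) auto
    then show ?thesis by (simp add: power_mult_distrib)
  qed
  have lower: "y * Lb r / 8 \<le> norm (\<Sum>n\<in>I. a n * ee ((\<theta> r - \<alpha>) * of_int n))" if r: "r \<in> R" for r
  proof -
    define \<beta> where "\<beta> = \<theta> r - \<alpha>"
    define K where "K = (\<Sum>j\<in>{1..Y}. ee (- \<beta> * of_nat j))"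
    define S where "S = (\<Sum>m\<in>M. of_real (mangoldt (nat m) * (1 - of_int m / x)) * ee (\<theta> r * of_int m))"
    define Er where "Er = (\<Sum>m\<in>M. \<Sum>j\<in>{1..Y}. mangoldt (nat m) * ee (\<theta> r * of_int m) * (ee (- \<beta> * of_nat j) * of_real (real j / x)))"
    let ?g = "\<lambda>n m. mangoldt (nat m) * ee (\<alpha> * of_int m) * (of_real (1 - of_int n / x) * ee (\<beta> * of_int n)) :: complex"
    have "(\<Sum>n\<in>I. a n * ee (\<beta> * of_int n)) = (\<Sum>n\<in>I. \<Sum>m | m \<in> M \<and> (n < m \<and> of_int m \<le> of_int n + y). ?g n m)"
      unfolding a_def A_def by (intro sum.cong refl) (simp add: sum_distrib_left sum_distrib_right mult_ac)
    also have "\<dots> = (\<Sum>m\<in>M. \<Sum>n | n \<in> I \<and> (n < m \<and> of_int m \<le> of_int n + y). ?g n m)"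
      by (rule sum.swap_restrict[OF finI finM])
    \<comment> \<open>Each \<open>m\<close> in \<open>M\<close> lies in exactly \<open>Y\<close>
      windows, those starting at \<open>m - j\<close>. The negative starting points are there so
      that this also holds for small \<open>m\<close>.\<close>
    also have "\<dots> = (\<Sum>m\<in>M. \<Sum>j\<in>{1..Y}. ?g (m - int j) m)"
    proof (rule sum.cong[OF refl])
      fix m assume m: "m \<in> M"
      show "(\<Sum>n | n \<in> I \<and> (n < m \<and> of_int m \<le> of_int n + y). ?g n m) = (\<Sum>j\<in>{1..Y}. ?g (m - int j) m)"
      proof (rule sum.reindex_bij_witness[where i = "\<lambda>j. m - int j" and j = "\<lambda>n. nat (m - n)"])
        fix n assume n: "n \<in> {n. n \<in> I \<and> (n < m \<and> of_int m \<le> of_int n + y)}"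
        then have "real (nat (m - n)) \<le> y" by simp
        then have "nat (m - n) \<le> Y" unfolding Y_def by (rule le_nat_floor)
        then show "nat (m - n) \<in> {1..Y}" using n by auto
      next
        fix j assume j: "j \<in> {1..Y}"
        then have jy: "real j \<le> y" using Y(1) by simp
        moreover have "- y < of_int (m - int j)" using jy m by (simp add: M_def)
        moreover have "of_int (m - int j) \<le> x" using m by (simp add: M_def)
        ultimately show "m - int j \<in> {n. n \<in> I \<and> (n < m \<and> of_int m \<le> of_int n + y)}"
          using j by (simp add: I_def)
      qed auto
    qed
    also have "\<dots> = (\<Sum>m\<in>M. \<Sum>j\<in>{1..Y}. (of_real (mangoldt (nat m) * (1 - of_int m / x)) * ee (\<theta> r * of_int m)) * ee (- \<beta> * of_nat j)
        + mangoldt (nat m) * ee (\<theta> r * of_int m) * (ee (- \<beta> * of_nat j) * of_real (real j / x)))"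
    proof (intro sum.cong refl)
      fix m j
      have "ee (\<alpha> * of_int m) * ee (\<beta> * of_int (m - int j)) = ee (\<theta> r * of_int m) * ee (- \<beta> * of_nat j)"
        unfolding ee_add[symmetric] by (simp add: \<beta>_def algebra_simps)
      moreover have "1 - real_of_int (m - int j) / x = (1 - of_int m / x) + real j / x"
        by (simp add: diff_divide_distrib)
      ultimately show "?g (m - int j) m = (of_real (mangoldt (nat m) * (1 - of_int m / x)) * ee (\<theta> r * of_int m)) * ee (- \<beta> * of_nat j)
        + mangoldt (nat m) * ee (\<theta> r * of_int m) * (ee (- \<beta> * of_nat j) * of_real (real j / x))"
        by (simp only: of_real_add of_real_mult of_real_mangoldt) (simp add: algebra_simps)
    qed
    also have "\<dots> = S * K + Er"
      unfolding S_def K_def Er_def sum_product by (simp add: sum.distrib)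
    finally have eq: "(\<Sum>n\<in>I. a n * ee (\<beta> * of_int n)) = S * K + Er" .
    have "norm Er \<le> (\<Sum>m\<in>M. \<Sum>j\<in>{1..Y}. ln x * (y / x))"
      unfolding Er_def
    proof (intro sum_norm_le)
      fix m j assume m: "m \<in> M" and j: "j \<in> {1..Y}"
      have "mangoldt (nat m) \<le> ln (real (nat m))" using m by (intro mangoldt_le) (simp add: M_def)
      also have "\<dots> \<le> ln x" using m x0 by (subst ln_le_cancel_iff) (auto simp: M_def)
      finally have "mangoldt (nat m) \<le> ln x" .
      moreover have "real j / x \<le> y / x" using j Y x0 by (intro divide_right_mono) auto
      ultimately have "mangoldt (nat m) * (real j / x) \<le> ln x * (y / x)"
        using x0 by (intro mult_mono) auto
      then show "norm (mangoldt (nat m) * ee (\<theta> r * of_int m) * (ee (- \<beta> * of_nat j) * of_real (real j / x))) \<le> ln x * (y / x)"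
        using x0 by (simp add: norm_mult norm_divide)
    qed
    also have "\<dots> = real (card M) * (real Y * (ln x * (y / x)))" by simp
    also have "\<dots> \<le> x * (real Y * (ln x * (y / x)))"
      using cardM x0 xy by (intro mult_right_mono mult_nonneg_nonneg) auto
    also have "\<dots> = real Y * (y * ln x)" using x0 by simp
    also have "\<dots> \<le> real Y * (Lb r / 4)" using big[OF r] by (intro mult_left_mono) auto
    finally have Er: "norm Er \<le> real Y * (Lb r / 4)" .
    have L0: "Lb r \<ge> 0" by (rule L_nonneg[OF r])
    have K: "norm K \<ge> real Y / 2" unfolding K_def
    proof (rule norm_sum_ee_ge)
      have "\<bar>- \<beta>\<bar> * real Y \<le> \<bar>\<beta>\<bar> * y" using Y(1) by (simp add: mult_left_mono)
      also have "\<dots> \<le> 5 / 24" using near[OF r] by (simp add: \<beta>_def)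
      finally show "\<bar>- \<beta>\<bar> * real Y \<le> 5 / 24" .
    qed
    have S: "norm S \<ge> Lb r"
    proof -
      have "(\<Sum>n | 1 \<le> n \<and> real n \<le> x. of_real (mangoldt n * (1 - real n / x)) * ee (\<theta> r * of_nat n)) = S"
        unfolding S_def
        by (rule sum.reindex_bij_witness[where i = nat and j = int]) (auto simp: M_def)
      then show ?thesis using lb[OF r] by simp
    qed
    \<comment> \<open>The 8 comes from \<open>Y >= y / 2\<close>, \<open>norm K >= Y / 2\<close> and
      \<open>norm Er <= Y * Lb r / 4\<close>.\<close>
    have "y * Lb r / 8 \<le> real Y * Lb r / 4"
      using mult_right_mono[OF Y(2) L0] by simp
    also have "\<dots> = Lb r * (real Y / 2) - real Y * (Lb r / 4)" by simp
    also have "\<dots> \<le> norm S * norm K - norm Er"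
      using S K L0 Er by (intro diff_mono mult_mono) auto
    also have "\<dots> \<le> norm (S * K + Er)"
      using norm_diff_ineq[of "S * K" Er] by (simp add: norm_mult)
    finally show ?thesis unfolding eq[symmetric] \<beta>_def .
  qed
  have "(\<Sum>r\<in>R. (y * Lb r / 8) ^ 2) \<le> (\<Sum>r\<in>R. norm (\<Sum>n\<in>I. a n * ee ((\<theta> r - \<alpha>) * of_int n)) ^ 2)"
  proof (intro sum_mono power_mono lower)
    fix r assume r: "r \<in> R"
    show "0 \<le> y * Lb r / 8" using L_nonneg[OF r] y0 by simp
  qed auto
  also have "\<dots> \<le> (real N + 2 * ((1 + ln (1 / d)) / d)) * (\<Sum>n\<in>I. norm (a n) ^ 2)"
    unfolding I_eq using sep close by (intro large_sieve_spaced fin d) auto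
  also have "\<dots> \<le> (x + y + 1 + 2 * ((1 + ln (1 / d)) / d)) * (\<Sum>n\<in>I. 4 * norm (A n) ^ 2)"
  proof (rule mult_mono)
    have "0 \<le> (1 + ln (1 / d)) / d" using d by (intro divide_nonneg_pos add_nonneg_nonneg) auto
    then show "0 \<le> x + y + 1 + 2 * ((1 + ln (1 / d)) / d)"
      using xy by linarith
    show "real N + 2 * ((1 + ln (1 / d)) / d) \<le> x + y + 1 + 2 * ((1 + ln (1 / d)) / d)"
      using NN by linarith
    show "(\<Sum>n\<in>I. norm (a n) ^ 2) \<le> (\<Sum>n\<in>I. 4 * norm (A n) ^ 2)" by (intro sum_mono a_le)
  qed (auto intro: sum_nonneg)
  also have "\<dots> = (x + y + 1 + 2 * ((1 + ln (1 / d)) / d)) * 4 * (\<Sum>n\<in>I. norm (A n) ^ 2)"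
    by (simp add: sum_distrib_left[symmetric])
  finally show ?thesis unfolding A_eq unfolding I_def .
qed

section \<open>Divisors and counting lemmas\<close>

definition divisor_count :: "nat \<Rightarrow> nat" where "divisor_count n = card {d. d dvd n}"

lemma divisor_count_mult_le:
  assumes "a > 0" "b > 0" shows "divisor_count (a * b) \<le> divisor_count a * divisor_count b"
proof -
  have "{d. d dvd a * b} \<subseteq> (\<lambda>(x, y). x * y) ` ({x. x dvd a} \<times> {y. y dvd b})"
  proof
    fix d assume "d \<in> {d. d dvd a * b}"
    then obtain x y where "d = x * y" "x dvd a" "y dvd b" using division_decomp by blast
    then show "d \<in> (\<lambda>(x, y). x * y) ` ({x. x dvd a} \<times> {y. y dvd b})" by auto
  qed
  moreover have fin: "finite ({x. x dvd a} \<times> {y. y dvd b})" using assms by auto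
  ultimately have "card {d. d dvd a * b} \<le> card ({x. x dvd a} \<times> {y. y dvd b})"
    by (meson card_image_le card_mono finite_imageI order.trans)
  then show ?thesis by (simp add: divisor_count_def card_cartesian_product)
qed

lemma divisor_count_prime_power:
  assumes "prime p" shows "divisor_count (p ^ a) = a + 1"
proof -
  have "{d. d dvd p ^ a} = (\<lambda>i. p ^ i) ` {..a}"
    using divides_primepow_nat[OF assms] by auto
  moreover have "inj_on (\<lambda>i. p ^ i) {..a}"
    using prime_gt_1_nat[OF assms] by (auto simp: inj_on_def)
  ultimately show ?thesis by (simp add: divisor_count_def card_image)
qed

text \<open>A prime power \<open>p ^ a\<close> contributes \<open>a + 1\<close>. For
  \<open>p > P\<close> this is at most \<open>p powr (a * \<eta>)\<close>, because
  \<open>p powr \<eta> >= 2\<close>; each smaller prime costs an additional factor \<open>M\<close>,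
  and there are at most \<open>P\<close> of them. The induction removes one prime at a time.\<close>

lemma divisor_bound:
  assumes \<eta>: "\<eta> > 0"
  shows "\<exists>C\<ge>1. \<forall>n\<ge>1. real (divisor_count n) \<le> C * real n powr \<eta>"
proof -
  define M where "M = max 1 (1 / (\<eta> * ln 2))"
  define P where "P = nat \<lceil>2 powr (1 / \<eta>)\<rceil>"
  have M1: "M \<ge> 1" by (simp add: M_def)
  have small: "real a + 1 \<le> M * real p powr (real a * \<eta>)" if "p \<ge> 2" for a p :: nat
  proof -
    have "M * (\<eta> * ln 2) \<ge> 1 / (\<eta> * ln 2) * (\<eta> * ln 2)"
      using \<eta> by (intro mult_right_mono) (auto simp: M_def)
    then have "M * (\<eta> * ln 2) \<ge> 1" using \<eta> by simp
    then have "real a * 1 \<le> real a * (M * (\<eta> * ln 2))" by (intro mult_left_mono) auto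
    then have "real a + 1 \<le> M * (1 + real a * \<eta> * ln 2)" using M1 by (simp add: algebra_simps)
    also have "1 + real a * \<eta> * ln 2 \<le> exp (real a * \<eta> * ln 2)" by (rule exp_ge_add_one_self)
    also have "exp (real a * \<eta> * ln 2) = 2 powr (real a * \<eta>)" by (simp add: powr_def)
    also have "\<dots> \<le> real p powr (real a * \<eta>)" using that \<eta> by (intro powr_mono2) auto
    finally show ?thesis using M1 by simp
  qed
  have large: "real a + 1 \<le> real p powr (real a * \<eta>)" if "p > P" for a p :: nat
  proof -
    have "real P \<ge> 2 powr (1 / \<eta>)" unfolding P_def by linarith
    then have "real p \<ge> 2 powr (1 / \<eta>)" using that by linarith
    then have "(2 powr (1 / \<eta>)) powr (real a * \<eta>) \<le> real p powr (real a * \<eta>)"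
      using \<eta> by (intro powr_mono2) auto
    moreover have "(2 powr (1 / \<eta>)) powr (real a * \<eta>) = 2 powr real a" using \<eta> by (simp add: powr_powr)
    moreover have "2 powr real a = 2 ^ a" by (simp add: powr_realpow)
    moreover have "real (a + 1) \<le> 2 ^ a"
    proof -
      have "Suc a \<le> 2 ^ a" by (rule Suc_leI[OF less_exp])
      then have "a + 1 \<le> 2 ^ a" by (simp only: Suc_eq_plus1)
      then show ?thesis by (metis of_nat_le_iff of_nat_power of_nat_numeral)
    qed
    ultimately show ?thesis by simp
  qed
  have main: "n \<ge> 1 \<Longrightarrow> real (divisor_count n) \<le> M ^ card {p. prime p \<and> p \<le> P \<and> p dvd n} * real n powr \<eta>" for n
  proof (induction n rule: less_induct)
    case (less n)
    show ?case
    proof (cases "n = 1")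
      case True
      have "{d :: nat. d dvd 1} = {1}" by auto
      then have "divisor_count 1 = 1" by (simp add: divisor_count_def)
      then show ?thesis using True M1 one_le_power[of M] by simp
    next
      case False
      then obtain p where p: "prime p" "p dvd n" using prime_factor_nat by blast
      define a where "a = multiplicity p n"
      have n0: "n \<noteq> 0" using less.prems by simp
      then obtain m where m: "n = p ^ a * m" "\<not> p dvd m"
        unfolding a_def using multiplicity_decompose'[of n p] p(1) by (metis not_prime_unit)
      have p2: "p \<ge> 2" using p(1) prime_ge_2_nat by blast
      have m0: "m \<ge> 1" using m n0 by (cases m) auto
      have a0: "a > 0" using m p(2) by (cases a) auto
      have mn: "m < n"
      proof -
        have "p ^ 1 \<le> p ^ a" using a0 p2 by (intro power_increasing) auto
        then have "2 * m \<le> p ^ a * m" using p2 by (intro mult_right_mono) auto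
        then show ?thesis using m m0 by simp
      qed
      let ?S = "\<lambda>n. {p. prime p \<and> p \<le> P \<and> p dvd n}"
      have finS: "finite (?S k)" for k by (rule finite_subset[of _ "{..P}"]) auto
      have "real (divisor_count n) \<le> real (divisor_count (p ^ a)) * real (divisor_count m)"
        using divisor_count_mult_le[of "p ^ a" m] m m0 p2 by (simp only: of_nat_mult[symmetric] of_nat_le_iff) simp
      also have "real (divisor_count (p ^ a)) = real a + 1"
        using divisor_count_prime_power[OF p(1)] by simp
      also have "(real a + 1) * real (divisor_count m) \<le> (real a + 1) * (M ^ card (?S m) * real m powr \<eta>)"
        using less.IH[OF mn m0] by (intro mult_left_mono) auto
      also have "\<dots> \<le> (M ^ card (?S n) / M ^ card (?S m) * real p powr (real a * \<eta>)) * (M ^ card (?S m) * real m powr \<eta>)"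
      proof (rule mult_right_mono)
        have sub: "?S m \<subseteq> ?S n" using m by auto
        show "real a + 1 \<le> M ^ card (?S n) / M ^ card (?S m) * real p powr (real a * \<eta>)"
        proof (cases "p \<le> P")
          case True
          have "insert p (?S m) \<subseteq> ?S n" using m p True a0 by auto
          moreover have "p \<notin> ?S m" using m by simp
          ultimately have "card (?S m) + 1 \<le> card (?S n)"
            using card_mono[OF finS, of "insert p (?S m)" n] finS by simp
          then have "M ^ (card (?S m) + 1) \<le> M ^ card (?S n)" using M1 by (intro power_increasing) auto
          then have "M \<le> M ^ card (?S n) / M ^ card (?S m)" using M1 by (simp add: pos_le_divide_eq)
          then have "M * real p powr (real a * \<eta>) \<le> M ^ card (?S n) / M ^ card (?S m) * real p powr (real a * \<eta>)"
            by (intro mult_right_mono) auto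
          then show ?thesis using small[OF p2, of a] by linarith
        next
          case False
          have "M ^ card (?S m) \<le> M ^ card (?S n)" using M1 card_mono[OF finS sub] by (intro power_increasing) auto
          then have "1 \<le> M ^ card (?S n) / M ^ card (?S m)" using M1 by (simp add: pos_le_divide_eq)
          then have "1 * real p powr (real a * \<eta>) \<le> M ^ card (?S n) / M ^ card (?S m) * real p powr (real a * \<eta>)"
            by (intro mult_right_mono) auto
          then show ?thesis using large[of p a] False by linarith
        qed
      qed (use M1 in auto)
      also have "\<dots> = M ^ card (?S n) * (real p powr (real a * \<eta>) * real m powr \<eta>)"
        using M1 by simp
      also have "real p powr (real a * \<eta>) * real m powr \<eta> = real n powr \<eta>"
      proof -
        have "real n = real p ^ a * real m" using m(1) by simp
        then have "real n powr \<eta> = (real p ^ a) powr \<eta> * real m powr \<eta>" by (simp add: powr_mult)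
        also have "(real p ^ a) powr \<eta> = real p powr (real a * \<eta>)"
          using p2 by (simp add: powr_powr flip: powr_realpow)
        finally show ?thesis by simp
      qed
      finally show ?thesis .
    qed
  qed
  show ?thesis
  proof (intro exI[of _ "M ^ P"] conjI allI impI)
    show "M ^ P \<ge> 1" using M1 by (rule one_le_power)
    fix n :: nat assume n: "n \<ge> 1"
    have "card {p. prime p \<and> p \<le> P \<and> p dvd n} \<le> card {1..P}"
      by (rule card_mono) (auto simp: Suc_le_eq prime_gt_0_nat)
    then have "M ^ card {p. prime p \<and> p \<le> P \<and> p dvd n} \<le> M ^ P" using M1 by (intro power_increasing) auto
    then show "real (divisor_count n) \<le> M ^ P * real n powr \<eta>"
      using main[OF n] by (meson mult_right_mono order.trans powr_ge_zero)
  qed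
qed

lemma card_congruent_le:
  fixes S :: "nat set"
  assumes "S \<subseteq> {..<N}" "m > 0" "\<And>i i'. i \<in> S \<Longrightarrow> i' \<in> S \<Longrightarrow> i mod m = i' mod m"
  shows "card S \<le> N div m + 1"
proof -
  have "inj_on (\<lambda>i. i div m) S"
    using assms(3) by (intro inj_onI) (metis div_mult_mod_eq)
  moreover have "(\<lambda>i. i div m) ` S \<subseteq> {..N div m}"
    using assms(1) by (auto intro!: div_le_mono)
  ultimately have "card S \<le> card {..N div m}" by (meson card_inj_on_le finite_atMost)
  then show ?thesis by simp
qed

lemma card_fibres_le:
  assumes B: "finite B" and S: "\<And>i j. (i, j) \<in> S \<Longrightarrow> j \<in> B" and c: "\<And>j. j \<in> B \<Longrightarrow> card {i. (i, j) \<in> S} \<le> c"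
  shows "card S \<le> c * card B"
proof -
  have "S = (\<Union>j\<in>B. (\<lambda>i. (i, j)) ` {i. (i, j) \<in> S})" using S by auto
  then have "card S \<le> (\<Sum>j\<in>B. card ((\<lambda>i. (i, j)) ` {i. (i, j) \<in> S}))"
    using card_UN_le[OF B, of "\<lambda>j. (\<lambda>i. (i, j)) ` {i. (i, j) \<in> S}"] by simp
  also have "\<dots> \<le> (\<Sum>j\<in>B. c)"
  proof (rule sum_mono)
    fix j assume "j \<in> B"
    have "card ((\<lambda>i. (i, j)) ` {i. (i, j) \<in> S}) = card {i. (i, j) \<in> S}"
      by (intro card_image) (auto simp: inj_on_def)
    then show "card ((\<lambda>i. (i, j)) ` {i. (i, j) \<in> S}) \<le> c" using c[OF \<open>j \<in> B\<close>] by simp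
  qed
  finally show ?thesis by (simp add: mult.commute)
qed

text \<open>One representative is fixed in each fibre of \<open>f\<close>; every other element forms
  a collision with its representative.\<close>

lemma card_le_image_plus_collisions:
  assumes "finite A"
  shows "card A \<le> card (f ` A) + card {(x, y). x \<in> A \<and> y \<in> A \<and> x \<noteq> y \<and> f x = f y}"
proof -
  define r where "r = (\<lambda>v. SOME x. x \<in> A \<and> f x = v)"
  have r: "r (f x) \<in> A \<and> f (r (f x)) = f x" if "x \<in> A" for x
    unfolding r_def by (rule someI_ex) (use that in blast)
  let ?C = "{(x, y). x \<in> A \<and> y \<in> A \<and> x \<noteq> y \<and> f x = f y}"
  have finC: "finite ?C" by (rule finite_subset[of _ "A \<times> A"]) (use assms in auto)
  have "A \<subseteq> r ` f ` A \<union> fst ` ?C"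
  proof
    fix x assume x: "x \<in> A"
    show "x \<in> r ` f ` A \<union> fst ` ?C"
    proof (cases "r (f x) = x")
      case True
      have "r (f x) \<in> r ` f ` A" using x by blast
      then show ?thesis using True by simp
    next
      case False
      then have "(x, r (f x)) \<in> ?C" using r[OF x] x by auto
      then show ?thesis by force
    qed
  qed
  then have "card A \<le> card (r ` f ` A \<union> fst ` ?C)"
    using assms finC by (intro card_mono) auto
  also have "\<dots> \<le> card (r ` f ` A) + card (fst ` ?C)" by (rule card_Un_le)
  also have "\<dots> \<le> card (f ` A) + card ?C"
    using assms finC by (intro add_mono card_image_le) auto
  finally show ?thesis .
qed

text \<open>Telescoping from \<open>(2 i + 3)^2 >= 4 (i + 1) (i + 2)\<close>. The restriction to odd
  numbers makes the sum small enough for the sieve.\<close>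

lemma sum_odd_inverse_squares_le:
  assumes "finite F" "\<And>p. p \<in> F \<Longrightarrow> odd p \<and> p \<ge> (3 :: nat)"
  shows "(\<Sum>p\<in>F. 1 / real p ^ 2) \<le> 1 / 4"
proof -
  have tel: "(\<Sum>i<n. 1 / real (2 * i + 3) ^ 2) \<le> 1 / 4 - 1 / (4 * (real n + 1))" for n
  proof (induction n)
    case (Suc n)
    have "1 / real (2 * n + 3) ^ 2 \<le> 1 / (4 * ((real n + 1) * (real n + 2)))"
      by (rule frac_le) (simp_all add: power2_eq_square algebra_simps add_pos_nonneg)
    also have "\<dots> = 1 / (4 * (real n + 1)) - 1 / (4 * (real n + 2))"
    proof -
      have "1 / (4 * a) - 1 / (4 * b) = (b - a) / (4 * (a * b))" if "a \<noteq> 0" "b \<noteq> 0" for a b :: real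
        using that by (simp add: divide_simps)
      from this[of "real n + 1" "real n + 2"] show ?thesis by simp
    qed
    finally show ?case using Suc by (simp add: add_ac)
  qed simp
  define n where "n = Suc (Max (insert 0 F))"
  have "F \<subseteq> (\<lambda>i. 2 * i + 3) ` {..<n}"
  proof
    fix p assume p: "p \<in> F"
    then obtain c where "p = 2 * c + 1" using assms(2) by (meson oddE)
    then have "p = 2 * (c - 1) + 3" using assms(2)[OF p] by simp
    moreover have "c - 1 < n"
    proof -
      have "p \<le> Max (insert 0 F)" using assms(1) p by (intro Max_ge) auto
      then show ?thesis using \<open>p = 2 * c + 1\<close> unfolding n_def by linarith
    qed
    ultimately show "p \<in> (\<lambda>i. 2 * i + 3) ` {..<n}" by blast
  qed
  then have "(\<Sum>p\<in>F. 1 / real p ^ 2) \<le> (\<Sum>p\<in>(\<lambda>i. 2 * i + 3) ` {..<n}. 1 / real p ^ 2)"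
    by (intro sum_mono2) auto
  also have "\<dots> = (\<Sum>i<n. 1 / real (2 * i + 3) ^ 2)" by (subst sum.reindex) (auto simp: inj_on_def)
  also have "\<dots> \<le> 1 / 4" using tel[of n] by (rule order.trans) simp
  finally show ?thesis .
qed

lemma sum_odd_squares_le:
  assumes "finite F" "\<And>p. p \<in> F \<Longrightarrow> odd p \<and> p \<ge> (3 :: nat)"
  shows "(\<Sum>p\<in>F. (real N / real p + 1) ^ 2) \<le> 5 / 16 * real N ^ 2 + 5 * real (card F)"
proof -
  have "(\<Sum>p\<in>F. (real N / real p + 1) ^ 2) \<le> (\<Sum>p\<in>F. 5 / 4 * real N ^ 2 * (1 / real p ^ 2) + 5)"
  proof (rule sum_mono)
    fix p
    define u where "u = real N / real p"
    \<comment> \<open>This splitting of \<open>(u + 1)^2\<close> gives the leading constant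
      \<open>5 / 4 * 1 / 4 = 5 / 16\<close>, small enough to be used twice in the sieve.\<close>
    have "0 \<le> (u / 2 - 2) ^ 2" by simp
    then have "(u + 1) ^ 2 \<le> 5 / 4 * u ^ 2 + 5" by (simp add: power2_eq_square algebra_simps)
    then show "(real N / real p + 1) ^ 2 \<le> 5 / 4 * real N ^ 2 * (1 / real p ^ 2) + 5"
      by (simp add: u_def power_divide)
  qed
  also have "\<dots> = 5 / 4 * real N ^ 2 * (\<Sum>p\<in>F. 1 / real p ^ 2) + 5 * real (card F)"
    by (simp add: sum.distrib sum_distrib_left)
  also have "\<dots> \<le> 5 / 4 * real N ^ 2 * (1 / 4) + 5 * real (card F)"
    using sum_odd_inverse_squares_le[OF assms] by (intro add_right_mono mult_left_mono) auto
  finally show ?thesis by simp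
qed

section \<open>Squarefree values of a linear form\<close>

lemma card_int_residue_le:
  fixes c :: int
  assumes "s > 0" "H > 0"
  shows "card {n :: int. \<bar>n\<bar> < int H \<and> int s dvd n - c} \<le> 2 * H div s + 1"
proof -
  let ?S = "{n :: int. \<bar>n\<bar> < int H \<and> int s dvd n - c}"
  define g where "g = (\<lambda>n. nat (n + int H) div s)"
  have "inj_on g ?S"
  proof (rule inj_onI)
    fix m n assume mn: "m \<in> ?S" "n \<in> ?S" "g m = g n"
    define M M' where "M = nat (m + int H)" and "M' = nat (n + int H)"
    have M: "int M = m + int H" "int M' = n + int H" using mn by (auto simp: M_def M'_def)
    have "int s dvd m - c" "int s dvd n - c" using mn by auto
    then have "int s dvd (m - c) - (n - c)" by (rule dvd_diff)
    then have "int s dvd int M - int M'" by (simp add: M)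
    then have "int M mod int s = int M' mod int s" by (simp add: mod_eq_dvd_iff)
    then have "M mod s = M' mod s" by (simp flip: zmod_int)
    moreover have "M div s = M' div s" using mn(3) by (simp add: g_def M_def M'_def)
    ultimately have "M = M'" by (metis div_mult_mod_eq)
    then show "m = n" using M by linarith
  qed
  moreover have "g ` ?S \<subseteq> {..2 * H div s}"
  proof
    fix v assume "v \<in> g ` ?S"
    then obtain n where n: "\<bar>n\<bar> < int H" "v = g n" by blast
    then have "nat (n + int H) \<le> 2 * H" by linarith
    then show "v \<in> {..2 * H div s}" by (simp add: g_def n(2) div_le_mono)
  qed
  ultimately have "card ?S \<le> card {..2 * H div s}" by (meson card_inj_on_le finite_atMost)
  then show ?thesis by simp
qed

lemma div_eq_imp_dist_less:
  fixes u v h :: nat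
  assumes "h > 0" "u div h = v div h" shows "\<bar>int u - int v\<bar> < int h"
proof -
  have "u = h * (v div h) + u mod h" "v = h * (v div h) + v mod h" using assms(2) by (metis mult_div_mod_eq)+
  moreover have "u mod h < h" "v mod h < h" using assms(1) by auto
  ultimately show ?thesis by linarith
qed

text \<open>The parities of \<open>k\<close> and \<open>l\<close> are fixed in such a way that \<open>k s + l t\<close> is odd: the density lost
  at the odd primes is then below 1, which would fail if the prime 2 had to be excluded as well.\<close>

locale counting =
  fixes s t N h k0 l0 :: nat
  assumes s1: "s \<ge> 1" and ts: "t \<le> s" and cop: "coprime s t" and Nh: "N = 512 * h" and h1: "h \<ge> 1"
    and k0: "k0 \<le> 1" and l0: "l0 \<le> 1" and par: "odd (k0 * s + l0 * t)"
begin

text \<open>With \<open>i\<close> and \<open>j\<close> below \<open>N\<close>, \<open>k\<close>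
  ranges over \<open>[2 N, 4 N)\<close> and \<open>l\<close> over \<open>[0, 2 N)\<close>. So
  \<open>l < k\<close>, and scales whose \<open>N\<close> differ by a factor 8 have no pair in
  common. The step 2 preserves the parities.\<close>

definition kk :: "nat \<Rightarrow> nat" where "kk i = 2 * N + k0 + 2 * i"
definition ll :: "nat \<Rightarrow> nat" where "ll j = l0 + 2 * j"
definition qq :: "nat \<times> nat \<Rightarrow> nat" where "qq x = kk (fst x) * s + ll (snd x) * t"

definition grid :: "(nat \<times> nat) set" where "grid = {..<N} \<times> {..<N}"

definition good :: "(nat \<times> nat) set" where
  "good = {x \<in> grid. coprime (kk (fst x)) (ll (snd x)) \<and> squarefree (qq x)}"

lemma finite_grid: "finite grid" by (simp add: grid_def)

lemma N_pos: "N > 0" using Nh h1 by simp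

lemma kk_bounds: "i < N \<Longrightarrow> 2 * N \<le> kk i" "i < N \<Longrightarrow> kk i < 4 * N"
  using k0 by (auto simp: kk_def)

lemma ll_bound: "j < N \<Longrightarrow> ll j < 2 * N"
  using l0 by (auto simp: ll_def)

lemma qq_odd: "odd (qq x)"
proof -
  have "qq x = (k0 * s + l0 * t) + 2 * (N * s + fst x * s + snd x * t)"
    by (simp add: qq_def kk_def ll_def algebra_simps)
  then show ?thesis using par by simp
qed

lemma qq_bounds:
  assumes "x \<in> grid" shows "2 * N * s \<le> qq x" "qq x \<le> 6 * N * s" "qq x > 0"
proof -
  have x: "fst x < N" "snd x < N" using assms by (auto simp: grid_def)
  show 1: "2 * N * s \<le> qq x" unfolding qq_def using kk_bounds(1)[OF x(1)] by (intro trans_le_add1 mult_right_mono) auto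
  have "kk (fst x) * s \<le> 4 * N * s" using kk_bounds(2)[OF x(1)] by (intro mult_right_mono) auto
  moreover have "ll (snd x) * t \<le> 2 * N * s" using ll_bound[OF x(2)] ts by (intro mult_mono) auto
  ultimately show "qq x \<le> 6 * N * s" unfolding qq_def by linarith
  show "qq x > 0" using qq_odd[of x] by (auto intro!: Nat.gr0I)
qed

lemma kk_inj: "kk i = kk i' \<Longrightarrow> i = i'" and ll_inj: "ll j = ll j' \<Longrightarrow> j = j'"
  by (auto simp: kk_def ll_def)

lemma mod_eq_of_dvd_diff:
  assumes "odd m" "int m dvd 2 * (int i - int i')" shows "i mod m = i' mod m"
proof -
  have "coprime (int m) 2" using assms(1) by simp
  then have "int m dvd int i - int i'" using assms(2) by (simp only: coprime_dvd_mult_right_iff)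
  then have "int i mod int m = int i' mod int m" by (simp add: mod_eq_dvd_iff)
  then show ?thesis by (metis nat_int zmod_int)
qed

lemma kk_diff: "int (kk i) - int (kk i') = 2 * (int i - int i')"
  and ll_diff: "int (ll j) - int (ll j') = 2 * (int j - int j')"
  by (simp_all add: kk_def ll_def)

lemma card_kk_dvd: "odd m \<Longrightarrow> card {i. i < N \<and> m dvd kk i} \<le> N div m + 1"
proof (rule card_congruent_le)
  fix i i' assume m: "odd m" and i: "i \<in> {i. i < N \<and> m dvd kk i}" "i' \<in> {i. i < N \<and> m dvd kk i}"
  have "int m dvd int (kk i) - int (kk i')" using i by (intro dvd_diff) auto
  then show "i mod m = i' mod m" unfolding kk_diff by (rule mod_eq_of_dvd_diff[OF m])
qed (auto intro: Nat.gr0I)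

lemma card_ll_dvd: "odd m \<Longrightarrow> card {j. j < N \<and> m dvd ll j} \<le> N div m + 1"
proof (rule card_congruent_le)
  fix i i' assume m: "odd m" and i: "i \<in> {i. i < N \<and> m dvd ll i}" "i' \<in> {i. i < N \<and> m dvd ll i}"
  have "int m dvd int (ll i) - int (ll i')" using i by (intro dvd_diff) auto
  then show "i mod m = i' mod m" unfolding ll_diff by (rule mod_eq_of_dvd_diff[OF m])
qed (auto intro: Nat.gr0I)

lemma real_div_add_1_le: "real (N div p + 1) \<le> real N / real p + 1"
  using of_nat_div_le_of_nat[of N p, where ?'a = real] by simp

lemma card_common_dvd:
  assumes "odd p"
  shows "real (card {x \<in> grid. p dvd kk (fst x) \<and> p dvd ll (snd x)}) \<le> (real N / real p + 1) ^ 2"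
proof -
  have "{x \<in> grid. p dvd kk (fst x) \<and> p dvd ll (snd x)} = {i. i < N \<and> p dvd kk i} \<times> {j. j < N \<and> p dvd ll j}"
    by (auto simp: grid_def)
  then have "card {x \<in> grid. p dvd kk (fst x) \<and> p dvd ll (snd x)} \<le> (N div p + 1) * (N div p + 1)"
    using card_kk_dvd[OF assms] card_ll_dvd[OF assms] by (simp only: card_cartesian_product) (intro mult_mono, auto)
  then have "real (card {x \<in> grid. p dvd kk (fst x) \<and> p dvd ll (snd x)}) \<le> real (N div p + 1) * real (N div p + 1)"
    by (simp only: of_nat_le_iff flip: of_nat_mult)
  also have "\<dots> \<le> (real N / real p + 1) * (real N / real p + 1)"
    using real_div_add_1_le[of p] by (intro mult_mono) auto
  finally show ?thesis by (simp add: power2_eq_square)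
qed

lemma qq_diff_fst:
  assumes "m dvd qq (i, j)" "m dvd qq (i', j)"
  shows "int m dvd int s * (2 * (int i - int i'))"
proof -
  have "int m dvd int (qq (i, j)) - int (qq (i', j))" using assms by (intro dvd_diff) auto
  also have "int (qq (i, j)) - int (qq (i', j)) = int s * (int (kk i) - int (kk i'))"
    by (simp add: qq_def algebra_simps)
  finally show ?thesis by (simp only: kk_diff)
qed

text \<open>If \<open>p\<close> does not divide \<open>s\<close>, then \<open>l\<close> determines
  \<open>k\<close> modulo \<open>p^2\<close>. If \<open>p^2\<close> divides \<open>s\<close>, then
  \<open>p^2\<close> divides \<open>l\<close>. If \<open>p\<close> divides \<open>s\<close> exactly
  once, then \<open>p\<close> divides \<open>l\<close>, and \<open>l\<close> determines
  \<open>k\<close> modulo \<open>p\<close>. Since \<open>p\<close> is odd, the step 2 of the grid is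
  invertible.\<close>

lemma card_square_dvd:
  assumes p: "prime p" "odd p"
  shows "real (card {x \<in> grid. p ^ 2 dvd qq x}) \<le> (real N / real p + 1) ^ 2 + real N"
proof -
  let ?S = "{x \<in> grid. p ^ 2 dvd qq x}"
  have p0: "p > 0" using p prime_gt_0_nat by blast
  have o2: "odd (p ^ 2)" using p by simp
  have r1: "real (N * (N div p ^ 2 + 1)) \<le> (real N / real p + 1) ^ 2 + real N"
  proof -
    have "real (N * (N div p ^ 2 + 1)) = real N * real (N div p ^ 2 + 1)" by (rule of_nat_mult)
    also have "\<dots> \<le> real N * (real N / real (p ^ 2) + 1)"
      using real_div_add_1_le[of "p ^ 2"] by (intro mult_left_mono) auto
    also have "\<dots> = (real N / real p) ^ 2 + real N" by (simp add: power_divide power2_eq_square algebra_simps)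
    also have "\<dots> \<le> (real N / real p + 1) ^ 2 + real N" by (intro add_right_mono power_mono) auto
    finally show ?thesis .
  qed
  consider "\<not> p dvd s" | "p ^ 2 dvd s" | "p dvd s" "\<not> p ^ 2 dvd s" by blast
  then show ?thesis
  proof cases
    case 1
    have "card ?S \<le> (N div p ^ 2 + 1) * card {..<N}"
    proof (rule card_fibres_le)
      fix j
      show "card {i. (i, j) \<in> ?S} \<le> N div p ^ 2 + 1"
      proof (rule card_congruent_le)
        fix i i' assume i: "i \<in> {i. (i, j) \<in> ?S}" "i' \<in> {i. (i, j) \<in> ?S}"
        have "int (p ^ 2) dvd int s * (2 * (int i - int i'))" using i by (intro qq_diff_fst[of _ i j i']) auto
        moreover have "coprime (int (p ^ 2)) (int s)"
          using 1 p(1) by (simp add: prime_imp_coprime)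
        ultimately have "int (p ^ 2) dvd 2 * (int i - int i')" by (simp add: coprime_dvd_mult_right_iff)
        then show "i mod p ^ 2 = i' mod p ^ 2" by (rule mod_eq_of_dvd_diff[OF o2])
      qed (use p0 in \<open>auto simp: grid_def\<close>)
    qed (auto simp: grid_def)
    then have "card ?S \<le> N * (N div p ^ 2 + 1)" by (simp add: mult.commute)
    then have "real (card ?S) \<le> real (N * (N div p ^ 2 + 1))" by (simp only: of_nat_le_iff)
    then show ?thesis using r1 by linarith
  next
    case 2
    have "coprime (p ^ 2) t" using 2 cop by (meson coprime_divisors dvd_refl)
    have "?S \<subseteq> {..<N} \<times> {j. j < N \<and> p ^ 2 dvd ll j}"
    proof
      fix x assume x: "x \<in> ?S"
      then have "p ^ 2 dvd ll (snd x) * t"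
        using 2 by (auto simp: qq_def dvd_add_right_iff)
      then have "p ^ 2 dvd ll (snd x)" using \<open>coprime (p ^ 2) t\<close> by (simp only: coprime_dvd_mult_left_iff)
      then show "x \<in> {..<N} \<times> {j. j < N \<and> p ^ 2 dvd ll j}" using x by (auto simp: grid_def mem_Times_iff)
    qed
    then have "card ?S \<le> card ({..<N} \<times> {j. j < N \<and> p ^ 2 dvd ll j})" by (intro card_mono) auto
    also have "\<dots> = N * card {j. j < N \<and> p ^ 2 dvd ll j}" by (simp add: card_cartesian_product)
    also have "\<dots> \<le> N * (N div p ^ 2 + 1)" using card_ll_dvd[OF o2] by (rule mult_left_mono) simp
    finally have "real (card ?S) \<le> real (N * (N div p ^ 2 + 1))" by (simp only: of_nat_le_iff)
    then show ?thesis using r1 by linarith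
  next
    case 3
    obtain c where c: "s = p * c" using 3(1) by blast
    have pc: "\<not> p dvd c" using 3(2) c by (auto simp: power2_eq_square)
    have cpt: "coprime p t" using 3(1) cop by (meson coprime_divisors dvd_refl)
    have "card ?S \<le> (N div p + 1) * card {j. j < N \<and> p dvd ll j}"
    proof (rule card_fibres_le)
      fix i j assume x: "(i, j) \<in> ?S"
      have "p dvd p ^ 2" by (simp add: power2_eq_square)
      then have "p dvd qq (i, j)" using x dvd_trans by blast
      then have "p dvd ll j * t" using 3(1) by (simp add: qq_def dvd_add_right_iff)
      then have "p dvd ll j" using cpt by (simp only: coprime_dvd_mult_left_iff)
      then show "j \<in> {j. j < N \<and> p dvd ll j}" using x by (auto simp: grid_def)
    next
      fix j
      show "card {i. (i, j) \<in> ?S} \<le> N div p + 1"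
      proof (rule card_congruent_le)
        fix i i' assume i: "i \<in> {i. (i, j) \<in> ?S}" "i' \<in> {i. (i, j) \<in> ?S}"
        have "int (p ^ 2) dvd int s * (2 * (int i - int i'))" using i by (intro qq_diff_fst[of _ i j i']) auto
        then have "int p * int p dvd int p * (int c * (2 * (int i - int i')))"
          by (simp add: c power2_eq_square mult.assoc)
        then have "int p dvd int c * (2 * (int i - int i'))" using p0 by simp
        moreover have "coprime (int p) (int c)" using pc p(1) by (simp add: prime_imp_coprime)
        ultimately have "int p dvd 2 * (int i - int i')" by (simp add: coprime_dvd_mult_right_iff)
        then show "i mod p = i' mod p" by (rule mod_eq_of_dvd_diff[OF p(2)])
      qed (use p0 in \<open>auto simp: grid_def\<close>)
    qed auto
    also have "\<dots> \<le> (N div p + 1) * (N div p + 1)" by (intro mult_left_mono card_ll_dvd p) auto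
    finally have "real (card ?S) \<le> real (N div p + 1) * real (N div p + 1)"
      by (simp only: of_nat_le_iff flip: of_nat_mult)
    also have "\<dots> \<le> (real N / real p + 1) * (real N / real p + 1)"
      using real_div_add_1_le[of p] by (intro mult_mono) auto
    finally show ?thesis by (simp add: power2_eq_square)
  qed
qed

text \<open>Two primitive vectors in the lattice of all \<open>(k, l)\<close> with \<open>p\<^sup>2\<close> dividing \<open>k s + l t\<close> span a
  determinant divisible by \<open>p\<^sup>2\<close>, so no small cell contains two of them.\<close>

lemma card_square_dvd_coprime:
  assumes p: "64 * h < p"
  shows "card {x \<in> grid. coprime (kk (fst x)) (ll (snd x)) \<and> p ^ 2 dvd qq x} \<le> 2 ^ 21"
proof -
  let ?S = "{x \<in> grid. coprime (kk (fst x)) (ll (snd x)) \<and> p ^ 2 dvd qq x}"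
  define g where "g = (\<lambda>x. (kk (fst x) div h, ll (snd x) div h))"
  have "inj_on g ?S"
  proof (rule inj_onI)
    fix x y assume x: "x \<in> ?S" and y: "y \<in> ?S" and g: "g x = g y"
    define k l k' l' where "k = int (kk (fst x))" and "l = int (ll (snd x))" and "k' = int (kk (fst y))" and "l' = int (ll (snd y))"
    define e where "e = k * l' - k' * l"

    have kk': "\<bar>k - k'\<bar> < int h" "\<bar>l' - l\<bar> < int h"
      using g h1 div_eq_imp_dist_less[of h "kk (fst x)" "kk (fst y)"] div_eq_imp_dist_less[of h "ll (snd y)" "ll (snd x)"]
      by (auto simp: g_def k_def k'_def l_def l'_def)
    have bd: "0 \<le> k" "k < 4 * int N" "0 \<le> l" "l < 2 * int N"
      using x kk_bounds[of "fst x"] ll_bound[of "snd x"] by (auto simp: grid_def k_def l_def mem_Times_iff)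
    \<comment> \<open>Expanded along the small differences, the determinant \<open>e\<close> is at
      most \<open>6 N h = 3072 h^2\<close>, which is below \<open>(64 h)^2\<close>.\<close>
    have "e = k * (l' - l) + l * (k - k')" by (simp add: e_def algebra_simps)
    then have "\<bar>e\<bar> \<le> k * \<bar>l' - l\<bar> + l * \<bar>k - k'\<bar>"
      using bd abs_triangle_ineq[of "k * (l' - l)" "l * (k - k')"] by (simp add: abs_mult)
    also have "\<dots> \<le> 4 * int N * int h + 2 * int N * int h"
      using bd kk' by (intro add_mono mult_mono) auto
    also have "\<dots> = 3072 * (int h * int h)" by (simp add: Nh)
    also have "\<dots> < 4096 * (int h * int h)" using h1 by simp
    also have "\<dots> = (64 * int h) ^ 2" by (simp add: power2_eq_square)
    also have "\<dots> \<le> int p ^ 2" using p by (intro power_mono) auto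
    finally have small: "\<bar>e\<bar> < int p ^ 2" .
    have dx: "int p ^ 2 dvd k * int s + l * int t"
    proof -
      have "int (p ^ 2) dvd int (qq x)" using x by (simp only: int_dvd_int_iff) simp
      then show ?thesis by (simp add: qq_def k_def l_def)
    qed
    have dy: "int p ^ 2 dvd k' * int s + l' * int t"
    proof -
      have "int (p ^ 2) dvd int (qq y)" using y by (simp only: int_dvd_int_iff) simp
      then show ?thesis by (simp add: qq_def k'_def l'_def)
    qed
    have "int p ^ 2 dvd l' * (k * int s + l * int t) - l * (k' * int s + l' * int t)"
      using dx dy by (intro dvd_diff dvd_mult)
    then have d1: "int p ^ 2 dvd e * int s" by (simp add: e_def algebra_simps)
    have "int p ^ 2 dvd k * (k' * int s + l' * int t) - k' * (k * int s + l * int t)"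
      using dx dy by (intro dvd_diff dvd_mult)
    then have d2: "int p ^ 2 dvd e * int t" by (simp add: e_def algebra_simps)
    have "coprime (int s) (int t)" using cop by simp
    then obtain a b where ab: "a * int s + b * int t = 1" using bezout_int[of "int s" "int t"] by auto
    have "int p ^ 2 dvd a * (e * int s) + b * (e * int t)" by (rule dvd_add[OF dvd_mult[OF d1] dvd_mult[OF d2]])
    also have "a * (e * int s) + b * (e * int t) = e * (a * int s + b * int t)" by (simp add: algebra_simps)
    finally have "int p ^ 2 dvd e" using ab by simp
    then have "e = 0" using small by (metis dvd_imp_le_int linorder_not_less abs_of_nonneg zero_le_power2)
    then have "kk (fst x) * ll (snd y) = kk (fst y) * ll (snd x)"
      by (simp add: e_def k_def k'_def l_def l'_def flip: of_nat_mult)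
    then have "kk (fst x) = kk (fst y) \<and> ll (snd y) = ll (snd x)"
      using x y coprime_crossproduct_nat[of "kk (fst x)" "ll (snd x)" "kk (fst y)" "ll (snd y)"]
      by (auto simp: mult.commute)
    then show "x = y" using kk_inj ll_inj by (metis prod_eqI)
  qed
  \<comment> \<open>The \<open>2048 * 1024 = 2^21\<close> cells of side \<open>h\<close> cover the
    whole range of \<open>(k, l)\<close>.\<close>
  moreover have "g ` ?S \<subseteq> {..<2048} \<times> {..<1024}"
  proof
    fix v assume "v \<in> g ` ?S"
    then obtain x where x: "x \<in> grid" "v = g x" by auto
    have "fst x < N" "snd x < N" using x by (auto simp: grid_def)
    then have "kk (fst x) < 2048 * h" "ll (snd x) < 1024 * h"
      using kk_bounds(2)[of "fst x"] ll_bound[of "snd x"] Nh by linarith+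
    then show "v \<in> {..<2048} \<times> {..<1024}" using h1 x by (simp add: g_def less_mult_imp_div_less)
  qed
  ultimately have "card ?S \<le> card ({..<2048 :: nat} \<times> {..<1024 :: nat})"
    by (meson card_inj_on_le finite_SigmaI finite_lessThan)
  then show ?thesis by simp
qed

text \<open>Equal values force \<open>s\<close> to divide the difference of the two
  \<open>l\<close>, whose modulus is below \<open>2 N < s\<close>; so that difference is 0.\<close>

lemma qq_inj:
  assumes "2 * N < s" "x \<in> grid" "y \<in> grid" "qq x = qq y" shows "x = y"
proof -
  let ?k = "int (kk (fst x)) - int (kk (fst y))" and ?l = "int (ll (snd x)) - int (ll (snd y))"
  have "int (kk (fst x)) * int s + int (ll (snd x)) * int t = int (kk (fst y)) * int s + int (ll (snd y)) * int t"
    using assms(4) by (simp add: qq_def flip: of_nat_mult of_nat_add)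
  then have e: "?k * int s + ?l * int t = 0" by (simp add: algebra_simps)
  then have "int s dvd ?l * int t" by (metis add_eq_0_iff dvd_minus_iff dvd_triv_right)
  moreover have "coprime (int s) (int t)" using cop by simp
  ultimately have "int s dvd ?l" by (simp only: coprime_dvd_mult_left_iff)
  moreover have "\<bar>?l\<bar> < int s"
    using assms ll_bound[of "snd x"] ll_bound[of "snd y"] by (auto simp: grid_def mem_Times_iff)
  ultimately have l: "?l = 0" by (metis dvd_imp_le_int linorder_not_less abs_of_nat)
  then have "?k = 0" using e s1 by simp
  then show "x = y" using l kk_inj ll_inj by (metis eq_iff_diff_eq_0 of_nat_eq_iff prod_eqI)
qed

text \<open>A pair with \<open>k s + l t = e d\<^sup>2\<close>, \<open>d > D\<close>, is encoded by \<open>e\<close> and the interval of length \<open>H\<close>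
  containing \<open>e d\<^sup>2\<close>.  Two pairs with the same code have a difference \<open>e (d - d') (d + d')\<close> that is
  small and lies in few residue classes modulo \<open>s\<close>, and that determines them up to a choice of two of
  its divisors.\<close>

lemma card_large_square:
  assumes s: "2 * N < s" and D: "D > 0" and H: "H \<ge> 1" and T: "T \<ge> 0"
    "\<And>n. 1 \<le> n \<Longrightarrow> n < H \<Longrightarrow> real (divisor_count n) \<le> T"
  shows "real (card {x \<in> grid. \<exists>p. prime p \<and> D < real p \<and> p ^ 2 dvd qq x}) \<le>
    (6 * real N * real s / D ^ 2) * (6 * real N * real s / real H + 1) + 4 * real N * (2 * real H / real s + 1) * T ^ 2"
proof -
  define A where "A = {x \<in> grid. \<exists>p. prime p \<and> D < real p \<and> p ^ 2 dvd qq x}"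
  have finA: "finite A" using finite_grid by (simp add: A_def)
  define d where "d = (\<lambda>x. SOME p. prime p \<and> D < real p \<and> p ^ 2 dvd qq x)"
  have d: "prime (d x) \<and> D < real (d x) \<and> d x ^ 2 dvd qq x" if "x \<in> A" for x
    unfolding d_def by (rule someI_ex) (use that in \<open>simp add: A_def\<close>)
  define e where "e = (\<lambda>x. qq x div d x ^ 2)"
  have qe: "qq x = e x * d x ^ 2" if "x \<in> A" for x using d[OF that] by (simp add: e_def)
  have AP: "x \<in> grid" if "x \<in> A" for x using that by (simp add: A_def)
  have e1: "e x \<ge> 1" if "x \<in> A" for x
    using qe[OF that] qq_bounds(3)[OF AP[OF that]] by (cases "e x") auto
  have eD: "real (e x) \<le> 6 * real N * real s / D ^ 2" if x: "x \<in> A" for x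
  proof -
    have "real (e x) * D ^ 2 \<le> real (e x) * real (d x) ^ 2"
      using d[OF x] D by (intro mult_left_mono power_mono) auto
    also have "\<dots> = real (qq x)" using qe[OF x] by simp
    also have "\<dots> \<le> real (6 * N * s)" using qq_bounds(2)[OF AP[OF x]] by (simp only: of_nat_le_iff)
    finally show ?thesis using D by (simp add: pos_le_divide_eq)
  qed
  define f where "f = (\<lambda>x. (e x, qq x div H))"
  let ?C = "{(x, y). x \<in> A \<and> y \<in> A \<and> x \<noteq> y \<and> f x = f y}"
  have img: "real (card (f ` A)) \<le> (6 * real N * real s / D ^ 2) * (6 * real N * real s / real H + 1)"
  proof -
    let ?E = "nat \<lfloor>6 * real N * real s / D ^ 2\<rfloor>"
    have "f ` A \<subseteq> {1..?E} \<times> {..6 * N * s div H}"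
    proof
      fix v assume "v \<in> f ` A"
      then obtain x where x: "x \<in> A" "v = f x" by blast
      have "e x \<le> ?E" using eD[OF x(1)] by (rule le_nat_floor)
      then show "v \<in> {1..?E} \<times> {..6 * N * s div H}"
        using x e1[OF x(1)] qq_bounds(2)[OF AP[OF x(1)]] by (simp add: f_def div_le_mono)
    qed
    then have "card (f ` A) \<le> card ({1..?E} \<times> {..6 * N * s div H})" by (intro card_mono) auto
    also have "\<dots> = ?E * (6 * N * s div H + 1)" by (simp add: card_cartesian_product)
    finally have "real (card (f ` A)) \<le> real ?E * real (6 * N * s div H + 1)"
      by (simp only: of_nat_le_iff flip: of_nat_mult)
    also have "\<dots> \<le> (6 * real N * real s / D ^ 2) * (6 * real N * real s / real H + 1)"
    proof (intro mult_mono)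
      show "real ?E \<le> 6 * real N * real s / D ^ 2" by simp
      show "real (6 * N * s div H + 1) \<le> 6 * real N * real s / real H + 1"
        using of_nat_div_le_of_nat[of "6 * N * s" H, where ?'a = real] by simp
    qed auto
    finally show ?thesis .
  qed
  define n where "n = (\<lambda>(x, y). int (qq x) - int (qq y))"
  \<comment> \<open>A collision has \<open>n = e (d - d') (d + d')\<close>. The number
    \<open>n\<close>, its divisor \<open>e\<close> and its divisor \<open>|d - d'|\<close> determine
    the pair: \<open>d + d'\<close> is positive, so the sign of \<open>n\<close> is that of
    \<open>d - d'\<close>.\<close>
  define G where "G = (\<lambda>z. (n z, e (fst z), nat \<bar>int (d (fst z)) - int (d (snd z))\<bar>))"
  \<comment> \<open>Modulo \<open>s\<close> the difference \<open>n\<close> is \<open>c t\<close>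
    with \<open>c\<close> the difference of the two \<open>l\<close>, so fewer than
    \<open>4 N\<close> classes occur.\<close>
  define NS where "NS = {m :: int. m \<noteq> 0 \<and> \<bar>m\<bar> < int H \<and> (\<exists>c\<in>{- (2 * int N)<..<2 * int N}. int s dvd m - c * int t)}"
  have n_fact: "n (x, y) = int (e x) * ((int (d x) - int (d y)) * (int (d x) + int (d y)))" if "(x, y) \<in> ?C" for x y
  proof -
    have "qq x = e x * d x ^ 2" "qq y = e x * d y ^ 2" using that qe[of x] qe[of y] by (auto simp: f_def)
    then show ?thesis by (simp add: n_def power2_eq_square algebra_simps)
  qed
  have n_nz: "n (x, y) \<noteq> 0" if "(x, y) \<in> ?C" for x y
    using that qq_inj[OF s, of x y] AP by (auto simp: n_def)
  have injG: "inj_on G ?C"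
  proof (rule inj_onI)
    fix z z' assume z: "z \<in> ?C" and z': "z' \<in> ?C" and GG: "G z = G z'"
    obtain x y where xy: "z = (x, y)" using surj_pair[of z] by blast
    obtain x' y' where xy': "z' = (x', y')" using surj_pair[of z'] by blast
    have c: "(x, y) \<in> ?C" "(x', y') \<in> ?C" using z z' xy xy' by auto
    define u v u' v' where "u = int (d x) - int (d y)" and "v = int (d x) + int (d y)"
      and "u' = int (d x') - int (d y')" and "v' = int (d x') + int (d y')"
    have dpos: "d w > 0" if "w \<in> A" for w using d[OF that] prime_gt_0_nat by blast
    have vpos: "v > 0" "v' > 0" using dpos[of x] dpos[of x'] c by (auto simp: v_def v'_def)
    have ee: "e x = e x'" using GG by (simp add: G_def xy xy')
    have au: "\<bar>u\<bar> = \<bar>u'\<bar>" using GG by (simp add: G_def xy xy' u_def u'_def eq_nat_nat_iff)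
    have "n (x, y) = n (x', y')" using GG by (simp add: G_def xy xy')
    then have eq: "int (e x) * (u * v) = int (e x) * (u' * v')"
      using n_fact[OF c(1)] n_fact[OF c(2)] ee by (simp add: u_def v_def u'_def v'_def)
    have nz: "int (e x) * (u * v) \<noteq> 0" using n_nz[OF c(1)] n_fact[OF c(1)] by (simp add: u_def v_def)
    then have uv: "u * v = u' * v'" using eq by simp
    have "u = u'"
    proof (rule ccontr)
      assume "u \<noteq> u'"
      then have "u' = - u" using au by linarith
      then have "u * v = u * (- v')" using uv by simp
      then have "v = - v'" using nz by (metis mult_cancel_left mult_zero_left mult_zero_right)
      then show False using vpos by simp
    qed
    then have "v = v'" using uv nz by simp
    then have dd: "d x = d x'" "d y = d y'" using \<open>u = u'\<close> by (auto simp: u_def v_def u'_def v'_def)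
    have "e y = e x" "e y' = e x'" using c by (auto simp: f_def)
    then have "qq x = qq x'" "qq y = qq y'"
      using qe[of x] qe[of x'] qe[of y] qe[of y'] c dd ee by auto
    then show "z = z'" using qq_inj[OF s] AP c xy xy' by auto
  qed
  let ?dv = "\<lambda>m :: int. {b :: nat. int b dvd m}"
  have dv_eq: "?dv m = {b. b dvd nat \<bar>m\<bar>}" for m by (simp flip: int_dvd_int_iff)
  have finNS: "finite NS" by (rule finite_subset[of _ "{- int H..int H}"]) (auto simp: NS_def)
  have findv: "finite (?dv m)" if "m \<in> NS" for m
    unfolding dv_eq using that by (intro finite_divisors_nat) (auto simp: NS_def)
  have "G ` ?C \<subseteq> (SIGMA m:NS. ?dv m \<times> ?dv m)"
  proof
    fix w assume "w \<in> G ` ?C"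
    then obtain x y where c: "(x, y) \<in> ?C" "w = G (x, y)" by auto
    have xy: "x \<in> grid" "y \<in> grid" using c AP by auto
    have "qq x div H = qq y div H" using c by (simp add: f_def)
    then have "\<bar>n (x, y)\<bar> < int H" using H div_eq_imp_dist_less[of H "qq x" "qq y"] by (simp add: n_def)
    moreover have "\<exists>c\<in>{- (2 * int N)<..<2 * int N}. int s dvd n (x, y) - c * int t"
    proof
      let ?c = "int (ll (snd x)) - int (ll (snd y))"
      have "n (x, y) - ?c * int t = (int (kk (fst x)) - int (kk (fst y))) * int s"
        by (simp add: n_def qq_def algebra_simps)
      then show "int s dvd n (x, y) - ?c * int t" by simp
      show "?c \<in> {- (2 * int N)<..<2 * int N}"
        using ll_bound[of "snd x"] ll_bound[of "snd y"] xy by (auto simp: grid_def mem_Times_iff)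
    qed
    ultimately have "n (x, y) \<in> NS" using n_nz[OF c(1)] by (simp add: NS_def)
    moreover have "int (e x) dvd n (x, y)" unfolding n_fact[OF c(1)] by simp
    moreover have "int (nat \<bar>int (d x) - int (d y)\<bar>) dvd n (x, y)"
      unfolding n_fact[OF c(1)] by (simp add: dvd_mult)
    ultimately show "w \<in> (SIGMA m:NS. ?dv m \<times> ?dv m)" using c(2) by (simp add: G_def)
  qed
  moreover have "finite (SIGMA m:NS. ?dv m \<times> ?dv m)" using finNS findv by (intro finite_SigmaI finite_cartesian_product) auto
  ultimately have "card ?C \<le> card (SIGMA m:NS. ?dv m \<times> ?dv m)"
    using injG by (meson card_inj_on_le)
  also have "\<dots> = (\<Sum>m\<in>NS. card (?dv m) * card (?dv m))"
    using finNS findv by (subst card_SigmaI) (auto simp: card_cartesian_product)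
  finally have "real (card ?C) \<le> (\<Sum>m\<in>NS. real (card (?dv m)) * real (card (?dv m)))"
    by (simp only: of_nat_le_iff flip: of_nat_mult of_nat_sum)
  also have "\<dots> \<le> (\<Sum>m\<in>NS. T * T)"
  proof (intro sum_mono)
    fix m assume m: "m \<in> NS"
    have "card (?dv m) = divisor_count (nat \<bar>m\<bar>)" unfolding dv_eq divisor_count_def ..
    moreover have "1 \<le> nat \<bar>m\<bar>" "nat \<bar>m\<bar> < H" using m by (auto simp: NS_def)
    ultimately have "real (card (?dv m)) \<le> T" using T(2) by simp
    then show "real (card (?dv m)) * real (card (?dv m)) \<le> T * T" using T(1) by (intro mult_mono) auto
  qed
  also have "\<dots> = real (card NS) * T ^ 2" by (simp add: power2_eq_square)
  also have "\<dots> \<le> (4 * real N * (2 * real H / real s + 1)) * T ^ 2"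
  proof (rule mult_right_mono)
    have "NS \<subseteq> (\<Union>c\<in>{- (2 * int N)<..<2 * int N}. {m :: int. \<bar>m\<bar> < int H \<and> int s dvd m - c * int t})"
      by (auto simp: NS_def)
    then have "card NS \<le> card (\<Union>c\<in>{- (2 * int N)<..<2 * int N}. {m :: int. \<bar>m\<bar> < int H \<and> int s dvd m - c * int t})"
      by (rule card_mono[rotated]) (auto intro!: finite_subset[of _ "{- int H..int H}"])
    also have "\<dots> \<le> (\<Sum>c\<in>{- (2 * int N)<..<2 * int N}. card {m :: int. \<bar>m\<bar> < int H \<and> int s dvd m - c * int t})"
      by (rule card_UN_le) simp
    also have "\<dots> \<le> (\<Sum>c\<in>{- (2 * int N)<..<2 * int N}. 2 * H div s + 1)"
      by (intro sum_mono card_int_residue_le) (use s1 H in auto)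
    also have "\<dots> = card {- (2 * int N)<..<2 * int N} * (2 * H div s + 1)" by (simp only: sum_constant of_nat_id)
    also have "\<dots> \<le> (4 * N) * (2 * H div s + 1)" by (rule mult_right_mono) auto
    finally have "real (card NS) \<le> real (4 * N) * real (2 * H div s + 1)"
      by (simp only: of_nat_le_iff flip: of_nat_mult)
    also have "\<dots> \<le> real (4 * N) * (2 * real H / real s + 1)"
      using of_nat_div_le_of_nat[of "2 * H" s, where ?'a = real] by (intro mult_left_mono) auto
    finally show "real (card NS) \<le> 4 * real N * (2 * real H / real s + 1)" by simp
  qed simp
  finally have col: "real (card ?C) \<le> 4 * real N * (2 * real H / real s + 1) * T ^ 2" .
  have "real (card A) \<le> real (card (f ` A)) + real (card ?C)"
    using card_le_image_plus_collisions[OF finA, of f] by (simp flip: of_nat_add)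
  then show ?thesis using img col unfolding A_def[symmetric] by linarith
qed

end

section \<open>The sieve over all odd primes\<close>

context counting
begin

text \<open>In units of \<open>N^2\<close>, common odd primes of \<open>k\<close> and
  \<open>l\<close> cost 5 / 16, and squares of primes up to \<open>64 h = N / 8\<close> cost 5 / 16
  + 1 / 8. Primes up to \<open>D = N^2 / E\<close> cost a constant each by the lattice argument,
  larger ones are treated by collisions. All of this, with the terms linear in \<open>N\<close>,
  stays below another 1 / 8 by \<open>small\<close>, and 1 / 8 is left.\<close>

lemma card_good_lower:
  fixes E T :: real
  assumes E1: "E \<ge> 1" and EN: "4 * E \<le> real N" and sE: "real s * E ^ 6 \<le> real N ^ 5"
    and T0: "T \<ge> 0" and T: "\<And>n. 1 \<le> n \<Longrightarrow> n \<le> 6 * N * s \<Longrightarrow> real (divisor_count n) \<le> T"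
    and small: "2 ^ 22 + 60 * T ^ 2 \<le> E / 8"
  shows "real N ^ 2 / 8 \<le> real (card good)"
proof -
  let ?M = "real N"
  define D where "D = ?M ^ 2 / E"
  define F1 where "F1 = {p. prime p \<and> odd p \<and> p \<le> 4 * N}"
  define F2 where "F2 = {p. prime p \<and> odd p \<and> p \<le> 64 * h}"
  define F3 where "F3 = {p. prime p \<and> 64 * h < p \<and> real p \<le> D}"
  define B1 where "B1 = (\<Union>p\<in>F1. {x \<in> grid. p dvd kk (fst x) \<and> p dvd ll (snd x)})"
  define B2 where "B2 = (\<Union>p\<in>F2. {x \<in> grid. p ^ 2 dvd qq x})"
  define B3 where "B3 = (\<Union>p\<in>F3. {x \<in> grid. coprime (kk (fst x)) (ll (snd x)) \<and> p ^ 2 dvd qq x})"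
  define B4 where "B4 = {x \<in> grid. \<exists>p. prime p \<and> D < real p \<and> p ^ 2 dvd qq x}"
  have M0: "?M > 0" using N_pos by simp
  have E0: "E > 0" using E1 by simp
  have D0: "D > 0" using M0 E0 by (simp add: D_def)
  have prime_dvd_qq: "odd p" if "p dvd qq x" for p x using that qq_odd[of x] dvd_trans by blast
  have sub: "grid \<subseteq> good \<union> B1 \<union> B2 \<union> B3 \<union> B4"
  proof
    fix x assume x: "x \<in> grid"
    then have xN: "fst x < N" by (auto simp: grid_def)
    show "x \<in> good \<union> B1 \<union> B2 \<union> B3 \<union> B4"
    proof (cases "coprime (kk (fst x)) (ll (snd x))")
      case False
      then obtain p where p: "prime p" "p dvd kk (fst x)" "p dvd ll (snd x)"
        by (metis coprime_iff_gcd_eq_1 dvd_gcdD1 dvd_gcdD2 prime_factor_nat)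
      have "p dvd qq x" using p by (simp add: qq_def)
      then have "odd p" by (rule prime_dvd_qq)
      have "kk (fst x) > 0" using kk_bounds(1)[OF xN] N_pos by linarith
      then have "p \<le> kk (fst x)" using p(2) by (simp add: dvd_imp_le)
      then have "p \<le> 4 * N" using kk_bounds(2)[OF xN] by linarith
      then have "x \<in> B1" using p x \<open>odd p\<close> by (auto simp: B1_def F1_def)
      then show ?thesis by simp
    next
      case c: True
      show ?thesis
      proof (cases "squarefree (qq x)")
        case True
        then show ?thesis using c x by (simp add: good_def)
      next
        case False
        then obtain y where y: "y ^ 2 dvd qq x" "\<not> y dvd 1" unfolding squarefree_def by blast
        then obtain p where p: "prime p" "p dvd y" by (metis prime_factor_nat dvd_refl)
        have p2: "p ^ 2 dvd qq x" using p(2) y(1) by (meson dvd_power_same dvd_trans)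
        have "p dvd p ^ 2" by (simp add: power2_eq_square)
        then have "odd p" using p2 prime_dvd_qq dvd_trans by blast
        then show ?thesis using p(1) p2 c x
          by (cases "p \<le> 64 * h"; cases "real p \<le> D") (auto simp: B2_def F2_def B3_def F3_def B4_def)
      qed
    qed
  qed
  have finB: "finite B1" "finite B2" "finite B3" "finite B4" "finite good"
    by (rule finite_subset[OF _ finite_grid], force simp: B1_def B2_def B3_def B4_def good_def)+
  have odd3: "odd p \<and> p \<ge> 3" if "prime p" "odd p" for p :: nat
    using that prime_ge_2_nat[of p] by (cases "p = 2") auto
  have F1: "finite F1" "card F1 \<le> 4 * N"
  proof -
    have sub: "F1 \<subseteq> {1..4 * N}" by (auto simp: F1_def dest: prime_ge_1_nat)
    then show "finite F1" by (rule finite_subset) simp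
    show "card F1 \<le> 4 * N" using card_mono[OF _ sub] by simp
  qed
  have F2: "finite F2" "card F2 \<le> 64 * h"
  proof -
    have sub: "F2 \<subseteq> {1..64 * h}" by (auto simp: F2_def dest: prime_ge_1_nat)
    then show "finite F2" by (rule finite_subset) simp
    show "card F2 \<le> 64 * h" using card_mono[OF _ sub] by simp
  qed
  have F3: "finite F3" "real (card F3) \<le> D"
  proof -
    have sub: "F3 \<subseteq> {1..nat \<lfloor>D\<rfloor>}" using le_nat_floor by (auto simp: F3_def dest: prime_ge_1_nat)
    then show "finite F3" by (rule finite_subset) simp
    have "card F3 \<le> nat \<lfloor>D\<rfloor>" using card_mono[OF _ sub] by simp
    then show "real (card F3) \<le> D" using D0 by linarith
  qed
  have c1: "real (card B1) \<le> 5 / 16 * ?M ^ 2 + 20 * ?M"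
  proof -
    have "card B1 \<le> (\<Sum>p\<in>F1. card {x \<in> grid. p dvd kk (fst x) \<and> p dvd ll (snd x)})"
      unfolding B1_def by (rule card_UN_le[OF F1(1)])
    then have "real (card B1) \<le> (\<Sum>p\<in>F1. real (card {x \<in> grid. p dvd kk (fst x) \<and> p dvd ll (snd x)}))"
      by (simp only: of_nat_le_iff flip: of_nat_sum)
    also have "\<dots> \<le> (\<Sum>p\<in>F1. (?M / real p + 1) ^ 2)"
      by (rule sum_mono) (simp add: F1_def card_common_dvd)
    also have "\<dots> \<le> 5 / 16 * ?M ^ 2 + 5 * real (card F1)"
      by (rule sum_odd_squares_le[OF F1(1)]) (simp add: F1_def odd3)
    also have "\<dots> \<le> 5 / 16 * ?M ^ 2 + 20 * ?M" using F1(2) by simp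
    finally show ?thesis .
  qed
  have hM: "64 * real h = ?M / 8" using Nh by simp
  have c2: "real (card B2) \<le> 5 / 16 * ?M ^ 2 + 5 * (?M / 8) + ?M / 8 * ?M"
  proof -
    have "card B2 \<le> (\<Sum>p\<in>F2. card {x \<in> grid. p ^ 2 dvd qq x})"
      unfolding B2_def by (rule card_UN_le[OF F2(1)])
    then have "real (card B2) \<le> (\<Sum>p\<in>F2. real (card {x \<in> grid. p ^ 2 dvd qq x}))"
      by (simp only: of_nat_le_iff flip: of_nat_sum)
    also have "\<dots> \<le> (\<Sum>p\<in>F2. (?M / real p + 1) ^ 2 + ?M)"
      by (rule sum_mono) (rule card_square_dvd, auto simp: F2_def)
    also have "\<dots> = (\<Sum>p\<in>F2. (?M / real p + 1) ^ 2) + real (card F2) * ?M" by (simp add: sum.distrib)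
    also have "\<dots> \<le> (5 / 16 * ?M ^ 2 + 5 * real (card F2)) + real (card F2) * ?M"
      by (rule add_right_mono, rule sum_odd_squares_le[OF F2(1)]) (simp add: F2_def odd3)
    also have "\<dots> \<le> 5 / 16 * ?M ^ 2 + 5 * (?M / 8) + ?M / 8 * ?M"
    proof -
      have "real (card F2) \<le> real (64 * h)" using F2(2) by (simp only: of_nat_le_iff)
      then have f: "real (card F2) \<le> ?M / 8" using hM by simp
      then have "real (card F2) * ?M \<le> ?M / 8 * ?M" by (rule mult_right_mono) simp
      then show ?thesis using f by linarith
    qed
    finally show ?thesis .
  qed
  have c3: "real (card B3) \<le> D * 2 ^ 21"
  proof -
    have "card B3 \<le> (\<Sum>p\<in>F3. card {x \<in> grid. coprime (kk (fst x)) (ll (snd x)) \<and> p ^ 2 dvd qq x})"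
      unfolding B3_def by (rule card_UN_le[OF F3(1)])
    also have "\<dots> \<le> (\<Sum>p\<in>F3. 2 ^ 21)"
      by (rule sum_mono) (rule card_square_dvd_coprime, auto simp: F3_def)
    also have "\<dots> = card F3 * 2 ^ 21" by (simp only: sum_constant of_nat_id)
    finally have "real (card B3) \<le> real (card F3 * 2 ^ 21)" by (simp only: of_nat_le_iff)
    also have "\<dots> \<le> D * 2 ^ 21" using F3(2) by simp
    finally show ?thesis .
  qed
  have c4: "real (card B4) \<le> 12 * ?M ^ 2 / E ^ 2 + 48 * ?M ^ 2 * T ^ 2 / E ^ 2 + 12 * ?M * T ^ 2"
  proof (cases "2 * N < s")
    \<comment> \<open>For \<open>s <= 2 N\<close> every such prime has \<open>p^2 <= 12 N^2\<close>,
      hence \<open>p <= 4 N <= D\<close>, and nothing beyond \<open>D\<close> remains.\<close>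
    case False
    have "B4 = {}"
    proof (rule ccontr)
      assume "B4 \<noteq> {}"
      then obtain x p where x: "x \<in> grid" "prime p" "D < real p" "p ^ 2 dvd qq x" by (auto simp: B4_def)
      have "p ^ 2 \<le> qq x" using x(4) qq_bounds(3)[OF x(1)] by (simp add: dvd_imp_le)
      also have "\<dots> \<le> 6 * N * s" by (rule qq_bounds(2)[OF x(1)])
      also have "\<dots> \<le> 6 * N * (2 * N)" using False by (intro mult_left_mono) auto
      also have "\<dots> \<le> (4 * N) ^ 2" by (simp add: power2_eq_square)
      finally have "p \<le> 4 * N" by (simp only: power2_nat_le_eq_le)
      then have "real p \<le> 4 * ?M" by linarith
      also have "4 * ?M \<le> D"
      proof -
        have "4 * ?M * E \<le> ?M * ?M" using mult_left_mono[OF EN, of ?M] by (simp add: mult_ac)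
        then show ?thesis using E0 by (simp add: D_def power2_eq_square pos_le_divide_eq)
      qed
      finally show False using x(3) by simp
    qed
    then show ?thesis using T0 E0 by simp
  next
    case True
    have s0: "real s > 0" using s1 by simp
    \<comment> \<open>With this length there are at most of order \<open>E^2\<close> intervals,
      hence of order \<open>s E^4 / N^3\<close> codes; by \<open>s E^6 <= N^5\<close> this is of
      order \<open>N^2 / E^2\<close>. The \<open>+ 1\<close> keeps \<open>H\<close>
      positive.\<close>
    define H where "H = nat \<lfloor>6 * ?M * real s / E ^ 2\<rfloor> + 1"
    have y0: "6 * ?M * real s / E ^ 2 > 0" using M0 s0 E0 by simp
    have Hlo: "6 * ?M * real s / E ^ 2 \<le> real H" and Hhi: "real H \<le> 6 * ?M * real s / E ^ 2 + 1"
      using y0 unfolding H_def by linarith+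
    have "6 * ?M * real s / E ^ 2 \<le> 6 * ?M * real s / 1"
      using E1 M0 s0 by (intro divide_left_mono) auto
    then have "real H \<le> real (6 * N * s + 1)" using Hhi by simp
    then have HN: "H \<le> 6 * N * s + 1" by (simp only: of_nat_le_iff)
    have "real (card B4) \<le> (6 * ?M * real s / D ^ 2) * (6 * ?M * real s / real H + 1) + 4 * ?M * (2 * real H / real s + 1) * T ^ 2"
      unfolding B4_def
      by (rule card_large_square[OF True D0 _ T0]) (use HN in \<open>auto simp: H_def intro!: T\<close>)
    also have "\<dots> \<le> 12 * ?M ^ 2 / E ^ 2 + (48 * ?M ^ 2 / E ^ 2 + 12 * ?M) * T ^ 2"
    proof (rule add_mono)
      have "6 * ?M * real s \<le> real H * E ^ 2" using Hlo E0 by (simp add: pos_divide_le_eq)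
      moreover have "real H > 0" unfolding H_def by (simp only: of_nat_0_less_iff)
      ultimately have "6 * ?M * real s / real H \<le> E ^ 2" by (simp add: pos_divide_le_eq mult.commute)
      moreover have "1 \<le> E ^ 2" using E1 by simp
      ultimately have a: "6 * ?M * real s / real H + 1 \<le> 2 * E ^ 2" by linarith
      have "6 * ?M * real s / D ^ 2 * (6 * ?M * real s / real H + 1) \<le> 6 * ?M * real s / D ^ 2 * (2 * E ^ 2)"
        by (rule mult_left_mono[OF a]) simp
      also have "\<dots> = 12 * (real s * E ^ 6) / (?M ^ 3 * E ^ 2)"
        using M0 E0 by (simp add: D_def field_simps power_numeral_reduce)
      also have "\<dots> \<le> 12 * ?M ^ 5 / (?M ^ 3 * E ^ 2)"
        using sE M0 E0 by (intro divide_right_mono) auto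
      also have "\<dots> = 12 * ?M ^ 2 / E ^ 2" using M0 E0 by (simp add: field_simps power_numeral_reduce)
      finally show "6 * ?M * real s / D ^ 2 * (6 * ?M * real s / real H + 1) \<le> 12 * ?M ^ 2 / E ^ 2" .
    next
      have "2 * real H / real s \<le> 2 * (6 * ?M * real s / E ^ 2 + 1) / real s"
        using Hhi s0 by (intro divide_right_mono) auto
      also have "\<dots> = 12 * ?M / E ^ 2 + 2 / real s" using s0 E0 by (simp add: field_simps)
      also have "\<dots> \<le> 12 * ?M / E ^ 2 + 2" using s1 by (simp add: divide_le_eq)
      finally have "2 * real H / real s + 1 \<le> 12 * ?M / E ^ 2 + 3" by simp
      then have "4 * ?M * (2 * real H / real s + 1) \<le> 4 * ?M * (12 * ?M / E ^ 2 + 3)"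
        using M0 by (intro mult_left_mono) auto
      also have "\<dots> = 48 * ?M ^ 2 / E ^ 2 + 12 * ?M" by (simp add: power2_eq_square algebra_simps)
      finally show "4 * ?M * (2 * real H / real s + 1) * T ^ 2 \<le> (48 * ?M ^ 2 / E ^ 2 + 12 * ?M) * T ^ 2"
        by (rule mult_right_mono) simp
    qed
    finally show ?thesis by (simp add: algebra_simps)
  qed
  have "card grid \<le> card (good \<union> B1 \<union> B2 \<union> B3 \<union> B4)" using sub finB by (intro card_mono) auto
  also have "\<dots> \<le> card good + card B1 + card B2 + card B3 + card B4"
    by (intro order.trans[OF card_Un_le] add_mono order.refl)
  finally have "real (card grid) \<le> real (card good + card B1 + card B2 + card B3 + card B4)" by (simp only: of_nat_le_iff)
  then have tot: "?M ^ 2 \<le> real (card good) + real (card B1) + real (card B2) + real (card B3) + real (card B4)"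
    by (simp add: grid_def card_cartesian_product power2_eq_square)
  define W where "W = ?M ^ 2 / E"
  have W0: "W > 0" using M0 E0 by (simp add: W_def)
  have MW: "4 * ?M \<le> W" using EN E0 M0 by (simp add: W_def power2_eq_square pos_le_divide_eq mult_ac)
  have WE: "?M ^ 2 / E ^ 2 \<le> W"
    unfolding W_def using E1 M0 by (intro divide_left_mono) (auto simp: power2_eq_square)
  have "48 * ?M ^ 2 * T ^ 2 / E ^ 2 = 48 * T ^ 2 * (?M ^ 2 / E ^ 2)" by simp
  also have "\<dots> \<le> 48 * T ^ 2 * W" by (rule mult_left_mono[OF WE]) simp
  finally have t1: "48 * ?M ^ 2 * T ^ 2 / E ^ 2 \<le> 48 * (T ^ 2 * W)" by simp
  have t2: "?M * T ^ 2 \<le> W * T ^ 2" using MW M0 by (intro mult_right_mono) auto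
  have "(2 ^ 22 + 60 * T ^ 2) * W \<le> E / 8 * W" using small W0 by (intro mult_right_mono) auto
  also have "\<dots> = ?M ^ 2 / 8" using E0 by (simp add: W_def)
  finally have fin: "2 ^ 22 * W + 60 * (T ^ 2 * W) \<le> ?M ^ 2 / 8" by (simp add: algebra_simps)
  have "12 * ?M ^ 2 / E ^ 2 \<le> 12 * W" using WE by simp
  then show ?thesis using tot c1 c2 c3 c4 t1 t2 fin MW W0 unfolding D_def W_def[symmetric]
    by (simp add: power2_eq_square mult_ac)
qed

end

text \<open>Take \<open>E = X powr \<delta>\<close> and the divisor bound with exponent
  \<open>\<delta> / 4\<close>, so that \<open>T^2\<close> is of order
  \<open>X powr (\<delta> / 2)\<close> and lies well below \<open>E\<close>. The lower bound for
  \<open>N ^ 5\<close> also yields \<open>N >= X powr (6 \<delta> / 5)\<close>, which exceeds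
  \<open>4 E\<close>.\<close>

lemma many_good:
  assumes \<delta>: "0 < \<delta>"
  shows "\<exists>X0\<ge>1. \<forall>X\<ge>X0. \<forall>s t N h k0 l0. counting s t N h k0 l0 \<and> real s * real N \<le> X \<and> real s * X powr (6 * \<delta>) \<le> real N ^ 5
    \<longrightarrow> real N ^ 2 / 8 \<le> real (card (counting.good s t N k0 l0))"
proof -
  obtain C where C: "C \<ge> 1" "\<And>n. n \<ge> 1 \<Longrightarrow> real (divisor_count n) \<le> C * real n powr (\<delta> / 4)"
    using divisor_bound[of "\<delta> / 4"] \<delta> by auto
  have "\<forall>\<^sub>F X in at_top. 2 ^ 22 + 60 * (C * (6 * X) powr (\<delta> / 4)) ^ 2 \<le> X powr \<delta> / 8"
    using \<delta> C(1) by real_asymp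
  moreover have "\<forall>\<^sub>F X in at_top. 4 * X powr \<delta> \<le> X powr (6 * \<delta> / 5)" using \<delta> by real_asymp
  ultimately have "\<forall>\<^sub>F X in at_top. 2 ^ 22 + 60 * (C * (6 * X) powr (\<delta> / 4)) ^ 2 \<le> X powr \<delta> / 8 \<and> 4 * X powr \<delta> \<le> X powr (6 * \<delta> / 5)"
    by (rule eventually_conj)
  then obtain X1 where X1: "\<And>X. X \<ge> X1 \<Longrightarrow> 2 ^ 22 + 60 * (C * (6 * X) powr (\<delta> / 4)) ^ 2 \<le> X powr \<delta> / 8 \<and> 4 * X powr \<delta> \<le> X powr (6 * \<delta> / 5)"
    unfolding eventually_at_top_linorder by blast
  show ?thesis
  proof (intro exI[of _ "max 1 X1"] conjI allI impI)
    fix X s t N h k0 l0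
    assume X: "max 1 X1 \<le> X" and "counting s t N h k0 l0 \<and> real s * real N \<le> X \<and> real s * X powr (6 * \<delta>) \<le> real N ^ 5"
    then have c: "counting s t N h k0 l0" and sN: "real s * real N \<le> X" and N5: "real s * X powr (6 * \<delta>) \<le> real N ^ 5" by auto
    interpret counting s t N h k0 l0 by (rule c)
    have X0: "X \<ge> 1" "X \<ge> X1" using X by auto
    show "real N ^ 2 / 8 \<le> real (card good)"
    proof (rule card_good_lower)
      show "1 \<le> X powr \<delta>" using X0 \<delta> by (simp add: ge_one_powr_ge_zero)
      have p6: "(X powr \<delta>) ^ 6 = X powr (6 * \<delta>)" using X0 by (simp add: powr_power mult.commute)
      then show "real s * (X powr \<delta>) ^ 6 \<le> real N ^ 5" using N5 by simp
      have "(X powr (6 * \<delta> / 5)) ^ 5 = X powr (6 * \<delta>)" using X0 by (simp add: powr_power)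
      also have "\<dots> \<le> real s * X powr (6 * \<delta>)" using s1 by (simp add: mult_le_cancel_right1)
      also have "\<dots> \<le> real N ^ 5" by (rule N5)
      finally have "X powr (6 * \<delta> / 5) \<le> real N" by (simp add: power_mono_iff)
      then show "4 * X powr \<delta> \<le> real N" using X1[OF X0(2)] by linarith
      show "0 \<le> C * (6 * X) powr (\<delta> / 4)" using C(1) by simp
      show "2 ^ 22 + 60 * (C * (6 * X) powr (\<delta> / 4)) ^ 2 \<le> X powr \<delta> / 8" using X1[OF X0(2)] by blast
      fix n :: nat assume n: "1 \<le> n" "n \<le> 6 * N * s"
      have "real n \<le> real (6 * N * s)" using n(2) by (simp only: of_nat_le_iff)
      also have "\<dots> \<le> 6 * X" using sN by (simp add: mult_ac)
      finally have "real n powr (\<delta> / 4) \<le> (6 * X) powr (\<delta> / 4)" using \<delta> by (intro powr_mono2) auto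
      then have "C * real n powr (\<delta> / 4) \<le> C * (6 * X) powr (\<delta> / 4)" using C(1) by (intro mult_left_mono) auto
      then show "real (divisor_count n) \<le> C * (6 * X) powr (\<delta> / 4)" using C(2)[OF n(1)] by linarith
    qed
  qed auto
qed

section \<open>Fractions close to a given one\<close>

text \<open>By \<open>det\<close> the passage from \<open>(k, l)\<close> to numerator and
  denominator is unimodular: it preserves primitive vectors and, up to sign, determinants. The bound
  \<open>s >= 4\<close> keeps all fractions within 1 / 16 of each other, as the large sieve with
  plain distances demands.\<close>

locale farey =
  fixes s t :: nat and u v :: int and \<alpha> :: real
  assumes s4: "s \<ge> 4" and det: "v * int s - u * int t = 1" and dist: "\<bar>\<alpha> - of_int u / real s\<bar> \<le> 1 / real s ^ 2"
begin

definition num :: "nat \<times> nat \<Rightarrow> int" where "num r = int (fst r) * u + int (snd r) * v"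
definition den :: "nat \<times> nat \<Rightarrow> nat" where "den r = fst r * s + snd r * t"
definition frac_of :: "nat \<times> nat \<Rightarrow> real" where "frac_of r = of_int (num r) / real (den r)"

definition admissible :: "nat \<times> nat \<Rightarrow> bool" where
  "admissible r \<longleftrightarrow> 1 \<le> fst r \<and> snd r \<le> fst r \<and> coprime (fst r) (snd r)"

lemma den_pos: "admissible r \<Longrightarrow> den r > 0" using s4 by (simp add: den_def admissible_def)

lemma coprime_num_den: "admissible r \<Longrightarrow> coprime (num r) (int (den r))"
proof (rule coprimeI)
  fix g assume r: "admissible r" and g: "g dvd num r" "g dvd int (den r)"
  have "g dvd int s * num r - u * int (den r)" "g dvd v * int (den r) - int t * num r"
    using g by (auto intro!: dvd_diff dvd_mult simp del: int_dvd_int_iff)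
  moreover have "int s * num r - u * int (den r) = int (snd r) * (v * int s - u * int t)"
    "v * int (den r) - int t * num r = int (fst r) * (v * int s - u * int t)"
    by (simp_all add: num_def den_def algebra_simps)
  ultimately have "g dvd int (snd r)" "g dvd int (fst r)" by (simp_all add: det)
  moreover have "coprime (int (fst r)) (int (snd r))" using r by (simp add: admissible_def)
  ultimately show "is_unit g" by (meson coprime_common_divisor)
qed

text \<open>The difference from \<open>u / s\<close> is exactly \<open>l / (s q)\<close>, and
  \<open>q >= k s >= l s\<close>.\<close>

lemma frac_of_bounds: assumes r: "admissible r" shows "0 \<le> frac_of r - of_int u / real s" "frac_of r - of_int u / real s \<le> 1 / real s ^ 2"
proof -
  have d: "real (den r) > 0" "real s > 0" using den_pos[OF r] s4 by auto
  have "int s * num r - u * int (den r) = int (snd r) * (v * int s - u * int t)"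
    by (simp add: num_def den_def algebra_simps)
  then have "int s * num r - u * int (den r) = int (snd r)" by (simp add: det)
  then have "real_of_int (int s * num r - u * int (den r)) = real_of_int (int (snd r))" by (simp only:)
  then have e: "real s * of_int (num r) - of_int u * real (den r) = real (snd r)" by simp
  have eq: "frac_of r - of_int u / real s = real (snd r) / (real s * real (den r))"
    unfolding e[symmetric] using d by (simp add: frac_of_def field_simps)
  then show "0 \<le> frac_of r - of_int u / real s" by simp
  have "snd r * s \<le> den r" using r unfolding den_def admissible_def by (intro trans_le_add1 mult_right_mono) auto
  then have "real (snd r * s) \<le> real (den r)" by (simp only: of_nat_le_iff)
  then have "real (snd r) * real s * real s \<le> real (den r) * real s" using d(2) by (intro mult_right_mono) auto
  then show "frac_of r - of_int u / real s \<le> 1 / real s ^ 2"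
    unfolding eq using d by (simp add: divide_le_eq le_divide_eq power2_eq_square mult_ac)
qed

lemma frac_of_near: "admissible r \<Longrightarrow> \<bar>frac_of r - \<alpha>\<bar> \<le> 2 / real s ^ 2"
  using frac_of_bounds[of r] dist by linarith

lemma frac_of_close: "admissible r \<Longrightarrow> admissible r' \<Longrightarrow> 2 * pi * \<bar>frac_of r - frac_of r'\<bar> \<le> 1"
proof -
  assume r: "admissible r" "admissible r'"
  have "4 ^ 2 \<le> real s ^ 2" using s4 by (intro power_mono) auto
  then have "1 / real s ^ 2 \<le> 1 / 16" using s4 by (intro divide_left_mono) auto
  then have d: "\<bar>frac_of r - frac_of r'\<bar> \<le> 1 / 16" using frac_of_bounds[OF r(1)] frac_of_bounds[OF r(2)] by linarith
  have "2 * pi * \<bar>frac_of r - frac_of r'\<bar> \<le> 2 * pi * (1 / 16)" using d by (intro mult_left_mono) auto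
  also have "\<dots> \<le> 1" using pi_less_4 by simp
  finally show ?thesis .
qed

text \<open>Up to sign the numerator of the difference is the determinant of the two pairs, a
  nonzero integer for distinct primitive pairs.\<close>

lemma frac_of_separated:
  assumes r: "admissible r" "admissible r'" "r \<noteq> r'" and Q: "real (den r) \<le> Q" "real (den r') \<le> Q"
  shows "1 / Q ^ 2 \<le> \<bar>frac_of r - frac_of r'\<bar>"
proof -
  have d: "real (den r) > 0" "real (den r') > 0" using den_pos r by auto
  define z where "z = num r * int (den r') - num r' * int (den r)"
  have z: "z = (int (snd r) * int (fst r') - int (fst r) * int (snd r')) * (v * int s - u * int t)"
    by (simp add: z_def num_def den_def algebra_simps)
  have "z \<noteq> 0"
  proof
    assume "z = 0"
    then have "int (fst r) * int (snd r') = int (fst r') * int (snd r)" using z by (simp add: det mult.commute)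
    then have "fst r * snd r' = fst r' * snd r" by (simp only: of_nat_eq_iff flip: of_nat_mult)
    then have "fst r = fst r' \<and> snd r' = snd r"
      using r coprime_crossproduct_nat[of "fst r" "snd r" "fst r'" "snd r'"] by (auto simp: admissible_def mult.commute)
    then show False using r(3) by (metis prod_eqI)
  qed
  then have "1 \<le> \<bar>z\<bar>" by simp
  then have z1: "1 \<le> \<bar>real_of_int z\<bar>" by linarith
  have "real (den r) * real (den r') \<le> Q * Q" using Q d by (intro mult_mono) auto
  then have "1 / Q ^ 2 \<le> 1 / (real (den r) * real (den r'))"
    using d Q by (intro divide_left_mono mult_pos_pos) (auto simp: power2_eq_square)
  also have "\<dots> \<le> \<bar>real_of_int z\<bar> / (real (den r) * real (den r'))" using z1 d by (intro divide_right_mono) auto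
  also have "\<dots> = \<bar>frac_of r - frac_of r'\<bar>"
  proof -
    have "frac_of r - frac_of r' = real_of_int z / (real (den r) * real (den r'))"
      using d by (simp add: frac_of_def z_def field_simps)
    then show ?thesis using d by (simp add: abs_mult)
  qed
  finally show ?thesis .
qed

end

lemma ex_farey_partner:
  fixes u :: int and s :: nat
  assumes "coprime u (int s)" "s \<ge> 1"
  shows "\<exists>t v. t \<le> s \<and> coprime s t \<and> v * int s - u * int t = 1"
proof -
  obtain a b where ab: "a * u + b * int s = 1" using bezout_int[of u "int s"] assms(1) by auto
  define t where "t = nat ((- a) mod int s)"
  have t: "int t = (- a) mod int s" using assms(2) by (simp add: t_def)
  then have tk: "int t = - a - int s * ((- a) div int s)" by (simp add: minus_div_mult_eq_mod[symmetric] algebra_simps)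
  define v where "v = b - u * ((- a) div int s)"
  have det: "v * int s - u * int t = 1" unfolding v_def tk using ab by (simp add: algebra_simps)
  have "int t < int s" unfolding t using assms(2) by simp
  then have "t \<le> s" by simp
  moreover have "coprime (int s) (int t)"
  proof (rule coprimeI)
    fix g assume "g dvd int s" "g dvd int t"
    then have "g dvd v * int s - u * int t" by (intro dvd_diff dvd_mult)
    then show "is_unit g" using det by simp
  qed
  then have "coprime s t" by simp
  ultimately show ?thesis using det by blast
qed

text \<open>To base 8 the logarithms of the two ends, divided by 512, are at least
  \<open>ln r / ln 8\<close> apart, and the lower one is nonnegative.\<close>

lemma card_scales_ge:
  fixes lo hi r :: real
  assumes lo: "512 \<le> lo" and r: "1 \<le> r" "lo * r \<le> hi"
  defines "I \<equiv> {i :: nat. lo \<le> 512 * 8 ^ i \<and> 512 * 8 ^ i \<le> hi}"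
  shows "finite I" "ln r / ln 8 - 1 \<le> real (card I)"
proof -
  define a b where "a = log 8 (lo / 512)" and "b = log 8 (hi / 512)"
  have "lo * 1 \<le> lo * r" using lo r by (intro mult_left_mono) auto
  then have hi: "hi \<ge> 512" using lo r by linarith
  have I: "I = {i. a \<le> real i \<and> real i \<le> b}"
    using lo hi by (auto simp: I_def a_def b_def log_le_iff le_log_iff powr_realpow field_simps)
  have a0: "a \<ge> 0" using lo by (simp add: a_def)
  have "I \<subseteq> {..nat \<lfloor>b\<rfloor>}" unfolding I using le_nat_floor by auto
  then show "finite I" by (rule finite_subset) simp
  have "{nat \<lceil>a\<rceil>..<nat \<lceil>a\<rceil> + nat \<lfloor>b - a\<rfloor>} \<subseteq> I"
  proof
    fix i assume i: "i \<in> {nat \<lceil>a\<rceil>..<nat \<lceil>a\<rceil> + nat \<lfloor>b - a\<rfloor>}"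
    then show "i \<in> I" unfolding I using a0 by simp linarith
  qed
  then have "card {nat \<lceil>a\<rceil>..<nat \<lceil>a\<rceil> + nat \<lfloor>b - a\<rfloor>} \<le> card I" by (rule card_mono[OF \<open>finite I\<close>])
  then have "nat \<lfloor>b - a\<rfloor> \<le> card I" by simp
  then have "b - a - 1 \<le> real (card I)" by linarith
  moreover have "ln r / ln 8 \<le> b - a"
  proof -
    have "0 < lo * r" using lo r by (intro mult_pos_pos) auto
    then have "ln (lo * r) \<le> ln hi" using hi r by simp
    then have "ln r \<le> ln hi - ln lo" using lo r by (simp add: ln_mult)
    moreover have "b - a = (ln hi - ln lo) / ln 8" using lo hi by (simp add: a_def b_def log_def ln_div diff_divide_distrib)
    ultimately show ?thesis by (simp add: divide_right_mono)
  qed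
  ultimately show "ln r / ln 8 - 1 \<le> real (card I)" by linarith
qed

section \<open>Lower bounds for the sum over windows\<close>

definition window_sum :: "real \<Rightarrow> real \<Rightarrow> real \<Rightarrow> real" where
  "window_sum \<alpha> x y = (\<Sum>n | - y < of_int n \<and> of_int n \<le> x.
       (cmod (\<Sum>m | n < m \<and> of_int m \<le> of_int n + y \<and> 1 \<le> m \<and> of_int m \<le> x.
          mangoldt (nat m) * ee (\<alpha> * of_int m)))\<^sup>2)"

lemma finite_window: "finite {n :: int. - y < of_int n \<and> of_int n \<le> (x :: real)}" for y :: real
  by (rule finite_subset[of _ "{\<lfloor>- y\<rfloor>..\<lfloor>x\<rfloor>}"]) (auto simp: le_floor_iff floor_le_iff)

text \<open>Meant for bounded \<open>x\<close>, where the asymptotic inequalities are not at hand: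
  one window already contains 2 as its only prime.\<close>

lemma window_sum_ge_ln_2:
  assumes "1 \<le> y" "2 \<le> x" shows "(ln 2) ^ 2 \<le> window_sum \<alpha> x y"
proof -
  define f where "f = (\<lambda>n :: int. (cmod (\<Sum>m | n < m \<and> of_int m \<le> of_int n + y \<and> 1 \<le> m \<and> of_int m \<le> x.
          mangoldt (nat m) * ee (\<alpha> * of_int m)))\<^sup>2)"
  \<comment> \<open>The window then ends at \<open>n + y\<close>, which lies in
    \<open>[2, 3)\<close>.\<close>
  define n where "n = 2 - \<lfloor>y\<rfloor>"
  have n: "- y < of_int n" "of_int n \<le> x" using assms unfolding n_def by linarith+
  let ?M = "{m. n < m \<and> real_of_int m \<le> of_int n + y \<and> 1 \<le> m \<and> of_int m \<le> x}"
  have "n < 2" "real_of_int 2 \<le> of_int n + y" "real_of_int 2 \<le> x" using assms unfolding n_def by linarith+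
  then have two: "2 \<in> ?M" by simp
  have sub: "m = 1 \<or> m = 2" if "m \<in> ?M" for m
  proof -
    have "1 \<le> m" "m < 3" using that unfolding n_def mem_Collect_eq by linarith+
    then show ?thesis by linarith
  qed
  have "finite ?M" by (rule finite_subset[of _ "{1, 2}"]) (use sub in auto)
  then have "(\<Sum>m\<in>?M. mangoldt (nat m) * ee (\<alpha> * of_int m)) = (\<Sum>m\<in>{2}. mangoldt (nat m) * ee (\<alpha> * of_int m))"
  proof (rule sum.mono_neutral_right)
    show "{2} \<subseteq> ?M" using two by blast
    show "\<forall>m\<in>?M - {2}. mangoldt (nat m) * ee (\<alpha> * of_int m) = 0" using sub by fastforce
  qed
  then have "f n = (cmod (mangoldt 2 * ee (\<alpha> * 2))) ^ 2" by (simp add: f_def)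
  also have "\<dots> = (ln 2) ^ 2" using mangoldt_primepow[of "2 :: nat" 1, where ?'a = complex] by (simp add: norm_mult norm_ee)
  finally have "(ln 2) ^ 2 = f n" by simp
  also have "\<dots> \<le> (\<Sum>n | - y < of_int n \<and> of_int n \<le> x. f n)"
    by (rule member_le_sum) (use n finite_window in \<open>auto simp: f_def\<close>)
  finally show ?thesis by (simp add: window_sum_def f_def)
qed

context farey
begin

text \<open>The constant is \<open>256^2 * 20\<close>: 256 is the 32 of the exponential sum times
  the 8 of the window lemma, and 20 is the 4 from the squared weight times the 5 from bounding the
  large sieve factor by \<open>5 x\<close>.\<close>

lemma window_sum_ge:
  assumes y1: "1 \<le> y" and ys: "y \<le> real s ^ 2 / 12" and y2: "y * ln x \<le> x / (128 * Q)" and yx: "y \<le> x" "2 \<le> x"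
    and Q: "1 \<le> Q" "Q ^ 2 * (1 + ln (Q ^ 2)) \<le> x"
    and R: "finite R" "\<And>r. r \<in> R \<Longrightarrow> admissible r" "\<And>r. r \<in> R \<Longrightarrow> real (den r) \<le> Q"
    and lb: "\<And>r. r \<in> R \<Longrightarrow> x / (32 * real (den r)) \<le>
      norm (\<Sum>n | 1 \<le> n \<and> real n \<le> x. of_real (mangoldt n * (1 - real n / x)) * ee (of_int (num r) * of_nat n / of_nat (den r)))"
  shows "(\<Sum>r\<in>R. 1 / real (den r) ^ 2) * (x * y ^ 2) / 1310720 \<le> window_sum \<alpha> x y"
proof -
  let ?L = "\<lambda>r. x / (32 * real (den r))"
  have den0: "real (den r) > 0" if "r \<in> R" for r using den_pos[OF R(2)[OF that]] by simp
  have "(\<Sum>r\<in>R. (y * ?L r / 8) ^ 2) \<le> (x + y + 1 + 2 * ((1 + ln (1 / (1 / Q ^ 2))) / (1 / Q ^ 2))) * 4 * window_sum \<alpha> x y"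
    unfolding window_sum_def
  proof (rule window_lower_bound[where \<theta> = frac_of])
    show "0 < 1 / Q ^ 2" "1 / Q ^ 2 \<le> 1" using Q(1) by auto
    show "1 / Q ^ 2 \<le> \<bar>frac_of r - frac_of t\<bar>" if "r \<in> R" "t \<in> R" "r \<noteq> t" for r t
      using that R by (intro frac_of_separated) auto
    show "2 * pi * \<bar>frac_of r - frac_of t\<bar> \<le> 1" if "r \<in> R" "t \<in> R" for r t
      using that R by (intro frac_of_close) auto
    show "\<bar>frac_of r - \<alpha>\<bar> * y \<le> 5 / 24" if "r \<in> R" for r
    proof -
      have "\<bar>frac_of r - \<alpha>\<bar> * y \<le> 2 / real s ^ 2 * (real s ^ 2 / 12)"
        using y1 ys by (intro mult_mono frac_of_near R that) auto
      also have "\<dots> \<le> 5 / 24" using s4 by simp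
      finally show ?thesis .
    qed
    show "?L r \<le> norm (\<Sum>n | 1 \<le> n \<and> real n \<le> x. of_real (mangoldt n * (1 - real n / x)) * ee (frac_of r * of_nat n))" if "r \<in> R" for r
      using lb[OF that] by (simp add: frac_of_def)
    show "y * ln x \<le> ?L r / 4" if "r \<in> R" for r
    proof -
      have "x / (128 * Q) \<le> x / (128 * real (den r))" using den0[OF that] R(3)[OF that] yx by (intro divide_left_mono) auto
      then show ?thesis using y2 by simp
    qed
  qed (use y1 yx R(1) in auto)
  also have "x + y + 1 + 2 * ((1 + ln (1 / (1 / Q ^ 2))) / (1 / Q ^ 2)) = x + y + 1 + 2 * (Q ^ 2 * (1 + ln (Q ^ 2)))" by simp
  also have "(x + y + 1 + 2 * (Q ^ 2 * (1 + ln (Q ^ 2)))) * 4 * window_sum \<alpha> x y \<le> (5 * x) * 4 * window_sum \<alpha> x y"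
  proof (intro mult_right_mono)
    show "0 \<le> window_sum \<alpha> x y" unfolding window_sum_def by (intro sum_nonneg) auto
    show "x + y + 1 + 2 * (Q ^ 2 * (1 + ln (Q ^ 2))) \<le> 5 * x" using Q(2) yx by linarith
  qed simp
  also have "(\<Sum>r\<in>R. (y * ?L r / 8) ^ 2) = (\<Sum>r\<in>R. (x * y) ^ 2 / 65536 * (1 / real (den r) ^ 2))"
    by (intro sum.cong refl) (simp add: power_divide power_mult_distrib mult_ac)
  also have "\<dots> = (x * y) ^ 2 / 65536 * (\<Sum>r\<in>R. 1 / real (den r) ^ 2)" by (rule sum_distrib_left[symmetric])
  finally have "x * ((\<Sum>r\<in>R. 1 / real (den r) ^ 2) * (x * y ^ 2) / 65536) \<le> x * (20 * window_sum \<alpha> x y)"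
    by (simp add: power2_eq_square mult_ac)
  then show ?thesis using yx by simp
qed

end

context counting
begin

definition pairs :: "(nat \<times> nat) set" where "pairs = (\<lambda>x. (kk (fst x), ll (snd x))) ` good"

lemma finite_pairs: "finite pairs"
  unfolding pairs_def good_def using finite_grid by simp

lemma pairs_memD:
  assumes "r \<in> pairs"
  shows "2 * N \<le> fst r" "fst r < 4 * N" "snd r < 2 * N" "coprime (fst r) (snd r)"
    "squarefree (fst r * s + snd r * t)" "fst r * s + snd r * t \<le> 6 * N * s"
proof -
  obtain x where x: "x \<in> good" and r: "r = (kk (fst x), ll (snd x))" using assms by (auto simp: pairs_def)
  have xP: "x \<in> grid" using x by (simp add: good_def)
  then have "fst x < N" "snd x < N" by (auto simp: grid_def)
  then show "2 * N \<le> fst r" "fst r < 4 * N" "snd r < 2 * N"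
    using kk_bounds[of "fst x"] ll_bound[of "snd x"] by (simp_all add: r)
  show "coprime (fst r) (snd r)" "squarefree (fst r * s + snd r * t)" using x by (simp_all add: r good_def qq_def)
  show "fst r * s + snd r * t \<le> 6 * N * s" using qq_bounds(2)[OF xP] by (simp add: r qq_def)
qed

text \<open>At least \<open>N^2 / 8\<close> pairs with denominators at most \<open>6 N s\<close>
  give \<open>1 / (8 * 36 s^2)\<close>. This does not depend on \<open>N\<close>, so the logarithm
  in the theorem comes from the number of scales.\<close>

lemma sum_pairs_ge:
  assumes "real N ^ 2 / 8 \<le> real (card good)"
  shows "1 / (288 * real s ^ 2) \<le> (\<Sum>r\<in>pairs. 1 / real (fst r * s + snd r * t) ^ 2)"
proof -
  have inj: "inj_on (\<lambda>x. (kk (fst x), ll (snd x))) good"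
    by (rule inj_onI) (metis kk_inj ll_inj prod.inject prod_eqI)
  have s0: "real s > 0" using s1 by simp
  have M0: "real N > 0" using N_pos by simp
  have "1 / (288 * real s ^ 2) = real N ^ 2 / 8 * (1 / (6 * real N * real s) ^ 2)"
    using s0 M0 by (simp add: power_mult_distrib)
  also have "\<dots> \<le> real (card good) * (1 / (6 * real N * real s) ^ 2)"
    using assms by (rule mult_right_mono) simp
  also have "\<dots> = (\<Sum>x\<in>good. 1 / (6 * real N * real s) ^ 2)" by simp
  also have "\<dots> \<le> (\<Sum>x\<in>good. 1 / real (qq x) ^ 2)"
  proof (rule sum_mono)
    fix x assume "x \<in> good"
    then have xP: "x \<in> grid" by (simp add: good_def)
    have "real (qq x) \<le> real (6 * N * s)" using qq_bounds(2)[OF xP] by (simp only: of_nat_le_iff)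
    then have "real (qq x) ^ 2 \<le> (6 * real N * real s) ^ 2" by (intro power_mono) auto
    then show "1 / (6 * real N * real s) ^ 2 \<le> 1 / real (qq x) ^ 2"
      using qq_bounds(3)[OF xP] s0 M0 by (intro divide_left_mono mult_pos_pos) auto
  qed
  also have "\<dots> = (\<Sum>r\<in>pairs. 1 / real (fst r * s + snd r * t) ^ 2)"
    unfolding pairs_def by (subst sum.reindex[OF inj]) (simp add: qq_def)
  finally show ?thesis .
qed

end

context farey
begin

text \<open>Different scales have disjoint ranges of \<open>k\<close>, so their contributions add
  up. The constant is \<open>288 * 1310720\<close>.\<close>

lemma window_sum_ge_scales:
  assumes y1: "1 \<le> y" and ys: "y \<le> real s ^ 2 / 12" and y2: "y * ln x \<le> x / (128 * Q)" and yx: "y \<le> x" "2 \<le> x"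
    and Q: "1 \<le> Q" "Q ^ 2 * (1 + ln (Q ^ 2)) \<le> x"
    and I: "finite I" "\<And>i. i \<in> I \<Longrightarrow> counting s t (512 * 8 ^ i) (8 ^ i) k0 l0"
      "\<And>i. i \<in> I \<Longrightarrow> real (512 * 8 ^ i) ^ 2 / 8 \<le> real (card (counting.good s t (512 * 8 ^ i) k0 l0))"
      "\<And>i. i \<in> I \<Longrightarrow> real (6 * (512 * 8 ^ i) * s) \<le> Q'"
    and Q': "Q' \<le> Q"
    and lb: "\<And>q a. squarefree q \<Longrightarrow> q > 0 \<Longrightarrow> coprime a (int q) \<Longrightarrow> real q \<le> Q' \<Longrightarrow> x / (32 * real q) \<le>
      norm (\<Sum>n | 1 \<le> n \<and> real n \<le> x. of_real (mangoldt n * (1 - real n / x)) * ee (of_int a * of_nat n / of_nat q))"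
  shows "real (card I) * (x * y ^ 2) / (377487360 * real s ^ 2) \<le> window_sum \<alpha> x y"
proof -
  define B where "B = (\<lambda>i :: nat. counting.pairs s t (512 * 8 ^ i) k0 l0)"
  define R where "R = (\<Union>i\<in>I. B i)"
  have B: "1024 * 8 ^ i \<le> fst r" "fst r < 2048 * 8 ^ i" "snd r < 1024 * 8 ^ i" "coprime (fst r) (snd r)"
    "squarefree (den r)" "den r \<le> 6 * (512 * 8 ^ i) * s" if "i \<in> I" "r \<in> B i" for i r
    using counting.pairs_memD[OF I(2)[OF that(1)] that(2)[unfolded B_def]] unfolding den_def by linarith+
  have finB: "finite (B i)" if "i \<in> I" for i using counting.finite_pairs[OF I(2)[OF that]] by (simp add: B_def)
  have disj: "B i \<inter> B j = {}" if "i \<in> I" "j \<in> I" "i < j" for i j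
  proof -
    have "(8 :: nat) ^ Suc i \<le> 8 ^ j" using that(3) by (intro power_increasing) auto
    then have "2048 * 8 ^ i \<le> 1024 * (8 :: nat) ^ j" by simp
    then show ?thesis using B(2)[OF that(1)] B(1)[OF that(2)] by fastforce
  qed
  have adm: "admissible r" if r: "r \<in> R" for r
  proof -
    obtain i where i: "i \<in> I" "r \<in> B i" using r by (auto simp: R_def)
    have "(8 :: nat) ^ i > 0" by simp
    then have "1 \<le> fst r" "snd r \<le> fst r" using B(1,3)[OF i] by linarith+
    then show ?thesis using B(4)[OF i] by (simp add: admissible_def)
  qed
  have denQ': "real (den r) \<le> Q'" if r: "r \<in> R" for r
  proof -
    obtain i where i: "i \<in> I" "r \<in> B i" using r by (auto simp: R_def)
    have "real (den r) \<le> real (6 * (512 * 8 ^ i) * s)" using B(6)[OF i] by (simp only: of_nat_le_iff)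
    then show ?thesis using I(4)[OF i(1)] by linarith
  qed
  have sq: "squarefree (den r)" if "r \<in> R" for r using that B(5) unfolding R_def by blast
  have "real (card I) * (1 / (288 * real s ^ 2)) = (\<Sum>i\<in>I. 1 / (288 * real s ^ 2))" by simp
  also have "\<dots> \<le> (\<Sum>i\<in>I. \<Sum>r\<in>B i. 1 / real (den r) ^ 2)"
    unfolding B_def den_def by (intro sum_mono counting.sum_pairs_ge[OF I(2)] I(3))
  also have "\<dots> = (\<Sum>r\<in>R. 1 / real (den r) ^ 2)"
    unfolding R_def
  proof (rule sum.UNION_disjoint[symmetric])
    show "\<forall>i\<in>I. \<forall>j\<in>I. i \<noteq> j \<longrightarrow> B i \<inter> B j = {}"
      using disj by (metis Int_commute linorder_neqE_nat)
  qed (use I(1) finB in auto)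
  finally have "real (card I) * (1 / (288 * real s ^ 2)) * (x * y ^ 2) / 1310720 \<le> (\<Sum>r\<in>R. 1 / real (den r) ^ 2) * (x * y ^ 2) / 1310720"
    using yx by (intro divide_right_mono mult_right_mono) auto
  also have "\<dots> \<le> window_sum \<alpha> x y"
  proof (rule window_sum_ge[OF y1 ys y2 yx Q])
    show "finite R" using I(1) finB by (simp add: R_def)
    show "admissible r" if "r \<in> R" for r by (rule adm[OF that])
    show "real (den r) \<le> Q" if "r \<in> R" for r using denQ'[OF that] Q' by linarith
    show "x / (32 * real (den r)) \<le> norm (\<Sum>n | 1 \<le> n \<and> real n \<le> x. of_real (mangoldt n * (1 - real n / x)) * ee (of_int (num r) * of_nat n / of_nat (den r)))"
      if "r \<in> R" for r
      by (rule lb[OF sq[OF that] den_pos[OF adm[OF that]] coprime_num_den[OF adm[OF that]] denQ'[OF that]])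
  qed
  finally show ?thesis by (simp add: mult_ac)
qed

end

lemma window_sum_ge_large:
  fixes \<epsilon> \<epsilon>' :: real
  assumes GRH and \<epsilon>: "0 < \<epsilon>" "\<epsilon> \<le> 5 / 9" and \<epsilon>': "0 < \<epsilon>'"
  shows "\<exists>c>0. \<exists>X\<ge>2. \<forall>\<alpha> x y u s. x \<ge> X \<and> 1 \<le> y \<and> y \<le> x powr (5 / 9 - \<epsilon>) \<and> s \<ge> 1 \<and> coprime u (int s) \<and>
      \<bar>\<alpha> - of_int u / real s\<bar> \<le> 1 / real s ^ 2 \<and> \<epsilon>' * real s ^ 2 \<le> y \<and> y \<le> real s ^ 2 / 12
    \<longrightarrow> c * x * y * ln x \<le> window_sum \<alpha> x y"
proof -
  \<comment> \<open>Since \<open>y\<close> is \<open>x powr \<epsilon>\<close> below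
    \<open>x powr (5 / 9)\<close>, the two ends of the range of scales gain
    \<open>3 \<epsilon> / 5\<close> in the exponent. The lower end uses
    \<open>6 \<delta> / 5\<close>, the desired ratio of the ends \<open>\<epsilon> / 5\<close> and
    the upper end \<open>\<delta>\<close>, together \<open>21 \<epsilon> / 50\<close>.\<close>
  define \<delta> where "\<delta> = \<epsilon> / 10"
  have \<delta>: "0 < \<delta>" "\<delta> < 1 / 3" using \<epsilon> by (auto simp: \<delta>_def)
  obtain Xa where Xa: "\<And>x q a. x \<ge> Xa \<Longrightarrow> squarefree q \<Longrightarrow> q > 0 \<Longrightarrow> coprime a (int q) \<Longrightarrow> real q \<le> x powr (1 / 3 - \<delta>) \<Longrightarrow>
      x / (32 * real q) \<le>
      norm (\<Sum>n | 1 \<le> n \<and> real n \<le> x. of_real (mangoldt n * (1 - real n / x)) * ee (of_int a * of_nat n / of_nat q))"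
    using exp_sum_lower[OF \<open>GRH\<close> \<delta>] by blast
  obtain Xb where Xb: "\<And>x s t N h k0 l0. x \<ge> Xb \<Longrightarrow> counting s t N h k0 l0 \<Longrightarrow> real s * real N \<le> x \<Longrightarrow>
      real s * x powr (6 * \<delta>) \<le> real N ^ 5 \<Longrightarrow> real N ^ 2 / 8 \<le> real (card (counting.good s t N k0 l0))"
    using many_good[OF \<delta>(1)] by blast
  define K where "K = (1 / \<epsilon>') powr (3 / 5)"
  have K0: "K > 0" using \<epsilon>' by (simp add: K_def)
  have "\<forall>\<^sub>F x in at_top. 512 \<le> x powr (6 * (\<epsilon> / 10) / 5)" using \<epsilon> by real_asymp
  moreover have "\<forall>\<^sub>F x in at_top. 6 * K * (x powr (1 / 3 - 3 / 5 * \<epsilon>) * x powr (6 * (\<epsilon> / 10) / 5) * x powr (\<epsilon> / 5)) \<le> x powr (1 / 3 - \<epsilon> / 10)"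
    using \<epsilon> K0 by real_asymp
  moreover have "\<forall>\<^sub>F x :: real in at_top. x powr (5 / 9) * ln x \<le> x / (128 * x powr (1 / 3))" by real_asymp
  moreover have "\<forall>\<^sub>F x :: real in at_top. (x powr (1 / 3)) ^ 2 * (1 + ln ((x powr (1 / 3)) ^ 2)) \<le> x" by real_asymp
  moreover have "\<forall>\<^sub>F x :: real in at_top. 1 \<le> \<epsilon> * ln x / (10 * ln 8)" using \<epsilon> by real_asymp
  moreover have "\<forall>\<^sub>F x :: real in at_top. max 2 (max Xa Xb) \<le> x" by (rule eventually_ge_at_top)
  ultimately have "\<forall>\<^sub>F x :: real in at_top. 512 \<le> x powr (6 * \<delta> / 5) \<and>
      6 * K * (x powr (1 / 3 - 3 / 5 * \<epsilon>) * x powr (6 * \<delta> / 5) * x powr (\<epsilon> / 5)) \<le> x powr (1 / 3 - \<delta>) \<and>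
      x powr (5 / 9) * ln x \<le> x / (128 * x powr (1 / 3)) \<and> (x powr (1 / 3)) ^ 2 * (1 + ln ((x powr (1 / 3)) ^ 2)) \<le> x \<and>
      1 \<le> \<epsilon> * ln x / (10 * ln 8) \<and> max 2 (max Xa Xb) \<le> x"
    unfolding \<delta>_def by eventually_elim blast
  then obtain X where X: "\<And>x. x \<ge> X \<Longrightarrow> 512 \<le> x powr (6 * \<delta> / 5) \<and>
      6 * K * (x powr (1 / 3 - 3 / 5 * \<epsilon>) * x powr (6 * \<delta> / 5) * x powr (\<epsilon> / 5)) \<le> x powr (1 / 3 - \<delta>) \<and>
      x powr (5 / 9) * ln x \<le> x / (128 * x powr (1 / 3)) \<and> (x powr (1 / 3)) ^ 2 * (1 + ln ((x powr (1 / 3)) ^ 2)) \<le> x \<and>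
      1 \<le> \<epsilon> * ln x / (10 * ln 8) \<and> max 2 (max Xa Xb) \<le> x"
    unfolding eventually_at_top_linorder by blast
  define c where "c = \<epsilon>' * (\<epsilon> / (10 * ln 8)) / 377487360"
  have "c > 0" using \<epsilon> \<epsilon>' by (simp add: c_def)
  moreover have "c * x * y * ln x \<le> window_sum \<alpha> x y"
    if xX: "x \<ge> X" and y: "1 \<le> y" "y \<le> x powr (5 / 9 - \<epsilon>)" and us: "s \<ge> 1" "coprime u (int s)"
      and dist: "\<bar>\<alpha> - of_int u / real s\<bar> \<le> 1 / real s ^ 2" and sy: "\<epsilon>' * real s ^ 2 \<le> y" "y \<le> real s ^ 2 / 12"
    for \<alpha> x y :: real and u :: int and s :: nat
  proof -
    note Xx = X[OF xX]
    have x: "x \<ge> 2" "x \<ge> Xa" "x \<ge> Xb" using Xx by auto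
    have s0: "real s > 0" using us by simp
    have s4: "s \<ge> 4"
    proof (rule ccontr)
      assume "\<not> s \<ge> 4"
      then have "real s ^ 2 \<le> 3 ^ 2" by (intro power_mono) auto
      then show False using y sy by simp
    qed
    obtain t v where tv: "t \<le> s" "coprime s t" "v * int s - u * int t = 1" using ex_farey_partner[OF us(2,1)] by blast
    interpret farey s t u v \<alpha> by unfold_locales (use s4 tv dist in auto)
    \<comment> \<open>\<open>s\<close> and \<open>t\<close> are not both even, so some choice of
      parities makes \<open>k s + l t\<close> odd.\<close>
    obtain k0 l0 :: nat where kl: "k0 \<le> 1" "l0 \<le> 1" "odd (k0 * s + l0 * t)"
    proof (cases "odd s")
      case True
      then show ?thesis by (intro that[of 1 0]) auto
    next
      case False
      then have "odd t" using tv(2) by (meson coprime_common_divisor_nat not_coprimeI odd_one)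
      then show ?thesis by (intro that[of 0 1]) auto
    qed
    have cnt: "counting s t (512 * 8 ^ i) (8 ^ i) k0 l0" for i
      by unfold_locales (use us tv kl in auto)
    \<comment> \<open>\<open>lo\<close> is the fifth root of what \<open>many_good\<close> demands
      of \<open>N ^ 5\<close>; \<open>hi\<close> keeps the denominators, at most
      \<open>6 N s\<close>, below \<open>x powr (1 / 3 - \<delta>)\<close>.\<close>
    define lo where "lo = (real s * x powr (6 * \<delta>)) powr (1 / 5)"
    define hi where "hi = x powr (1 / 3 - \<delta>) / (6 * real s)"
    have lo_eq: "lo = real s powr (1 / 5) * x powr (6 * \<delta> / 5)"
      using x s0 by (simp add: lo_def powr_mult powr_powr)
    have lo512: "512 \<le> lo"
    proof -
      have "1 * x powr (6 * \<delta> / 5) \<le> real s powr (1 / 5) * x powr (6 * \<delta> / 5)"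
        using us by (intro mult_right_mono) (auto simp: ge_one_powr_ge_zero)
      moreover have "512 \<le> x powr (6 * \<delta> / 5)" using Xx by blast
      ultimately show ?thesis unfolding lo_eq by linarith
    qed
    have ratio: "lo * x powr (\<epsilon> / 5) \<le> hi"
    proof -
      \<comment> \<open>The power 3 / 5 turns \<open>s^2\<close> into
        \<open>s powr (1 / 5) * s\<close>, the product in which \<open>s\<close> enters the quotient
        of \<open>lo\<close> and \<open>hi\<close>, and turns 5 / 9 into 1 / 3.\<close>
      have "real s ^ 2 \<le> (1 / \<epsilon>') * x powr (5 / 9 - \<epsilon>)"
        using sy(1) y(2) \<epsilon>' by (simp add: pos_le_divide_eq mult.commute)
      then have "(real s ^ 2) powr (3 / 5) \<le> ((1 / \<epsilon>') * x powr (5 / 9 - \<epsilon>)) powr (3 / 5)"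
        by (intro powr_mono2) auto
      also have "\<dots> = K * x powr (1 / 3 - 3 / 5 * \<epsilon>)"
      proof -
        have "(5 / 9 - \<epsilon>) * (3 / 5) = 1 / 3 - 3 / 5 * \<epsilon>" by (simp add: field_simps)
        then show ?thesis unfolding K_def powr_mult powr_powr by (simp only:)
      qed
      also have "(real s ^ 2) powr (3 / 5) = real s powr (1 / 5) * real s"
      proof -
        have "real s powr (6 / 5) = real s powr (1 / 5 + 1)" by simp
        also have "\<dots> = real s powr (1 / 5) * real s powr 1" by (rule powr_add)
        finally have "real s powr (6 / 5) = real s powr (1 / 5) * real s" using s0 by simp
        moreover have "real s ^ 2 = real s powr 2" using s0 by simp
        then have "(real s ^ 2) powr (3 / 5) = real s powr (6 / 5)" by (simp only: powr_powr) simp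
        ultimately show ?thesis by simp
      qed
      finally have a: "real s powr (1 / 5) * real s \<le> K * x powr (1 / 3 - 3 / 5 * \<epsilon>)" .
      have "lo * x powr (\<epsilon> / 5) * (6 * real s) = 6 * (real s powr (1 / 5) * real s) * (x powr (6 * \<delta> / 5) * x powr (\<epsilon> / 5))"
        by (simp add: lo_eq)
      also have "\<dots> \<le> 6 * (K * x powr (1 / 3 - 3 / 5 * \<epsilon>)) * (x powr (6 * \<delta> / 5) * x powr (\<epsilon> / 5))"
        using a by (intro mult_right_mono mult_left_mono) auto
      also have "\<dots> \<le> x powr (1 / 3 - \<delta>)" using Xx by (simp add: mult_ac)
      finally show ?thesis using s0 by (simp add: hi_def pos_le_divide_eq)
    qed
    define I where "I = {i :: nat. lo \<le> 512 * 8 ^ i \<and> 512 * 8 ^ i \<le> hi}"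
    have rat1: "1 \<le> x powr (\<epsilon> / 5)" using x \<epsilon> by (simp add: ge_one_powr_ge_zero)
    have finI: "finite I" and cardI: "ln (x powr (\<epsilon> / 5)) / ln 8 - 1 \<le> real (card I)"
      using card_scales_ge[OF lo512 rat1 ratio] by (simp_all add: I_def)
    \<comment> \<open>Half of the available logarithm absorbs the \<open>- 1\<close> in the count of
      scales.\<close>
    have "ln (x powr (\<epsilon> / 5)) / ln 8 = 2 * (\<epsilon> * ln x / (10 * ln 8))" using x by (simp add: ln_powr)
    then have cI: "\<epsilon> * ln x / (10 * ln 8) \<le> real (card I)" using cardI Xx by linarith
    have q3: "x powr (1 / 3 - \<delta>) \<le> x powr (1 / 3)" using x \<delta> by (intro powr_mono) auto
    have y59: "y \<le> x powr (5 / 9)"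
      using y(2) powr_mono[of "5 / 9 - \<epsilon>" "5 / 9" x] x \<epsilon> by linarith
    have "real (card I) * (x * y ^ 2) / (377487360 * real s ^ 2) \<le> window_sum \<alpha> x y"
    proof (rule window_sum_ge_scales[OF y(1) sy(2) _ _ x(1), where Q = "x powr (1 / 3)" and Q' = "x powr (1 / 3 - \<delta>)"])
      have "y * ln x \<le> x powr (5 / 9) * ln x" using y59 x by (intro mult_right_mono) auto
      then show "y * ln x \<le> x / (128 * x powr (1 / 3))" using Xx by linarith
      show "y \<le> x" using y59 powr_mono[of "5 / 9" 1 x] x by simp
      show "1 \<le> x powr (1 / 3)" using x by (simp add: ge_one_powr_ge_zero)
      show "(x powr (1 / 3)) ^ 2 * (1 + ln ((x powr (1 / 3)) ^ 2)) \<le> x" using Xx by blast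
      show "finite I" by (rule finI)
      show "counting s t (512 * 8 ^ i) (8 ^ i) k0 l0" for i by (rule cnt)
      show q: "real (6 * (512 * 8 ^ i) * s) \<le> x powr (1 / 3 - \<delta>)" if "i \<in> I" for i
      proof -
        have "512 * 8 ^ i \<le> hi" using that by (simp add: I_def)
        then have "512 * 8 ^ i * (6 * real s) \<le> x powr (1 / 3 - \<delta>)" using s0 by (simp add: hi_def pos_le_divide_eq)
        then show ?thesis by (simp add: mult_ac)
      qed
      show "real (512 * 8 ^ i) ^ 2 / 8 \<le> real (card (counting.good s t (512 * 8 ^ i) k0 l0))" if i: "i \<in> I" for i
      proof (rule Xb[OF x(3) cnt])
        have "real s * real (512 * 8 ^ i) \<le> real (6 * (512 * 8 ^ i) * s)" using s0 by simp
        also have "\<dots> \<le> x powr (1 / 3 - \<delta>)" by (rule q[OF i])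
        also have "\<dots> \<le> x" using powr_mono[of "1 / 3 - \<delta>" 1 x] x \<delta> by simp
        finally show "real s * real (512 * 8 ^ i) \<le> x" .
        have "lo ^ 5 = real s * x powr (6 * \<delta>)" using s0 x by (simp add: lo_def powr_power)
        moreover have "lo ^ 5 \<le> (512 * 8 ^ i) ^ 5" using i lo512 by (intro power_mono) (auto simp: I_def)
        ultimately show "real s * x powr (6 * \<delta>) \<le> real (512 * 8 ^ i) ^ 5" by simp
      qed
      show "x powr (1 / 3 - \<delta>) \<le> x powr (1 / 3)" by (rule q3)
    qed (use Xa[OF x(2)] in blast)
    moreover have "c * x * y * ln x \<le> real (card I) * (x * y ^ 2) / (377487360 * real s ^ 2)"
    proof -
      \<comment> \<open>One of the two factors \<open>y\<close> is traded against \<open>s^2\<close>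
        at the cost of \<open>\<epsilon>'\<close>.\<close>
      have "\<epsilon>' * y \<le> y ^ 2 / real s ^ 2"
        using mult_right_mono[OF sy(1), of y] y s0 by (simp add: pos_le_divide_eq power2_eq_square mult_ac)
      then have "\<epsilon> * ln x / (10 * ln 8) * (\<epsilon>' * y) \<le> real (card I) * (y ^ 2 / real s ^ 2)"
        using cI y \<epsilon> \<epsilon>' x by (intro mult_mono) auto
      then have "x * (\<epsilon> * ln x / (10 * ln 8) * (\<epsilon>' * y)) / 377487360 \<le> x * (real (card I) * (y ^ 2 / real s ^ 2)) / 377487360"
        using x by (intro divide_right_mono mult_left_mono) auto
      then show ?thesis by (simp add: c_def mult_ac)
    qed
    ultimately show ?thesis by linarith
  qed
  moreover have "2 \<le> max 2 X" "\<And>x. max 2 X \<le> x \<Longrightarrow> X \<le> x" by auto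
  ultimately show ?thesis by meson
qed

theorem theorem1p4:
  fixes \<epsilon> \<epsilon>' :: real
  assumes "GRH" and "\<epsilon> > 0" and "\<epsilon>' > 0"
  shows "\<exists>c>0. \<forall>\<alpha> x y :: real.
    x \<ge> 2 \<and> 1 \<le> y \<and> y \<le> x powr (5 / 9 - \<epsilon>) \<and>
    (\<exists>(u :: int) (s :: int). s \<ge> 1 \<and> coprime u s \<and>
       \<bar>\<alpha> - of_int u / of_int s\<bar> \<le> 1 / (of_int s)\<^sup>2 \<and>
       \<epsilon>' * (of_int s)\<^sup>2 \<le> y \<and> y \<le> (of_int s)\<^sup>2 / 12)
    \<longrightarrow>
    1 / x * (\<Sum>n | - y < of_int n \<and> of_int n \<le> x.
       (cmod (\<Sum>m | n < m \<and> of_int m \<le> of_int n + y \<and> 1 \<le> m \<and> of_int m \<le> x.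
          mangoldt (nat m) * ee (\<alpha> * of_int m)))\<^sup>2)
    \<ge> c * y * ln x"
proof (cases "\<epsilon> \<le> 5 / 9")
  case False
  \<comment> \<open>For \<open>\<epsilon> > 5 / 9\<close> the exponent is negative and the bound on
    \<open>y\<close> falls below 1, so the assumptions are contradictory.\<close>
  have "\<not> (x \<ge> 2 \<and> 1 \<le> y \<and> y \<le> x powr (5 / 9 - \<epsilon>))" for x y :: real
    using False powr_less_mono[of "5 / 9 - \<epsilon>" 0 x] by auto
  then show ?thesis by (intro exI[of _ 1]) auto
next
  case \<epsilon>: True
  obtain c X where c: "c > 0" and X: "X \<ge> 2" and main: "\<And>\<alpha> x y u s. x \<ge> X \<Longrightarrow> 1 \<le> y \<Longrightarrow> y \<le> x powr (5 / 9 - \<epsilon>) \<Longrightarrow> s \<ge> 1 \<Longrightarrow>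
      coprime u (int s) \<Longrightarrow> \<bar>\<alpha> - of_int u / real s\<bar> \<le> 1 / real s ^ 2 \<Longrightarrow> \<epsilon>' * real s ^ 2 \<le> y \<Longrightarrow> y \<le> real s ^ 2 / 12 \<Longrightarrow>
      c * x * y * ln x \<le> window_sum \<alpha> x y"
    using window_sum_ge_large[OF assms(1,2) \<epsilon> assms(3)] by blast
  \<comment> \<open>The second entry is for \<open>2 <= x < X\<close>: there
    \<open>y * ln x <= X * ln X\<close> because \<open>y <= x\<close>, and the sum over windows is
    at least \<open>(ln 2)^2\<close>.\<close>
  define c' where "c' = min c ((ln 2) ^ 2 / (X * (X * ln X)))"
  have X0: "X > 0" "ln X > 0" using X by auto
  have "c' > 0" using c X0 by (simp add: c'_def)
  moreover have "c' * y * ln x \<le> 1 / x * window_sum \<alpha> x y"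
    if x: "x \<ge> 2" and y: "1 \<le> y" "y \<le> x powr (5 / 9 - \<epsilon>)" and us: "s \<ge> 1" "coprime u s"
      "\<bar>\<alpha> - of_int u / of_int s\<bar> \<le> 1 / (of_int s)\<^sup>2" "\<epsilon>' * (of_int s)\<^sup>2 \<le> y" "y \<le> (of_int s)\<^sup>2 / 12"
    for \<alpha> x y :: real and u s :: int
  proof (cases "x \<ge> X")
    case True
    have s: "int (nat s) = s" "real (nat s) = real_of_int s" using us(1) by auto
    have "c * x * y * ln x \<le> window_sum \<alpha> x y"
      by (rule main[OF True y, of "nat s" u]) (use us s in auto)
    moreover have "c' * (x * y * ln x) \<le> c * (x * y * ln x)"
      using x y by (intro mult_right_mono) (auto simp: c'_def)
    ultimately have "c' * y * ln x * x \<le> window_sum \<alpha> x y" by (simp add: mult_ac)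
    then show ?thesis using x by (simp add: pos_le_divide_eq)
  next
    case False
    have yx: "y \<le> x" using y(2) powr_mono[of "5 / 9 - \<epsilon>" 1 x] x assms(2) by simp
    have "c' * (y * ln x) \<le> (ln 2) ^ 2 / (X * (X * ln X)) * (X * ln X)"
      using yx y x False X0 \<open>c' > 0\<close> by (intro mult_mono) (auto simp: c'_def)
    also have "\<dots> = 1 / X * (ln 2) ^ 2" using X0 by simp
    also have "\<dots> \<le> 1 / x * window_sum \<alpha> x y"
      using x False window_sum_ge_ln_2[OF y(1) x, of \<alpha>] by (intro mult_mono divide_left_mono) auto
    finally show ?thesis by simp
  qed
  ultimately show ?thesis unfolding window_sum_def by blast
qed

end
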